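(* Let $R$ be a finite commutative ring with identity. The involutory Cayley graph $\Gamma(R)$ has genus exactly $1$ if and only if one of the following holds: (1) $R$ is isomorphic to $\mathbb{Z}_2[x,y]/\langle x^2,xy,y^2\rangle$, to $\mathbb{Z}_4[x]/\langle x^2,2x\rangle$, or to $\mathbb{Z}_{2^n}$ for some $n\geq 3$; (2) $R$ is isomorphic to $\mathbb{Z}_{p^n}\times\mathbb{Z}_{q^m}$, $\mathbb{Z}_{p^n}\times\mathbb{Z}_{q^m}\times\mathbb{Z}_2$, $\mathbb{Z}_{p^n}\times\mathbb{Z}_4$, or $\mathbb{Z}_{p^n}\times\mathbb{Z}_2[x]/\langle x^2\rangle$ for some odd primes $p,q$ and positive integers $n,m$. In particular, $\Gamma(R)$ has genus $1$ if and only if $\Gamma(R)$ is connected and $4$-regular.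
   Context: All rings are finite, commutative, with nonzero identity. An element $u$ is an involution if $u^2=1$. The involutory Cayley graph $\Gamma(R)$ is the simple undirected graph with vertex set $R$ in which distinct $x,y$ are adjacent iff $(x-y)^2=1$ (the Cayley graph of $(R,+)$ with respect to the set of involutions). Genus means the orientable genus of a graph; genus $1$ means embeddable on the torus but not in the plane. *)

theory Defs
  imports "HOL-Analysis.Analysis" "HOL-Algebra.Algebra"
begin

definition inv_adj :: "('a, 'b) ring_scheme \<Rightarrow> 'a \<Rightarrow> 'a \<Rightarrow> bool" where
  "inv_adj R x y \<longleftrightarrow> x \<in> carrier R \<and> y \<in> carrier R \<and> x \<noteq> y \<and>
     (x \<ominus>\<^bsub>R\<^esub> y) \<otimes>\<^bsub>R\<^esub> (x \<ominus>\<^bsub>R\<^esub> y) = \<one>\<^bsub>R\<^esub>"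

definition inv_edges :: "('a, 'b) ring_scheme \<Rightarrow> 'a set set" where
  "inv_edges R = {{x, y} | x y. inv_adj R x y}"

definition graph_embeds_in :: "'v set \<Rightarrow> 'v set set \<Rightarrow> 'p::real_normed_vector set \<Rightarrow> bool" where
  "graph_embeds_in V E S \<longleftrightarrow>
     (\<exists>(f :: 'v \<Rightarrow> 'p) (\<gamma> :: 'v set \<Rightarrow> real \<Rightarrow> 'p).
        inj_on f V \<and> f ` V \<subseteq> S \<and>
        (\<forall>e\<in>E. arc (\<gamma> e) \<and> path_image (\<gamma> e) \<subseteq> S \<and>
                {pathstart (\<gamma> e), pathfinish (\<gamma> e)} = f ` e \<and>
                path_image (\<gamma> e) \<inter> f ` V = f ` e) \<and>
        (\<forall>e\<in>E. \<forall>e'\<in>E. e \<noteq> e' \<longrightarrow>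
                path_image (\<gamma> e) \<inter> path_image (\<gamma> e') = f ` (e \<inter> e')))"

definition planar_graph :: "'v set \<Rightarrow> 'v set set \<Rightarrow> bool" where
  "planar_graph V E \<longleftrightarrow> graph_embeds_in V E (UNIV :: complex set)"

definition torus :: "(complex \<times> complex) set" where
  "torus = {(z, w). cmod z = 1 \<and> cmod w = 1}"

definition toroidal_graph :: "'v set \<Rightarrow> 'v set set \<Rightarrow> bool" where
  "toroidal_graph V E \<longleftrightarrow> graph_embeds_in V E torus"

definition genus_one :: "'v set \<Rightarrow> 'v set set \<Rightarrow> bool" where
  "genus_one V E \<longleftrightarrow> toroidal_graph V E \<and> \<not> planar_graph V E"

text \<open>Z_2[x,y]/<x^2,xy,y^2>: a + b x + c y with a,b,c in {0,1}.\<close>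
definition Z2xy :: "(int \<times> int \<times> int) ring" where
  "Z2xy = \<lparr> carrier = {0,1} \<times> {0,1} \<times> {0,1},
     mult = (\<lambda>(a,b,c) (a2,b2,c2). ((a * a2) mod 2, (a * b2 + b * a2) mod 2, (a * c2 + c * a2) mod 2)),
     one = (1,0,0), ring.zero = (0,0,0),
     ring.add = (\<lambda>(a,b,c) (a2,b2,c2). ((a + a2) mod 2, (b + b2) mod 2, (c + c2) mod 2)) \<rparr>"

text \<open>Z_4[x]/<x^2,2x>: a + b x with a in {0,..,3}, b in {0,1}.\<close>
definition Z4x :: "(int \<times> int) ring" where
  "Z4x = \<lparr> carrier = {0..3} \<times> {0,1},
     mult = (\<lambda>(a,b) (a2,b2). ((a * a2) mod 4, (a * b2 + b * a2) mod 2)),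
     one = (1,0), ring.zero = (0,0),
     ring.add = (\<lambda>(a,b) (a2,b2). ((a + a2) mod 4, (b + b2) mod 2)) \<rparr>"

text \<open>Z_2[x]/<x^2>: a + b x with a,b in {0,1}.\<close>
definition Z2x :: "(int \<times> int) ring" where
  "Z2x = \<lparr> carrier = {0,1} \<times> {0,1},
     mult = (\<lambda>(a,b) (a2,b2). ((a * a2) mod 2, (a * b2 + b * a2) mod 2)),
     one = (1,0), ring.zero = (0,0),
     ring.add = (\<lambda>(a,b) (a2,b2). ((a + a2) mod 2, (b + b2) mod 2)) \<rparr>"

end

theory Submission
  imports Defs
begin

text \<open>
  The involutions form an elementary abelian 2-group, so their number is 1, 2, 4 or a multiple of 8,
  and every component of the graph is a coset of the subgroup they generate.
  One or two involutions give a disjoint union of cycles, edges and points, which is planar.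
  Eight or more violate the bound of at most 3V edges for toroidal graphs. That bound is obtained
  by lifting a toroidal drawing to a \<open>\<int>\<^sup>2\<close>-periodic drawing in the plane and applying the
  planar bound 3V - 6 to large finite pieces. The planar bounds come from counting faces, which
  Janiszewski's theorem and the Jordan curve theorem allow for topological drawings.

  With four involutions no component is planar: it has 2V edges, and it is either triangle-free,
  or has characteristic 3 and is a union of edge-disjoint triangles.
  Two disjoint pieces of a toroidal graph cannot both be non-planar: if one of them contains a
  closed curve that is not null-homotopic, closed curves in the other are all parallel to it,
  so the other lies in an annulus. Hence genus one forces connectedness. Conversely
  the connected 4-regular graph is a quotient of the square grid, which embeds in the torus.

  Connectedness means that the ring is generated by its involutions. Unless -1 = 1 it is
  therefore \<open>\<int>[u]\<close> with \<open>u\<^sup>2 = 1\<close>, and the lattice of relations \<open>i + j u = 0\<close> can be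
  classified by its intersections with the two diagonals.
\<close>

section \<open>Arcs in the plane\<close>

text \<open>Planarity and toroidality are defined by continuous drawings, so every count has to come
  out of plane topology. Only upper bounds on edges are wanted, and for these Euler's formula is
  enough as an inequality, proved one added edge at a time. On the torus the 6 in 3V - 6 is lost:
  the boundary of an N by N block grows like N, its area like N^2, so only the leading coefficient
  survives. Four involutions give 2V edges, too many for a triangle-free plane graph (2V - 4) but
  compatible with 3V - 6. In characteristic 3 the gap is closed by a sharper count: edge-disjoint
  triangles force 12 vertices, while a component has at most 9. The two diagonals of the relation
  lattice belong to the parts where u acts as 1 and as -1. Away from the prime 2 the ring is the
  product of these parts; the 2-primary part need not split, so it is cut out by an idempotent and
  treated apart. For -1 = 1 there is no such lattice; the graph is then K_{4,4}, drawn as a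
  circulant graph on Z/8.\<close>

lemma subarc:
  assumes "arc g" "0 \<le> s" "s < t" "t \<le> (1::real)"
  shows "arc (subpath s t g)" "path_image (subpath s t g) = g ` {s..t}"
    "pathstart (subpath s t g) = g s" "pathfinish (subpath s t g) = g t"
  using assms by (auto simp: arc_subpath_arc path_image_subpath)

text \<open>An arc does not separate the plane, so Janiszewski's theorem applies to \<open>A\<close>
  and the arc as soon as their intersection is connected. In the applications the intersection is at
  most one point.\<close>

lemma connected_component_Compl_Un_arc:
  fixes A :: "complex set"
  assumes "compact A" "arc g" "connected (A \<inter> path_image g)"
    "connected_component (- A) a b" "a \<notin> path_image g" "b \<notin> path_image g"
  shows "connected_component (- (A \<union> path_image g)) a b"
proof (rule Janiszewski)
  show "closed (path_image g)"
    using assms(2) by (simp add: closed_arc_image)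
  have "connected (- path_image g)"
    using assms(2) by (simp add: connected_arc_complement)
  then show "connected_component (- path_image g) a b"
    using assms(5,6) by (auto simp: connected_iff_connected_component)
qed (use assms in auto)

lemma connected_component_Compl_Un_subarc:
  fixes A :: "complex set"
  assumes "compact A" "arc g" "0 \<le> s" "s < t" "t \<le> 1" "connected (A \<inter> g ` {s..t})"
    "connected_component (- A) a b" "a \<notin> g ` {s..t}" "b \<notin> g ` {s..t}"
  shows "connected_component (- (A \<union> g ` {s..t})) a b"
  using connected_component_Compl_Un_arc[of A "subpath s t g" a b] subarc[OF assms(2-5)] assms
  by simp

lemma compact_subarc: "arc g \<Longrightarrow> 0 \<le> s \<Longrightarrow> t \<le> 1 \<Longrightarrow> compact (g ` {s..t})"
  unfolding arc_def path_def
  by (rule compact_continuous_image) (auto elim: continuous_on_subset)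

text \<open>If a point \<open>g s\<close> were away from the closure of \<open>U\<close>, a short
  subarc around it could be cut out. What is left of the arc are two stubs, each glued on at one
  point, which do not separate \<open>U\<close> from \<open>g s\<close>; yet a connection would have
  to leave \<open>U\<close> through the removed subarc.\<close>

lemma arc_interior_subset_closure_component:
  fixes A :: "complex set"
  assumes A: "compact A" and g: "arc g" and gA: "path_image g \<inter> A = {pathstart g, pathfinish g}"
    and C: "C \<in> components (- A)" and gC: "g ` {0<..<1} \<subseteq> C"
    and U: "U \<in> components (- (A \<union> path_image g))" "U \<subseteq> C"
  shows "g ` {0<..<1} \<subseteq> closure U"
proof (rule ccontr)
  assume "\<not> ?thesis"
  then obtain s where "s \<in> {0<..<1}" "g s \<notin> closure U"
    by blast
  then have s: "0 < s" "s < 1" "g s \<notin> closure U"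
    by auto
  have inj: "inj_on g {0..1}" and cont: "continuous_on {0..1} g"
    using g by (auto simp: arc_def path_def)
  obtain e where e: "e > 0" "ball (g s) e \<subseteq> - closure U"
    using s(3) open_contains_ball[of "- closure U"] by auto
  obtain d where d: "d > 0" "\<And>t. t \<in> {0..1} \<Longrightarrow> dist t s < d \<Longrightarrow> dist (g t) (g s) < e"
    using cont s(1,2) e(1) unfolding continuous_on_iff by (metis atLeastAtMost_iff less_imp_le)
  \<comment> \<open>The subarc between \<open>s1\<close> and \<open>s2\<close> is cut out. The
    bounds \<open>s/2\<close> and \<open>(s+1)/2\<close> leave a proper stub at either end, and each
    stub touches \<open>A\<close> in one endpoint only.\<close>
  define s1 where "s1 = max (s - d/2) (s/2)"
  define s2 where "s2 = min (s + d/2) ((s+1)/2)"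
  have s12: "0 < s1" "s1 < s" "s < s2" "s2 < 1"
    using s d(1) by (auto simp: s1_def s2_def min_def max_def)
  have near: "g t \<notin> closure U" if "s1 \<le> t" "t \<le> s2" for t
  proof -
    have "dist t s < d"
      using that d(1) by (auto simp: s1_def s2_def dist_real_def)
    moreover have "t \<in> {0..1}"
      using that s12 by auto
    ultimately have "dist (g t) (g s) < e"
      using d(2) by blast
    then show ?thesis
      using e(2) by (auto simp: dist_commute subset_iff)
  qed
  have pi: "path_image g = g ` {0..1}" by (simp add: path_image_def)
  have ends: "g 0 \<in> A" "g 1 \<in> A" "\<And>t. 0 < t \<Longrightarrow> t < 1 \<Longrightarrow> g t \<notin> A"
  proof -
    show "g 0 \<in> A" "g 1 \<in> A" using gA by (auto simp: pathstart_def pathfinish_def)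
    fix t :: real assume t: "0 < t" "t < 1"
    show "g t \<notin> A"
    proof
      assume "g t \<in> A"
      then have "g t = g 0 \<or> g t = g 1"
        using gA t by (auto simp: pi pathstart_def pathfinish_def)
      then show False
        using inj t unfolding inj_on_def by force
    qed
  qed
  obtain u where u: "u \<in> U"
    using U(1) in_components_nonempty by blast
  have Usub: "U \<subseteq> - (A \<union> path_image g)"
    using U(1) in_components_subset by blast
  have "connected_component (- A) u (g s)"
  proof -
    have "u \<in> C" "g s \<in> C" using u U(2) gC s by auto
    then show ?thesis
      using C in_components_connected in_components_subset unfolding connected_component_def by blast
  qed
  moreover have "A \<inter> g ` {0..s1} = {g 0}"
  proof
    show "{g 0} \<subseteq> A \<inter> g ` {0..s1}" using ends(1) s12 by simp
    show "A \<inter> g ` {0..s1} \<subseteq> {g 0}"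
    proof
      fix z assume "z \<in> A \<inter> g ` {0..s1}"
      then obtain t where "z = g t" "g t \<in> A" "0 \<le> t" "t \<le> s1" by auto
      then show "z \<in> {g 0}" using ends(3)[of t] s12 by (cases "t = 0") simp_all
    qed
  qed
  moreover have u01: "u \<notin> g ` {0..1}"
    using u Usub pi by auto
  moreover have "g ` {0..s1} \<subseteq> g ` {0..1}" "g ` {s2..1} \<subseteq> g ` {0..1}"
    using s12 by (auto intro!: image_mono)
  then have u_s: "u \<notin> g ` {0..s1}" "u \<notin> g ` {s2..1}" using u01 by blast+
  moreover have gs: "g s \<notin> g ` {0..s1}" "g s \<notin> g ` {s2..1}"
    using s12 inj_on_image_mem_iff[OF inj, of s "{0..s1}"] inj_on_image_mem_iff[OF inj, of s "{s2..1}"]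
    by (simp_all add: subset_iff)
  ultimately have *: "connected_component (- (A \<union> g ` {0..s1})) u (g s)"
    using s12 by (intro connected_component_Compl_Un_subarc[OF A g]) simp_all
  have "(A \<union> g ` {0..s1}) \<inter> g ` {s2..1} = {g 1}"
  proof
    show "{g 1} \<subseteq> (A \<union> g ` {0..s1}) \<inter> g ` {s2..1}" using ends(2) s12 by simp
    show "(A \<union> g ` {0..s1}) \<inter> g ` {s2..1} \<subseteq> {g 1}"
    proof
      fix z assume z: "z \<in> (A \<union> g ` {0..s1}) \<inter> g ` {s2..1}"
      then obtain t where t: "z = g t" "s2 \<le> t" "t \<le> 1" unfolding Int_iff image_iff by (metis atLeastAtMost_iff)
      have "g t \<notin> g ` {0..s1}"
        using t s12 inj_on_image_mem_iff[OF inj, of t "{0..s1}"] by (simp add: subset_iff)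
      then have "g t \<in> A" using z unfolding t(1) by (metis IntD1 UnE)
      then show "z \<in> {g 1}" using ends(3)[of t] t s12 by (cases "t = 1") simp_all
    qed
  qed
  then have "connected_component (- (A \<union> g ` {0..s1} \<union> g ` {s2..1})) u (g s)"
    using s12 * u_s gs A compact_subarc[OF g, of 0 s1]
    by (intro connected_component_Compl_Un_subarc[OF compact_Un g]) simp_all
  then obtain T where T: "connected T" "T \<subseteq> - (A \<union> g ` {0..s1} \<union> g ` {s2..1})" "u \<in> T" "g s \<in> T"
    unfolding connected_component_def by blast
  \<comment> \<open>\<open>T\<close> runs from \<open>u\<close> in \<open>U\<close> to
    \<open>g s\<close> outside, hence crosses the frontier of \<open>U\<close>, which lies on
    \<open>A\<close> and the arc. The cut-out subarc is the only place left for the crossing, and it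
    misses the closure of \<open>U\<close>.\<close>
  have "g s \<notin> U" using s(3) closure_subset by blast
  then have "T \<inter> U \<noteq> {}" "T - U \<noteq> {}" using T(3,4) u by blast+
  then have "T \<inter> frontier U \<noteq> {}"
    using T(1) by (rule connected_Int_frontier[rotated])
  then obtain z where z: "z \<in> T" "z \<in> frontier U" by auto
  have "closed (A \<union> path_image g)"
    using A g by (simp add: closed_Un closed_arc_image compact_imp_closed)
  then have "z \<in> A \<union> path_image g"
    using z(2) U(1) frontier_of_components_closed_complement by blast
  then obtain t where t: "z = g t" "t \<in> {0..1}" "\<not> t \<le> s1" "\<not> s2 \<le> t"
    using T(2) z(1) by (force simp: pi)
  then have "z \<notin> closure U"
    using near by auto
  then show False
    using z(2) by (simp add: frontier_def)
qed

text \<open>A third component \<open>U3\<close> contains a crosscut \<open>k\<close> joining two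
  points of the arc. Together with parts of the arc it yields two closed sets meeting exactly in
  \<open>k\<close>, neither of which separates \<open>U1\<close> from \<open>U2\<close>; by
  Janiszewski their union does not either.\<close>

lemma arc_splits_at_most_two:
  fixes A :: "complex set"
  assumes A: "compact A" and g: "arc g" and gA: "path_image g \<inter> A = {pathstart g, pathfinish g}"
    and C: "C \<in> components (- A)" and gC: "g ` {0<..<1} \<subseteq> C"
    and U: "U1 \<in> components (- (A \<union> path_image g))" "U1 \<subseteq> C"
      "U2 \<in> components (- (A \<union> path_image g))" "U2 \<subseteq> C"
      "U3 \<in> components (- (A \<union> path_image g))" "U3 \<subseteq> C"
    and ne: "U1 \<noteq> U3" "U2 \<noteq> U3"
  shows "U1 = U2"
proof -
  have inj: "inj_on g {0..1}" and cont: "continuous_on {0..1} g"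
    using g by (auto simp: arc_def path_def)
  have pi: "path_image g = g ` {0..1}" by (simp add: path_image_def)
  have geq: "t = t'" if "g t = g t'" "t \<in> {0..1}" "t' \<in> {0..1}" for t t'
    using inj that unfolding inj_on_def by auto
  have ends: "g 0 \<in> A" "g 1 \<in> A" "\<And>t. 0 < t \<Longrightarrow> t < 1 \<Longrightarrow> g t \<notin> A"
  proof -
    show "g 0 \<in> A" "g 1 \<in> A" using gA by (auto simp: pathstart_def pathfinish_def)
    fix t :: real assume t: "0 < t" "t < 1"
    show "g t \<notin> A"
    proof
      assume "g t \<in> A"
      then have "g t = g 0 \<or> g t = g 1"
        using gA t by (auto simp: pi pathstart_def pathfinish_def)
      then show False
        using inj t unfolding inj_on_def by force
    qed
  qed
  note cl = arc_interior_subset_closure_component[OF A g gA C gC]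
  define Y where "Y = A \<union> path_image g"
  have Ycl: "closed Y"
    using A g by (simp add: Y_def closed_Un closed_arc_image compact_imp_closed)
  have Usub: "U1 \<inter> Y = {}" "U2 \<inter> Y = {}" "U3 \<inter> Y = {}"
    using U in_components_subset unfolding Y_def by blast+
  have disj: "U1 \<inter> U3 = {}" "U2 \<inter> U3 = {}"
    using ne U components_nonoverlap unfolding Y_def by blast+
  have U3: "open U3" "connected U3"
    using U(5) in_components_connected open_components[OF open_Compl[OF Ycl]] unfolding Y_def by blast+
  have fr: "frontier U3 \<subseteq> Y"
    using U(5) Ycl frontier_of_components_closed_complement unfolding Y_def by blast
  have frg: "g t \<in> frontier U3" if "0 < t" "t < 1" for t
    using cl[OF U(5,6)] that U3(1) Usub(3) by (force simp: frontier_def interior_open Y_def pi)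
  \<comment> \<open>Pieces of the arc are relatively open in the frontier of \<open>U3\<close>,
    which is the form in which the density of accessible frontier points is used.\<close>
  have piece: "openin (top_of_set (frontier U3)) (g ` {\<alpha><..<\<beta>})" if "0 < \<alpha>" "\<alpha> < \<beta>" "\<beta> < 1" for \<alpha> \<beta>
  proof -
    have "g ` {\<alpha><..<\<beta>} = frontier U3 \<inter> - (A \<union> g ` {0..\<alpha>} \<union> g ` {\<beta>..1})" (is "_ = ?R")
    proof
      show "g ` {\<alpha><..<\<beta>} \<subseteq> ?R"
      proof
        fix z assume "z \<in> g ` {\<alpha><..<\<beta>}"
        then obtain t where t: "z = g t" "\<alpha> < t" "t < \<beta>" by auto
        have "g t \<in> frontier U3" "g t \<notin> A" using frg[of t] ends(3)[of t] t that by simp_all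
        moreover have "g t \<notin> g ` {0..\<alpha>}" "g t \<notin> g ` {\<beta>..1}"
          using t that inj_on_image_mem_iff[OF inj, of t "{0..\<alpha>}"]
            inj_on_image_mem_iff[OF inj, of t "{\<beta>..1}"] by (simp_all add: subset_iff)
        ultimately show "z \<in> ?R" using t by simp
      qed
      show "?R \<subseteq> g ` {\<alpha><..<\<beta>}"
      proof
        fix z assume z: "z \<in> ?R"
        then have "z \<in> Y" "z \<notin> A" using fr by blast+
        then have "z \<in> g ` {0..1}" unfolding Y_def pi by simp
        then obtain t where t: "z = g t" "t \<in> {0..1}" by blast
        have "z \<notin> g ` {0..\<alpha>}" "z \<notin> g ` {\<beta>..1}" using z by simp_all
        with t(1) have "t \<notin> {0..\<alpha>}" "t \<notin> {\<beta>..1}" by blast+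
        then show "z \<in> g ` {\<alpha><..<\<beta>}" using t by auto
      qed
    qed
    moreover have "closed (A \<union> g ` {0..\<alpha>} \<union> g ` {\<beta>..1})"
      using A compact_subarc[OF g] that by (intro closed_Un compact_imp_closed) auto
    ultimately show ?thesis
      using openin_open_Int[OF open_Compl] by metis
  qed
  have "g ` {1/5<..<2/5} \<noteq> g ` {3/5<..<4/5}"
  proof
    assume *: "g ` {1/5<..<2/5} = g ` {3/5<..<4/5}"
    have "g (3/10) \<in> g ` {1/5<..<2/5}" by auto
    then obtain t where "g (3/10) = g t" "t \<in> {3/5<..<4/5}"
      using * by auto
    then show False using geq[of "3/10" t] by auto
  qed
  moreover have "openin (top_of_set (frontier U3)) (g ` {1/5<..<2/5})"
      "openin (top_of_set (frontier U3)) (g ` {3/5<..<4/5})"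
    by (rule piece; simp)+
  moreover have "g ` {1/5<..<2/5} \<noteq> {}" "g ` {3/5<..<4/5} \<noteq> {}"
    by simp_all
  ultimately obtain k where k: "arc k" "pathstart k \<in> g ` {1/5<..<2/5}"
      "pathfinish k \<in> g ` {3/5<..<4/5}" "k ` {0<..<1} \<subseteq> U3"
    using dense_accessible_frontier_point_pairs[OF U3] by metis
  from k(2) obtain s where s: "pathstart k = g s" "1/5 < s" "s < 2/5" by auto
  from k(3) obtain t where t: "pathfinish k = g t" "3/5 < t" "t < 4/5" by auto
  have kim: "path_image k \<subseteq> U3 \<union> {g s, g t}"
  proof
    fix z assume "z \<in> path_image k"
    then obtain r where r: "r \<in> {0..1}" "z = k r" by (auto simp: path_image_def)
    then show "z \<in> U3 \<union> {g s, g t}"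
      using k(4)[THEN subsetD, of "k r"] s(1) t(1)
      by (cases "r = 0"; cases "r = 1") (simp_all add: pathstart_def pathfinish_def)
  qed
  have kends: "g s \<in> path_image k" "g t \<in> path_image k"
    using s t by (metis pathstart_in_path_image, metis pathfinish_in_path_image)
  \<comment> \<open>\<open>P\<close> omits the open middle of the arc, \<open>Q\<close> omits
    \<open>A\<close> and the two ends. Hence \<open>U1\<close> and \<open>U2\<close> can be joined
    through \<open>g (1/2)\<close> off \<open>P\<close> and through \<open>g (1/10)\<close> off
    \<open>Q\<close>; the intervals for \<open>s\<close> and \<open>t\<close> were placed around
    these parameters.\<close>
  define P where "P = A \<union> g ` {0..s} \<union> g ` {t..1} \<union> path_image k"
  define Q where "Q = g ` {s..t} \<union> path_image k"
  obtain u1 u2 where u: "u1 \<in> U1" "u2 \<in> U2"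
    using U(1,3)[THEN in_components_nonempty] by blast
  have join: "connected_component (- Z) u1 u2"
    if Z: "U1 \<inter> Z = {}" "U2 \<inter> Z = {}" "g r \<notin> Z" "0 < r" "r < 1" for Z r
  proof -
    have "connected U1" "connected U2" using U in_components_connected by auto
    moreover have "g r \<in> closure U1" "g r \<in> closure U2"
      using cl[OF U(1,2)] cl[OF U(3,4)] Z(4,5) by auto
    ultimately have "connected (insert (g r) U1)" "connected (insert (g r) U2)"
      by (auto intro: connected_intermediate_closure closure_subset[THEN subsetD])
    then have "connected (insert (g r) U1 \<union> insert (g r) U2)"
      by (intro connected_Un) auto
    moreover have "insert (g r) U1 \<union> insert (g r) U2 \<subseteq> - Z" using Z by auto
    ultimately show ?thesis using u unfolding connected_component_def by blast
  qed
  have "connected_component (- (P \<union> Q)) u1 u2"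
  proof (rule Janiszewski)
    show "compact P"
      using A compact_subarc[OF g, of 0 s] compact_subarc[OF g, of t 1] s t k(1)
      unfolding P_def by (intro compact_Un) (auto simp: compact_arc_image)
    show "closed Q"
      using compact_subarc[OF g, of s t] s t k(1)
      unfolding Q_def by (intro closed_Un) (auto simp: compact_imp_closed closed_arc_image)
    have "z \<in> path_image k" if z: "z \<in> P" "z \<in> g ` {s..t}" for z
    proof -
      obtain r where r: "z = g r" "s \<le> r" "r \<le> t" using z(2) by auto
      then have "z \<notin> A" using ends(3)[of r] s t by auto
      then consider "z \<in> path_image k" | r' where "r' \<in> {0..s} \<union> {t..1}" "g r' = g r"
        using z(1) r(1) unfolding P_def by (metis UnE UnI1 UnI2 imageE)
      then show ?thesis
      proof cases
        case 2
        then have "r' = r" using geq[of r' r] r s t by auto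
        then have "r = s \<or> r = t" using r 2 by auto
        then show ?thesis using kends r by auto
      qed
    qed
    then have "P \<inter> Q = path_image k"
      unfolding Q_def by (auto simp: P_def)
    then show "connected (P \<inter> Q)"
      using k(1) by (simp add: connected_arc_image)
    have sub: "g ` {0..s} \<subseteq> Y" "g ` {t..1} \<subseteq> Y" "g ` {s..t} \<subseteq> Y" "A \<subseteq> Y" "g s \<in> Y" "g t \<in> Y"
      using s t unfolding Y_def pi by auto
    have "P \<union> Q \<subseteq> Y \<union> U3"
      using sub kim unfolding P_def Q_def by (intro Un_least) (assumption | blast)+
    then have UP: "U1 \<inter> P = {}" "U2 \<inter> P = {}" "U1 \<inter> Q = {}" "U2 \<inter> Q = {}"
      using Usub disj by blast+
    have kno: "g r \<notin> path_image k" if "0 < r" "r < 1" "r \<noteq> s" "r \<noteq> t" for r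
    proof
      assume "g r \<in> path_image k"
      moreover have "g r \<in> Y" using that by (auto simp: Y_def pi)
      ultimately have "g r = g s \<or> g r = g t"
        using kim Usub(3) by blast
      then show False using geq[of r s] geq[of r t] that s t by auto
    qed
    show "connected_component (- P) u1 u2"
    proof (rule join[of _ "1/2"])
      show "U1 \<inter> P = {}" "U2 \<inter> P = {}"
        using UP by auto
      have "g (1/2) \<notin> g ` {0..s}" "g (1/2) \<notin> g ` {t..1}"
        using s t inj_on_image_mem_iff[OF inj, of "1/2" "{0..s}"]
            inj_on_image_mem_iff[OF inj, of "1/2" "{t..1}"] by (simp_all add: subset_iff)
      then show "g (1/2) \<notin> P"
        using kno[of "1/2"] ends(3)[of "1/2"] s t unfolding P_def by auto
    qed auto
    show "connected_component (- Q) u1 u2"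
    proof (rule join[of _ "1/10"])
      show "U1 \<inter> Q = {}" "U2 \<inter> Q = {}"
        using UP by auto
      have "g (1/10) \<notin> g ` {s..t}"
        using s t inj_on_image_mem_iff[OF inj, of "1/10" "{s..t}"] by (simp add: subset_iff)
      then show "g (1/10) \<notin> Q"
        using kno[of "1/10"] s t unfolding Q_def by auto
    qed auto
  qed
  moreover have "Y \<subseteq> P \<union> Q"
  proof -
    have "{0..1} = {0..s} \<union> {s..t} \<union> {t..1}" using s t by auto
    then show ?thesis unfolding Y_def pi P_def Q_def by blast
  qed
  ultimately have "connected_component (- Y) u1 u2"
    using connected_component_of_subset[of "- (P \<union> Q)" u1 u2 "- Y"] by blast
  then obtain T where T: "connected T" "T \<subseteq> - Y" "u1 \<in> T" "u2 \<in> T"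
    unfolding connected_component_def by blast
  then show "U1 = U2"
    using U(1,3) u unfolding Y_def[symmetric]
    by (intro joinable_components_eq[of T "- Y"]) (simp_all add: disjoint_iff, metis+)
qed

lemma arc_interior_disjoint:
  assumes "arc g" "path_image g \<inter> A = {pathstart g, pathfinish g}"
  shows "g ` {0<..<1} \<inter> A = {}"
proof -
  have "g t \<notin> A" if t: "0 < t" "t < 1" for t
  proof
    assume "g t \<in> A"
    moreover have "g t \<in> path_image g" using t by (simp add: path_image_def)
    ultimately have "g t = g 0 \<or> g t = g 1"
      using assms(2) by (auto simp: pathstart_def pathfinish_def)
    moreover have "inj_on g {0..1}" using assms(1) by (simp add: arc_def)
    ultimately show False
      using t inj_on_eq_iff[of g "{0..1}" t 0] inj_on_eq_iff[of g "{0..1}" t 1] by simp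
  qed
  then show ?thesis by auto
qed

text \<open>Otherwise the inverse of the parametrization would embed an open set of the plane in the
  line, against invariance of dimension.\<close>

lemma open_not_subset_arc:
  fixes S :: "complex set"
  assumes "open S" "S \<noteq> {}" "arc g"
  shows "\<not> S \<subseteq> path_image g"
proof
  assume S: "S \<subseteq> path_image g"
  obtain h where h: "homeomorphism {0..1} (path_image g) g h"
    using homeomorphism_arc[OF assms(3)] by blast
  have "continuous_on S h" "inj_on h S"
    using h S unfolding homeomorphism_def
    by (blast intro: continuous_on_subset, metis inj_onI subsetD)
  then have "DIM(complex) \<le> DIM(real)"
    using invariance_of_dimension assms(1,2) by blast
  then show False by simp
qed

text \<open>The arc and a second arc inside \<open>A\<close> between its ends form a Jordan curve.
  Both sides accumulate at the midpoint of \<open>g\<close>, which lies in the open set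
  \<open>C\<close>; so \<open>C\<close> has points on both sides, and no component of the new
  complement crosses the curve.\<close>

lemma arc_splits_at_least_two:
  fixes A :: "complex set"
  assumes A: "compact A" and g: "arc g" and gA: "path_image g \<inter> A = {pathstart g, pathfinish g}"
    and pc: "path_component A (pathstart g) (pathfinish g)"
    and C: "C \<in> components (- A)" and gC: "g ` {0<..<1} \<subseteq> C"
  obtains U1 U2 where "U1 \<in> components (- (A \<union> path_image g))" "U1 \<subseteq> C"
      "U2 \<in> components (- (A \<union> path_image g))" "U2 \<subseteq> C" "U1 \<noteq> U2"
proof -
  have ne: "pathstart g \<noteq> pathfinish g" using g arc_distinct_ends by metis
  obtain p where p: "path p" "path_image p \<subseteq> A" "pathstart p = pathfinish g" "pathfinish p = pathstart g"
    using path_component_sym[OF pc] unfolding path_component_def by blast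
  obtain h where h: "arc h" "path_image h \<subseteq> path_image p"
    "pathstart h = pathfinish g" "pathfinish h = pathstart g"
    using path_contains_arc[OF p(1,3,4)] ne by metis
  define c where "c = g +++ h"
  have hA: "path_image h \<subseteq> A" using h(2) p(2) by (rule subset_trans)
  then have "path_image g \<inter> path_image h \<subseteq> path_image g \<inter> A" by (rule Int_mono[OF subset_refl])
  then have sub: "path_image g \<inter> path_image h \<subseteq> {pathstart g, pathstart h}"
    unfolding gA h(3) .
  have "simple_path c"
    unfolding c_def by (rule simple_path_join_loop) (use g h sub in auto)
  moreover have "pathfinish c = pathstart c"
    using h by (simp add: c_def)
  ultimately obtain inner outer where io: "open inner" "open outer" "inner \<inter> outer = {}"
    "inner \<union> outer = - path_image c" "frontier inner = path_image c" "frontier outer = path_image c"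
    by (rule Jordan_curve)
  have pc: "path_image c = path_image g \<union> path_image h"
    unfolding c_def using h by (simp add: path_image_join)
  have "open C"
    using C A open_components[of "- A" C] by (simp add: compact_imp_closed open_Compl)
  have half: "g (1/2) \<in> C" "g (1/2) \<in> path_image c"
    using gC pc by (auto simp: path_image_def)
  then have "C \<inter> inner \<noteq> {}" "C \<inter> outer \<noteq> {}"
    using io(5,6) open_Int_closure_eq_empty[OF \<open>open C\<close>] unfolding frontier_def by blast+
  then obtain x y where xy: "x \<in> C" "x \<in> inner" "y \<in> C" "y \<in> outer" by blast
  have CA: "C \<subseteq> - A" using C in_components_subset by blast
  have xyn: "x \<in> - (A \<union> path_image g)" "y \<in> - (A \<union> path_image g)"
    using xy CA io(4) pc by blast+
  define U where "U z = connected_component_set (- (A \<union> path_image g)) z" for z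
  have Uc: "U z \<in> components (- (A \<union> path_image g))" "z \<in> U z" "U z \<subseteq> C"
    if z: "z \<in> - (A \<union> path_image g)" "z \<in> C" for z
  proof -
    show "U z \<in> components (- (A \<union> path_image g))" using z unfolding U_def components_def by blast
    show zU: "z \<in> U z" using z unfolding U_def by simp
    have "U z \<subseteq> - A" using connected_component_subset unfolding U_def by fastforce
    moreover have "connected (U z)" unfolding U_def by simp
    ultimately show "U z \<subseteq> C"
      using C zU z(2) components_maximal[of C "- A" "U z"] by blast
  qed
  have "U x \<noteq> U y"
  proof
    assume "U x = U y"
    then have "y \<in> U x" using Uc xyn xy by metis
    moreover have "y \<notin> inner" using xy io(3) by blast
    moreover have "x \<in> U x" using Uc xyn xy by metis
    moreover have "connected (U x)" unfolding U_def by simp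
    ultimately have "U x \<inter> frontier inner \<noteq> {}"
      using xy(2) connected_Int_frontier[of "U x" inner] by blast
    moreover have "U x \<subseteq> - (A \<union> path_image g)" unfolding U_def by (rule connected_component_subset)
    ultimately show False using io(5) pc hA by blast
  qed
  then show ?thesis using that[of "U x" "U y"] Uc xyn xy by blast
qed

text \<open>This is the induction step of Euler's formula: only the component \<open>C\<close>
  around the open arc changes, into one or two pieces collected in \<open>N\<close>, and into
  exactly two if the arc closes a cycle.\<close>

lemma components_Compl_Un_arc:
  fixes A :: "complex set"
  assumes A: "compact A" and g: "arc g" and gA: "path_image g \<inter> A = {pathstart g, pathfinish g}"
  obtains C N where "C \<in> components (- A)" "g ` {0<..<1} \<subseteq> C"
    "components (- (A \<union> path_image g)) = (components (- A) - {C}) \<union> N"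
    "\<And>U. U \<in> N \<Longrightarrow> U \<subseteq> C" "(components (- A) - {C}) \<inter> N = {}"
    "finite N" "1 \<le> card N" "card N \<le> 2"
    "path_component A (pathstart g) (pathfinish g) \<Longrightarrow> card N = 2"
proof -
  let ?A' = "A \<union> path_image g"
  have cont: "continuous_on {0..1} g" using g by (auto simp: arc_def path_def)
  have dis: "g ` {0<..<1} \<inter> A = {}" by (rule arc_interior_disjoint[OF g gA])
  have "connected (g ` {0<..<1})"
    by (rule connected_continuous_image) (auto intro: continuous_on_subset[OF cont])
  moreover have "g (1/2) \<in> g ` {0<..<1}" by (rule imageI) simp
  then have "- A \<noteq> {}" using dis by blast
  moreover have "g ` {0<..<1} \<subseteq> - A" using dis by auto
  ultimately obtain C where C: "C \<in> components (- A)" "g ` {0<..<1} \<subseteq> C"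
    using exists_component_superset by blast
  have "{0..1} = insert 0 (insert 1 {0<..<1::real})" by auto
  then have "path_image g = insert (g 0) (insert (g 1) (g ` {0<..<1}))"
    unfolding path_image_def by (metis image_insert)
  then have piC: "path_image g \<subseteq> A \<union> C"
    using gA C(2) by (auto simp: pathstart_def pathfinish_def)
  define N where "N = {U \<in> components (- ?A'). U \<subseteq> C}"
  have old: "D \<in> components (- ?A')" if D: "D \<in> components (- A)" "D \<noteq> C" for D
  proof -
    have "D \<inter> C = {}" using D C(1) components_nonoverlap by blast
    moreover have "D \<subseteq> - A" using D in_components_subset by blast
    ultimately have "D \<subseteq> - ?A'" using piC by blast
    then show ?thesis
      using D(1) unfolding in_components_maximal by auto
  qed
  have eq: "components (- ?A') = (components (- A) - {C}) \<union> N"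
  proof (intro equalityI subsetI)
    fix U assume U: "U \<in> components (- ?A')"
    then have Us: "connected U" "U \<subseteq> - A" "U \<noteq> {}"
      using in_components_connected in_components_subset in_components_nonempty by blast+
    then obtain D where D: "D \<in> components (- A)" "U \<subseteq> D"
      using exists_component_superset[of U "- A"] by blast
    show "U \<in> (components (- A) - {C}) \<union> N"
    proof (cases "D = C")
      case True
      then show ?thesis using U D by (simp add: N_def)
    next
      case False
      then have "U = D"
        using components_eq[OF U old[OF D(1) False]] D(2) Us(3) by blast
      then show ?thesis using D False by simp
    qed
  qed (use old in \<open>auto simp: N_def\<close>)
  have Nsub: "U \<subseteq> C" if "U \<in> N" for U using that by (simp add: N_def)
  have Nne: "U \<noteq> {}" if "U \<in> N" for U using that in_components_nonempty by (auto simp: N_def)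
  have disj: "(components (- A) - {C}) \<inter> N = {}"
    using Nsub Nne C(1) components_nonoverlap[of _ "- A" C] by blast
  have "open C"
    using C A open_components[of "- A" C] by (simp add: compact_imp_closed open_Compl)
  \<comment> \<open>A point of \<open>C\<close> off the arc lies in some new component, so
    \<open>N\<close> is nonempty.\<close>
  then obtain x where x: "x \<in> C" "x \<notin> path_image g"
    using open_not_subset_arc[OF _ _ g, of C] C(1) in_components_nonempty by blast
  have "x \<in> - ?A'" using x C(1) in_components_subset by blast
  then obtain U where U: "U \<in> components (- ?A')" "x \<in> U"
    using Union_components by blast
  have "U \<in> N"
    using U eq x C(1) components_nonoverlap[of U "- A" C] by blast
  have two: "U1 = U2" if "U1 \<in> N" "U2 \<in> N" "U3 \<in> N" "U1 \<noteq> U3" "U2 \<noteq> U3" for U1 U2 U3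
    using that arc_splits_at_most_two[OF A g gA C, of U1 U2 U3] unfolding N_def by blast
  obtain W where W: "N \<subseteq> {U, W}"
  proof (cases "N \<subseteq> {U}")
    case False
    then obtain W where "W \<in> N" "W \<noteq> U" by blast
    then have "N \<subseteq> {U, W}" using two \<open>U \<in> N\<close> by blast
    then show ?thesis using that by blast
  qed (use that in blast)
  then have fin: "finite N" by (rule finite_subset) simp
  have "card N \<le> card {U, W}" using W by (intro card_mono) auto
  also have "\<dots> \<le> 2" by (simp add: card_insert_if)
  finally have le2: "card N \<le> 2" .
  have ge1: "1 \<le> card N" using fin \<open>U \<in> N\<close> by (metis One_nat_def Suc_leI card_gt_0_iff empty_iff)
  have "card N = 2" if pc: "path_component A (pathstart g) (pathfinish g)"
  proof -
    obtain U1 U2 where "U1 \<in> N" "U2 \<in> N" "U1 \<noteq> U2"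
      by (rule arc_splits_at_least_two[OF A g gA pc C]) (simp add: N_def)
    then have "card {U1, U2} \<le> card N" using fin by (intro card_mono) auto
    then show ?thesis using le2 \<open>U1 \<noteq> U2\<close> by simp
  qed
  note card2 = this
  show ?thesis
    by (rule that[OF C eq]) (use Nsub disj fin ge1 le2 card2 in simp_all)
qed

section \<open>Plane drawings and Euler bounds\<close>

text \<open>A nonempty subset of minimum degree two. For finite graphs this amounts to containing a
  cycle without putting its vertices in order, and its negation directly yields a leaf.\<close>

definition cyclic_edges :: "'v set set \<Rightarrow> bool" where
  "cyclic_edges B \<longleftrightarrow>
     (\<exists>B'\<subseteq>B. B' \<noteq> {} \<and> (\<forall>e\<in>B'. \<forall>v\<in>e. \<exists>e'\<in>B'. e' \<noteq> e \<and> v \<in> e'))"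

definition is_triangle :: "'v set set \<Rightarrow> bool" where
  "is_triangle B \<longleftrightarrow> (\<exists>a b c. a \<noteq> b \<and> b \<noteq> c \<and> a \<noteq> c \<and> B = {{a, b}, {b, c}, {a, c}})"

lemma card_triangle: "is_triangle B \<Longrightarrow> card B = 3"
  unfolding is_triangle_def by (auto simp: card_insert_if doubleton_eq_iff)

text \<open>An edge ab of a subset of minimum degree two continues at both ends, to c at a and to d
  at b. If c = d this is a triangle; otherwise the continuation at c is a fourth edge.\<close>

lemma cyclic_edges_triangle_or_four:
  assumes "cyclic_edges B" "finite B" "\<And>e. e \<in> B \<Longrightarrow> card e = 2"
  shows "(\<exists>D\<subseteq>B. is_triangle D) \<or> 4 \<le> card B"
proof -
  from assms(1) obtain B' where
    *: "B' \<subseteq> B \<and> B' \<noteq> {} \<and> (\<forall>e\<in>B'. \<forall>v\<in>e. \<exists>e'\<in>B'. e' \<noteq> e \<and> v \<in> e')"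
    unfolding cyclic_edges_def by (elim exE)
  then have B': "B' \<subseteq> B" "B' \<noteq> {}" by simp_all
  have deg: "\<exists>e'\<in>B'. e' \<noteq> e \<and> v \<in> e'" if "e \<in> B'" "v \<in> e" for e v
    using * that by simp
  have other: "\<exists>c. c \<noteq> a \<and> c \<noteq> b \<and> {a, c} \<in> B'" if ab: "{a, b} \<in> B'" for a b
  proof -
    obtain e' where e': "e' \<in> B'" "e' \<noteq> {a, b}" "a \<in> e'" using deg[OF ab, of a] by blast
    then have "card e' = 2" using assms(3) B' by blast
    then obtain x y where "e' = {x, y}" "x \<noteq> y" unfolding card_2_iff by blast
    then show ?thesis using e' by (cases "x = a") (auto simp: insert_commute)
  qed
  obtain e where e: "e \<in> B'" using B' by blast
  then have "card e = 2" using assms(3) B' by blast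
  then obtain a b where ab: "e = {a, b}" "a \<noteq> b" unfolding card_2_iff by blast
  obtain c where c: "c \<noteq> a" "c \<noteq> b" "{a, c} \<in> B'" using other e ab by blast
  obtain d where d: "d \<noteq> a" "d \<noteq> b" "{b, d} \<in> B'"
    using other[of b a] e ab by (auto simp: insert_commute)
  show ?thesis
  proof (cases "c = d")
    case True
    have "is_triangle {{a, b}, {b, c}, {a, c}}" unfolding is_triangle_def using c ab by blast
    moreover have "{{a, b}, {b, c}, {a, c}} \<subseteq> B" using e ab c d True B' by blast
    ultimately show ?thesis by blast
  next
    case False
    obtain x where x: "x \<noteq> a" "x \<noteq> c" "{c, x} \<in> B'"
      using other[of c a] c by (auto simp: insert_commute)
    have "{{a, b}, {a, c}, {b, d}, {c, x}} \<subseteq> B" using e ab c d x B' by blast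
    moreover have "card {{a, b}, {a, c}, {b, d}, {c, x}} = 4"
      using ab c d x False by (auto simp: card_insert_if doubleton_eq_iff)
    ultimately have "4 \<le> card B" using card_mono[OF assms(2)] by metis
    then show ?thesis by blast
  qed
qed

text \<open>\<open>d\<close> factors through \<open>c\<close>. With path components before and after
  an edge is added, this says that their number does not grow, and drops when two of them
  merge.\<close>

lemma card_image_coarser:
  assumes "finite S" "\<And>x y. x \<in> S \<Longrightarrow> y \<in> S \<Longrightarrow> c x = c y \<Longrightarrow> d x = d y"
  shows "card (d ` S) \<le> card (c ` S)"
    and "x \<in> S \<Longrightarrow> y \<in> S \<Longrightarrow> c x \<noteq> c y \<Longrightarrow> d x = d y \<Longrightarrow> card (d ` S) < card (c ` S)"
proof -
  define k where "k z = d (SOME x. x \<in> S \<and> c x = z)" for z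
  have k: "k (c x) = d x" if "x \<in> S" for x
  proof -
    have "(SOME y. y \<in> S \<and> c y = c x) \<in> S \<and> c (SOME y. y \<in> S \<and> c y = c x) = c x"
      by (rule someI[of "\<lambda>y. y \<in> S \<and> c y = c x" x]) (simp add: that)
    then show ?thesis using assms(2) that unfolding k_def by blast
  qed
  then have eq: "d ` S = k ` (c ` S)" by (auto simp: image_image)
  then show le: "card (d ` S) \<le> card (c ` S)" using assms(1) by (simp add: card_image_le)
  assume xy: "x \<in> S" "y \<in> S" "c x \<noteq> c y" "d x = d y"
  then have "\<not> inj_on k (c ` S)" using k by (metis imageI inj_onD)
  then have "card (k ` (c ` S)) \<noteq> card (c ` S)"
    using assms(1) by (metis eq_card_imp_inj_on finite_imageI)
  then show "card (d ` S) < card (c ` S)" using le eq by simp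
qed

section \<open>Faces of a plane drawing and Euler's inequality\<close>

locale plane_graph =
  fixes V :: "'v set" and E :: "'v set set" and f :: "'v \<Rightarrow> complex"
    and \<gamma> :: "'v set \<Rightarrow> real \<Rightarrow> complex"
  assumes finV: "finite V" and EV: "\<And>e. e \<in> E \<Longrightarrow> e \<subseteq> V"
    and injf: "inj_on f V"
    and arcs: "\<And>e. e \<in> E \<Longrightarrow> arc (\<gamma> e)"
    and ends: "\<And>e. e \<in> E \<Longrightarrow> {pathstart (\<gamma> e), pathfinish (\<gamma> e)} = f ` e"
    and verts: "\<And>e. e \<in> E \<Longrightarrow> path_image (\<gamma> e) \<inter> f ` V = f ` e"
    and cross: "\<And>e e'. e \<in> E \<Longrightarrow> e' \<in> E \<Longrightarrow> e \<noteq> e' \<Longrightarrow>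
                  path_image (\<gamma> e) \<inter> path_image (\<gamma> e') = f ` (e \<inter> e')"
begin

lemma finE: "finite E"
proof -
  have "E \<subseteq> Pow V" using EV by blast
  then show ?thesis using finV finite_subset by blast
qed

lemma card_edge: "e \<in> E \<Longrightarrow> card e = 2"
proof -
  assume e: "e \<in> E"
  have "pathstart (\<gamma> e) \<noteq> pathfinish (\<gamma> e)" using arcs[OF e] arc_distinct_ends by metis
  then have "card (f ` e) = 2" using ends[OF e] by (metis card_2_iff)
  moreover have "inj_on f e" using injf EV[OF e] inj_on_subset by blast
  ultimately show ?thesis by (simp add: card_image)
qed

text \<open>All vertices are included, even those on no edge of \<open>B\<close>, so that edges can
  be added one at a time to a fixed finite point set.\<close>

definition body :: "'v set set \<Rightarrow> complex set" where
  "body B = f ` V \<union> (\<Union>e\<in>B. path_image (\<gamma> e))"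

definition faces :: "complex set set" where
  "faces = components (- body E)"

text \<open>Only the open edge is tested: an edge that meets the closure of a face just in an
  endpoint does not count.\<close>

definition bd :: "complex set \<Rightarrow> 'v set set" where
  "bd U = {e \<in> E. closure U \<inter> \<gamma> e ` {0<..<1} \<noteq> {}}"

lemma compact_body: "B \<subseteq> E \<Longrightarrow> compact (body B)"
  unfolding body_def using finE finV arcs
  by (intro compact_Un compact_UN) (auto intro: finite_imp_compact finite_subset compact_arc_image)

lemma body_insert: "body (insert e B) = body B \<union> path_image (\<gamma> e)"
  unfolding body_def by blast

lemma arc_Int_body:
  assumes "e \<in> E" "B \<subseteq> E" "e \<notin> B"
  shows "path_image (\<gamma> e) \<inter> body B = {pathstart (\<gamma> e), pathfinish (\<gamma> e)}"
proof -
  have "path_image (\<gamma> e) \<inter> path_image (\<gamma> e') \<subseteq> f ` e" if "e' \<in> B" for e'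
    using cross[of e e'] that assms by blast
  then have "path_image (\<gamma> e) \<inter> body B = f ` e"
    using verts[OF assms(1)] unfolding body_def by blast
  then show ?thesis using ends[OF assms(1)] by simp
qed

text \<open>Without edges there is one face. A new edge either merges two components of the drawing
  and leaves at least as many faces, or it joins points of one component, closes a cycle and splits
  a face. The image in the formula counts the components that contain vertices.\<close>

lemma face_count:
  assumes "B \<subseteq> E"
  shows "finite (components (- body B)) \<and>
    card B + 1 + card ((\<lambda>z. path_component_set (body B) z) ` f ` V)
      \<le> card (components (- body B)) + card V"
proof -
  have "finite B" using assms finE finite_subset by blast
  then show ?thesis using assms
  proof (induction rule: finite_induct)
    case empty
    have "connected (UNIV - f ` V)"
      by (rule connected_open_delete_finite) (use finV in auto)
    moreover have "UNIV - f ` V \<noteq> {}"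
      using finV by (metis Diff_eq_empty_iff finite_imageI finite_subset infinite_UNIV_char_0)
    ultimately have "components (- body {}) = {- body {}}"
      unfolding components_eq_sing_iff by (simp add: body_def Compl_eq_Diff_UNIV)
    moreover have "card ((\<lambda>z. path_component_set (body {}) z) ` f ` V) \<le> card V"
      using finV by (metis card_image_le finite_imageI le_trans)
    ultimately show ?case by simp
  next
    case (insert e B)
    let ?c = "\<lambda>z. path_component_set (body B) z"
    let ?d = "\<lambda>z. path_component_set (body (insert e B)) z"
    have e: "e \<in> E" and B: "B \<subseteq> E" using insert.prems by auto
    have IH: "finite (components (- body B))"
      "card B + 1 + card (?c ` f ` V) \<le> card (components (- body B)) + card V"
      using insert.IH B by auto
    obtain C N where CN: "C \<in> components (- body B)" 
      "components (- (body B \<union> path_image (\<gamma> e))) = (components (- body B) - {C}) \<union> N"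
      "(components (- body B) - {C}) \<inter> N = {}" "finite N" "1 \<le> card N"
      "path_component (body B) (pathstart (\<gamma> e)) (pathfinish (\<gamma> e)) \<Longrightarrow> card N = 2"
      using components_Compl_Un_arc[OF compact_body[OF B] arcs[OF e] arc_Int_body[OF e B insert.hyps(2)]]
      by metis
    have cardC: "card (components (- body B) - {C}) + 1 = card (components (- body B))"
      using CN(1) IH(1) by (metis Suc_eq_plus1 card_Suc_Diff1)
    have comps: "finite (components (- body (insert e B)))"
      "card (components (- body (insert e B))) = card (components (- body B) - {C}) + card N"
      using CN(2-4) IH(1) by (simp_all add: body_insert card_Un_disjoint)
    have sub: "body B \<subseteq> body (insert e B)" by (auto simp: body_insert)
    have fin: "finite (f ` V)" using finV by simp
    have coarse: "?d x = ?d y" if "x \<in> f ` V" "y \<in> f ` V" "?c x = ?c y" for x y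
    proof -
      have "x \<in> body B" using that(1) by (auto simp: body_def)
      then have "path_component (body B) x x" by (simp add: path_component_refl)
      then have "path_component (body B) y x" using that(3) by auto
      then have "path_component (body (insert e B)) y x"
        by (rule path_component_of_subset[OF sub])
      then show ?thesis by (metis path_component_eq mem_Collect_eq)
    qed
    have st: "pathstart (\<gamma> e) \<in> f ` V" "pathfinish (\<gamma> e) \<in> f ` V"
      using ends[OF e] EV[OF e] by blast+
    show ?case
    proof (cases "path_component (body B) (pathstart (\<gamma> e)) (pathfinish (\<gamma> e))")
      case True
      have "card (?d ` f ` V) \<le> card (?c ` f ` V)"
        by (rule card_image_coarser(1)[OF fin coarse])
      then show ?thesis
        using IH(2) comps cardC CN(6)[OF True] insert.hyps by simp
    next
      case False
      have "path_component (body (insert e B)) (pathstart (\<gamma> e)) (pathfinish (\<gamma> e))"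
        unfolding path_component_def using arcs[OF e]
        by (intro exI[of _ "\<gamma> e"]) (auto simp: arc_imp_path body_insert)
      then have "?d (pathstart (\<gamma> e)) = ?d (pathfinish (\<gamma> e))"
        by (metis path_component_eq mem_Collect_eq)
      moreover have "pathfinish (\<gamma> e) \<in> ?c (pathfinish (\<gamma> e))"
        using st by (auto simp: body_def path_component_refl)
      then have "?c (pathstart (\<gamma> e)) \<noteq> ?c (pathfinish (\<gamma> e))"
        using False by auto
      ultimately have "card (?d ` f ` V) < card (?c ` f ` V)"
        by (intro card_image_coarser(2)[OF fin coarse st])
      then show ?thesis
        using IH(2) comps cardC CN(5) insert.hyps by simp
    qed
  qed
qed

lemma finite_faces: "finite faces"
  using face_count[of E] by (simp add: faces_def)

lemma card_faces:
  assumes "V \<noteq> {}"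
  shows "card E + 2 \<le> card faces + card V"
proof -
  have "card ((\<lambda>z. path_component_set (body E) z) ` f ` V) \<noteq> 0"
    using finV assms by simp
  then show ?thesis using face_count[of E] by (simp add: faces_def)
qed

text \<open>Without \<open>e\<close>, the open edge lies in a single face; the faces touching
  \<open>e\<close> are among the at most two pieces into which \<open>e\<close> cuts it.\<close>

lemma edge_two_faces:
  assumes "e \<in> E"
  shows "card {U \<in> faces. e \<in> bd U} \<le> 2"
proof -
  let ?B = "E - {e}"
  have B: "?B \<subseteq> E" "e \<notin> ?B" by auto
  have E: "body E = body ?B \<union> path_image (\<gamma> e)"
    using assms body_insert[of e ?B] by (simp add: insert_absorb)
  obtain C N where CN: "C \<in> components (- body ?B)" "\<gamma> e ` {0<..<1} \<subseteq> C"
      "components (- (body ?B \<union> path_image (\<gamma> e))) = (components (- body ?B) - {C}) \<union> N"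
      "finite N" "card N \<le> 2"
    using components_Compl_Un_arc[OF compact_body[OF B(1)] arcs[OF assms] arc_Int_body[OF assms B]]
    by metis
  have "open C"
    using CN(1) compact_body[OF B(1)] open_components by (metis compact_imp_closed open_Compl)
  have "{U \<in> faces. e \<in> bd U} \<subseteq> N"
  proof clarify
    fix U assume U: "U \<in> faces" "e \<in> bd U"
    then have "closure U \<inter> C \<noteq> {}" using CN(2) unfolding bd_def by blast
    then have "C \<inter> U \<noteq> {}" using open_Int_closure_eq_empty[OF \<open>open C\<close>, of U] by blast
    then have "U \<notin> components (- body ?B) - {C}"
      using CN(1) components_nonoverlap[of U "- body ?B" C] by blast
    then show "U \<in> N" using U(1) CN(3) E by (auto simp: faces_def)
  qed
  then show ?thesis using CN(4,5) card_mono le_trans by blast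
qed

text \<open>Incidences of faces and edges, counted from both sides.\<close>

lemma sum_bd: "(\<Sum>U\<in>faces. card (bd U)) \<le> 2 * card E"
proof -
  have "(\<Sum>U\<in>faces. card (bd U)) = (\<Sum>U\<in>faces. \<Sum>e\<in>E. if e \<in> bd U then 1 else 0)"
    using finE by (intro sum.cong) (auto simp: bd_def sum.If_cases Int_def)
  also have "\<dots> = (\<Sum>e\<in>E. \<Sum>U\<in>faces. if e \<in> bd U then 1 else 0)"
    by (rule sum.swap)
  also have "\<dots> = (\<Sum>e\<in>E. card {U \<in> faces. e \<in> bd U})"
    using finite_faces by (intro sum.cong) (auto simp: sum.If_cases Int_def)
  also have "\<dots> \<le> (\<Sum>e\<in>E. 2)" by (intro sum_mono edge_two_faces)
  finally show ?thesis by simp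
qed

text \<open>A forest does not separate the plane. A leaf edge is taken away together with its free
  end; its arc meets the rest in at most one point and can be put back without separating
  anything.\<close>

lemma connected_Compl_body_acyclic:
  assumes "B \<subseteq> E" "\<not> cyclic_edges B"
  shows "connected (- body B)"
proof -
  have "finite B" using assms finE finite_subset by blast
  then show ?thesis using assms
  proof (induction rule: finite_psubset_induct)
    case (psubset B)
    show ?case
    proof (cases "B = {}")
      case True
      have "connected (UNIV - f ` V)"
        by (rule connected_open_delete_finite) (use finV in auto)
      then show ?thesis using True by (simp add: body_def Compl_eq_Diff_UNIV)
    next
      case False
      then have "\<not> (\<forall>e\<in>B. \<forall>v\<in>e. \<exists>e'\<in>B. e' \<noteq> e \<and> v \<in> e')"
        using psubset.prems(2) unfolding cyclic_edges_def by (metis subset_refl)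
      then obtain e v where ev: "e \<in> B" "v \<in> e" "\<And>e'. e' \<in> B \<Longrightarrow> v \<in> e' \<Longrightarrow> e' = e"
        by metis
      have e: "e \<in> E" using ev(1) psubset.prems(1) by blast
      have vV: "v \<in> V" using ev(2) EV[OF e] by blast
      let ?D = "B - {e}"
      have D: "?D \<subseteq> E" "e \<notin> ?D" using psubset.prems by auto
      have "\<not> cyclic_edges ?D"
        using psubset.prems(2) unfolding cyclic_edges_def by (meson Diff_subset subset_trans)
      then have conn: "connected (- body ?D)"
        using psubset.IH[of ?D] D ev(1) by blast
      \<comment> \<open>The free end \<open>f v\<close> leaves the point set too: otherwise the arc
        would meet the remaining drawing in both endpoints, a disconnected intersection.\<close>
      define A where "A = f ` (V - {v}) \<union> (\<Union>e\<in>?D. path_image (\<gamma> e))"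
      have vno: "f v \<notin> path_image (\<gamma> e')" if "e' \<in> ?D" for e'
      proof
        assume "f v \<in> path_image (\<gamma> e')"
        moreover have e': "e' \<in> E" using that D by blast
        ultimately have "f v \<in> f ` e'" using verts[OF e'] vV by blast
        then have "v \<in> e'" using inj_on_image_mem_iff[OF injf vV EV[OF e']] by blast
        then show False using ev(3)[of e'] that by blast
      qed
      have vA: "f v \<notin> A"
        using vno vV inj_on_image_mem_iff[OF injf vV, of "V - {v}"] unfolding A_def by blast
      have bodyD: "body ?D = insert (f v) A"
        unfolding body_def A_def using vV by blast
      have bodyB: "body B = A \<union> path_image (\<gamma> e)"
      proof -
        have "f v \<in> path_image (\<gamma> e)" using verts[OF e] ev(2) by blast
        moreover have "body B = body ?D \<union> path_image (\<gamma> e)"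
          using ev(1) body_insert[of e ?D] by (simp add: insert_absorb)
        ultimately show ?thesis using bodyD by auto
      qed
      have A: "compact A"
        unfolding A_def using D finE finV arcs psubset.hyps
        by (intro compact_Un compact_UN) (auto intro: finite_imp_compact finite_subset compact_arc_image)
      have "path_image (\<gamma> e) \<inter> A \<subseteq> path_image (\<gamma> e) \<inter> body ?D" using bodyD by auto
      then have "A \<inter> path_image (\<gamma> e) \<subseteq> {pathstart (\<gamma> e), pathfinish (\<gamma> e)}"
        unfolding arc_Int_body[OF e D] by (simp add: Int_commute)
      moreover have "f v \<in> {pathstart (\<gamma> e), pathfinish (\<gamma> e)}"
        unfolding ends[OF e] using ev(2) by (rule imageI)
      ultimately obtain w where "A \<inter> path_image (\<gamma> e) \<subseteq> {w}" using vA by (cases "f v = pathstart (\<gamma> e)") auto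
      then have cI: "connected (A \<inter> path_image (\<gamma> e))"
        by (metis connected_empty connected_sing subset_singletonD)
      \<comment> \<open>Passing from \<open>body ?D\<close> to \<open>A\<close> adds the single
        point \<open>f v\<close> to the complement, and it is a limit point of that
        complement.\<close>
      have cA: "connected (- A)"
      proof (rule connected_intermediate_closure[OF conn])
        show "- body ?D \<subseteq> - A" using bodyD by blast
        have "open (- A)" using A by (simp add: compact_imp_closed open_Compl)
        then have "f v islimpt (- A)" using vA by (simp add: interior_limit_point interior_open)
        then have "f v \<in> closure (- A - {f v})" by (simp add: islimpt_in_closure)
        moreover have "- A - {f v} = - body ?D" using bodyD by blast
        ultimately show "- A \<subseteq> closure (- body ?D)"
          using closure_subset[of "- body ?D"] bodyD by auto
      qed
      show ?thesis
        unfolding connected_iff_connected_component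
      proof (intro ballI)
        fix x y assume xy: "x \<in> - body B" "y \<in> - body B"
        then have "connected_component (- A) x y"
          using cA bodyB by (auto simp: connected_iff_connected_component)
        then show "connected_component (- body B) x y"
          using connected_component_Compl_Un_arc[OF A arcs[OF e] cI] xy bodyB by auto
      qed
    qed
  qed
qed

text \<open>The frontier of a face lies on the vertices and on the edges it touches, so deleting all
  other edges does not enlarge the face.\<close>

lemma face_component_bd:
  assumes "U \<in> faces"
  shows "U \<in> components (- body (bd U))"
proof -
  have U: "connected U" "U \<noteq> {}" "U \<subseteq> - body E"
    using assms in_components_connected in_components_nonempty in_components_subset
    unfolding faces_def by blast+
  have mono: "- body E \<subseteq> - body (bd U)" by (auto simp: body_def bd_def)
  have "closed (body E)" using compact_body[of E] by (simp add: compact_imp_closed)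
  then have fr: "frontier U \<subseteq> body E"
    using assms frontier_of_components_closed_complement unfolding faces_def by blast
  have "frontier U \<subseteq> body (bd U)"
  proof
    fix z assume z: "z \<in> frontier U"
    show "z \<in> body (bd U)"
    proof (cases "z \<in> f ` V")
      case False
      then obtain e where e: "e \<in> E" "z \<in> path_image (\<gamma> e)"
        using fr z unfolding body_def by blast
      then obtain t where t: "t \<in> {0..1}" "z = \<gamma> e t" by (auto simp: path_image_def)
      have "pathstart (\<gamma> e) \<in> f ` V" "pathfinish (\<gamma> e) \<in> f ` V"
        using ends[OF e(1)] EV[OF e(1)] by blast+
      then have "t \<noteq> 0" "t \<noteq> 1" using False t by (auto simp: pathstart_def pathfinish_def)
      then have "z \<in> \<gamma> e ` {0<..<1}" using t by simp
      moreover have "z \<in> closure U" using z by (simp add: frontier_def)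
      ultimately have "e \<in> bd U" using e(1) unfolding bd_def by blast
      then show ?thesis using e(2) unfolding body_def by blast
    qed (simp add: body_def)
  qed
  then have "d = U" if "U \<subseteq> d" "d \<subseteq> - body (bd U)" "connected d" for d
    using connected_Int_frontier[of d U] that U(2) by blast
  then show ?thesis
    unfolding in_components_maximal using U mono by blast
qed

text \<open>Edges without a cycle do not separate the plane, so the face would be the full
  complement of its boundary and leave no room for a second face.\<close>

lemma cyclic_bd:
  assumes "U \<in> faces" "2 \<le> card faces"
  shows "cyclic_edges (bd U)"
proof (rule ccontr)
  assume "\<not> cyclic_edges (bd U)"
  then have "connected (- body (bd U))"
    by (rule connected_Compl_body_acyclic[rotated]) (auto simp: bd_def)
  then have eq: "U = - body (bd U)"
    using face_component_bd[OF assms(1)] connected_eq_components_subset_sing by blast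
  obtain W where W: "W \<in> faces" "W \<noteq> U"
    using assms by (metis card_le_Suc0_iff_eq finite_faces not_less_eq_eq numeral_2_eq_2)
  have "W \<subseteq> - body E" "W \<noteq> {}"
    using W(1) in_components_subset in_components_nonempty unfolding faces_def by blast+
  moreover have "- body E \<subseteq> - body (bd U)" by (auto simp: body_def bd_def)
  ultimately have "W \<inter> U \<noteq> {}" using eq by blast
  then show False
    using W assms(1) components_nonoverlap[of W "- body E" U] unfolding faces_def by blast
qed

lemma finite_bd: "finite (bd U)" "bd U \<subseteq> E"
  using finE by (auto simp: bd_def)

lemma bd_triangle_or_four:
  assumes "U \<in> faces" "2 \<le> card faces"
  shows "(\<exists>D\<subseteq>bd U. is_triangle D) \<or> 4 \<le> card (bd U)"
  using cyclic_edges_triangle_or_four[OF cyclic_bd[OF assms] finite_bd(1)] card_edge finite_bd(2)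
  by blast

text \<open>Two edges of the triangle do not separate the plane, and the third produces at most two
  components. Two faces with this boundary are those components already, and any further face would
  have to lie inside one of them.\<close>

lemma same_triangle_two_faces:
  assumes U: "U1 \<in> faces" "U2 \<in> faces" "U1 \<noteq> U2" "bd U1 = bd U2" "is_triangle (bd U1)"
  shows "card faces \<le> 2"
proof -
  let ?B = "bd U1"
  obtain e where e: "e \<in> ?B" using U(5) unfolding is_triangle_def by blast
  have eE: "e \<in> E" using e finite_bd by blast
  let ?D = "?B - {e}"
  have D: "?D \<subseteq> E" "e \<notin> ?D" using finite_bd by auto
  have "card ?D = 2" using card_triangle[OF U(5)] e by simp
  have "\<not> cyclic_edges ?D"
  proof
    assume "cyclic_edges ?D"
    moreover have "card e' = 2" if "e' \<in> ?D" for e' using that D(1) card_edge by blast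
    ultimately have "(\<exists>T\<subseteq>?D. is_triangle T) \<or> 4 \<le> card ?D"
      using finite_bd(1) by (intro cyclic_edges_triangle_or_four) auto
    then obtain T where "T \<subseteq> ?D" "is_triangle T" using \<open>card ?D = 2\<close> by auto
    then have "3 \<le> card ?D" using card_triangle card_mono[of ?D T] finite_bd(1) by force
    then show False using \<open>card ?D = 2\<close> by simp
  qed
  then have conn: "connected (- body ?D)" using connected_Compl_body_acyclic D by blast
  have eq: "body ?B = body ?D \<union> path_image (\<gamma> e)"
    using e body_insert[of e ?D] by (simp add: insert_absorb)
  obtain C N where CN: "C \<in> components (- body ?D)"
      "components (- (body ?D \<union> path_image (\<gamma> e))) = (components (- body ?D) - {C}) \<union> N"
      "finite N" "card N \<le> 2"
    using components_Compl_Un_arc[OF compact_body[OF D(1)] arcs[OF eE] arc_Int_body[OF eE D]]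
    by metis
  have old: "components (- body ?D) - {C} = {}"
    using conn CN(1) connected_eq_components_subset_sing by blast
  then have N: "components (- body ?B) = N" using CN(2) unfolding eq old by simp
  have U12: "U1 \<in> N" "U2 \<in> N" using face_component_bd U N by metis+
  then have N2: "N = {U1, U2}"
    using CN(3,4) U(3) card_seteq[of N "{U1, U2}"] by auto
  have "faces \<subseteq> {U1, U2}"
  proof
    fix W assume W: "W \<in> faces"
    then have Ws: "connected W" "W \<noteq> {}" "W \<subseteq> - body E"
      using in_components_connected in_components_nonempty in_components_subset
      unfolding faces_def by blast+
    moreover have "- body E \<subseteq> - body ?B" by (auto simp: body_def bd_def)
    ultimately obtain T where "T \<in> components (- body ?B)" "W \<subseteq> T"
      using exists_component_superset[of W "- body ?B"] by blast
    then have "W \<subseteq> U1 \<or> W \<subseteq> U2" using N N2 by blast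
    then show "W \<in> {U1, U2}"
      using W Ws(2) U components_nonoverlap[of W "- body E"] unfolding faces_def by blast
  qed
  then have "card faces \<le> card {U1, U2}" by (intro card_mono) auto
  also have "\<dots> \<le> 2" by (simp add: card_insert_if)
  finally show ?thesis .
qed

text \<open>\<open>card V \<le> card E\<close> forces at least two faces, so every face has a cycle
  on its boundary and thus three edges. Then 3F \<le> 2E is combined with E + 2 \<le> F + V.\<close>

lemma edge_bound:
  assumes "V \<noteq> {}" "card V \<le> card E"
  shows "card E + 6 \<le> 3 * card V"
proof -
  have F: "card E + 2 \<le> card faces + card V" by (rule card_faces[OF assms(1)])
  have "3 \<le> card (bd U)" if "U \<in> faces" for U
  proof -
    have "(\<exists>D\<subseteq>bd U. is_triangle D) \<or> 4 \<le> card (bd U)"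
      by (rule bd_triangle_or_four[OF that]) (use F assms(2) in linarith)
    then show ?thesis
    proof
      assume "\<exists>D\<subseteq>bd U. is_triangle D"
      then show ?thesis using card_mono[OF finite_bd(1)] card_triangle by metis
    qed simp
  qed
  then have "(\<Sum>U\<in>faces. 3) \<le> (\<Sum>U\<in>faces. card (bd U))" by (intro sum_mono)
  then show ?thesis using sum_bd F by simp
qed

lemma edge_bound_triangle_free:
  assumes "V \<noteq> {}" "card V \<le> card E" "\<And>D. D \<subseteq> E \<Longrightarrow> \<not> is_triangle D"
  shows "card E + 4 \<le> 2 * card V"
proof -
  have F: "card E + 2 \<le> card faces + card V" by (rule card_faces[OF assms(1)])
  have "4 \<le> card (bd U)" if "U \<in> faces" for U
  proof -
    have "(\<exists>D\<subseteq>bd U. is_triangle D) \<or> 4 \<le> card (bd U)"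
      by (rule bd_triangle_or_four[OF that]) (use F assms(2) in linarith)
    moreover have "\<not> is_triangle D" if "D \<subseteq> bd U" for D
      using that finite_bd(2) by (intro assms(3)) (rule subset_trans)
    ultimately show ?thesis by blast
  qed
  then have "(\<Sum>U\<in>faces. 4) \<le> (\<Sum>U\<in>faces. card (bd U))" by (intro sum_mono)
  then show ?thesis using sum_bd F by simp
qed

text \<open>If T of the F faces are triangles, then 4F - T \<le> 2E = 4V. Since F \<ge> V + 2, this
  gives T \<ge> 8; and disjoint triangles use 3T \<le> E = 2V edges, so V \<ge> 12.\<close>

lemma edge_disjoint_triangles_bound:
  assumes "V \<noteq> {}" "card E = 2 * card V"
    and dis: "\<And>D D'. D \<subseteq> E \<Longrightarrow> D' \<subseteq> E \<Longrightarrow> is_triangle D \<Longrightarrow> is_triangle D' \<Longrightarrow> D \<noteq> D' \<Longrightarrow> D \<inter> D' = {}"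
  shows "12 \<le> card V"
proof -
  have F: "card E + 2 \<le> card faces + card V" by (rule card_faces[OF assms(1)])
  have Vp: "0 < card V" using assms(1) finV by (simp add: card_gt_0_iff)
  then have F3: "3 \<le> card faces" using F assms(2) by linarith
  define T where "T = {U \<in> faces. is_triangle (bd U)}"
  have fT: "finite T" "T \<subseteq> faces" using finite_faces by (auto simp: T_def)
  \<comment> \<open>Two triangular faces with the same boundary would leave only two faces in all,
    but there are at least three.\<close>
  have inj: "bd U1 \<noteq> bd U2" if "U1 \<in> T" "U2 \<in> T" "U1 \<noteq> U2" for U1 U2
    using same_triangle_two_faces[of U1 U2] that F3 unfolding T_def by auto
  have "card (\<Union>U\<in>T. bd U) = (\<Sum>U\<in>T. card (bd U))"
  proof (rule card_UN_disjoint[OF fT(1)])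
    show "\<forall>i\<in>T. \<forall>j\<in>T. i \<noteq> j \<longrightarrow> bd i \<inter> bd j = {}"
      using dis[OF finite_bd(2) finite_bd(2)] inj unfolding T_def by blast
  qed (simp add: finite_bd)
  also have "\<dots> = (\<Sum>U\<in>T. 3)" by (intro sum.cong) (auto simp: T_def card_triangle)
  finally have "3 * card T = card (\<Union>U\<in>T. bd U)" by simp
  also have "\<dots> \<le> card E" using finE finite_bd(2) by (intro card_mono) auto
  finally have T3: "3 * card T \<le> 2 * card V" using assms(2) by simp
  have four: "4 \<le> card (bd U)" if "U \<in> faces - T" for U
  proof -
    have "(\<exists>D\<subseteq>bd U. is_triangle D) \<or> 4 \<le> card (bd U)"
      using bd_triangle_or_four[of U] that F3 by simp
    then show ?thesis
    proof
      assume "\<exists>D\<subseteq>bd U. is_triangle D"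
      then obtain D where D: "D \<subseteq> bd U" "is_triangle D" by blast
      then have "D \<noteq> bd U" using that by (auto simp: T_def)
      then have "card D < card (bd U)" using D finite_bd(1) by (intro psubset_card_mono) auto
      then show ?thesis using card_triangle[OF D(2)] by simp
    qed simp
  qed
  have "4 * card (faces - T) + 3 * card T = (\<Sum>U\<in>faces - T. 4) + (\<Sum>U\<in>T. 3)" by simp
  also have "\<dots> \<le> (\<Sum>U\<in>faces - T. card (bd U)) + (\<Sum>U\<in>T. card (bd U))"
    using four by (intro add_mono sum_mono) (auto simp: T_def card_triangle)
  also have "\<dots> = (\<Sum>U\<in>faces. card (bd U))"
    using sum.subset_diff[OF fT(2) finite_faces, of "\<lambda>U. card (bd U)"] by simp
  also have "\<dots> \<le> 4 * card V" using sum_bd assms(2) by simp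
  finally have "4 * card (faces - T) + 3 * card T \<le> 4 * card V" .
  moreover have "card (faces - T) + card T = card faces"
    using fT finite_faces by (metis card_Diff_subset card_mono le_add_diff_inverse2)
  ultimately show ?thesis using F T3 assms(2) by linarith
qed

end

lemma planar_graph_plane_graph:
  assumes "planar_graph V E" "finite V" "\<And>e. e \<in> E \<Longrightarrow> e \<subseteq> V"
  obtains f \<gamma> where "plane_graph V E f \<gamma>"
proof -
  from assms(1) obtain f :: "'a \<Rightarrow> complex" and \<gamma> where *: "inj_on f V \<and> f ` V \<subseteq> UNIV \<and>
    (\<forall>e\<in>E. arc (\<gamma> e) \<and> path_image (\<gamma> e) \<subseteq> UNIV \<and>
       {pathstart (\<gamma> e), pathfinish (\<gamma> e)} = f ` e \<and> path_image (\<gamma> e) \<inter> f ` V = f ` e) \<and>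
    (\<forall>e\<in>E. \<forall>e'\<in>E. e \<noteq> e' \<longrightarrow> path_image (\<gamma> e) \<inter> path_image (\<gamma> e') = f ` (e \<inter> e'))"
    unfolding planar_graph_def graph_embeds_in_def by (elim exE)
  have "plane_graph V E f \<gamma>"
    by unfold_locales (use * assms in simp_all)
  then show ?thesis by (rule that)
qed

section \<open>Toroidal drawings and their periodic lifts\<close>

text \<open>The universal covering of the torus by the plane; its deck transformations are the
  translations by the points \<open>lpt k\<close>.\<close>

definition tmap :: "complex \<Rightarrow> complex \<times> complex" where
  "tmap z = (cis (2 * pi * Re z), cis (2 * pi * Im z))"

definition lpt :: "int \<times> int \<Rightarrow> complex" where
  "lpt k = Complex (of_int (fst k)) (of_int (snd k))"

lemma lpt_simps [simp]: "Re (lpt k) = of_int (fst k)" "Im (lpt k) = of_int (snd k)"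
  by (simp_all add: lpt_def)

lemma lpt_add: "lpt (k + l) = lpt k + lpt l"
  and lpt_minus: "lpt (- k) = - lpt k"
  and lpt_diff: "lpt (k - l) = lpt k - lpt l"
  and lpt_0: "lpt 0 = 0"
  by (simp_all add: complex_eq_iff)

lemma lpt_eq_iff: "lpt k = lpt l \<longleftrightarrow> k = l"
  by (auto simp: complex_eq_iff prod_eq_iff)

lemma cis_2pi_eq_iff: "cis (2 * pi * x) = cis (2 * pi * y) \<longleftrightarrow> (\<exists>n::int. x = y + of_int n)"
proof
  assume "cis (2 * pi * x) = cis (2 * pi * y)"
  then have "exp (\<i> * of_real (2 * pi * x)) = exp (\<i> * of_real (2 * pi * y))"
    by (simp add: cis_conv_exp)
  then obtain n :: int where "\<i> * of_real (2 * pi * x) = \<i> * of_real (2 * pi * y) + of_int (2 * n) * pi * \<i>"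
    unfolding exp_eq by auto
  then have "2 * pi * x = 2 * pi * y + of_int (2 * n) * pi"
    by (simp add: complex_eq_iff)
  then have "2 * pi * (x - (y + of_int n)) = 0" by (simp add: algebra_simps)
  then show "\<exists>n::int. x = y + of_int n" by auto
next
  assume "\<exists>n::int. x = y + of_int n"
  then obtain n :: int where n: "x = y + of_int n" ..
  have "cis (2 * pi * x) = cis (2 * pi * y) * cis (2 * pi * of_int n)"
    unfolding cis_mult n by (simp add: algebra_simps)
  also have "cis (2 * pi * of_int n) = 1" by (rule cis_multiple_2pi) simp
  finally show "cis (2 * pi * x) = cis (2 * pi * y)" by simp
qed

lemma tmap_eq_iff: "tmap z = tmap w \<longleftrightarrow> (\<exists>k. z = w + lpt k)"
proof
  assume "tmap z = tmap w"
  then obtain m n :: int where "Re z = Re w + of_int m" "Im z = Im w + of_int n"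
    unfolding tmap_def by (auto simp: cis_2pi_eq_iff)
  then have "z = w + lpt (m, n)" by (simp add: complex_eq_iff)
  then show "\<exists>k. z = w + lpt k" by blast
next
  assume "\<exists>k. z = w + lpt k"
  then obtain k where "z = w + lpt k" ..
  then show "tmap z = tmap w" unfolding tmap_def by (auto simp: cis_2pi_eq_iff)
qed

lemma tmap_add_lpt [simp]: "tmap (z + lpt k) = tmap z"
  unfolding tmap_eq_iff by blast

lemma tmap_in_torus: "tmap z \<in> torus"
  by (simp add: tmap_def torus_def)

text \<open>The interval is contractible, so the path has a continuous logarithm, which is purely
  imaginary because the path has norm one.\<close>

lemma circle_path_lift:
  assumes "path g" "\<And>t. t \<in> {0..1} \<Longrightarrow> cmod (g t) = 1"
  obtains h :: "real \<Rightarrow> real" where "continuous_on {0..1} h"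
    "\<And>t. t \<in> {0..1} \<Longrightarrow> g t = cis (2 * pi * h t)"
proof -
  have "continuous_on {0..1} g" using assms(1) by (simp add: path_def)
  moreover have "contractible {0..1::real}" by (simp add: convex_imp_contractible)
  moreover have "g t \<noteq> 0" if "t \<in> {0..1}" for t using assms(2)[OF that] by auto
  ultimately obtain l where l: "continuous_on {0..1} l" "\<And>t. t \<in> {0..1} \<Longrightarrow> g t = exp (l t)"
    using continuous_logarithm_on_contractible by blast
  show ?thesis
  proof (rule that[of "\<lambda>t. Im (l t) / (2 * pi)"])
    show "continuous_on {0..1} (\<lambda>t. Im (l t) / (2 * pi))"
      using l(1) by (intro continuous_intros) auto
    fix t :: real assume t: "t \<in> {0..1}"
    have "exp (Re (l t)) = 1" using l(2)[OF t] assms(2)[OF t] by (simp add: norm_exp_eq_Re)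
    then have "g t = cis (Im (l t))" using l(2)[OF t] by (simp add: exp_eq_polar)
    then show "g t = cis (2 * pi * (Im (l t) / (2 * pi)))" by simp
  qed
qed

lemma torus_path_lift:
  assumes "path g" "path_image g \<subseteq> torus" "tmap z0 = pathstart g"
  obtains h where "path h" "pathstart h = z0" "\<And>t. t \<in> {0..1} \<Longrightarrow> tmap (h t) = g t"
proof -
  have m: "cmod (fst (g t)) = 1 \<and> cmod (snd (g t)) = 1" if "t \<in> {0..1}" for t
  proof -
    have "g t \<in> torus" using that assms(2) by (auto simp: path_image_def)
    then show ?thesis by (auto simp: torus_def)
  qed
  have cg: "continuous_on {0..1} g" using assms(1) by (simp add: path_def)
  have "path (\<lambda>t. fst (g t))" "path (\<lambda>t. snd (g t))"
    unfolding path_def using cg by (auto intro: continuous_intros)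
  note p = this
  have m1: "cmod (fst (g t)) = 1" and m2: "cmod (snd (g t)) = 1" if "t \<in> {0..1}" for t
    using m[OF that] by simp_all
  obtain h1 where h1: "continuous_on {0..1} h1"
    "\<And>t. t \<in> {0..1} \<Longrightarrow> fst (g t) = cis (2 * pi * h1 t)"
    using circle_path_lift[OF p(1) m1] by metis
  obtain h2 where h2: "continuous_on {0..1} h2"
    "\<And>t. t \<in> {0..1} \<Longrightarrow> snd (g t) = cis (2 * pi * h2 t)"
    using circle_path_lift[OF p(2) m2] by metis
  define h where "h t = Complex (h1 t) (h2 t)" for t
  have th: "tmap (h t) = g t" if "t \<in> {0..1}" for t
    using h1(2)[OF that] h2(2)[OF that] by (simp add: tmap_def h_def prod_eq_iff)
  then have "tmap z0 = tmap (h 0)" using assms(3) by (simp add: pathstart_def)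
  then obtain k where k: "z0 = h 0 + lpt k" unfolding tmap_eq_iff by blast
  show ?thesis
  proof (rule that[of "\<lambda>t. h t + lpt k"])
    have "continuous_on {0..1} h"
      unfolding h_def Complex_eq using h1(1) h2(1) by (intro continuous_intros)
    then show "path (\<lambda>t. h t + lpt k)" unfolding path_def by (intro continuous_intros)
    show "pathstart (\<lambda>t. h t + lpt k) = z0" using k by (simp add: pathstart_def)
  qed (use th in auto)
qed

text \<open>One lift to the plane is fixed for every vertex and every edge. The lift of
  \<open>e\<close> starts at the chosen lift of its source, and \<open>d e\<close> is the
  translation by which it misses the chosen lift of its target. Incidence conditions are stated
  through \<open>tmap\<close>, that is on the torus itself.\<close>

locale torus_drawing =
  fixes V :: "'v set" and E :: "'v set set" and f :: "'v \<Rightarrow> complex"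
    and \<gamma> :: "'v set \<Rightarrow> real \<Rightarrow> complex" and s t :: "'v set \<Rightarrow> 'v" and d :: "'v set \<Rightarrow> int \<times> int"
  assumes finV: "finite V"
    and injf: "\<And>u v. u \<in> V \<Longrightarrow> v \<in> V \<Longrightarrow> tmap (f u) = tmap (f v) \<Longrightarrow> u = v"
    and st: "\<And>e. e \<in> E \<Longrightarrow> s e \<in> V \<and> t e \<in> V \<and> s e \<noteq> t e \<and> e = {s e, t e}"
    and path: "\<And>e. e \<in> E \<Longrightarrow> path (\<gamma> e)"
    and start: "\<And>e. e \<in> E \<Longrightarrow> \<gamma> e 0 = f (s e)"
    and finish: "\<And>e. e \<in> E \<Longrightarrow> \<gamma> e 1 = f (t e) + lpt (d e)"
    and inj: "\<And>e x y. e \<in> E \<Longrightarrow> x \<in> {0..1} \<Longrightarrow> y \<in> {0..1} \<Longrightarrow> tmap (\<gamma> e x) = tmap (\<gamma> e y) \<Longrightarrow> x = y"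
    and vert: "\<And>e x v. e \<in> E \<Longrightarrow> x \<in> {0..1} \<Longrightarrow> v \<in> V \<Longrightarrow> tmap (\<gamma> e x) = tmap (f v) \<Longrightarrow>
                 (x = 0 \<and> v = s e) \<or> (x = 1 \<and> v = t e)"
    and cross: "\<And>e e' x y. e \<in> E \<Longrightarrow> e' \<in> E \<Longrightarrow> e \<noteq> e' \<Longrightarrow> x \<in> {0..1} \<Longrightarrow> y \<in> {0..1} \<Longrightarrow>
                 tmap (\<gamma> e x) = tmap (\<gamma> e' y) \<Longrightarrow> \<exists>v\<in>V. tmap (\<gamma> e x) = tmap (f v)"

text \<open>Vertices are lifted arbitrarily; lifting each arc from its start then determines the
  translation at its end.\<close>

lemma toroidal_graph_torus_drawing:
  fixes V :: "'v set"
  assumes "toroidal_graph V E" "finite V" "\<And>e. e \<in> E \<Longrightarrow> e \<subseteq> V"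
  obtains f \<gamma> s t d where "torus_drawing V E f \<gamma> s t d"
proof -
  from assms(1) obtain F :: "'v \<Rightarrow> complex \<times> complex" and G where
    *: "inj_on F V \<and> F ` V \<subseteq> torus \<and>
    (\<forall>e\<in>E. arc (G e) \<and> path_image (G e) \<subseteq> torus \<and>
       {pathstart (G e), pathfinish (G e)} = F ` e \<and> path_image (G e) \<inter> F ` V = F ` e) \<and>
    (\<forall>e\<in>E. \<forall>e'\<in>E. e \<noteq> e' \<longrightarrow> path_image (G e) \<inter> path_image (G e') = F ` (e \<inter> e'))"
    unfolding toroidal_graph_def graph_embeds_in_def by (elim exE)
  have injF: "inj_on F V" and FT: "F ` V \<subseteq> torus"
    and G: "\<And>e. e \<in> E \<Longrightarrow> arc (G e)" "\<And>e. e \<in> E \<Longrightarrow> path_image (G e) \<subseteq> torus"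
      "\<And>e. e \<in> E \<Longrightarrow> {pathstart (G e), pathfinish (G e)} = F ` e"
      "\<And>e. e \<in> E \<Longrightarrow> path_image (G e) \<inter> F ` V = F ` e"
    and X: "\<And>e e'. e \<in> E \<Longrightarrow> e' \<in> E \<Longrightarrow> e \<noteq> e' \<Longrightarrow> path_image (G e) \<inter> path_image (G e') = F ` (e \<inter> e')"
    using * by simp_all
  have "\<exists>z. tmap z = F v" if "v \<in> V" for v
  proof -
    have m: "cmod (fst (F v)) = 1" "cmod (snd (F v)) = 1"
      using FT that by (auto simp: torus_def)
    then obtain a b where "fst (F v) = cis a" "snd (F v) = cis b"
      by (metis complex_norm_eq_1_exp_eq cis_conv_exp mult.commute)
    then have "tmap (Complex (a / (2 * pi)) (b / (2 * pi))) = F v"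
      by (simp add: tmap_def prod_eq_iff)
    then show ?thesis by blast
  qed
  then obtain f where f: "\<And>v. v \<in> V \<Longrightarrow> tmap (f v) = F v" by metis
  have "\<exists>a b. a \<in> e \<and> b \<in> e \<and> F a = pathstart (G e) \<and> F b = pathfinish (G e)" if "e \<in> E" for e
    using G(3)[OF that] by (metis image_iff insertI1 insertI2)
  then obtain s t where st: "\<And>e. e \<in> E \<Longrightarrow> s e \<in> e \<and> t e \<in> e \<and> F (s e) = pathstart (G e) \<and> F (t e) = pathfinish (G e)"
    by metis
  have stV: "s e \<in> V" "t e \<in> V" if "e \<in> E" for e using st that assms(3) by blast+
  have "\<exists>h. path h \<and> pathstart h = f (s e) \<and> (\<forall>x\<in>{0..1}. tmap (h x) = G e x)" if "e \<in> E" for e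
  proof -
    have "tmap (f (s e)) = pathstart (G e)" using f stV st that by metis
    then show ?thesis
      using torus_path_lift[OF arc_imp_path[OF G(1)[OF that]] G(2)[OF that]] by metis
  qed
  then obtain \<gamma> where \<gamma>: "\<And>e. e \<in> E \<Longrightarrow> path (\<gamma> e) \<and> pathstart (\<gamma> e) = f (s e) \<and> (\<forall>x\<in>{0..1}. tmap (\<gamma> e x) = G e x)"
    by metis
  have "\<exists>k. \<gamma> e 1 = f (t e) + lpt k" if "e \<in> E" for e
  proof -
    have "tmap (\<gamma> e 1) = pathfinish (G e)" using \<gamma>[OF that] by (simp add: pathfinish_def)
    then have "tmap (\<gamma> e 1) = tmap (f (t e))" using f stV st that by metis
    then show ?thesis by (simp add: tmap_eq_iff)
  qed
  then obtain d where d: "\<And>e. e \<in> E \<Longrightarrow> \<gamma> e 1 = f (t e) + lpt (d e)" by metis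
  have injG: "x = y" if "e \<in> E" "x \<in> {0..1}" "y \<in> {0..1}" "G e x = G e y" for e x y
    using G(1)[OF that(1)] that(2-4) by (simp add: arc_def inj_on_def)
  have FG: "F (s e) = G e 0" "F (t e) = G e 1" if "e \<in> E" for e
    using st[OF that] by (simp_all add: pathstart_def pathfinish_def)
  have e_eq: "e = {s e, t e}" if "e \<in> E" for e
  proof -
    have "F ` e = F ` {s e, t e}" using G(3)[OF that] st[OF that] by simp
    moreover have "e \<subseteq> V" "{s e, t e} \<subseteq> V" using assms(3) stV that by auto
    ultimately show ?thesis using inj_on_image_eq_iff[OF injF] by blast
  qed
  have "torus_drawing V E f \<gamma> s t d"
  proof
    show "finite V" by fact
  next
    fix u v assume "u \<in> V" "v \<in> V" "tmap (f u) = tmap (f v)"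
    then show "u = v" using f injF by (metis inj_onD)
  next
    fix e assume e: "e \<in> E"
    have "s e \<noteq> t e" using injG[OF e, of 0 1] FG[OF e] by auto
    then show "s e \<in> V \<and> t e \<in> V \<and> s e \<noteq> t e \<and> e = {s e, t e}"
      using stV[OF e] e_eq[OF e] by simp
    show "path (\<gamma> e)" "\<gamma> e 0 = f (s e)" "\<gamma> e 1 = f (t e) + lpt (d e)"
      using \<gamma>[OF e] d[OF e] by (simp_all add: pathstart_def)
    fix x :: real assume x: "x \<in> {0..1}"
    have gx: "tmap (\<gamma> e x) = G e x" using \<gamma>[OF e] x by simp
    { fix y :: real assume y: "y \<in> {0..1}" "tmap (\<gamma> e x) = tmap (\<gamma> e y)"
      then show "x = y" using gx \<gamma>[OF e] injG[OF e x y(1)] by simp }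
    { fix v assume v: "v \<in> V" "tmap (\<gamma> e x) = tmap (f v)"
      then have gv: "G e x = F v" using gx f by simp
      have "G e x \<in> path_image (G e)" unfolding path_image_def using x by (rule imageI)
      then have "F v \<in> path_image (G e) \<inter> F ` V" using gv v(1) by simp
      then have "F v \<in> F ` e" using G(4)[OF e] by simp
      then have "v \<in> e" using inj_on_image_mem_iff[OF injF v(1) assms(3)[OF e]] by blast
      then have "v = s e \<or> v = t e" using e_eq[OF e] by blast
      then show "(x = 0 \<and> v = s e) \<or> (x = 1 \<and> v = t e)"
        using gv FG[OF e] injG[OF e x, of 0] injG[OF e x, of 1] by auto }
    { fix e' and y :: real assume e': "e' \<in> E" "e \<noteq> e'" "y \<in> {0..1}" "tmap (\<gamma> e x) = tmap (\<gamma> e' y)"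
      then have "G e x = G e' y" using gx \<gamma>[OF e'(1)] by simp
      moreover have "G e x \<in> path_image (G e)" "G e' y \<in> path_image (G e')"
        unfolding path_image_def using x e'(3) by blast+
      ultimately have "G e x \<in> path_image (G e) \<inter> path_image (G e')" by simp
      then have "G e x \<in> F ` (e \<inter> e')" using X[OF e e'(1,2)] by simp
      then obtain v where "v \<in> e" "G e x = F v" by auto
      moreover have "v \<in> V" using \<open>v \<in> e\<close> assms(3)[OF e] by blast
      ultimately show "\<exists>v\<in>V. tmap (\<gamma> e x) = tmap (f v)" using gx f by metis }
  qed
  then show ?thesis by (rule that)
qed

context torus_drawing
begin

lemma edge_subset: "e \<in> E \<Longrightarrow> e \<subseteq> V"
  using st[of e] by (metis empty_subsetI insert_subset)

lemma finE: "finite E"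
proof -
  have "E \<subseteq> Pow V" using edge_subset by blast
  then show ?thesis using finV finite_subset by blast
qed

text \<open>\<open>q\<close> is a map from the plane whose fibres lie in those of
  \<open>tmap\<close>: the identity, or a quotient by some of the translations. Index
  \<open>j\<close> stands for the lift of the edge \<open>b j\<close> moved by \<open>c j\<close>.
  Lifts of different edges can meet only over vertices; \<open>H\<close> keeps two lifts of the same
  edge apart.\<close>

lemma planar_lift:
  fixes q :: "complex \<Rightarrow> complex" and V' :: "'u set" and pos :: "'u \<Rightarrow> complex"
    and \<epsilon> :: "'j \<Rightarrow> 'u set"
  assumes q: "continuous_on UNIV q" "\<And>z w. q z = q w \<Longrightarrow> tmap z = tmap w"
    and injp: "inj_on (\<lambda>u. q (pos u)) V'"
    and bv: "\<And>u. u \<in> V' \<Longrightarrow> bv u \<in> V \<and> tmap (pos u) = tmap (f (bv u))"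
    and J: "\<And>j. j \<in> J \<Longrightarrow> b j \<in> E \<and> \<epsilon> j = {s' j, t' j} \<and> s' j \<in> V' \<and> t' j \<in> V' \<and>
       q (pos (s' j)) = q (\<gamma> (b j) 0 + lpt (c j)) \<and> q (pos (t' j)) = q (\<gamma> (b j) 1 + lpt (c j))"
    and H: "\<And>j j' z. j \<in> J \<Longrightarrow> j' \<in> J \<Longrightarrow> b j = b j' \<Longrightarrow> q (z + lpt (c j)) = q (z + lpt (c j')) \<Longrightarrow> j = j'"
  shows "planar_graph V' (\<epsilon> ` J)"
proof -
  define ix where "ix e = (SOME j. j \<in> J \<and> \<epsilon> j = e)" for e
  have ix: "ix e \<in> J" "\<epsilon> (ix e) = e" if "e \<in> \<epsilon> ` J" for e
    using someI_ex[of "\<lambda>j. j \<in> J \<and> \<epsilon> j = e"] that unfolding ix_def by blast+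
  define G where "G e x = q (\<gamma> (b (ix e)) x + lpt (c (ix e)))" for e x
  define P where "P u = q (pos u)" for u
  have G0: "G e 0 = P (s' (ix e))" and G1: "G e 1 = P (t' (ix e))" if "e \<in> \<epsilon> ` J" for e
    using J[OF ix(1)[OF that]] by (simp_all add: G_def P_def)
  have ee: "e = {s' (ix e), t' (ix e)}" "s' (ix e) \<in> V'" "t' (ix e) \<in> V'" "b (ix e) \<in> E" if "e \<in> \<epsilon> ` J" for e
    using J[OF ix(1)[OF that]] ix(2)[OF that] by simp_all
  have Gq: "tmap (\<gamma> (b (ix e)) x) = tmap (\<gamma> (b (ix e')) y)" if "G e x = G e' y" for e e' x y
    using q(2)[OF that[unfolded G_def]] by simp
  have arcG: "arc (G e)" if e: "e \<in> \<epsilon> ` J" for e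
  proof -
    have "continuous_on {0..1} (\<gamma> (b (ix e)))" using path[OF ee(4)[OF e]] by (simp add: path_def)
    then have "continuous_on {0..1} (G e)"
      unfolding G_def by (intro continuous_on_compose2[OF q(1)] continuous_intros) auto
    moreover have "inj_on (G e) {0..1}"
      using inj[OF ee(4)[OF e]] Gq by (meson inj_onI)
    ultimately show ?thesis by (simp add: arc_def path_def)
  qed
  have endp: "G e x \<in> P ` e" if "e \<in> \<epsilon> ` J" "x = 0 \<or> x = 1" for e x
    using G0[OF that(1)] G1[OF that(1)] that(2) ee(1)[OF that(1)] by (metis image_eqI insertI1 insertI2)
  have endv: "x = 0 \<or> x = 1" if e: "e \<in> \<epsilon> ` J" "x \<in> {0..1}" "v \<in> V" "tmap (\<gamma> (b (ix e)) x) = tmap (f v)" for e x v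
    using vert[OF ee(4)[OF e(1)] e(2,3,4)] by blast
  have eV: "e \<subseteq> V'" if "e \<in> \<epsilon> ` J" for e
    using ee(1,2,3)[OF that] by (metis empty_subsetI insert_subset)
  have im: "{pathstart (G e), pathfinish (G e)} = P ` e" if "e \<in> \<epsilon> ` J" for e
  proof -
    have "P ` {s' (ix e), t' (ix e)} = {G e 0, G e 1}" using G0[OF that] G1[OF that] by simp
    then show ?thesis using ee(1)[OF that] by (metis pathstart_def pathfinish_def)
  qed
  have vG: "path_image (G e) \<inter> P ` V' = P ` e" if e: "e \<in> \<epsilon> ` J" for e
  proof
    show "P ` e \<subseteq> path_image (G e) \<inter> P ` V'"
      using im[OF e] eV[OF e] by (metis Int_greatest empty_subsetI image_mono insert_subset
          pathfinish_in_path_image pathstart_in_path_image)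
    show "path_image (G e) \<inter> P ` V' \<subseteq> P ` e"
    proof
      fix z assume "z \<in> path_image (G e) \<inter> P ` V'"
      then obtain x u where xu: "x \<in> {0..1}" "z = G e x" "u \<in> V'" "z = P u"
        unfolding path_image_def by blast
      then have "tmap (\<gamma> (b (ix e)) x) = tmap (pos u)"
        using q(2)[of "\<gamma> (b (ix e)) x + lpt (c (ix e))" "pos u"] by (simp add: G_def P_def)
      then have "x = 0 \<or> x = 1" using endv[OF e xu(1)] bv[OF xu(3)] by metis
      then show "z \<in> P ` e" using endp[OF e] xu(2) by blast
    qed
  qed
  have cG: "path_image (G e) \<inter> path_image (G e') = P ` (e \<inter> e')"
    if e: "e \<in> \<epsilon> ` J" "e' \<in> \<epsilon> ` J" "e \<noteq> e'" for e e'
  proof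
    have "P ` (e \<inter> e') \<subseteq> P ` e" "P ` (e \<inter> e') \<subseteq> P ` e'" by auto
    then show "P ` (e \<inter> e') \<subseteq> path_image (G e) \<inter> path_image (G e')"
      using vG[OF e(1)] vG[OF e(2)] by blast
    show "path_image (G e) \<inter> path_image (G e') \<subseteq> P ` (e \<inter> e')"
    proof
      fix z assume "z \<in> path_image (G e) \<inter> path_image (G e')"
      then obtain x y where xy: "x \<in> {0..1}" "z = G e x" "y \<in> {0..1}" "z = G e' y"
        unfolding path_image_def by blast
      then have tm: "tmap (\<gamma> (b (ix e)) x) = tmap (\<gamma> (b (ix e')) y)" using Gq by metis
      have "(x = 0 \<or> x = 1) \<and> (y = 0 \<or> y = 1)"
      proof (cases "b (ix e) = b (ix e')")
        case False
        then obtain v where "v \<in> V" "tmap (\<gamma> (b (ix e)) x) = tmap (f v)"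
          using cross[OF ee(4)[OF e(1)] ee(4)[OF e(2)] False xy(1,3) tm] by blast
        then show ?thesis using endv[OF e(1) xy(1)] endv[OF e(2) xy(3)] tm by metis
      next
        \<comment> \<open>Two lifts of one edge could meet only at equal parameters, since the edge
          is simple on the torus; \<open>H\<close> then identifies the two indices.\<close>
        case True
        then have "x = y" using inj[OF ee(4)[OF e(1)] xy(1,3)] tm by simp
        then have "q (\<gamma> (b (ix e)) x + lpt (c (ix e))) = q (\<gamma> (b (ix e)) x + lpt (c (ix e')))"
          using xy True by (simp add: G_def)
        then have "ix e = ix e'" using H[OF ix(1)[OF e(1)] ix(1)[OF e(2)] True] by blast
        then show ?thesis using ix(2)[OF e(1)] ix(2)[OF e(2)] e(3) by simp
      qed
      then have "z \<in> P ` e" "z \<in> P ` e'"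
        using endp[OF e(1), of x] endp[OF e(2), of y] xy(2,4) by simp_all
      then obtain u u' where u: "u \<in> e" "z = P u" "u' \<in> e'" "z = P u'" by blast
      then have "u = u'" using injp eV[OF e(1)] eV[OF e(2)] unfolding P_def inj_on_def by blast
      then show "z \<in> P ` (e \<inter> e')" using u by blast
    qed
  qed
  show ?thesis
    unfolding planar_graph_def graph_embeds_in_def
  proof (intro exI conjI ballI impI)
    show "inj_on P V'" unfolding P_def by (rule injp)
  qed (use arcG im vG cG in simp_all)
qed

text \<open>With at least 3V + 1 edges on the torus, a block of N by N translates has at least (3V +
  1)N^2 edges, while its vertices lie in a block only slightly larger. For large N this contradicts
  the bound for plane graphs.\<close>

lemma edge_bound_torus:
  shows "card E \<le> 3 * card V"
proof (rule ccontr)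
  assume big: "\<not> card E \<le> 3 * card V"
  have "finite ((\<lambda>e. nat \<bar>fst (d e)\<bar> + nat \<bar>snd (d e)\<bar>) ` E)" using finE by simp
  then obtain D where D: "\<And>e. e \<in> E \<Longrightarrow> nat \<bar>fst (d e)\<bar> + nat \<bar>snd (d e)\<bar> \<le> D"
    by (meson finite_nat_set_iff_bounded_le imageI)
  \<comment> \<open>An edge reaches at most \<open>D\<close> cells beyond its start, so a margin of
    \<open>D\<close> is needed on both sides of the block.\<close>
  define M where "M = 2 * D"
  \<comment> \<open>Chosen so that the margin costs less than the surplus N^2 of edges: 3V(2NM +
    M^2) \<le> N * 3V(2M + M^2) = N(N - 1).\<close>
  define N where "N = 3 * card V * (2 * M + M * M) + 1"
  define I where "I = {1 - int D .. int N + int D}"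
  define V' where "V' = V \<times> (I \<times> I)"
  define K where "K = {1 .. int N} \<times> {1 .. int N}"
  define \<epsilon> where "\<epsilon> j = {(s (fst j), snd j), (t (fst j), snd j + d (fst j))}" for j
  have "planar_graph V' (\<epsilon> ` (E \<times> K))"
  \<comment> \<open>Here \<open>q\<close> is the identity: the finite piece is drawn in the
    universal cover itself.\<close>
  proof (rule planar_lift[where q = "\<lambda>z. z" and pos = "\<lambda>u. f (fst u) + lpt (snd u)"
        and bv = fst and b = fst and c = snd
        and s' = "\<lambda>j. (s (fst j), snd j)" and t' = "\<lambda>j. (t (fst j), snd j + d (fst j))"])
    show "inj_on (\<lambda>u. f (fst u) + lpt (snd u)) V'"
    proof (rule inj_onI)
      fix u v assume uv: "u \<in> V'" "v \<in> V'" "f (fst u) + lpt (snd u) = f (fst v) + lpt (snd v)"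
      then have "tmap (f (fst u)) = tmap (f (fst v))" by (metis tmap_add_lpt)
      then have 1: "fst u = fst v" using injf uv(1,2) by (auto simp: V'_def)
      then have "snd u = snd v" using uv(3) by (simp add: lpt_eq_iff)
      then show "u = v" using 1 by (simp add: prod_eq_iff)
    qed
    fix j assume j: "j \<in> E \<times> K"
    then have e: "fst j \<in> E" and k: "snd j \<in> K" by auto
    have "\<bar>fst (d (fst j))\<bar> + \<bar>snd (d (fst j))\<bar> \<le> int D" using D[OF e] by linarith
    then have "snd j \<in> I \<times> I" "snd j + d (fst j) \<in> I \<times> I"
      using k unfolding K_def I_def by (auto simp: mem_Times_iff)
    then show "fst j \<in> E \<and> \<epsilon> j = {(s (fst j), snd j), (t (fst j), snd j + d (fst j))} \<and>
         (s (fst j), snd j) \<in> V' \<and> (t (fst j), snd j + d (fst j)) \<in> V' \<and>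
         f (fst (s (fst j), snd j)) + lpt (snd (s (fst j), snd j)) = \<gamma> (fst j) 0 + lpt (snd j) \<and>
         f (fst (t (fst j), snd j + d (fst j))) + lpt (snd (t (fst j), snd j + d (fst j))) =
           \<gamma> (fst j) 1 + lpt (snd j)"
      using e st[OF e] start[OF e] finish[OF e] by (simp add: \<epsilon>_def V'_def lpt_add)
  qed (auto simp: V'_def lpt_eq_iff prod_eq_iff)
  moreover have fV': "finite V'" using finV by (simp add: V'_def I_def)
  moreover have "e \<subseteq> V'" if "e \<in> \<epsilon> ` (E \<times> K)" for e
  proof -
    from that obtain j where j0: "e = \<epsilon> j" "j \<in> E \<times> K" by (rule imageE)
    then have j: "e = \<epsilon> j" "fst j \<in> E" "snd j \<in> K" by (simp_all add: mem_Times_iff)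
    have "\<bar>fst (d (fst j))\<bar> + \<bar>snd (d (fst j))\<bar> \<le> int D" using D[OF j(2)] by linarith
    then have "snd j \<in> I \<times> I" "snd j + d (fst j) \<in> I \<times> I"
      using j(3) unfolding K_def I_def by (auto simp: mem_Times_iff)
    moreover have "s (fst j) \<in> V" "t (fst j) \<in> V" using st[OF j(2)] by simp_all
    ultimately show ?thesis unfolding j(1) \<epsilon>_def V'_def by simp
  qed
  ultimately obtain p \<delta> where "plane_graph V' (\<epsilon> ` (E \<times> K)) p \<delta>"
    using planar_graph_plane_graph by metis
  then interpret pl: plane_graph V' "\<epsilon> ` (E \<times> K)" p \<delta> .
  have "inj_on \<epsilon> (E \<times> K)"
  proof (rule inj_onI)
    fix j j' assume j: "j \<in> E \<times> K" "j' \<in> E \<times> K" "\<epsilon> j = \<epsilon> j'"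
    then have e: "fst j \<in> E" "fst j' \<in> E" by auto
    have "fst ` \<epsilon> j = fst ` \<epsilon> j'" using j(3) by simp
    then have "{s (fst j), t (fst j)} = {s (fst j'), t (fst j')}" by (simp add: \<epsilon>_def)
    then have 1: "fst j = fst j'" using st[OF e(1)] st[OF e(2)] by metis
    then have "snd j = snd j'" using j(3) st[OF e(2)] by (auto simp: \<epsilon>_def doubleton_eq_iff)
    then show "j = j'" using 1 by (simp add: prod_eq_iff)
  qed
  then have cE: "card (\<epsilon> ` (E \<times> K)) = card E * (N * N)"
    by (simp add: card_image card_cartesian_product K_def)
  have cV: "card V' = card V * ((N + M) * (N + M))"
  proof -
    have "card I = N + M" unfolding I_def M_def by (simp add: nat_eq_iff2)
    then show ?thesis by (simp add: V'_def card_cartesian_product)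
  qed
  have "card V \<noteq> 0"
  proof
    assume "card V = 0"
    then have "V = {}" using finV by simp
    then have "E = {}" using st by (metis all_not_in_conv)
    then show False using big by simp
  qed
  then have "V' \<noteq> {}" using cV N_def fV' by auto
  then have "card (\<epsilon> ` (E \<times> K)) \<le> 3 * card V'"
    using pl.edge_bound by linarith
  then have le: "card E * (N * N) \<le> 3 * card V * ((N + M) * (N + M))" using cE cV by simp
  have "3 * card V + 1 \<le> card E" using big by simp
  then have "(3 * card V + 1) * (N * N) \<le> card E * (N * N)" by (rule mult_le_mono1)
  with le have "(3 * card V + 1) * (N * N) \<le> 3 * card V * ((N + M) * (N + M))" by (rule order_trans[rotated])
  then have "N * N \<le> 3 * card V * (2 * N * M + M * M)" by (simp add: algebra_simps)
  also have "\<dots> \<le> 3 * card V * (N * (2 * M + M * M))"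
    by (intro mult_le_mono2) (simp add: algebra_simps N_def)
  also have "\<dots> = N * (N - 1)" by (simp add: N_def algebra_simps)
  also have "\<dots> < N * N" by (intro mult_strict_left_mono) (simp_all add: N_def)
  finally show False by simp
qed

end

section \<open>Disjoint pieces of a toroidal drawing\<close>

text \<open>Translates of \<open>p\<close> by 0, A, 2A and so on are strung together. The last
  clause keeps the iterate in a strip along \<open>A\<close>, which bounds it in the transverse
  direction.\<close>

lemma periodic_path_iterate:
  fixes z A :: complex
  assumes "path p" "path_image p \<subseteq> S" "pathstart p = z" "pathfinish p = z + A"
    and S: "\<And>w. w \<in> S \<Longrightarrow> w + A \<in> S"
  shows "\<exists>r. path r \<and> path_image r \<subseteq> S \<and> pathstart r = z \<and> pathfinish r = z + of_nat (Suc n) * A \<and>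
     (\<forall>w\<in>path_image r. \<exists>w'\<in>path_image p. \<exists>k::nat. w = w' + of_nat k * A)"
proof (induction n)
  case 0
  have "\<exists>w'\<in>path_image p. \<exists>k::nat. w = w' + of_nat k * A" if "w \<in> path_image p" for w
    using that by (intro bexI[of _ w] exI[of _ 0]) simp_all
  then show ?case using assms by (intro exI[of _ p]) simp
next
  case (Suc n)
  then obtain r where r: "path r" "path_image r \<subseteq> S" "pathstart r = z"
    "pathfinish r = z + of_nat (Suc n) * A"
    "\<forall>w\<in>path_image r. \<exists>w'\<in>path_image p. \<exists>k::nat. w = w' + of_nat k * A" by blast
  define h where "h = (\<lambda>w. w + of_nat (Suc n) * A) \<circ> p"
  have ph: "path h" unfolding h_def using assms(1)
    by (intro path_continuous_image) (auto intro!: continuous_intros)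
  have "w + of_nat k * A \<in> S" if "w \<in> S" for w and k :: nat
    using that by (induction k) (auto simp: algebra_simps dest: S)
  then have hS: "path_image h \<subseteq> S"
    using assms(2) unfolding h_def path_image_compose by blast
  have hs: "pathstart h = pathfinish r" and hf: "pathfinish h = z + of_nat (Suc (Suc n)) * A"
    using assms(3,4) r(4) by (simp_all add: h_def pathstart_compose pathfinish_compose algebra_simps)
  have hw: "\<exists>w'\<in>path_image p. \<exists>k::nat. w = w' + of_nat k * A" if "w \<in> path_image h" for w
    using that unfolding h_def path_image_compose by blast
  show ?case
  proof (intro exI[of _ "r +++ h"] conjI ballI)
    show "path (r +++ h)" using r(1) ph hs by simp
    show "path_image (r +++ h) \<subseteq> S" using r(2) hS hs by (simp add: path_image_join)
    show "pathstart (r +++ h) = z" using r(3) by simp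
    show "pathfinish (r +++ h) = z + of_nat (Suc (Suc n)) * A" using hf by simp
    fix w assume "w \<in> path_image (r +++ h)"
    then show "\<exists>w'\<in>path_image p. \<exists>k::nat. w = w' + of_nat k * A"
      using path_image_join[of r h] hs r(5) hw by auto
  qed
qed

text \<open>Clamping both coordinates to the square makes the Fashoda theorem applicable. No false
  crossing arises: at a meeting point the real part of \<open>r\<close> and the imaginary part of
  \<open>p\<close> are strictly inside the square, so nothing was cut off there.\<close>

lemma clamped_paths_meet:
  fixes p r :: "real \<Rightarrow> complex"
  assumes p: "path p" and r: "path r" and K: "0 < K"
    and p1: "\<And>x. x \<in> {0..1} \<Longrightarrow> \<bar>Im (p x)\<bar> < K" and p2: "Re (p 0) \<le> - K" "K \<le> Re (p 1)"
    and r1: "\<And>x. x \<in> {0..1} \<Longrightarrow> \<bar>Re (r x)\<bar> < K" and r2: "Im (r 0) \<le> - K" "K \<le> Im (r 1)"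
  shows "\<exists>x\<in>{0..1}. \<exists>y\<in>{0..1}. p x = r y"
proof -
  define c where "c x = max (- K) (min K x)" for x :: real
  define F where "F g x = (\<chi> i. if i = 1 then c (Re (g x)) else c (Im (g x)) :: real^2)"
    for g :: "real \<Rightarrow> complex" and x :: real
  have cb: "- K \<le> c x" "c x \<le> K" for x using K by (auto simp: c_def)
  have F1: "F g x $ 1 = c (Re (g x))" and F2: "F g x $ 2 = c (Im (g x))" for g x
    by (simp_all add: F_def)
  have pF: "path (F g)" if "path g" for g
  proof -
    have *: "continuous_on {0..1} g" using that by (simp add: path_def)
    have "continuous_on {0..1} (\<lambda>x. if i = 1 then c (Re (g x)) else c (Im (g x)))" for i :: 2
      using * by (cases "i = 1") (auto simp: c_def intro!: continuous_intros)
    then show ?thesis unfolding path_def F_def by (intro continuous_on_vec_lambda)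
  qed
  have img: "path_image (F g) \<subseteq> cbox (\<chi> i. - K) (\<chi> i. K)" for g
    using cb by (auto simp: path_image_def mem_box_cart F_def)
  obtain z where z: "z \<in> path_image (F p)" "z \<in> path_image (F r)"
  proof (rule fashoda[OF pF[OF p] pF[OF r] img img])
    show "pathstart (F p) $ 1 = (\<chi> i. - K :: real^2) $ 1" "pathfinish (F p) $ 1 = (\<chi> i. K :: real^2) $ 1"
      "pathstart (F r) $ 2 = (\<chi> i. - K :: real^2) $ 2" "pathfinish (F r) $ 2 = (\<chi> i. K :: real^2) $ 2"
      using p2 r2 K by (simp_all add: pathstart_def pathfinish_def F1 F2 c_def)
  qed
  then obtain x y where xy: "x \<in> {0..1}" "y \<in> {0..1}" "F p x = F r y"
    unfolding path_image_def by (metis imageE)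
  have "c (Re (p x)) = c (Re (r y))" "c (Im (p x)) = c (Im (r y))"
    using xy(3) F1 F2 by metis+
  then have "Re (p x) = Re (r y)" "Im (p x) = Im (r y)"
    using p1[OF xy(1)] r1[OF xy(2)] unfolding c_def by (auto simp: min_def max_def split: if_splits)
  then have "p x = r y" by (simp add: complex_eq_iff)
  then show ?thesis using xy(1,2) by blast
qed

text \<open>In coordinates where \<open>A\<close> and \<open>B\<close> are the unit vectors, a long
  iterate of \<open>p\<close> runs horizontally in a bounded strip and a long iterate of
  \<open>r\<close> vertically in another; such paths cross.\<close>

lemma periodic_paths_meet:
  fixes z w A B :: complex
  assumes p: "path p" "path_image p \<subseteq> S" "pathstart p = z" "pathfinish p = z + A"
    and r: "path r" "path_image r \<subseteq> T" "pathstart r = w" "pathfinish r = w + B"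
    and S: "\<And>v n. v \<in> S \<Longrightarrow> v + of_int n * A \<in> S"
    and T: "\<And>v n. v \<in> T \<Longrightarrow> v + of_int n * B \<in> T"
    and ind: "Re A * Im B - Im A * Re B \<noteq> 0"
  shows "S \<inter> T \<noteq> {}"
proof -
  define D where "D = Re A * Im B - Im A * Re B"
  \<comment> \<open>Cramer's rule: \<open>L\<close> is the linear map that takes \<open>A\<close> to
    1 and \<open>B\<close> to the imaginary unit.\<close>
  define L where "L v = Complex ((Re v * Im B - Im v * Re B) / D) ((Re A * Im v - Im A * Re v) / D)" for v
  have D0: "D \<noteq> 0" using ind by (simp add: D_def)
  have Ladd: "L (u + v) = L u + L v" for u v
    by (simp add: L_def complex_eq_iff add_divide_distrib[symmetric] algebra_simps)
  have Lr: "L (of_real a * v) = of_real a * L v" for a v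
    by (simp add: L_def complex_eq_iff algebra_simps)
  have LA: "L A = 1" and LB: "L B = \<i>"
    using D0 by (simp_all add: L_def complex_eq_iff D_def algebra_simps)
  have Lnat: "L (of_nat n * v) = of_nat n * L v" for n v using Lr[of "real n" v] by simp
  have Lint: "L (of_int n * v) = of_int n * L v" for n v using Lr[of "real_of_int n" v] by simp
  have Linj: "u = v" if "L u = L v" for u v
  proof -
    have 1: "Re u * Im B - Im u * Re B = Re v * Im B - Im v * Re B"
      "Re A * Im u - Im A * Re u = Re A * Im v - Im A * Re v"
      using that D0 by (simp_all add: L_def complex_eq_iff divide_cancel_right)
    have 2: "D * (Re u - Re v) = Re A * ((Re u * Im B - Im u * Re B) - (Re v * Im B - Im v * Re B))
        + Re B * ((Re A * Im u - Im A * Re u) - (Re A * Im v - Im A * Re v))"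
      by (simp add: D_def algebra_simps)
    have 3: "D * (Im u - Im v) = Im A * ((Re u * Im B - Im u * Re B) - (Re v * Im B - Im v * Re B))
        + Im B * ((Re A * Im u - Im A * Re u) - (Re A * Im v - Im A * Re v))"
      by (simp add: D_def algebra_simps)
    have "D * (Re u - Re v) = 0" "D * (Im u - Im v) = 0"
      unfolding 2 3 unfolding 1 by simp_all
    then show ?thesis using D0 by (simp add: complex_eq_iff)
  qed
  have Lc: "continuous_on U L" for U
    unfolding L_def Complex_eq by (intro continuous_intros) (use D0 in auto)
  have bdd: "\<exists>M. \<forall>v\<in>path_image g. cmod (L v) \<le> M" if "path g" for g
  proof -
    have "compact (L ` path_image g)"
      using that Lc by (intro compact_continuous_image compact_path_image)
    then have "bounded (L ` path_image g)" by (rule compact_imp_bounded)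
    then show ?thesis unfolding bounded_iff by blast
  qed
  obtain M1 M2 where M: "\<And>v. v \<in> path_image p \<Longrightarrow> cmod (L v) \<le> M1" "\<And>v. v \<in> path_image r \<Longrightarrow> cmod (L v) \<le> M2"
    using bdd[OF p(1)] bdd[OF r(1)] by blast
  define K where "K = max M1 M2 + 1"
  have zp: "z \<in> path_image p" "w \<in> path_image r" using p(3) r(3) by (metis pathstart_in_path_image)+
  have "0 \<le> M1" using M(1)[OF zp(1)] norm_ge_zero order_trans by blast
  then have K0: "0 < K" by (simp add: K_def)
  \<comment> \<open>\<open>K\<close> bounds both base paths in the new coordinates, so 2n periods,
    centred by subtracting n of them, lead from beyond -K to beyond K once n exceeds 2K.\<close>
  obtain n :: nat where n: "2 * K < real n" using reals_Archimedean2 by blast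
  have bz: "\<bar>Re (L z)\<bar> \<le> K" "\<bar>Im (L w)\<bar> \<le> K"
    using M(1)[OF zp(1)] M(2)[OF zp(2)] abs_Re_le_cmod[of "L z"] abs_Im_le_cmod[of "L w"]
    by (simp_all add: K_def)
  have S1: "v + A \<in> S" if "v \<in> S" for v using S[OF that, of 1] by simp
  have T1: "v + B \<in> T" if "v \<in> T" for v using T[OF that, of 1] by simp
  \<comment> \<open>The iteration with parameter k strings together k + 1 copies, hence 2n - 1 for
    2n periods.\<close>
  obtain P where P: "path P" "path_image P \<subseteq> S" "pathstart P = z"
    "pathfinish P = z + of_nat (Suc (2 * n - 1)) * A"
    "\<And>v. v \<in> path_image P \<Longrightarrow> \<exists>v'\<in>path_image p. \<exists>k::nat. v = v' + of_nat k * A"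
    using periodic_path_iterate[OF p S1, of "2 * n - 1"] by metis
  obtain R where R: "path R" "path_image R \<subseteq> T" "pathstart R = w"
    "pathfinish R = w + of_nat (Suc (2 * n - 1)) * B"
    "\<And>v. v \<in> path_image R \<Longrightarrow> \<exists>v'\<in>path_image r. \<exists>k::nat. v = v' + of_nat k * B"
    using periodic_path_iterate[OF r T1, of "2 * n - 1"] by metis
  have n0: "0 < n" using n K0 by (cases n) auto
  then have n2: "Suc (2 * n - 1) = 2 * n" by simp
  define P' where "P' x = L (P x) - of_nat n" for x
  define R' where "R' x = L (R x) - of_nat n * \<i>" for x
  have "\<exists>x\<in>{0..1}. \<exists>y\<in>{0..1}. P' x = R' y"
  proof (rule clamped_paths_meet[OF _ _ K0])
    have "path (\<lambda>x. L (P x))" "path (\<lambda>x. L (R x))"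
      using path_continuous_image[OF P(1) Lc] path_continuous_image[OF R(1) Lc] by (simp_all add: o_def)
    then show "path P'" "path R'" unfolding path_def P'_def R'_def by (auto intro!: continuous_intros)
    show "\<bar>Im (P' x)\<bar> < K" if "x \<in> {0..1}" for x
    proof -
      have "P x \<in> path_image P" using that by (simp add: path_image_def)
      then obtain v k where v: "v \<in> path_image p" "P x = v + of_nat k * A" using P(5) by blast
      then have "Im (P' x) = Im (L v)" by (simp add: P'_def Ladd Lnat LA)
      then show ?thesis using M(1)[OF v(1)] abs_Im_le_cmod[of "L v"] by (simp add: K_def)
    qed
    show "\<bar>Re (R' x)\<bar> < K" if "x \<in> {0..1}" for x
    proof -
      have "R x \<in> path_image R" using that by (simp add: path_image_def)
      then obtain v k where v: "v \<in> path_image r" "R x = v + of_nat k * B" using R(5) by blast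
      then have "Re (R' x) = Re (L v)" by (simp add: R'_def Ladd Lnat LB)
      then show ?thesis using M(2)[OF v(1)] abs_Re_le_cmod[of "L v"] by (simp add: K_def)
    qed
    have "Re (P' 0) = Re (L z) - real n" "Im (R' 0) = Im (L w) - real n"
      using P(3) R(3) by (simp_all add: P'_def R'_def pathstart_def)
    then show "Re (P' 0) \<le> - K" "Im (R' 0) \<le> - K" using bz n by linarith+
    have "P 1 = z + of_nat (2 * n) * A" "R 1 = w + of_nat (2 * n) * B"
      using P(4) R(4) n2 by (simp_all add: pathfinish_def)
    then have "Re (P' 1) = Re (L z) + real n" "Im (R' 1) = Im (L w) + real n"
      by (simp_all add: P'_def R'_def Ladd Lnat LA LB del: of_nat_mult)
    then show "K \<le> Re (P' 1)" "K \<le> Im (R' 1)" using bz n by linarith+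
  qed
  then obtain x y where xy: "x \<in> {0..1}" "y \<in> {0..1}" "P' x = R' y" by blast
  \<comment> \<open>The centring is itself a translation by periods, under which \<open>S\<close>
    and \<open>T\<close> are invariant, so the crossing is one of \<open>S\<close> and
    \<open>T\<close>.\<close>
  have "P' x = L (P x + of_int (- int n) * A)" "R' y = L (R y + of_int (- int n) * B)"
    unfolding P'_def R'_def Ladd Lint LA LB by simp_all
  then have "P x + of_int (- int n) * A = R y + of_int (- int n) * B" using xy(3) Linj by metis
  moreover have "P x \<in> S" "R y \<in> T" using xy P(2) R(2) by (auto simp: path_image_def)
  ultimately show ?thesis using S T by (metis IntI empty_iff)
qed

section \<open>Closed walks and the translations they carry\<close>

context torus_drawing
begin

inductive walk :: "'v set set \<Rightarrow> 'v \<Rightarrow> 'v \<Rightarrow> int \<times> int \<Rightarrow> bool" for F u where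
  walk_refl: "walk F u u 0"
| walk_fwd: "walk F u v k \<Longrightarrow> e \<in> F \<Longrightarrow> s e = v \<Longrightarrow> walk F u (t e) (k + d e)"
| walk_bwd: "walk F u v k \<Longrightarrow> e \<in> F \<Longrightarrow> t e = v \<Longrightarrow> walk F u (s e) (k - d e)"

lemma walk_trans: "walk F v w l \<Longrightarrow> walk F u v k \<Longrightarrow> walk F u w (k + l)"
proof (induction rule: walk.induct)
  case (walk_fwd w l e)
  then show ?case using walk.walk_fwd[of F u w "k + l" e] by (simp add: add.assoc)
next
  case (walk_bwd w l e)
  then show ?case using walk.walk_bwd[of F u w "k + l" e] by (simp add: add_diff_eq)
qed simp

lemma walk_sym: "walk F u v k \<Longrightarrow> walk F v u (- k)"
proof (induction rule: walk.induct)
  case walk_refl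
  then show ?case using walk.walk_refl[of F u] by simp
next
  case (walk_fwd v k e)
  have "walk F (t e) (s e) (0 - d e)" using walk.walk_refl walk_fwd.hyps(2) by (rule walk.walk_bwd) simp
  then show ?case using walk_trans[of F v u "- k" "t e" "0 - d e"] walk_fwd by (simp add: algebra_simps)
next
  case (walk_bwd v k e)
  have "walk F (s e) (t e) (0 + d e)" using walk.walk_refl walk_bwd.hyps(2) by (rule walk.walk_fwd) simp
  then show ?case using walk_trans[of F v u "- k" "s e" "0 + d e"] walk_bwd by (simp add: algebra_simps)
qed

text \<open>A walk in the quotient graph is recorded with the translation by which its lift to the plane moves; \<open>preim F W\<close> is the set of all lifts of the part \<open>(W, F)\<close>.\<close>
definition preim :: "'v set set \<Rightarrow> 'v set \<Rightarrow> complex set" where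
  "preim F W = {z. (\<exists>v\<in>W. tmap z = tmap (f v)) \<or> (\<exists>e\<in>F. \<exists>x\<in>{0..1}. tmap z = tmap (\<gamma> e x))}"

lemma preim_add_lpt: "z \<in> preim F W \<Longrightarrow> z + lpt k \<in> preim F W"
  by (simp add: preim_def)

lemma arc_in_preim: "e \<in> F \<Longrightarrow> x \<in> {0..1} \<Longrightarrow> \<gamma> e x + lpt k \<in> preim F W"
  unfolding preim_def mem_Collect_eq tmap_add_lpt by blast

lemma walk_path_component:
  assumes "walk F u v k" "F \<subseteq> E" "u \<in> W"
  shows "path_component (preim F W) (f u) (f v + lpt k)"
  using assms(1)
proof (induction rule: walk.induct)
  case walk_refl
  have "f u \<in> preim F W" using assms(3) unfolding preim_def by blast
  then show ?case by (simp add: lpt_0 path_component_refl)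
next
  case (walk_fwd v k e)
  have e: "e \<in> E" using walk_fwd assms(2) by blast
  define h where "h x = \<gamma> e x + lpt k" for x
  have "path h" using path[OF e] unfolding h_def path_def by (intro continuous_intros)
  moreover have "path_image h \<subseteq> preim F W"
    using arc_in_preim[OF walk_fwd(2)] unfolding path_image_def h_def by blast
  moreover have "pathstart h = f v + lpt k" "pathfinish h = f (t e) + lpt (k + d e)"
    using start[OF e] finish[OF e] walk_fwd(3) by (simp_all add: h_def pathstart_def pathfinish_def lpt_add)
  ultimately have "path_component (preim F W) (f v + lpt k) (f (t e) + lpt (k + d e))"
    unfolding path_component_def by blast
  then show ?case using walk_fwd.IH path_component_trans by blast
next
  case (walk_bwd v k e)
  have e: "e \<in> E" using walk_bwd assms(2) by blast
  define h where "h x = \<gamma> e x + lpt (k - d e)" for x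
  have "path h" using path[OF e] unfolding h_def path_def by (intro continuous_intros)
  moreover have "path_image h \<subseteq> preim F W"
    using arc_in_preim[OF walk_bwd(2)] unfolding path_image_def h_def by blast
  moreover have "pathfinish h = f v + lpt k" "pathstart h = f (s e) + lpt (k - d e)"
    using start[OF e] finish[OF e] walk_bwd(3) by (simp_all add: h_def pathstart_def pathfinish_def lpt_diff)
  ultimately have "path_component (preim F W) (f (s e) + lpt (k - d e)) (f v + lpt k)"
    unfolding path_component_def by blast
  then show ?case using walk_bwd.IH path_component_trans path_component_sym by blast
qed

text \<open>Iterates of non-parallel periodic paths cross (Fashoda), and a crossing would be a common point of the two parts.\<close>
lemma disjoint_closed_walks_parallel:
  assumes F: "F1 \<subseteq> E" "F2 \<subseteq> E" and W: "W1 \<subseteq> V" "W2 \<subseteq> V" "W1 \<inter> W2 = {}"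
    and FW: "\<And>e. e \<in> F1 \<Longrightarrow> e \<subseteq> W1" "\<And>e. e \<in> F2 \<Longrightarrow> e \<subseteq> W2"
    and u: "u \<in> W1" "w \<in> W2" and walks: "walk F1 u u k" "walk F2 w w l"
  shows "fst k * snd l - snd k * fst l = 0"
proof (rule ccontr)
  assume ne: "fst k * snd l - snd k * fst l \<noteq> 0"
  obtain p where p: "path p" "path_image p \<subseteq> preim F1 W1" "pathstart p = f u" "pathfinish p = f u + lpt k"
    using walk_path_component[OF walks(1) F(1) u(1)] unfolding path_component_def by blast
  obtain r where r: "path r" "path_image r \<subseteq> preim F2 W2" "pathstart r = f w" "pathfinish r = f w + lpt l"
    using walk_path_component[OF walks(2) F(2) u(2)] unfolding path_component_def by blast
  have mul: "of_int n * lpt k = lpt (n * fst k, n * snd k)" for n k by (simp add: complex_eq_iff)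
  have "Re (lpt k) * Im (lpt l) - Im (lpt k) * Re (lpt l) = of_int (fst k * snd l - snd k * fst l)"
    by simp
  then have "Re (lpt k) * Im (lpt l) - Im (lpt k) * Re (lpt l) \<noteq> 0" using ne of_int_eq_0_iff by metis
  then have "preim F1 W1 \<inter> preim F2 W2 \<noteq> {}"
    using periodic_paths_meet[OF p r] preim_add_lpt mul by metis
  then obtain z where z: "z \<in> preim F1 W1" "z \<in> preim F2 W2" by blast
  have vv: False if "a \<in> W1" "b \<in> W2" "tmap (f a) = tmap (f b)" for a b
    using injf[of a b] that W by blast
  have over: "\<exists>v\<in>e. tmap (\<gamma> e x) = tmap (f v)" if "e \<in> E" "x \<in> {0..1}" "v \<in> V" "tmap (\<gamma> e x) = tmap (f v)" for e x v
    using vert[OF that] st[OF that(1)] that(4) by (metis insertI1 insertI2)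
  \<comment> \<open>A common point lies over a vertex, which then belongs to both parts, or it is
    interior to an edge of each part, and these edges would cross.\<close>
  show False
  proof (cases "\<exists>v\<in>V. tmap z = tmap (f v)")
    case True
    then obtain v where v: "v \<in> V" "tmap z = tmap (f v)" by blast
    have "\<exists>a\<in>W1. tmap z = tmap (f a)"
      using z(1) over[OF _ _ v(1)] v(2) F(1) FW(1) unfolding preim_def
      by simp (metis atLeastAtMost_iff subsetD)
    moreover have "\<exists>a\<in>W2. tmap z = tmap (f a)"
      using z(2) over[OF _ _ v(1)] v(2) F(2) FW(2) unfolding preim_def
      by simp (metis atLeastAtMost_iff subsetD)
    ultimately show False using vv by metis
  next
    case False
    then obtain e1 x1 where e1: "e1 \<in> F1" "x1 \<in> {0..1}" "tmap z = tmap (\<gamma> e1 x1)"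
      using z(1) W(1) unfolding preim_def by blast
    from False obtain e2 x2 where e2: "e2 \<in> F2" "x2 \<in> {0..1}" "tmap z = tmap (\<gamma> e2 x2)"
      using z(2) W(2) unfolding preim_def by blast
    have "e1 \<noteq> e2"
    proof
      assume "e1 = e2"
      then have "e1 \<subseteq> W1 \<inter> W2" using FW(1)[OF e1(1)] FW(2)[OF e2(1)] by simp
      moreover have "e1 \<noteq> {}" using st[of e1] e1(1) F(1) by auto
      ultimately show False using W(3) by blast
    qed
    then show False
      using cross[OF subsetD[OF F(1) e1(1)] subsetD[OF F(2) e2(1)] _ e1(2) e2(2)] e1(3) e2(3) False by metis
  qed
qed

text \<open>If all translations of closed walks are multiples of \<open>(a, b)\<close>, the part can be drawn in the annulus obtained from the plane by dividing out \<open>(a, b)\<close> alone.\<close>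
lemma planar_if_walks_parallel:
  assumes F: "F \<subseteq> E" "W \<subseteq> V" "\<And>e. e \<in> F \<Longrightarrow> e \<subseteq> W"
    and ab: "coprime a b"
    and walks: "\<And>u k. u \<in> W \<Longrightarrow> walk F u u k \<Longrightarrow> a * snd k - b * fst k = 0"
  shows "planar_graph W F"
proof -
  \<comment> \<open>Each vertex will be placed at the end of a lifted walk from a base vertex of its
    component. The base vertex is chosen by a condition that depends on the component alone, so the
    two ends of an edge share it.\<close>
  define root where "root v = (SOME u. \<exists>k. walk F u v k)" for v
  have ex: "\<exists>k. walk F (root v) v k" for v
    unfolding root_def by (rule someI_ex) (blast intro: walk_refl)
  then obtain k where k: "\<And>v. walk F (root v) v (k v)" by metis
  have conn_in: "v \<in> W \<longleftrightarrow> u \<in> W" if "walk F u v l" for u v l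
    using that
  proof (induction rule: walk.induct)
    case (walk_fwd v l e)
    then show ?case using F(1,3) st by (metis insert_subset subsetD)
  next
    case (walk_bwd v l e)
    then show ?case using F(1,3) st by (metis insert_subset subsetD)
  qed simp
  have root_eq: "root v = root v'" if "walk F v v' l" for v v' l
  proof -
    have "(\<exists>k. walk F u v k) \<longleftrightarrow> (\<exists>k. walk F u v' k)" for u
      using that walk_sym walk_trans by metis
    then show ?thesis unfolding root_def by simp
  qed
  define A where "A = lpt (a, b)"
  \<comment> \<open>\<open>px\<close> and \<open>py\<close> are coordinates along and across (a, b),
    scaled so that the translation by (a, b) adds 1 to \<open>px\<close> and fixes
    \<open>py\<close>. Hence \<open>q\<close> is the quotient map by this translation, with the
    punctured plane as annulus.\<close>
  define px where "px z = (of_int a * Re z + of_int b * Im z) / (of_int (a * a + b * b))" for z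
  define py where "py z = of_int a * Im z - of_int b * Re z" for z
  define q where "q z = exp (Complex (py z) (2 * pi * px z))" for z
  have ab0: "a \<noteq> 0 \<or> b \<noteq> 0" using ab by auto
  then have N0: "a * a + b * b \<noteq> 0" by (simp add: sum_squares_eq_zero_iff)
  define N where "N = real_of_int (a * a + b * b)"
  have Nr: "N \<noteq> 0" "N = of_int a * of_int a + of_int b * of_int b"
    using N0 unfolding N_def by (metis of_int_eq_0_iff, simp)
  have qeq: "q z = q w \<longleftrightarrow> (\<exists>n::int. z = w + of_int n * A)" for z w
  proof
    assume "q z = q w"
    then obtain n :: int where
      "Complex (py z) (2 * pi * px z) = Complex (py w) (2 * pi * px w) + of_int (2 * n) * pi * \<i>"
      unfolding q_def exp_eq by auto
    then have 1: "py z = py w" "2 * pi * px z = 2 * pi * px w + of_int (2 * n) * pi"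
      by (simp_all add: complex_eq_iff)
    from 1(2) have "2 * pi * (px z - (px w + of_int n)) = 0" by (simp add: algebra_simps)
    then have "px z = px w + of_int n" by simp
    then have 2: "of_int a * Re z + of_int b * Im z = of_int a * Re w + of_int b * Im w + of_int n * N"
      using Nr(1) unfolding px_def N_def[symmetric] by (simp add: field_simps)
    have "N * Re z = of_int a * (of_int a * Re z + of_int b * Im z) - of_int b * py z"
      by (simp add: Nr(2) py_def algebra_simps)
    also have "\<dots> = N * (Re w + of_int n * of_int a)"
      unfolding 2 1(1) by (simp add: Nr(2) py_def algebra_simps)
    finally have re: "Re z = Re w + of_int n * of_int a" using Nr(1) by simp
    have "N * Im z = of_int b * (of_int a * Re z + of_int b * Im z) + of_int a * py z"
      by (simp add: Nr(2) py_def algebra_simps)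
    also have "\<dots> = N * (Im w + of_int n * of_int b)"
      unfolding 2 1(1) by (simp add: Nr(2) py_def algebra_simps)
    finally have "Im z = Im w + of_int n * of_int b" using Nr(1) by simp
    then have "z = w + of_int n * A" using re by (simp add: A_def complex_eq_iff)
    then show "\<exists>n::int. z = w + of_int n * A" ..
  next
    assume "\<exists>n::int. z = w + of_int n * A"
    then obtain n :: int where n: "z = w + of_int n * A" ..
    have "py z = py w" by (simp add: n py_def A_def algebra_simps)
    moreover have "px z = px w + of_int n"
    proof -
      have "of_int a * Re z + of_int b * Im z = (of_int a * Re w + of_int b * Im w) + of_int n * N"
        by (simp add: n A_def Nr(2) algebra_simps)
      then show ?thesis using Nr(1) unfolding px_def N_def[symmetric] by (simp add: field_simps)
    qed
    ultimately have "Complex (py z) (2 * pi * px z) = Complex (py w) (2 * pi * px w) + of_int (2 * n) * pi * \<i>"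
      by (simp add: complex_eq_iff algebra_simps)
    then show "q z = q w" unfolding q_def exp_eq by blast
  qed
  have mul: "of_int n * A = lpt (n * a, n * b)" for n by (simp add: A_def complex_eq_iff)
  have qt: "tmap z = tmap w" if "q z = q w" for z w
    using that unfolding qeq mul by auto
  have "planar_graph W ((\<lambda>e. e) ` F)"
  proof (rule planar_lift[where q = q and pos = "\<lambda>v. f v + lpt (k v)" and bv = "\<lambda>v. v"
        and b = "\<lambda>e. e" and s' = s and t' = t and c = "\<lambda>e. k (s e)"])
    show "continuous_on UNIV q"
      unfolding q_def px_def py_def Complex_eq using N0
      by (intro continuous_intros) (simp_all only: of_int_eq_0_iff not_False_eq_True ball_simps simp_thms)
    show "tmap z = tmap w" if "q z = q w" for z w by (rule qt[OF that])
    show "inj_on (\<lambda>u. q (f u + lpt (k u))) W"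
    proof (rule inj_onI)
      fix x y assume "x \<in> W" "y \<in> W" "q (f x + lpt (k x)) = q (f y + lpt (k y))"
      then show "x = y" using qt[of "f x + lpt (k x)" "f y + lpt (k y)"] injf[of x y] F(2) by auto
    qed
    show "u \<in> V \<and> tmap (f u + lpt (k u)) = tmap (f u)" if "u \<in> W" for u
      using that F(2) by auto
    show "e = e'" if "e = e'" for e e' :: "'v set" by (rule that)
    fix e assume e: "e \<in> F"
    then have eE: "e \<in> E" using F(1) by blast
    have stW: "s e \<in> W" "t e \<in> W" using F(3)[OF e] st[OF eE] by (metis insert_subset)+
    have w1: "walk F (s e) (t e) (0 + d e)" using walk_refl e by (rule walk_fwd) simp
    have r: "root (s e) = root (t e)" by (rule root_eq[OF w1])
    \<comment> \<open>From the base vertex to the source of \<open>e\<close>, along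
      \<open>e\<close>, and back from its target: this closed walk measures how far \<open>e\<close>
      misses the chosen place of its target, so the gap is parallel to (a, b).\<close>
    have "walk F (root (s e)) (t e) (k (s e) + d e)" using k e by (rule walk_fwd) simp
    then have "walk F (root (s e)) (root (s e)) (k (s e) + d e + - k (t e))"
      using walk_trans[OF walk_sym[OF k[of "t e"]]] r by simp
    moreover have "root (s e) \<in> W" using conn_in[OF k[of "s e"]] stW by simp
    ultimately have "a * snd (k (s e) + d e + - k (t e)) - b * fst (k (s e) + d e + - k (t e)) = 0"
      using walks by blast
    then have par: "a * snd (k (s e) + d e - k (t e)) = b * fst (k (s e) + d e - k (t e))" by simp
    obtain n where n: "k (s e) + d e - k (t e) = (n * a, n * b)"
    proof -
      let ?x = "fst (k (s e) + d e - k (t e))" and ?y = "snd (k (s e) + d e - k (t e))"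
      have "a dvd b * ?x" using par by (metis dvd_triv_left)
      then have "a dvd ?x" using ab coprime_dvd_mult_right_iff by blast
      then obtain n where n: "?x = a * n" by blast
      have "b dvd a * ?y" using par by (metis dvd_triv_left)
      then have "b dvd ?y" using ab coprime_commute coprime_dvd_mult_right_iff by blast
      then obtain m where m: "?y = b * m" by blast
      have "a * b * m = a * b * n" using par unfolding n m by (simp add: mult_ac)
      \<comment> \<open>Coprimality turns a parallel vector into an integer multiple. If a or b is
        zero, n and m need not agree, and the factor of the nonzero coordinate is taken.\<close>
      then consider "m = n" | "a = 0" | "b = 0" by auto
      then show ?thesis
      proof cases
        case 1
        then show ?thesis using that[of n] n m by (simp add: prod_eq_iff algebra_simps)
      next
        case 2
        then show ?thesis using that[of m] n m by (simp add: prod_eq_iff algebra_simps)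
      next
        case 3
        then show ?thesis using that[of n] n m by (simp add: prod_eq_iff algebra_simps)
      qed
    qed
    have "\<gamma> e 1 + lpt (k (s e)) = f (t e) + lpt (k (t e)) + lpt (k (s e) + d e - k (t e))"
      using finish[OF eE] by (simp add: lpt_add lpt_diff)
    also have "\<dots> = f (t e) + lpt (k (t e)) + of_int n * A" using n mul by simp
    finally have "q (f (t e) + lpt (k (t e))) = q (\<gamma> e 1 + lpt (k (s e)))"
      unfolding qeq by (metis add_diff_cancel_right' diff_add_cancel mult_minus_left of_int_minus uminus_add_conv_diff add.commute)
    then show "e \<in> E \<and> e = {s e, t e} \<and> s e \<in> W \<and> t e \<in> W \<and>
         q (f (s e) + lpt (k (s e))) = q (\<gamma> e 0 + lpt (k (s e))) \<and>
         q (f (t e) + lpt (k (t e))) = q (\<gamma> e 1 + lpt (k (s e)))"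
      using eE stW st[OF eE] start[OF eE] by metis
  qed
  then show ?thesis by simp
qed

theorem disjoint_parts_planar:
  assumes F: "F1 \<subseteq> E" "F2 \<subseteq> E" and W: "W1 \<subseteq> V" "W2 \<subseteq> V" "W1 \<inter> W2 = {}"
    and FW: "\<And>e. e \<in> F1 \<Longrightarrow> e \<subseteq> W1" "\<And>e. e \<in> F2 \<Longrightarrow> e \<subseteq> W2"
  shows "planar_graph W1 F1 \<or> planar_graph W2 F2"
proof (cases "\<forall>u\<in>W1. \<forall>k. walk F1 u u k \<longrightarrow> k = 0")
  case True
  have "planar_graph W1 F1"
  proof (rule planar_if_walks_parallel[OF F(1) W(1) FW(1)])
    \<comment> \<open>All translations vanish here, so any primitive direction serves.\<close>
    show "coprime 1 (0::int)" by simp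
    fix u k assume "u \<in> W1" "walk F1 u u k"
    then have "k = 0" using True by blast
    then show "1 * snd k - 0 * fst k = 0" by simp
  qed
  then show ?thesis ..
next
  case False
  then obtain u k where uk: "u \<in> W1" "walk F1 u u k" "k \<noteq> 0" by blast
  define g where "g = gcd (fst k) (snd k)"
  have g0: "g \<noteq> 0" using uk(3) by (auto simp: g_def prod_eq_iff)
  \<comment> \<open>The annulus argument needs a primitive direction, hence the division by the
    gcd.\<close>
  obtain a b where ab: "fst k = a * g" "snd k = b * g" "coprime a b"
    using gcd_coprime_exists[of "fst k" "snd k"] g0 unfolding g_def by blast
  have "planar_graph W2 F2"
  proof (rule planar_if_walks_parallel[OF F(2) W(2) FW(2) ab(3)])
    fix w l assume w: "w \<in> W2" "walk F2 w w l"
    have "fst k * snd l - snd k * fst l = 0"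
      by (rule disjoint_closed_walks_parallel[OF F W FW uk(1) w(1) uk(2) w(2)])
    then have "g * (a * snd l - b * fst l) = 0" by (simp add: ab algebra_simps)
    then show "a * snd l - b * fst l = 0" using g0 by simp
  qed
  then show ?thesis ..
qed

end

text \<open>Meant for drawings given by formulas, where an edge may carry several indices. The
  condition \<open>key\<close> covers injectivity of an arc, agreement of repeated indices and
  absence of crossings at once; one arc per edge is picked afterwards.\<close>

lemma graph_embeds_in_arcsI:
  fixes F :: "'v \<Rightarrow> 'p::real_normed_vector" and G :: "'j \<Rightarrow> real \<Rightarrow> 'p"
  assumes inj: "inj_on F V" and FS: "F ` V \<subseteq> S"
    and J: "\<And>j. j \<in> J \<Longrightarrow> a j \<in> V \<and> b j \<in> V \<and> a j \<noteq> b j \<and> \<epsilon> j = {a j, b j} \<and>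
       continuous_on {0..1} (G j) \<and> G j ` {0..1} \<subseteq> S \<and> G j 0 = F (a j) \<and> G j 1 = F (b j)"
    and key: "\<And>j j' x y. j \<in> J \<Longrightarrow> j' \<in> J \<Longrightarrow> x \<in> {0..1} \<Longrightarrow> y \<in> {0..1} \<Longrightarrow> G j x = G j' y \<Longrightarrow>
       x \<in> {0, 1} \<and> y \<in> {0, 1} \<or> x = y \<and> \<epsilon> j = \<epsilon> j'"
    and vert: "\<And>j x v. j \<in> J \<Longrightarrow> x \<in> {0..1} \<Longrightarrow> v \<in> V \<Longrightarrow> G j x = F v \<Longrightarrow> x \<in> {0, 1}"
  shows "graph_embeds_in V (\<epsilon> ` J) S"
proof -
  define ix where "ix e = (SOME j. j \<in> J \<and> \<epsilon> j = e)" for e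
  have ix: "ix e \<in> J" "\<epsilon> (ix e) = e" if "e \<in> \<epsilon> ` J" for e
    using someI_ex[of "\<lambda>j. j \<in> J \<and> \<epsilon> j = e"] that unfolding ix_def by blast+
  define H where "H e = G (ix e)" for e
  have ab: "a (ix e) \<in> V" "b (ix e) \<in> V" "a (ix e) \<noteq> b (ix e)" "e = {a (ix e), b (ix e)}"
    "H e 0 = F (a (ix e))" "H e 1 = F (b (ix e))" "continuous_on {0..1} (H e)" "H e ` {0..1} \<subseteq> S"
    if "e \<in> \<epsilon> ` J" for e
    using J[OF ix(1)[OF that]] ix(2)[OF that] unfolding H_def by auto
  have sub: "e \<subseteq> V" if "e \<in> \<epsilon> ` J" for e
    using ab(1,2,4)[OF that] by (metis empty_subsetI insert_subset)
  have ends: "{pathstart (H e), pathfinish (H e)} = F ` e" if "e \<in> \<epsilon> ` J" for e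
  proof -
    have "F ` {a (ix e), b (ix e)} = {H e 0, H e 1}" using ab(5,6)[OF that] by simp
    then show ?thesis using ab(4)[OF that] by (metis pathstart_def pathfinish_def)
  qed
  have endp: "H e x \<in> F ` e" if "e \<in> \<epsilon> ` J" "x \<in> {0, 1}" for e x
    using ends[OF that(1)] that(2) by (auto simp: pathstart_def pathfinish_def)
  have arcH: "arc (H e)" if e: "e \<in> \<epsilon> ` J" for e
  proof -
    have "x = y" if xy: "x \<in> {0..1}" "y \<in> {0..1}" "H e x = H e y" for x y
    proof (rule ccontr)
      assume ne: "x \<noteq> y"
      then have "x \<in> {0, 1} \<and> y \<in> {0, 1}"
        using key[OF ix(1)[OF e] ix(1)[OF e] xy(1,2)] xy(3) unfolding H_def by blast
      then have "H e 0 = H e 1" using ne xy(3) by auto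
      then have "F (a (ix e)) = F (b (ix e))" using ab(5,6)[OF e] by simp
      then show False using inj ab(1-3)[OF e] by (metis inj_onD)
    qed
    then show ?thesis using ab(7)[OF e] by (auto simp: arc_def path_def intro: inj_onI)
  qed
  have vH: "path_image (H e) \<inter> F ` V = F ` e" if e: "e \<in> \<epsilon> ` J" for e
  proof
    show "F ` e \<subseteq> path_image (H e) \<inter> F ` V"
      using ends[OF e] sub[OF e] by (metis Int_greatest empty_subsetI image_mono insert_subset
          pathfinish_in_path_image pathstart_in_path_image)
    show "path_image (H e) \<inter> F ` V \<subseteq> F ` e"
    proof
      fix z assume "z \<in> path_image (H e) \<inter> F ` V"
      then obtain x u where xu: "x \<in> {0..1}" "z = H e x" "u \<in> V" "z = F u"
        unfolding path_image_def by blast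
      then have "x \<in> {0, 1}" using vert[OF ix(1)[OF e] xu(1,3)] unfolding H_def by metis
      then show "z \<in> F ` e" using endp[OF e] xu(2) by blast
    qed
  qed
  have cH: "path_image (H e) \<inter> path_image (H e') = F ` (e \<inter> e')"
    if e: "e \<in> \<epsilon> ` J" "e' \<in> \<epsilon> ` J" "e \<noteq> e'" for e e'
  proof
    have "F ` (e \<inter> e') \<subseteq> F ` e" "F ` (e \<inter> e') \<subseteq> F ` e'" by auto
    then show "F ` (e \<inter> e') \<subseteq> path_image (H e) \<inter> path_image (H e')"
      using vH[OF e(1)] vH[OF e(2)] by blast
    show "path_image (H e) \<inter> path_image (H e') \<subseteq> F ` (e \<inter> e')"
    proof
      fix z assume "z \<in> path_image (H e) \<inter> path_image (H e')"
      then obtain x y where xy: "x \<in> {0..1}" "z = H e x" "y \<in> {0..1}" "z = H e' y"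
        unfolding path_image_def by blast
      then have "x \<in> {0, 1} \<and> y \<in> {0, 1}"
        using key[OF ix(1)[OF e(1)] ix(1)[OF e(2)] xy(1,3)] ix(2)[OF e(1)] ix(2)[OF e(2)] e(3)
        unfolding H_def by metis
      then have "z \<in> F ` e" "z \<in> F ` e'"
        using endp[OF e(1), of x] endp[OF e(2), of y] xy(2,4) by simp_all
      then obtain u u' where u: "u \<in> e" "z = F u" "u' \<in> e'" "z = F u'" by blast
      then have "u = u'" using inj sub[OF e(1)] sub[OF e(2)] unfolding inj_on_def by blast
      then show "z \<in> F ` (e \<inter> e')" using u by blast
    qed
  qed
  have imS: "path_image (H e) \<subseteq> S" if "e \<in> \<epsilon> ` J" for e
    using ab(8)[OF that] by (simp add: path_image_def)
  show ?thesis
    unfolding graph_embeds_in_def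
  proof (intro exI conjI ballI impI)
    show "inj_on F V" by (rule inj)
    show "F ` V \<subseteq> S" by (rule FS)
  qed (use arcH ends vH cH imS in simp_all)
qed

section \<open>Explicit drawings of cycles and of quotients of the grid\<close>

lemma int_diff_unit_interval:
  fixes x y :: real
  assumes "x \<in> {0..1}" "y \<in> {0..1}" "x - y = of_int k"
  shows "x \<in> {0, 1} \<and> y \<in> {0, 1} \<or> x = y"
proof -
  have "- 1 \<le> real_of_int k" "real_of_int k \<le> 1"
    using assms unfolding atLeastAtMost_iff by linarith+
  then have "- 1 \<le> k" "k \<le> 1" by linarith+
  then consider "k = -1" | "k = 0" | "k = 1" by linarith
  then show ?thesis using assms by cases auto
qed

text \<open>The first coordinate of \<open>pos\<close> selects one of several concentric circles,
  the second one of n equally spaced points on it; edges are the circular arcs between neighbouring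
  points.\<close>

lemma disjoint_cycles_planar:
  fixes pos :: "'v \<Rightarrow> nat \<times> nat"
  assumes n: "2 \<le> n" and inj: "inj_on pos V" and lt: "\<And>v. v \<in> V \<Longrightarrow> snd (pos v) < n"
    and E: "\<And>e. e \<in> E \<Longrightarrow> \<exists>x y. e = {x, y} \<and> x \<in> V \<and> y \<in> V \<and> fst (pos x) = fst (pos y) \<and>
       snd (pos y) = (snd (pos x) + 1) mod n"
  shows "planar_graph V E"
proof -
  \<comment> \<open>Radius r + 1 keeps the circle with r = 0 from shrinking to a point.\<close>
  define W where "W r x = of_nat (Suc r) * cis (2 * pi * (x / real n))" for r :: nat and x :: real
  have n0: "real n \<noteq> 0" using n by simp
  have Weq: "r = r' \<and> (\<exists>k::int. x = y + of_int k * real n)" if "W r x = W r' y" for r r' x y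
  proof -
    have "cmod (W r x) = cmod (W r' y)" using that by simp
    then have "real (Suc r) = real (Suc r')" unfolding W_def norm_mult norm_of_nat by simp
    then have r: "r = r'" by simp
    have "complex_of_nat (Suc r') \<noteq> 0" by (metis of_nat_eq_0_iff nat.distinct(2))
    then have "cis (2 * pi * (x / real n)) = cis (2 * pi * (y / real n))"
      using that unfolding W_def r by (metis mult_left_cancel)
    then obtain k :: int where "x / real n = y / real n + of_int k" unfolding cis_2pi_eq_iff by blast
    then have "x = y + of_int k * real n" using n0 by (simp add: field_simps)
    then show ?thesis using r by blast
  qed
  have Wper: "W r (x + real n) = W r x" for r x
  proof -
    have "(x + real n) / real n = x / real n + of_int 1" using n0 by (simp add: field_simps)
    then have "cis (2 * pi * ((x + real n) / real n)) = cis (2 * pi * (x / real n))"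
      unfolding cis_2pi_eq_iff by blast
    then show ?thesis unfolding W_def by simp
  qed
  define F where "F v = W (fst (pos v)) (real (snd (pos v)))" for v
  have "\<exists>a b. \<forall>e\<in>E. e = {a e, b e} \<and> a e \<in> V \<and> b e \<in> V \<and> fst (pos (a e)) = fst (pos (b e)) \<and>
       snd (pos (b e)) = (snd (pos (a e)) + 1) mod n"
    using E by metis
  then obtain a b where ab: "\<And>e. e \<in> E \<Longrightarrow> e = {a e, b e}" "\<And>e. e \<in> E \<Longrightarrow> a e \<in> V" "\<And>e. e \<in> E \<Longrightarrow> b e \<in> V"
    "\<And>e. e \<in> E \<Longrightarrow> fst (pos (a e)) = fst (pos (b e))" "\<And>e. e \<in> E \<Longrightarrow> snd (pos (b e)) = (snd (pos (a e)) + 1) mod n"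
    by metis
  define G where "G e x = W (fst (pos (a e))) (real (snd (pos (a e))) + x)" for e x
  have same: "i = i'" if "int i - int i' = k * int n" "i < n" "i' < n" for i i' :: nat and k :: int
  proof -
    have "int i mod int n = (int i' + k * int n) mod int n" using that(1) by (simp add: algebra_simps)
    then show ?thesis using that(2,3) by simp
  qed
  have "graph_embeds_in V ((\<lambda>e. e) ` E) (UNIV :: complex set)"
  proof (rule graph_embeds_in_arcsI[where F = F and G = G and a = a and b = b])
    show "inj_on F V"
    proof (rule inj_onI)
      fix x y assume xy: "x \<in> V" "y \<in> V" "F x = F y"
      then obtain k :: int where k: "fst (pos x) = fst (pos y)"
        "real (snd (pos x)) = real (snd (pos y)) + of_int k * real n" unfolding F_def using Weq by blast
      then have "real_of_int (int (snd (pos x)) - int (snd (pos y))) = real_of_int (k * int n)" by simp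
      then have "snd (pos x) = snd (pos y)" using same lt xy(1,2) of_int_eq_iff by blast
      then show "x = y" using k(1) inj xy(1,2) by (metis inj_onD prod_eq_iff)
    qed
    fix e assume e: "e \<in> E"
    have ne: "a e \<noteq> b e"
    proof
      assume "a e = b e"
      then have *: "snd (pos (a e)) = (snd (pos (a e)) + 1) mod n" using ab(5)[OF e] by simp
      have "snd (pos (a e)) < n" using lt ab(2)[OF e] by blast
      then show False using * n by (cases "snd (pos (a e)) + 1 = n") auto
    qed
    have G1: "G e 1 = F (b e)"
    proof (cases "snd (pos (a e)) + 1 = n")
      case True
      then have "real (snd (pos (a e))) + 1 = 0 + real n" by linarith
      then have "G e 1 = W (fst (pos (a e))) 0" unfolding G_def using Wper by metis
      moreover have "snd (pos (b e)) = 0" using ab(5)[OF e] True by simp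
      ultimately show ?thesis using ab(4)[OF e] by (simp add: F_def)
    next
      case False
      then have "snd (pos (b e)) = snd (pos (a e)) + 1"
        using ab(5)[OF e] lt[OF ab(2)[OF e]] by simp
      then show ?thesis using ab(4)[OF e] by (simp add: F_def G_def add.commute)
    qed
    have "continuous_on {0..1} (G e)" unfolding G_def W_def using n0 by (intro continuous_intros) auto
    then show "a e \<in> V \<and> b e \<in> V \<and> a e \<noteq> b e \<and> e = {a e, b e} \<and> continuous_on {0..1} (G e) \<and>
        G e ` {0..1} \<subseteq> UNIV \<and> G e 0 = F (a e) \<and> G e 1 = F (b e)"
      using ab(1-3)[OF e] ne G1 by (simp add: F_def G_def)
    fix x :: real assume x: "x \<in> {0..1}"
    { fix v assume v: "v \<in> V" "G e x = F v"
      then obtain k :: int where "real (snd (pos (a e))) + x = real (snd (pos v)) + of_int k * real n"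
        unfolding G_def F_def using Weq by blast
      then have "x - 0 = of_int (int (snd (pos v)) + k * int n - int (snd (pos (a e))))" by simp
      from int_diff_unit_interval[OF x _ this] show "x \<in> {0, 1}" by auto }
    { fix e' and y :: real assume e': "e' \<in> E" "y \<in> {0..1}" "G e x = G e' y"
      then obtain k :: int where k: "fst (pos (a e)) = fst (pos (a e'))"
        "real (snd (pos (a e))) + x = real (snd (pos (a e'))) + y + of_int k * real n"
        unfolding G_def using Weq by blast
      then have "x - y = of_int (int (snd (pos (a e'))) + k * int n - int (snd (pos (a e))))" by simp
      then consider "x \<in> {0, 1} \<and> y \<in> {0, 1}" | "x = y"
        using int_diff_unit_interval[OF x e'(2)] by blast
      then show "x \<in> {0, 1} \<and> y \<in> {0, 1} \<or> x = y \<and> e = e'"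
      proof cases
        case 2
        then have "real_of_int (int (snd (pos (a e))) - int (snd (pos (a e')))) = real_of_int (k * int n)"
          using k(2) by simp
        then have "snd (pos (a e)) = snd (pos (a e'))"
          using same lt ab(2)[OF e] ab(2)[OF e'(1)] of_int_eq_iff by blast
        then have p: "pos (a e) = pos (a e')" using k(1) by (simp add: prod_eq_iff)
        then have "a e = a e'" using inj ab(2)[OF e] ab(2)[OF e'(1)] by (metis inj_onD)
        moreover have "pos (b e) = pos (b e')"
          using p ab(4,5)[OF e] ab(4,5)[OF e'(1)] by (simp add: prod_eq_iff)
        then have "b e = b e'" using inj ab(3)[OF e] ab(3)[OF e'(1)] by (metis inj_onD)
        ultimately show ?thesis using 2 ab(1)[OF e] ab(1)[OF e'(1)] by metis
      qed simp }
  qed simp_all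
  then show ?thesis by (simp add: planar_graph_def)
qed

text \<open>The lattice of identifications is spanned by (m, 0) and (c, n), the Hermite normal form
  of a sublattice of finite index. A linear change of basis turns the plane modulo this lattice into
  the standard torus, and the unit grid descends to the drawing.\<close>

lemma grid_quotient_toroidal:
  fixes g :: "int \<times> int \<Rightarrow> 'v" and m n c :: int
  assumes mn: "0 < m" "0 < n"
    and lat: "\<And>x y. g x = g y \<longleftrightarrow> (\<exists>k l. x - y = (k * m + l * c, l * n))"
    and ne: "\<And>x. g x \<noteq> g (x + (1, 0))" "\<And>x. g x \<noteq> g (x + (0, 1))"
  shows "toroidal_graph (range g) {{g x, g (x + d)} |x d. d = (1, 0) \<or> d = (0, 1)}"
proof -
  \<comment> \<open>The linear map that takes (m, 0) and (c, n) to the two unit vectors.\<close>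
  define L where "L z = Complex (Re z / of_int m - of_int c * Im z / (of_int m * of_int n)) (Im z / of_int n)" for z
  define \<rho> where "\<rho> z = tmap (L z)" for z
  have \<rho>eq: "\<exists>k. z = w + lpt k \<and> g k = g 0" if zw: "\<rho> z = \<rho> w" for z w
  proof -
    obtain k where "L z = L w + lpt k" using zw unfolding \<rho>_def tmap_eq_iff by blast
    then have 1: "Re z / of_int m - of_int c * Im z / (of_int m * of_int n) =
        Re w / of_int m - of_int c * Im w / (of_int m * of_int n) + of_int (fst k)"
      and 2: "Im z / of_int n = Im w / of_int n + of_int (snd k)"
      by (simp_all add: L_def complex_eq_iff)
    have im: "Im z = Im w + of_int (snd k) * of_int n" using 2 mn by (simp add: field_simps)
    have "of_int c * Im z / (of_int m * of_int n) = of_int c * Im w / (of_int m * of_int n) + of_int c * of_int (snd k) / of_int m"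
      using mn unfolding im by (simp add: field_simps)
    then have "Re z / of_int m = Re w / of_int m + of_int c * of_int (snd k) / of_int m + of_int (fst k)"
      using 1 by simp
    then have "Re z = Re w + of_int c * of_int (snd k) + of_int (fst k) * of_int m"
      using mn by (simp add: field_simps)
    then have "z = w + lpt (fst k * m + snd k * c, snd k * n)"
      using im by (simp add: complex_eq_iff)
    moreover have "g (fst k * m + snd k * c, snd k * n) = g 0" unfolding lat by auto
    ultimately show ?thesis by blast
  qed
  have \<rho>g: "\<rho> (lpt x) = \<rho> (lpt y)" if gxy: "g x = g y" for x y
  proof -
    obtain k l where kl: "x - y = (k * m + l * c, l * n)" using gxy unfolding lat by blast
    have x: "fst x = fst y + (k * m + l * c)" "snd x = snd y + l * n"
      using kl by (auto simp: prod_eq_iff algebra_simps)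
    have "L (lpt x) = L (lpt y) + lpt (k, l)"
      using mn by (simp add: L_def complex_eq_iff x field_simps)
    then show ?thesis unfolding \<rho>_def tmap_eq_iff by blast
  qed
  have gadd: "g (x + z) = g (y + z)" if "g x = g y" for x y z using that unfolding lat by simp
  have glpt: "g x = g y" if rxy: "\<rho> (lpt x) = \<rho> (lpt y)" for x y
  proof -
    obtain k where "lpt x = lpt y + lpt k" "g k = g 0" using \<rho>eq[OF rxy] by blast
    then have "x = y + k" by (metis lpt_add lpt_eq_iff)
    then show ?thesis using gadd[OF \<open>g k = g 0\<close>, of y] by (simp add: add.commute)
  qed
  define F where "F v = \<rho> (lpt (SOME x. g x = v))" for v
  have Fg: "F (g x) = \<rho> (lpt x)" for x
    unfolding F_def by (rule \<rho>g) (rule someI[of "\<lambda>y. g y = g x" x], simp)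
  define J where "J = (UNIV :: (int \<times> int) set) \<times> ({(1, 0), (0, 1)} :: (int \<times> int) set)"
  define G where "G j x = \<rho> (lpt (fst j) + of_real x * lpt (snd j))" for j x
  have key: "x \<in> {0, 1} \<and> y \<in> {0, 1} \<or> x = y \<and> snd j = snd j' \<and> g (fst j) = g (fst j')"
    if j: "j \<in> J" "j' \<in> J" "x \<in> {0..1}" "y \<in> {0..1}" "G j x = G j' y" for j j' x y
  proof -
    obtain k where k: "lpt (fst j) + of_real x * lpt (snd j) = lpt (fst j') + of_real y * lpt (snd j') + lpt k"
        "g k = g 0"
      using \<rho>eq[OF j(5)[unfolded G_def]] by metis
    have re: "of_int (fst (fst j)) + x * of_int (fst (snd j)) = of_int (fst (fst j')) + y * of_int (fst (snd j')) + of_int (fst k)"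
      and im: "of_int (snd (fst j)) + x * of_int (snd (snd j)) = of_int (snd (fst j')) + y * of_int (snd (snd j')) + of_int (snd k)"
      using k(1) by (simp_all add: complex_eq_iff)
    have gk: "g (fst j) = g (fst j')" if "fst j = fst j' + k"
      unfolding that using gadd[OF k(2), of "fst j'"] by (simp add: add.commute)
    show ?thesis
    proof (cases "snd j = snd j'")
      case True
      have "snd j = (1, 0) \<or> snd j = (0, 1)" using j(1) by (auto simp: J_def)
      then have "\<exists>i::int. x - y = of_int i"
      proof
        assume "snd j = (1, 0)"
        then have "x - y = of_int (fst (fst j') + fst k - fst (fst j))" using re True by simp
        then show ?thesis by blast
      next
        assume "snd j = (0, 1)"
        then have "x - y = of_int (snd (fst j') + snd k - snd (fst j))" using im True by simp
        then show ?thesis by blast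
      qed
      then consider "x \<in> {0, 1} \<and> y \<in> {0, 1}" | "x = y"
        using int_diff_unit_interval[OF j(3,4)] by blast
      then show ?thesis
      proof cases
        case 2
        then have "lpt (fst j) = lpt (fst j' + k)" using k(1) True by (simp add: lpt_add)
        then show ?thesis using gk 2 True by (simp add: lpt_eq_iff)
      qed simp
    next
      case False
      then have "snd j = (1, 0) \<and> snd j' = (0, 1) \<or> snd j = (0, 1) \<and> snd j' = (1, 0)"
        using j(1,2) by (auto simp: J_def)
      \<comment> \<open>A horizontal and a vertical grid segment meet only in grid points, so both
        parameters are integers.\<close>
      then have "(\<exists>i::int. x - 0 = of_int i) \<and> (\<exists>i::int. y - 0 = of_int i)"
      proof
        assume *: "snd j = (1, 0) \<and> snd j' = (0, 1)"
        then have "x - 0 = of_int (fst (fst j') + fst k - fst (fst j))"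
          "y - 0 = of_int (snd (fst j) - snd (fst j') - snd k)" using re im by simp_all
        then show ?thesis by blast
      next
        assume *: "snd j = (0, 1) \<and> snd j' = (1, 0)"
        then have "x - 0 = of_int (snd (fst j') + snd k - snd (fst j))"
          "y - 0 = of_int (fst (fst j) - fst (fst j') - fst k)" using re im by simp_all
        then show ?thesis by blast
      qed
      then show ?thesis using int_diff_unit_interval[OF j(3), of 0] int_diff_unit_interval[OF j(4), of 0] by auto
    qed
  qed
  have "graph_embeds_in (range g) ((\<lambda>j. {g (fst j), g (fst j + snd j)}) ` J) torus"
  proof (rule graph_embeds_in_arcsI[where F = F and G = G and a = "\<lambda>j. g (fst j)" and b = "\<lambda>j. g (fst j + snd j)"])
    show "inj_on F (range g)" using Fg glpt by (metis (no_types, lifting) inj_onI rangeE)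
    show "F ` range g \<subseteq> torus" unfolding F_def \<rho>_def using tmap_in_torus by blast
    fix j assume j: "j \<in> J"
    then have "snd j = (1, 0) \<or> snd j = (0, 1)" by (auto simp: J_def)
    then have gn: "g (fst j) \<noteq> g (fst j + snd j)" using ne by metis
    have "continuous_on {0..1} (G j)"
      unfolding G_def \<rho>_def tmap_def L_def Complex_eq using mn by (intro continuous_intros) auto
    then show "g (fst j) \<in> range g \<and> g (fst j + snd j) \<in> range g \<and> g (fst j) \<noteq> g (fst j + snd j) \<and>
         {g (fst j), g (fst j + snd j)} = {g (fst j), g (fst j + snd j)} \<and> continuous_on {0..1} (G j) \<and>
         G j ` {0..1} \<subseteq> torus \<and> G j 0 = F (g (fst j)) \<and> G j 1 = F (g (fst j + snd j))"
      using gn tmap_in_torus by (auto simp: Fg G_def lpt_add \<rho>_def)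
    fix x :: real assume x: "x \<in> {0..1}"
    { fix v assume v: "v \<in> range g" "G j x = F v"
      then obtain y where "v = g y" by blast
      then have "G j x = G (y, snd j) 0" using v(2) Fg by (simp add: G_def)
      moreover have "(y, snd j) \<in> J" using j by (auto simp: J_def)
      ultimately show "x \<in> {0, 1}" using key[OF j _ x, of "(y, snd j)" 0] by auto }
    { fix j' and y :: real assume j': "j' \<in> J" "y \<in> {0..1}" "G j x = G j' y"
      have "x \<in> {0, 1} \<and> y \<in> {0, 1} \<or> x = y \<and> snd j = snd j' \<and> g (fst j) = g (fst j')"
        by (rule key[OF j j'(1) x j'(2,3)])
      then show "x \<in> {0, 1} \<and> y \<in> {0, 1} \<or>
          x = y \<and> {g (fst j), g (fst j + snd j)} = {g (fst j'), g (fst j' + snd j')}"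
        using gadd[of "fst j" "fst j'" "snd j"] by auto }
  qed
  moreover have "(\<lambda>j. {g (fst j), g (fst j + snd j)}) ` J = {{g x, g (x + d)} |x d. d = (1, 0) \<or> d = (0, 1)}"
  proof (intro equalityI subsetI)
    fix e assume "e \<in> (\<lambda>j. {g (fst j), g (fst j + snd j)}) ` J"
    then obtain j where j: "j \<in> J" "e = {g (fst j), g (fst j + snd j)}" by (rule imageE) simp
    then have "snd j = (1, 0) \<or> snd j = (0, 1)" by (auto simp: J_def)
    then show "e \<in> {{g x, g (x + d)} |x d. d = (1, 0) \<or> d = (0, 1)}" using j(2) by blast
  next
    fix e assume "e \<in> {{g x, g (x + d)} |x d. d = (1, 0) \<or> d = (0, 1)}"
    then obtain x d where xd: "e = {g x, g (x + d)}" "d = (1, 0) \<or> d = (0, 1)" by blast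
    show "e \<in> (\<lambda>j. {g (fst j), g (fst j + snd j)}) ` J"
      by (rule image_eqI[of _ _ "(x, d)"]) (use xd in \<open>auto simp: J_def\<close>)
  qed
  ultimately show ?thesis by (simp add: toroidal_graph_def)
qed

section \<open>Lattices of relations\<close>

lemma int_subgroup_principal:
  fixes P :: "int \<Rightarrow> bool"
  assumes "P N" "0 < N" "\<And>x y. P x \<Longrightarrow> P y \<Longrightarrow> P (x - y)" 
  obtains a where "0 < a" "\<And>x. P x \<longleftrightarrow> a dvd x"
proof -
  define n where "n = (LEAST n. 0 < n \<and> P (int n))"
  have n: "0 < n" "P (int n)"
    using LeastI[of "\<lambda>n. 0 < n \<and> P (int n)" "nat N"] assms(1,2) unfolding n_def by simp_all
  have least: "n \<le> m" if "0 < m" "P (int m)" for m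
    unfolding n_def by (rule Least_le) (use that in simp)
  have P0: "P 0" using assms(3)[OF assms(1,1)] by simp
  have Pneg: "P (- x)" if "P x" for x using assms(3)[OF P0 that] by simp
  have Padd: "P (x + y)" if "P x" "P y" for x y using assms(3)[OF that(1) Pneg[OF that(2)]] by simp
  have mulnat: "P (int k * int n)" for k
    by (induction k) (auto simp: P0 algebra_simps intro: Padd n(2))
  have mul: "P (k * int n)" for k
  proof (cases "0 \<le> k")
    case True then show ?thesis using mulnat[of "nat k"] by simp
  next
    case False then show ?thesis using Pneg[OF mulnat[of "nat (- k)"]] by simp
  qed
  have "P x \<longleftrightarrow> int n dvd x" for x
  proof
    assume "P x"
    then have "P (x - x div int n * int n)" using assms(3) mul by blast
    then have m: "P (x mod int n)" by (simp add: minus_div_mult_eq_mod)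
    have "x mod int n = 0"
    proof (rule ccontr)
      assume "x mod int n \<noteq> 0"
      moreover have "0 \<le> x mod int n" using n(1) by simp
      ultimately have "0 < nat (x mod int n)" by linarith
      then have "n \<le> nat (x mod int n)" using m n(1) by (intro least) simp_all
      then show False using n(1) pos_mod_bound[of "int n" x] by linarith
    qed
    then show "int n dvd x" by (rule mod_0_imp_dvd)
  next
    assume "int n dvd x"
    then obtain k where "x = int n * k" by (rule dvdE)
    then show "P x" using mul[of k] by (simp add: mult.commute)
  qed
  then show ?thesis using that[of "int n"] n(1) by simp
qed

lemma int_two_power_odd:
  fixes N :: int
  assumes "0 < N"
  obtains K m where "N = 2 ^ K * m" "odd m" "0 < m"
proof -
  have "\<exists>K m. N = 2 ^ K * m \<and> odd m"
    using multiplicity_decompose'[of N 2] assms by (metis not_is_unit_0 odd_one less_irrefl)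
  then obtain K m where "N = 2 ^ K * m" "odd m" by blast
  moreover have "0 < m" using assms calculation(1) by (simp add: zero_less_mult_iff)
  ultimately show ?thesis by (rule that)
qed

definition odd_prime_power :: "int \<Rightarrow> bool" where
  "odd_prime_power a \<longleftrightarrow> (\<exists>(p::nat) n. Factorial_Ring.prime p \<and> odd p \<and> 1 \<le> n \<and> a = int (p ^ n))"

text \<open>Outside the first two cases the full power of one prime factor splits off and leaves a
  nontrivial coprime cofactor.\<close>

lemma odd_int_cases:
  fixes a :: int
  assumes "0 < a" "odd a"
  obtains "a = 1" | "odd_prime_power a" | s t where "a = s * t" "coprime s t" "1 < s" "1 < t" "odd s" "odd t"
proof -
  consider "a = 1" | "1 < a" using assms(1) by linarith
  then show thesis
  proof cases
    case 2
    define b where "b = nat a"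
    have b: "1 < b" "odd b" "a = int b" using 2 assms by (auto simp: b_def even_nat_iff)
    then obtain p where p: "Factorial_Ring.prime p" "p dvd b" using prime_factor_nat[of b] by auto
    have op: "odd p" using p(2) b(2) by (metis dvd_trans)
    obtain t where t: "b = p ^ multiplicity p b * t" "\<not> p dvd t"
      using multiplicity_decompose'[of b p] p(1) b(1) by (metis less_numeral_extra(3) not_prime_unit bot_nat_0.not_eq_extremum less_trans zero_less_one)
    define n where "n = multiplicity p b"
    have n1: "1 \<le> n" using p b(1) unfolding n_def by (simp add: prime_multiplicity_gt_zero_iff Suc_le_eq)
    show thesis
    proof (cases "t = 1")
      case True
      then have "odd_prime_power a" unfolding odd_prime_power_def using p(1) op n1 t(1) b(3) n_def
        by (metis mult.right_neutral)
      then show thesis by (rule that(2))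
    next
      case False
      have "t \<noteq> 0" using t(1) b(1) by (intro notI) simp
      then have t1: "1 < t" using False by simp
      have "1 < p" using p(1) prime_gt_1_nat by blast
      then have s1: "1 < p ^ n" using n1 by (intro one_less_power) simp_all
      have "coprime p t" using p(1) t(2) prime_imp_coprime by blast
      then have "coprime (p ^ n) t" by simp
      moreover have "odd t" using t(1) b(2) by (metis even_mult_iff)
      moreover have "odd (p ^ n)" using op by simp
      moreover have "a = int (p ^ n) * int t" using b(3) t(1) unfolding n_def by (metis of_nat_mult)
      ultimately show thesis using that(3)[of "int (p ^ n)" "int t"] s1 t1
        by (metis coprime_int_iff even_of_nat of_nat_1 of_nat_less_iff)
    qed
  qed (rule that(1))
qed

lemma odd_not_dvd_2:
  fixes c :: int
  assumes "1 < c" "odd c"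
  shows "\<not> c dvd 2"
proof
  assume "c dvd 2"
  then have "c \<le> 2" by (simp add: zdvd_imp_le)
  then have "c = 2" using assms(1) by simp
  then show False using assms(2) by simp
qed

text \<open>The lattice \<open>\<Lambda>\<close> consists of the relations \<open>i + j u = 0\<close> in a ring generated by an involution \<open>u\<close>; \<open>invs\<close> says that \<open>1, -1, u, -u\<close> are the only involutions, and \<open>d1\<close>, \<open>d2\<close>, \<open>d3\<close> that these are distinct.\<close>
locale inv_lattice =
  fixes \<Lambda> :: "int \<Rightarrow> int \<Rightarrow> bool" and N :: int
  assumes add: "\<And>i j i' j'. \<Lambda> i j \<Longrightarrow> \<Lambda> i' j' \<Longrightarrow> \<Lambda> (i + i') (j + j')"
    and neg: "\<And>i j. \<Lambda> i j \<Longrightarrow> \<Lambda> (- i) (- j)"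
    and swap: "\<And>i j. \<Lambda> i j \<Longrightarrow> \<Lambda> j i"
    and N: "0 < N" "\<Lambda> N 0"
    and invs: "\<And>i j. \<Lambda> (i * i + j * j - 1) (2 * i * j) \<Longrightarrow>
        \<Lambda> (i - 1) j \<or> \<Lambda> (i + 1) j \<or> \<Lambda> i (j - 1) \<or> \<Lambda> i (j + 1)"
    and d1: "\<not> \<Lambda> 2 0" and d2: "\<not> \<Lambda> 1 1" and d3: "\<not> \<Lambda> 1 (- 1)"
begin

lemma diff: "\<Lambda> i j \<Longrightarrow> \<Lambda> i' j' \<Longrightarrow> \<Lambda> (i - i') (j - j')"
  using add[of i j "- i'" "- j'"] neg[of i' j'] by simp

lemma zero: "\<Lambda> 0 0"
  using diff[OF N(2) N(2)] by simp

lemma mul: "\<Lambda> i j \<Longrightarrow> \<Lambda> (k * i) (k * j)"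
proof -
  assume ij: "\<Lambda> i j"
  have n: "\<Lambda> (int n * i) (int n * j)" for n
    by (induction n) (auto simp: zero algebra_simps intro: add ij)
  show ?thesis
  proof (cases "0 \<le> k")
    case True then show ?thesis using n[of "nat k"] by simp
  next
    case False then show ?thesis using neg[OF n[of "nat (- k)"]] by simp
  qed
qed

lemma lin: "\<Lambda> i j \<Longrightarrow> \<Lambda> i' j' \<Longrightarrow> x = k * i + l * i' \<Longrightarrow> y = k * j + l * j' \<Longrightarrow> \<Lambda> x y"
  using add[OF mul[of i j k] mul[of i' j' l]] by simp

text \<open>Replacing u by -u exchanges the two diagonals, so results for one of them carry over to
  the other.\<close>

lemma mirror: "inv_lattice (\<lambda>i j. \<Lambda> i (- j)) N"
proof
  fix i j i' j'
  show "\<Lambda> (i + i') (- (j + j'))" if "\<Lambda> i (- j)" "\<Lambda> i' (- j')"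
    using add[OF that] by simp
  show "\<Lambda> (- i) (- (- j))" if "\<Lambda> i (- j)" using neg[OF that] by simp
  show "\<Lambda> j (- i)" if "\<Lambda> i (- j)" using neg[OF swap[OF that]] by simp
  show "\<Lambda> (i - 1) (- j) \<or> \<Lambda> (i + 1) (- j) \<or> \<Lambda> i (- (j - 1)) \<or> \<Lambda> i (- (j + 1))"
    if "\<Lambda> (i * i + j * j - 1) (- (2 * i * j))"
  proof -
    have eqs: "- (j - 1) = - j + 1" "- (j + 1) = - j - 1" by simp_all
    have "\<Lambda> (i * i + (- j) * (- j) - 1) (2 * i * (- j))" using that by simp
    from invs[OF this] show ?thesis unfolding eqs by blast
  qed
qed (use N d1 d2 d3 in simp_all)

end

text \<open>A relation (x, x) reads x(1 + u) = 0 and (x, -x) reads x(1 - u) = 0, so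
  \<open>\<alpha>'\<close> and \<open>\<beta>'\<close> are the additive orders of 1 + u and 1 - u.
  Powers of 2 are split off because the diagonals determine the lattice only away from 2.\<close>

locale inv_lattice_gens = inv_lattice +
  fixes \<alpha>' \<beta>' \<alpha> \<beta> :: int and a b :: nat
  assumes \<alpha>': "0 < \<alpha>'" "\<And>x. \<Lambda> x x \<longleftrightarrow> \<alpha>' dvd x" "\<alpha>' = 2 ^ a * \<alpha>" "odd \<alpha>" "0 < \<alpha>"
    and \<beta>': "0 < \<beta>'" "\<And>x. \<Lambda> x (- x) \<longleftrightarrow> \<beta>' dvd x" "\<beta>' = 2 ^ b * \<beta>" "odd \<beta>" "0 < \<beta>"
begin

text \<open>A relation and its swap, which is its product with u, add up to a relation on the
  diagonal.\<close>

lemma sumD: "\<Lambda> i j \<Longrightarrow> \<alpha>' dvd i + j"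
  using add[OF _ swap, of i j i j] \<alpha>'(2)[of "i + j"] by (simp add: add.commute)

lemma diffD: "\<Lambda> i j \<Longrightarrow> \<beta>' dvd i - j"
  using diff[OF _ swap, of i j i j] \<beta>'(2)[of "i - j"] by simp

lemma odd_sumD: "\<Lambda> i j \<Longrightarrow> \<alpha> dvd i + j"
  using sumD \<alpha>'(3) by (metis dvd_mult_right)

lemma odd_diffD: "\<Lambda> i j \<Longrightarrow> \<beta> dvd i - j"
  using diffD \<beta>'(3) by (metis dvd_mult_right)

text \<open>If \<open>\<alpha>\<close> = s t with coprime factors, there is c with c = 0 modulo 2^a
  s and 2c = 1 modulo t. Then 1 - 2c(1 + u) is an involution. Where u = 1 it equals 1 modulo s and
  -1 modulo t, so it is none of 1, -1, u, -u.\<close>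

lemma alpha_prime_power: "\<alpha> = 1 \<or> odd_prime_power \<alpha>"
  using \<alpha>'(5,4)
proof (cases rule: odd_int_cases)
  case (3 s t)
  have "coprime (2 ^ Suc a * s) t" using 3 by simp
  then obtain y z where yz: "y * (2 ^ Suc a * s) + z * t = 1"
    using bezout_int[of "2 ^ Suc a * s" t] by (auto simp: coprime_iff_gcd_eq_1)
  \<comment> \<open>The Bezout identity reads 2c = 1 - z t; the additional factor 2 in the coprime
    pair is what allows c to be half of such a number.\<close>
  define c where "c = 2 ^ a * s * y"
  have "2 * c - 1 = t * (- z)" using yz by (simp add: c_def algebra_simps)
  then have tc: "t dvd 2 * c - 1" by simp
  have sc: "s dvd c" by (simp add: c_def)
  have "2 ^ a * s dvd c" by (simp add: c_def)
  then have ac: "\<alpha>' dvd c * (2 * c - 1)"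
    using tc 3(1) \<alpha>'(3) mult_dvd_mono[of "2 ^ a * s" c t "2 * c - 1"] by (simp add: mult.assoc)
  have s2: "\<not> s dvd 2" and t1: "\<not> t dvd 1" and t2: "\<not> t dvd 2"
    using odd_not_dvd_2[of s] odd_not_dvd_2[of t] 3 dvd_trans[of t 1 2] by auto
  have "\<Lambda> (4 * (c * (2 * c - 1))) (4 * (c * (2 * c - 1)))" using \<alpha>'(2) ac by simp
  moreover have "4 * (c * (2 * c - 1)) = (1 - 2 * c) * (1 - 2 * c) + (- 2 * c) * (- 2 * c) - 1"
    "4 * (c * (2 * c - 1)) = 2 * (1 - 2 * c) * (- 2 * c)" by (simp_all add: algebra_simps)
  ultimately have "\<Lambda> ((1 - 2 * c) - 1) (- 2 * c) \<or> \<Lambda> ((1 - 2 * c) + 1) (- 2 * c) \<or>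
      \<Lambda> (1 - 2 * c) (- 2 * c - 1) \<or> \<Lambda> (1 - 2 * c) (- 2 * c + 1)"
    by (intro invs) metis
  moreover have "s dvd \<alpha>" "t dvd \<alpha>" using 3(1) by simp_all
  moreover have False if "\<Lambda> ((1 - 2 * c) - 1) (- 2 * c)"
  proof -
    have "\<alpha>' dvd - 2 * c" using that \<alpha>'(2) by simp
    then have "t dvd 2 * c" using \<alpha>'(3) 3(1) by (metis dvd_minus_iff dvd_mult_right mult_minus_left)
    then have "t dvd 2 * c - (2 * c - 1)" using tc by (rule dvd_diff)
    then show False using t1 by simp
  qed
  moreover have F: False if "s dvd 2 - 4 * c"
  proof -
    have "s dvd (2 - 4 * c) + 4 * c" by (intro dvd_add that dvd_mult sc)
    then show False using s2 by simp
  qed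
  moreover have False if "\<Lambda> ((1 - 2 * c) + 1) (- 2 * c)"
    using odd_sumD[OF that] \<open>s dvd \<alpha>\<close> F by (simp add: algebra_simps) (metis dvd_trans)
  moreover have False if "\<Lambda> (1 - 2 * c) (- 2 * c + 1)"
    using odd_sumD[OF that] \<open>s dvd \<alpha>\<close> F by (simp add: algebra_simps) (metis dvd_trans)
  moreover have False if "\<Lambda> (1 - 2 * c) (- 2 * c - 1)"
  proof -
    have "\<alpha> dvd - (4 * c)" using odd_sumD[OF that] by (simp add: algebra_simps)
    then have "t dvd 4 * c" using \<open>t dvd \<alpha>\<close> by (metis dvd_minus_iff dvd_trans)
    moreover have "t dvd 2 * (2 * c - 1)" using tc by (rule dvd_mult)
    ultimately have "t dvd 4 * c - 2 * (2 * c - 1)" by (rule dvd_diff)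
    then show False using t2 by simp
  qed
  ultimately show ?thesis by blast
qed auto

text \<open>\<open>e\<close> is the idempotent modulo N that is 1 on the 2-primary part and 0 on the
  odd part. On the odd part 2 is invertible, so elements split along the diagonals: with 1 - e = 2h,
  (1 - e)(i + j u) = h(i + j)(1 + u) + h(i - j)(1 - u).\<close>

lemma idempotent_ex:
  obtains K e where "\<Lambda> (2 ^ K * e) 0" "\<And>k. \<Lambda> (k * (e * (1 - e))) 0" "\<alpha> dvd e" "\<beta> dvd e"
    "\<And>i j. \<alpha> dvd i + j \<Longrightarrow> \<beta> dvd i - j \<Longrightarrow> \<Lambda> ((1 - e) * i) ((1 - e) * j)"
proof -
  obtain K m where K: "N = 2 ^ K * m" "odd m" "0 < m" using int_two_power_odd[OF N(1)] .
  \<comment> \<open>One factor 2 more than in N, so that h, half of 1 - e, is still divisible by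
    2^K.\<close>
  have "coprime (2 ^ Suc K) m" using K(2) by simp
  then obtain y z where yz: "y * 2 ^ Suc K + z * m = 1"
    using bezout_int[of "2 ^ Suc K" m] by (auto simp: coprime_iff_gcd_eq_1)
  define e where "e = z * m"
  define h where "h = y * 2 ^ K"
  have h: "1 - e = 2 * h" using yz by (simp add: e_def h_def algebra_simps)
  have Nd: "\<Lambda> x 0" if "N dvd x" for x
    using that mul[OF N(2)] by (auto simp: mult.commute elim!: dvdE)
  have NN: "\<Lambda> N N" "\<Lambda> N (- N)"
    using add[OF N(2) swap[OF N(2)]] diff[OF N(2) swap[OF N(2)]] by simp_all
  have aN: "\<alpha>' dvd N" "\<beta>' dvd N" using NN \<alpha>'(2) \<beta>'(2) by simp_all
  have pow: "2 ^ c dvd h" if "2 ^ c dvd N" for c :: nat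
  proof -
    have "coprime (2 ^ c) m" using K(2) by simp
    then have "(2::int) ^ c dvd 2 ^ K" using that K(1) coprime_dvd_mult_left_iff by blast
    then show ?thesis by (simp add: h_def)
  qed
  have od: "c dvd e" if "c dvd N" "odd c" for c
  proof -
    have "coprime c (2 ^ K)" using that(2) by (simp add: coprime_commute)
    then have "c dvd m" using that(1) K(1) coprime_dvd_mult_right_iff by blast
    then show ?thesis by (simp add: e_def)
  qed
  show ?thesis
  proof (rule that)
    show "\<Lambda> (2 ^ K * e) 0" by (rule Nd) (simp add: e_def K(1))
    have "N dvd e * (1 - e)" unfolding h by (simp add: e_def h_def K(1))
    then show "\<Lambda> (k * (e * (1 - e))) 0" for k by (rule Nd[OF dvd_mult])
    show "\<alpha> dvd e" "\<beta> dvd e"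
      using od aN \<alpha>'(3,4) \<beta>'(3,4) by (metis dvd_mult_right)+
    fix i j assume ij: "\<alpha> dvd i + j" "\<beta> dvd i - j"
    have "2 ^ a dvd h" "2 ^ b dvd h" using pow aN \<alpha>'(3) \<beta>'(3) by (metis dvd_mult_left)+
    then have "\<alpha>' dvd h * (i + j)" "\<beta>' dvd h * (i - j)"
      using ij \<alpha>'(3) \<beta>'(3) by (simp_all add: mult_dvd_mono)
    then have "\<Lambda> (h * (i + j)) (h * (i + j))" "\<Lambda> (h * (i - j)) (- (h * (i - j)))"
      using \<alpha>'(2) \<beta>'(2) by simp_all
    then show "\<Lambda> ((1 - e) * i) ((1 - e) * j)"
      by (rule lin[where k = 1 and l = 1]) (simp_all add: h algebra_simps)
  qed
qed

lemma not_dvd_2: "0 < c \<Longrightarrow> c \<noteq> 1 \<Longrightarrow> odd c \<Longrightarrow> \<not> c dvd (2::int)"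
  using odd_not_dvd_2[of c] by simp

text \<open>1 - 2e and (1 - e) + e u are involutions acting as 1 on the odd part, where none of -1,
  u, -u acts as 1. So both equal 1, which gives 2e = 0 and e u = e: the 2-primary part is 0 or
  Z_2.\<close>

lemma two_odd_parts:
  assumes "\<alpha> \<noteq> 1" "\<beta> \<noteq> 1"
  shows "(\<forall>i j. \<Lambda> i j \<longleftrightarrow> \<alpha> dvd i + j \<and> \<beta> dvd i - j) \<or>
    (\<forall>i j. \<Lambda> i j \<longleftrightarrow> \<alpha> dvd i + j \<and> \<beta> dvd i - j \<and> 2 dvd i + j)"
proof -
  obtain K e where e: "\<And>k. \<Lambda> (k * (e * (1 - e))) 0" "\<alpha> dvd e" "\<beta> dvd e"
    "\<And>i j. \<alpha> dvd i + j \<Longrightarrow> \<beta> dvd i - j \<Longrightarrow> \<Lambda> ((1 - e) * i) ((1 - e) * j)"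
    using idempotent_ex by metis
  have a2: "\<not> \<alpha> dvd 2" and b2: "\<not> \<beta> dvd 2" using not_dvd_2 \<alpha>' \<beta>' assms by auto
  have ae: "\<not> \<alpha> dvd 2 + k * e" for k
  proof
    assume "\<alpha> dvd 2 + k * e"
    then have "\<alpha> dvd (2 + k * e) - k * e" by (rule dvd_diff) (simp add: e(2))
    then show False using a2 by simp
  qed
  have be: "\<not> \<beta> dvd 2 + k * e" for k
  proof
    assume "\<beta> dvd 2 + k * e"
    then have "\<beta> dvd (2 + k * e) - k * e" by (rule dvd_diff) (simp add: e(3))
    then show False using b2 by simp
  qed
  have "\<Lambda> ((1 - 2 * e) * (1 - 2 * e) + 0 * 0 - 1) (2 * (1 - 2 * e) * 0)"
    using e(1)[of "-4"] by (simp add: algebra_simps)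
  then have "\<Lambda> ((1 - 2 * e) - 1) 0 \<or> \<Lambda> ((1 - 2 * e) + 1) 0 \<or> \<Lambda> (1 - 2 * e) (0 - 1) \<or> \<Lambda> (1 - 2 * e) (0 + 1)"
    by (rule invs)
  moreover have "\<not> \<Lambda> ((1 - 2 * e) + 1) 0" using odd_sumD[of "(1 - 2 * e) + 1" 0] ae[of "-2"] by auto
  moreover have "\<not> \<Lambda> (1 - 2 * e) (0 - 1)" using odd_diffD[of "1 - 2 * e" "0 - 1"] be[of "-2"] by auto
  moreover have "\<not> \<Lambda> (1 - 2 * e) (0 + 1)" using odd_sumD[of "1 - 2 * e" "0 + 1"] ae[of "-2"] by auto
  ultimately have "\<Lambda> (- 2 * e) 0" by simp
  then have e20: "\<Lambda> (2 * e) 0" using neg by fastforce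
  have "\<Lambda> ((1 - e) * (1 - e) + e * e - 1) (2 * (1 - e) * e)"
    using e(1)[of "-2"] swap[OF e(1)[of 2]] add[of "-2 * (e * (1 - e))" 0 0 "2 * (e * (1 - e))"]
    by (simp add: algebra_simps)
  then have "\<Lambda> ((1 - e) - 1) e \<or> \<Lambda> ((1 - e) + 1) e \<or> \<Lambda> (1 - e) (e - 1) \<or> \<Lambda> (1 - e) (e + 1)"
    by (rule invs)
  moreover have "\<not> \<Lambda> ((1 - e) + 1) e" using odd_sumD[of "(1 - e) + 1" e] ae[of 0] by auto
  moreover have "\<not> \<Lambda> (1 - e) (e - 1)" using odd_diffD[of "1 - e" "e - 1"] be[of "-2"] by auto
  moreover have "\<not> \<Lambda> (1 - e) (e + 1)" using odd_sumD[of "1 - e" "e + 1"] ae[of 0] by auto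
  ultimately have ee: "\<Lambda> (- e) e" by simp
  show ?thesis
  \<comment> \<open>If e is not 0, the 2-primary part is Z_2 with u = 1, and it contributes the
    parity of i + j.\<close>
  proof (cases "\<Lambda> e 0")
    case True
    have "\<Lambda> i j" if "\<alpha> dvd i + j" "\<beta> dvd i - j" for i j
    proof -
      have "\<Lambda> (i * e) (j * e)"
        by (rule lin[OF True swap[OF True], of _ i j]) simp_all
      with e(4)[OF that] show ?thesis by (rule lin[where k = 1 and l = 1]) (simp_all add: algebra_simps)
    qed
    then show ?thesis using odd_sumD odd_diffD by blast
  next
    case False
    have "\<Lambda> i j" if ij: "\<alpha> dvd i + j" "\<beta> dvd i - j" "2 dvd i + j" for i j
    proof -
      obtain r where r: "i + j = 2 * r" using ij(3) by blast
      have "\<Lambda> (i * e) (j * e)"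
        by (rule lin[OF e20 ee, of _ r j]) (use r in \<open>simp_all add: algebra_simps\<close>, metis distrib_left mult.commute mult.left_commute)
      with e(4)[OF ij(1,2)] show ?thesis by (rule lin[where k = 1 and l = 1]) (simp_all add: algebra_simps)
    qed
    moreover have "2 dvd i + j" if ij: "\<Lambda> i j" for i j
    proof (rule ccontr)
      assume "\<not> 2 dvd i + j"
      then obtain r where r: "i + j = 2 * r + 1" by (metis oddE)
      have "\<Lambda> (e * i - j * (- e)) (e * j - j * e)" using diff[OF mul[OF ij, of e] mul[OF ee, of j]] .
      moreover have "e * i - j * (- e) = e * (2 * r + 1)" unfolding r[symmetric] by (simp add: algebra_simps)
      ultimately have "\<Lambda> (e * (2 * r + 1)) 0" by (simp add: mult.commute)
      then have "\<Lambda> e 0" using e20 by (rule lin[where k = 1 and l = "- r"]) (simp_all add: algebra_simps)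
      then show False using False by simp
    qed
    ultimately show ?thesis using odd_sumD odd_diffD by blast
  qed
qed

text \<open>Since u acts as 1 on the odd part, 1 - 2e can only be 1 or u. In the first case the
  2-primary part has characteristic 2 with e and e u independent. In the second u = -1 there, the
  part is Z_{2^l}, and 1 + 2^(l-1) e would be a further involution for l \<ge> 3.\<close>

lemma one_odd_part:
  assumes "\<alpha> \<noteq> 1" "\<beta> = 1"
  shows "(\<forall>i j. \<Lambda> i j \<longleftrightarrow> \<alpha> dvd i + j \<and> 2 dvd i \<and> 2 dvd j) \<or>
    (\<forall>i j. \<Lambda> i j \<longleftrightarrow> \<alpha> dvd i + j \<and> 4 dvd i - j)"
proof -
  obtain K e where e: "\<Lambda> (2 ^ K * e) 0" "\<And>k. \<Lambda> (k * (e * (1 - e))) 0" "\<alpha> dvd e"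
    "\<And>i j. \<alpha> dvd i + j \<Longrightarrow> \<beta> dvd i - j \<Longrightarrow> \<Lambda> ((1 - e) * i) ((1 - e) * j)"
    using idempotent_ex by metis
  have a2: "\<not> \<alpha> dvd 2" using not_dvd_2 \<alpha>' assms by auto
  have ae: "\<not> \<alpha> dvd 2 + k * e" for k
  proof
    assume "\<alpha> dvd 2 + k * e"
    then have "\<alpha> dvd (2 + k * e) - k * e" by (rule dvd_diff) (simp add: e(3))
    then show False using a2 by simp
  qed
  \<comment> \<open>With \<open>\<beta>\<close> = 1 the pair (1, -1) meets both divisibility
    conditions, so (1 - e)(1 - u) = 0: on the odd part u is 1. Consequently e u = e would mean u =
    1.\<close>
  have e1: "\<Lambda> (1 - e) (- (1 - e))" using e(4)[of 1 "-1"] assms(2) by simp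
  have ne: "\<not> \<Lambda> e (- e)" using add[OF e1, of e "- e"] d3 by auto
  have "\<Lambda> ((1 - 2 * e) * (1 - 2 * e) + 0 * 0 - 1) (2 * (1 - 2 * e) * 0)"
    using e(2)[of "-4"] by (simp add: algebra_simps)
  then have "\<Lambda> ((1 - 2 * e) - 1) 0 \<or> \<Lambda> ((1 - 2 * e) + 1) 0 \<or> \<Lambda> (1 - 2 * e) (0 - 1) \<or> \<Lambda> (1 - 2 * e) (0 + 1)"
    by (rule invs)
  moreover have "\<not> \<Lambda> ((1 - 2 * e) + 1) 0" using odd_sumD[of "(1 - 2 * e) + 1" 0] ae[of "-2"] by auto
  moreover have "\<not> \<Lambda> (1 - 2 * e) (0 + 1)" using odd_sumD[of "1 - 2 * e" "0 + 1"] ae[of "-2"] by auto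
  ultimately consider "\<Lambda> (- 2 * e) 0" | "\<Lambda> (1 - 2 * e) (- 1)" by auto
  then show ?thesis
  proof cases
    case 1
    then have e20: "\<Lambda> (2 * e) 0" using neg by fastforce
    have "\<Lambda> i j" if ij: "\<alpha> dvd i + j" "2 dvd i" "2 dvd j" for i j
    proof -
      obtain r r' where r: "i = 2 * r" "j = 2 * r'" using ij(2,3) by blast
      have "\<Lambda> (e * i) (e * j)"
        by (rule lin[OF e20 swap[OF e20], of _ r r']) (simp_all add: r)
      with e(4)[OF ij(1)] assms(2) have "\<Lambda> (e * i + (1 - e) * i) (e * j + (1 - e) * j)" by (intro add) simp_all
      then show ?thesis by (simp add: algebra_simps)
    qed
    moreover have "2 dvd i \<and> 2 dvd j" if ij: "\<Lambda> i j" for i j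
    proof (rule ccontr)
      assume odd: "\<not> (2 dvd i \<and> 2 dvd j)"
      \<comment> \<open>As 2e = 0, only the parities x and y of i and j matter; each pattern other
        than (0, 0) would lead to e u = e.\<close>
      obtain r x where r: "i = 2 * r + x" "x = 0 \<or> x = 1" by (metis add.right_neutral evenE oddE)
      obtain r' y where r': "j = 2 * r' + y" "y = 0 \<or> y = 1" by (metis add.right_neutral evenE oddE)
      have "\<Lambda> (r * (2 * e)) (r' * (2 * e))" by (rule lin[OF e20 swap[OF e20], of _ r r']) simp_all
      from diff[OF mul[OF ij, of e] this] have xy: "\<Lambda> (x * e) (y * e)"
        by (simp add: r(1) r'(1) algebra_simps)
      have "x = 1 \<or> y = 1" using odd r r' by auto
      then consider "x = 1" "y = 0" | "x = 0" "y = 1" | "x = 1" "y = 1" using r(2) r'(2) by auto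
      then show False
      proof cases
        case 1
        then have "\<Lambda> e 0" using xy by simp
        from diff[OF this swap[OF this]] show False using ne by simp
      next
        case 2
        then have "\<Lambda> 0 e" using xy by simp
        from diff[OF swap[OF this] this] show False using ne by simp
      next
        case 3
        then have "\<Lambda> e e" using xy by simp
        from diff[OF this swap[OF e20]] show False using ne by simp
      qed
    qed
    ultimately show ?thesis using odd_sumD by blast
  next
    case 2
    from diff[OF 2 e1] have "\<Lambda> (- e) (- e)" by simp
    then have ee: "\<Lambda> e e" using neg by fastforce
    have n2: "\<not> \<Lambda> (e * 2) 0"
    proof
      assume "\<Lambda> (e * 2) 0"
      from diff[OF ee swap[OF this]] show False using ne by simp
    qed
    obtain \<gamma> where \<gamma>: "0 < \<gamma>" "\<And>x. \<Lambda> (e * x) 0 \<longleftrightarrow> \<gamma> dvd x"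
    proof (rule int_subgroup_principal[of "\<lambda>x. \<Lambda> (e * x) 0" "2 ^ K"])
      show "\<Lambda> (e * 2 ^ K) 0" using e(1) by (simp add: mult.commute)
      show "\<Lambda> (e * (x - y)) 0" if "\<Lambda> (e * x) 0" "\<Lambda> (e * y) 0" for x y
        using diff[OF that] by (simp add: algebra_simps)
    qed simp_all
    have "\<gamma> dvd 2 ^ K" using \<gamma>(2)[of "2 ^ K"] e(1) by (simp add: mult.commute)
    then obtain l where l: "\<gamma> = 2 ^ l" using \<gamma>(1) divides_primepow[of "2::int" \<gamma> K] by (auto simp: abs_of_pos)
    have "\<not> \<gamma> dvd 2" using n2 \<gamma>(2) by blast
    then have "l \<noteq> 0" "l \<noteq> 1"
      unfolding l by (metis dvd_refl one_dvd power_0 power_one_right)+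
    have "\<gamma> = 4"
    proof (rule ccontr)
      assume "\<gamma> \<noteq> 4"
      then have "l \<noteq> 2" using l by auto
      then have "3 \<le> l" using \<open>l \<noteq> 0\<close> \<open>l \<noteq> 1\<close> by linarith
      then obtain k where k: "l = k + 3" by (metis add.commute le_Suc_ex)
      \<comment> \<open>\<open>x\<close> is half of \<open>\<gamma>\<close>, the additive order of
        e, so (1 + x e)^2 = 1 while x e is not 0.\<close>
      define x where "x = (2::int) ^ (k + 2)"
      have g2: "\<gamma> = 2 * x" and x4: "4 dvd x" and x0: "0 < x" by (simp_all add: l k x_def power_add)
      obtain w where w: "x = 2 * w" using x4 by (metis dvd_def mult.assoc numeral_Bit0_eq_double)
      have "\<Lambda> (e * (\<gamma> * (1 + w * e))) 0" using \<gamma>(2) by simp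
      then have "\<Lambda> ((1 + x * e) * (1 + x * e) + 0 * 0 - 1) (2 * (1 + x * e) * 0)"
        by (simp add: g2 w algebra_simps)
      then have "\<Lambda> ((1 + x * e) - 1) 0 \<or> \<Lambda> ((1 + x * e) + 1) 0 \<or> \<Lambda> (1 + x * e) (0 - 1) \<or> \<Lambda> (1 + x * e) (0 + 1)"
        by (rule invs)
      moreover have "\<not> \<Lambda> ((1 + x * e) - 1) 0"
        using \<gamma>(2)[of x] g2 x0 zdvd_imp_le[of \<gamma> x] by (auto simp: mult.commute)
      moreover have "\<not> \<Lambda> ((1 + x * e) + 1) 0" using odd_sumD[of "(1 + x * e) + 1" 0] ae[of x] by (auto simp: algebra_simps)
      moreover have "\<not> \<Lambda> (1 + x * e) (0 + 1)" using odd_sumD[of "1 + x * e" "0 + 1"] ae[of x] by (auto simp: algebra_simps)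
      moreover have "\<not> \<Lambda> (1 + x * e) (0 - 1)"
      proof
        assume "\<Lambda> (1 + x * e) (0 - 1)"
        \<comment> \<open>Multiplying 1 + x e = u by e and using e u = -e leaves e(2 + x e) = 0,
          which is impossible modulo 4.\<close>
        from add[OF mul[OF this, of e] ee] have "\<Lambda> (e * (2 + x * e)) 0" by (simp add: algebra_simps)
        then have "\<gamma> dvd 2 + x * e" using \<gamma>(2) by blast
        moreover have "4 dvd \<gamma>" using g2 x4 by simp
        ultimately have "4 dvd 2 + x * e" using dvd_trans by blast
        moreover have "4 dvd x * e" using x4 by simp
        ultimately have "4 dvd (2::int)" using dvd_add_left_iff by blast
        then show False by simp
      qed
      ultimately show False by blast
    qed
    have "\<Lambda> i j" if ij: "\<alpha> dvd i + j" "4 dvd i - j" for i j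
    proof -
      have "\<Lambda> (e * (i - j)) 0" using \<gamma>(2) \<open>\<gamma> = 4\<close> ij(2) by blast
      then have "\<Lambda> (e * i) (e * j)" using ee by (rule lin[where k = 1 and l = j]) (simp_all add: algebra_simps)
      with e(4)[OF ij(1)] assms(2) have "\<Lambda> (e * i + (1 - e) * i) (e * j + (1 - e) * j)" by (intro add) simp_all
      then show ?thesis by (simp add: algebra_simps)
    qed
    moreover have "4 dvd i - j" if "\<Lambda> i j" for i j
    proof -
      from diff[OF mul[OF that, of e] mul[OF ee, of j]] have "\<Lambda> (e * (i - j)) 0" by (simp add: algebra_simps)
      then show ?thesis using \<gamma>(2) \<open>\<gamma> = 4\<close> by blast
    qed
    ultimately show ?thesis using odd_sumD by blast
  qed
qed

text \<open>The characteristic is 2^l with l \<ge> 2. For l = 2 the involution 1 + 2u has to be -1,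
  which adds the relation 2 + 2u = 0. For l \<ge> 3 the involution 1 + 2^(l-1) is neither 1 nor -1,
  so it is u or -u, and u is an integer modulo 2^l.\<close>

lemma no_odd_part:
  assumes "\<alpha> = 1" "\<beta> = 1"
  shows "(\<forall>i j. \<Lambda> i j \<longleftrightarrow> 4 dvd i + j \<and> 2 dvd j) \<or>
    (\<exists>n w. 3 \<le> n \<and> 2 ^ n dvd w * w - 1 \<and> (\<forall>i j. \<Lambda> i j \<longleftrightarrow> 2 ^ n dvd i + w * j))"
proof -
  obtain K e where e: "\<Lambda> (2 ^ K * e) 0"
    "\<And>i j. \<alpha> dvd i + j \<Longrightarrow> \<beta> dvd i - j \<Longrightarrow> \<Lambda> ((1 - e) * i) ((1 - e) * j)"
    using idempotent_ex by metis
  have "\<Lambda> (1 - e) 0" using e(2)[of 1 0] assms by simp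
  from add[OF e(1) mul[OF this, of "2 ^ K"]] have K: "\<Lambda> (2 ^ K) 0" by (simp add: algebra_simps)
  obtain \<gamma> where \<gamma>: "0 < \<gamma>" "\<And>x. \<Lambda> x 0 \<longleftrightarrow> \<gamma> dvd x"
  proof (rule int_subgroup_principal[of "\<lambda>x. \<Lambda> x 0" "2 ^ K"])
    show "\<Lambda> (x - y) 0" if "\<Lambda> x 0" "\<Lambda> y 0" for x y using diff[OF that] by simp
  qed (use K in simp_all)
  have "\<gamma> dvd 2 ^ K" using \<gamma>(2) K by simp
  then obtain l where l: "\<gamma> = 2 ^ l" using \<gamma>(1) divides_primepow[of "2::int" \<gamma> K] by (auto simp: abs_of_pos)
  have "\<not> \<gamma> dvd 2" using d1 \<gamma>(2) by blast
  then have l01: "l \<noteq> 0" "l \<noteq> 1"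
    unfolding l by (metis dvd_refl one_dvd power_0 power_one_right)+
  show ?thesis
  proof (cases "l = 2")
    case True
    then have g4: "\<And>x. \<Lambda> x 0 \<longleftrightarrow> 4 dvd x" using \<gamma>(2) l by simp
    have "\<Lambda> 4 0" using g4 by simp
    from add[OF this swap[OF this]] have "\<Lambda> (1 * 1 + 2 * 2 - 1) (2 * 1 * 2)" by simp
    then have "\<Lambda> (1 - 1) 2 \<or> \<Lambda> (1 + 1) 2 \<or> \<Lambda> 1 (2 - 1) \<or> \<Lambda> 1 (2 + 1)" by (rule invs)
    moreover have "\<not> \<Lambda> 0 2" using swap d1 by blast
    moreover have "\<not> \<Lambda> 1 3" using diff[OF _ swap[OF \<open>\<Lambda> 4 0\<close>], of 1 3] d3 by auto
    ultimately have L22: "\<Lambda> 2 2" using d2 by auto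
    have "2 dvd j \<and> 4 dvd i + j" if ij: "\<Lambda> i j" for i j
    proof (cases "2 dvd j")
      case True
      then obtain r where r: "j = 2 * r" by blast
      from diff[OF ij mul[OF L22, of r]] have "\<Lambda> (i - 2 * r) 0" by (simp add: r mult.commute)
      then have "4 dvd i - 2 * r" using g4 by blast
      then show ?thesis using r by presburger
    next
      case False
      then obtain r where r: "j = 2 * r + 1" by (metis oddE)
      \<comment> \<open>Subtracting multiples of 2 + 2u leaves the relation x + u = 0 with x odd;
        modulo 4 this makes u equal to 1 or -1.\<close>
      define x where "x = i - 2 * r"
      from diff[OF ij mul[OF L22, of r]] have x: "\<Lambda> x 1" by (simp add: r x_def algebra_simps)
      from diff[OF mul[OF x, of x] swap[OF x]] have "\<Lambda> (x * x - 1) 0" by simp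
      then have "4 dvd x * x - 1" using g4 by blast
      then have "2 dvd x * x - 1" by presburger
      then have "odd x" by auto
      then have "4 dvd x - 1 \<or> 4 dvd x + 1" by presburger
      then have False
      proof
        assume "4 dvd x - 1"
        then have "\<Lambda> (x - 1) 0" using g4 by blast
        from diff[OF x this] show False using d2 by simp
      next
        assume "4 dvd x + 1"
        then have "\<Lambda> (x + 1) 0" using g4 by blast
        from diff[OF this x] show False using d3 by simp
      qed
      then show ?thesis ..
    qed
    moreover have "\<Lambda> i j" if ij: "4 dvd i + j" "2 dvd j" for i j
    proof -
      obtain r where r: "j = 2 * r" using ij(2) by blast
      have "4 dvd i - 2 * r" using ij(1) r by presburger
      then have "\<Lambda> (i - 2 * r) 0" using g4 by blast
      from add[OF this mul[OF L22, of r]] show ?thesis by (simp add: r mult.commute)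
    qed
    ultimately show ?thesis by blast
  next
    case False
    then have "3 \<le> l" using l01 by linarith
    then obtain k where k: "l = k + 3" by (metis add.commute le_Suc_ex)
    define x where "x = (2::int) ^ (k + 2)"
    have g2: "\<gamma> = 2 * x" and x4: "4 dvd x" and x0: "0 < x" by (simp_all add: l k x_def power_add)
    obtain h where h: "x = 2 * h" using x4 by (metis dvd_def mult.assoc numeral_Bit0_eq_double)
    have sq: "(1 + x) * (1 + x) - 1 = \<gamma> * (1 + h)" by (simp add: g2 h algebra_simps)
    then have "\<Lambda> ((1 + x) * (1 + x) - 1) 0" using \<gamma>(2) by simp
    then have "\<Lambda> ((1 + x) * (1 + x) + 0 * 0 - 1) (2 * (1 + x) * 0)" by simp
    then have "\<Lambda> ((1 + x) - 1) 0 \<or> \<Lambda> ((1 + x) + 1) 0 \<or> \<Lambda> (1 + x) (0 - 1) \<or> \<Lambda> (1 + x) (0 + 1)"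
      by (rule invs)
    moreover have "\<not> \<Lambda> ((1 + x) - 1) 0"
      using \<gamma>(2)[of x] g2 x0 zdvd_imp_le[of \<gamma> x] by auto
    moreover have "\<not> \<Lambda> ((1 + x) + 1) 0"
    proof
      assume "\<Lambda> ((1 + x) + 1) 0"
      then have "\<gamma> dvd x + 2" using \<gamma>(2) by (simp add: algebra_simps)
      moreover have "4 dvd \<gamma>" using g2 x4 by simp
      ultimately have "4 dvd x + 2" using dvd_trans by blast
      then show False using x4 by presburger
    qed
    ultimately have "\<exists>w. \<Lambda> (- w) 1 \<and> w * w = (1 + x) * (1 + x)"
    proof -
      assume "\<Lambda> ((1 + x) - 1) 0 \<or> \<Lambda> ((1 + x) + 1) 0 \<or> \<Lambda> (1 + x) (0 - 1) \<or> \<Lambda> (1 + x) (0 + 1)"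
        "\<not> \<Lambda> ((1 + x) - 1) 0" "\<not> \<Lambda> ((1 + x) + 1) 0"
      then consider "\<Lambda> (1 + x) (- 1)" | "\<Lambda> (1 + x) 1" by auto
      then show ?thesis
      proof cases
        case 1
        from neg[OF this] show ?thesis by (intro exI[of _ "1 + x"]) simp
      next
        case 2
        then show ?thesis by (intro exI[of _ "- (1 + x)"]) (simp add: algebra_simps)
      qed
    qed
    then obtain w where w: "\<Lambda> (- w) 1" "w * w = (1 + x) * (1 + x)" by blast
    have "\<Lambda> i j \<longleftrightarrow> 2 ^ l dvd i + w * j" for i j
    proof -
      have "\<Lambda> i j \<longleftrightarrow> \<Lambda> (i + w * j) 0"
        using diff[OF _ mul[OF w(1), of j], of i j] add[OF _ mul[OF w(1), of j], of "i + w * j" 0]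
        by (auto simp: algebra_simps)
      then show ?thesis using \<gamma>(2) l by simp
    qed
    moreover have "2 ^ l dvd w * w - 1" using sq w(2) l by simp
    ultimately show ?thesis using \<open>3 \<le> l\<close> by blast
  qed
qed

end

context inv_lattice
begin

text \<open>The cases are whether \<open>\<alpha>\<close> and \<open>\<beta>\<close> equal 1. The
  sign \<open>\<sigma>\<close> is the value of u on the odd part when only one of them differs from
  1, and \<open>w\<close> in the last line is the integer that equals u modulo 2^n.\<close>

theorem classification:
  shows "(\<exists>\<alpha> \<beta>. odd_prime_power \<alpha> \<and> odd_prime_power \<beta> \<and>
      ((\<forall>i j. \<Lambda> i j \<longleftrightarrow> \<alpha> dvd i + j \<and> \<beta> dvd i - j) \<or>
       (\<forall>i j. \<Lambda> i j \<longleftrightarrow> \<alpha> dvd i + j \<and> \<beta> dvd i - j \<and> 2 dvd i + j))) \<or>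
    (\<exists>\<alpha> \<sigma>. odd_prime_power \<alpha> \<and> (\<sigma> = 1 \<or> \<sigma> = - 1) \<and>
      ((\<forall>i j. \<Lambda> i j \<longleftrightarrow> \<alpha> dvd i + \<sigma> * j \<and> 2 dvd i \<and> 2 dvd j) \<or>
       (\<forall>i j. \<Lambda> i j \<longleftrightarrow> \<alpha> dvd i + \<sigma> * j \<and> 4 dvd i - \<sigma> * j))) \<or>
    (\<forall>i j. \<Lambda> i j \<longleftrightarrow> 4 dvd i + j \<and> 2 dvd j) \<or>
    (\<exists>n w. 3 \<le> n \<and> 2 ^ n dvd w * w - 1 \<and> (\<forall>i j. \<Lambda> i j \<longleftrightarrow> 2 ^ n dvd i + w * j))"
proof -
  have NN: "\<Lambda> N N" "\<Lambda> N (- N)"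
    using add[OF N(2) swap[OF N(2)]] diff[OF N(2) swap[OF N(2)]] by simp_all
  obtain \<alpha>' where A: "0 < \<alpha>'" "\<And>x. \<Lambda> x x \<longleftrightarrow> \<alpha>' dvd x"
    by (rule int_subgroup_principal[of "\<lambda>x. \<Lambda> x x" N]) (use NN N(1) diff in auto)
  obtain \<beta>' where B: "0 < \<beta>'" "\<And>x. \<Lambda> x (- x) \<longleftrightarrow> \<beta>' dvd x"
  proof (rule int_subgroup_principal[of "\<lambda>x. \<Lambda> x (- x)" N])
    show "\<Lambda> (x - y) (- (x - y))" if "\<Lambda> x (- x)" "\<Lambda> y (- y)" for x y using diff[OF that] by simp
  qed (use NN N(1) in auto)
  obtain a \<alpha> where a: "\<alpha>' = 2 ^ a * \<alpha>" "odd \<alpha>" "0 < \<alpha>" using int_two_power_odd[OF A(1)] .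
  obtain b \<beta> where b: "\<beta>' = 2 ^ b * \<beta>" "odd \<beta>" "0 < \<beta>" using int_two_power_odd[OF B(1)] .
  interpret G: inv_lattice_gens \<Lambda> N \<alpha>' \<beta>' \<alpha> \<beta> a b
    by unfold_locales (use A B a b in simp_all)
  interpret M: inv_lattice "\<lambda>i j. \<Lambda> i (- j)" N by (rule mirror)
  interpret MG: inv_lattice_gens "\<lambda>i j. \<Lambda> i (- j)" N \<beta>' \<alpha>' \<beta> \<alpha> b a
    by unfold_locales (use A B a b in simp_all)
  consider "\<alpha> \<noteq> 1" "\<beta> \<noteq> 1" | "\<alpha> \<noteq> 1" "\<beta> = 1" | "\<alpha> = 1" "\<beta> \<noteq> 1" | "\<alpha> = 1" "\<beta> = 1" by blast
  then show ?thesis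
  proof cases
    case 1
    then have "odd_prime_power \<alpha>" "odd_prime_power \<beta>"
      using G.alpha_prime_power MG.alpha_prime_power by blast+
    then show ?thesis using G.two_odd_parts[OF 1] by blast
  next
    case 2
    then have p: "odd_prime_power \<alpha>" using G.alpha_prime_power by blast
    have "(\<forall>i j. \<Lambda> i j \<longleftrightarrow> \<alpha> dvd i + 1 * j \<and> 2 dvd i \<and> 2 dvd j) \<or>
       (\<forall>i j. \<Lambda> i j \<longleftrightarrow> \<alpha> dvd i + 1 * j \<and> 4 dvd i - 1 * j)"
      using G.one_odd_part[OF 2] by simp
    then show ?thesis using p by blast
  next
    case 3
    then have p: "odd_prime_power \<beta>" using MG.alpha_prime_power by blast
    have flip: "\<Lambda> i j \<longleftrightarrow> Q i j" if "\<forall>i j. \<Lambda> i (- j) \<longleftrightarrow> Q i (- j)" for Q i j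
      using that by (metis minus_minus)
    have "(\<forall>i j. \<Lambda> i j \<longleftrightarrow> \<beta> dvd i + (- 1) * j \<and> 2 dvd i \<and> 2 dvd j) \<or>
       (\<forall>i j. \<Lambda> i j \<longleftrightarrow> \<beta> dvd i + (- 1) * j \<and> 4 dvd i - (- 1) * j)"
      using MG.one_odd_part[OF 3(2,1)]
    proof
      assume *: "\<forall>i j. \<Lambda> i (- j) \<longleftrightarrow> \<beta> dvd i + j \<and> 2 dvd i \<and> 2 dvd j"
      have "\<Lambda> i j \<longleftrightarrow> \<beta> dvd i + (- 1) * j \<and> 2 dvd i \<and> 2 dvd j" for i j
        by (rule flip) (use * in simp)
      then show ?thesis by blast
    next
      assume *: "\<forall>i j. \<Lambda> i (- j) \<longleftrightarrow> \<beta> dvd i + j \<and> 4 dvd i - j"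
      have "\<Lambda> i j \<longleftrightarrow> \<beta> dvd i + (- 1) * j \<and> 4 dvd i - (- 1) * j" for i j
        by (rule flip) (use * in simp)
      then show ?thesis by blast
    qed
    then show ?thesis using p by blast
  next
    case 4
    then show ?thesis using G.no_odd_part[OF 4] by blast
  qed
qed

end

section \<open>Involutory Cayley graphs\<close>

locale inv_ring = cring R for R (structure) +
  assumes fin: "finite (carrier R)" and ne: "\<one> \<noteq> \<zero>"
begin

section \<open>Involutions, degrees and triangles\<close>

definition Inv :: "'a set" where
  "Inv = {u \<in> carrier R. u \<otimes> u = \<one>}"

definition \<iota> :: "int \<Rightarrow> 'a" where
  "\<iota> k = [k] \<cdot> \<one>"

lemma iota_closed [simp]: "\<iota> k \<in> carrier R"
  by (simp add: \<iota>_def)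

lemma iota_add: "\<iota> (k + l) = \<iota> k \<oplus> \<iota> l"
  unfolding \<iota>_def by (rule add.int_pow_mult) simp

lemma iota_1 [simp]: "\<iota> 1 = \<one>"
  unfolding \<iota>_def by (rule add.int_pow_1) simp

lemma iota_0 [simp]: "\<iota> 0 = \<zero>"
  using add_pow_int_ge[of 0 R "\<one>"] by (simp add: \<iota>_def)

lemma iota_neg: "\<iota> (- k) = \<ominus> \<iota> k"
  unfolding \<iota>_def by (rule add.int_pow_neg) simp

lemma iota_diff: "\<iota> (k - l) = \<iota> k \<ominus> \<iota> l"
  using iota_add[of k "- l"] by (simp add: iota_neg a_minus_def)

lemma iota_mult: "\<iota> (k * l) = \<iota> k \<otimes> \<iota> l"
proof -
  have "\<iota> k \<otimes> \<iota> l = [k] \<cdot> (\<one> \<otimes> \<iota> l)"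
    unfolding \<iota>_def by (rule add_pow_ldistr_int) simp_all
  also have "\<dots> = [k] \<cdot> ([l] \<cdot> \<one>)" by (simp add: \<iota>_def)
  also have "\<dots> = add_pow R (l * k) \<one>" by (rule add.int_pow_pow) simp
  finally show ?thesis by (simp add: \<iota>_def mult.commute)
qed

lemma iota_2: "\<iota> 2 = \<one> \<oplus> \<one>"
  using iota_add[of 1 1] by simp

lemma iota_char:
  obtains n where "0 < n" "\<And>k. \<iota> k = \<zero> \<longleftrightarrow> n dvd k"
proof -
  have "\<not> inj (\<lambda>k::nat. \<iota> (int k))"
    using fin finite_subset[of "range (\<lambda>k::nat. \<iota> (int k))" "carrier R"] finite_imageD[of "\<lambda>k::nat. \<iota> (int k)" UNIV]
    by (auto simp: image_subset_iff)
  then obtain k l :: nat where kl: "k \<noteq> l" "\<iota> (int k) = \<iota> (int l)" unfolding inj_on_def by auto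
  have "\<iota> (int k - int l) = \<zero>" "\<iota> (int l - int k) = \<zero>" using kl(2) by (simp_all add: iota_diff a_minus_def r_neg)
  then have "\<iota> \<bar>int k - int l\<bar> = \<zero>" by (simp add: abs_if)
  then show ?thesis
    by (rule int_subgroup_principal[of "\<lambda>k. \<iota> k = \<zero>"]) (use kl(1) that in \<open>auto simp: iota_diff a_minus_def\<close>)
qed

lemma InvD [simp]: "u \<in> Inv \<Longrightarrow> u \<in> carrier R" "u \<in> Inv \<Longrightarrow> u \<otimes> u = \<one>"
  by (simp_all add: Inv_def)

lemma one_Inv [simp]: "\<one> \<in> Inv"
  by (simp add: Inv_def del: InvD)

lemma neg_Inv [simp]: "u \<in> Inv \<Longrightarrow> \<ominus> u \<in> Inv"
  by (simp add: Inv_def l_minus r_minus del: InvD)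

lemma mult_Inv [simp]: "u \<in> Inv \<Longrightarrow> v \<in> Inv \<Longrightarrow> u \<otimes> v \<in> Inv"
proof -
  assume uv: "u \<in> Inv" "v \<in> Inv"
  then have c: "u \<in> carrier R" "v \<in> carrier R" by simp_all
  then have "(u \<otimes> v) \<otimes> (u \<otimes> v) = (u \<otimes> u) \<otimes> (v \<otimes> v)" by (simp add: m_ac)
  then show ?thesis using uv c by (simp add: Inv_def del: InvD)
qed

lemma finite_Inv: "finite Inv"
  using fin by (simp add: Inv_def del: InvD)

lemma Inv_ne_zero: "u \<in> Inv \<Longrightarrow> u \<noteq> \<zero>"
  using ne by (auto simp: Inv_def simp del: InvD)

lemma adj_iff: "inv_adj R x y \<longleftrightarrow> x \<in> carrier R \<and> y \<in> carrier R \<and> x \<ominus> y \<in> Inv"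
proof -
  have "x \<noteq> y" if "x \<in> carrier R" "x \<ominus> y \<in> Inv"
    using that Inv_ne_zero[OF that(2)] by (auto simp: a_minus_def r_neg)
  then show ?thesis unfolding inv_adj_def Inv_def by auto
qed

lemma minus_minus_eq: "x \<in> carrier R \<Longrightarrow> y \<in> carrier R \<Longrightarrow> \<ominus> (x \<ominus> y) = y \<ominus> x"
  by (simp add: a_minus_def minus_add a_comm)

lemma adj_sym: "inv_adj R x y \<Longrightarrow> inv_adj R y x"
  using neg_Inv[of "x \<ominus> y"] minus_minus_eq[of x y] unfolding adj_iff by simp

lemma sub_sub: "x \<in> carrier R \<Longrightarrow> y \<in> carrier R \<Longrightarrow> x \<ominus> (x \<ominus> y) = y"
  by (simp add: a_minus_def minus_add a_assoc[symmetric] r_neg)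

lemma nbrs: "x \<in> carrier R \<Longrightarrow> {y. inv_adj R x y} = (\<lambda>u. x \<ominus> u) ` Inv"
proof (intro equalityI subsetI)
  fix y assume x: "x \<in> carrier R" and "y \<in> {y. inv_adj R x y}"
  then have "y = x \<ominus> (x \<ominus> y)" "x \<ominus> y \<in> Inv" by (simp_all add: adj_iff sub_sub)
  then show "y \<in> (\<lambda>u. x \<ominus> u) ` Inv" by blast
next
  fix y assume x: "x \<in> carrier R" and "y \<in> (\<lambda>u. x \<ominus> u) ` Inv"
  then obtain u where "u \<in> Inv" "y = x \<ominus> u" by blast
  then show "y \<in> {y. inv_adj R x y}" using x by (simp add: adj_iff sub_sub)
qed

lemma card_nbrs: "x \<in> carrier R \<Longrightarrow> card {y. inv_adj R x y} = card Inv"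
  unfolding nbrs by (rule card_image, rule inj_onI) (metis InvD(1) sub_sub)

lemma edge_iff: "{x, y} \<in> inv_edges R \<longleftrightarrow> inv_adj R x y"
  unfolding inv_edges_def using adj_sym by (auto simp: doubleton_eq_iff)

definition edges_in :: "'a set \<Rightarrow> 'a set set" where
  "edges_in W = {e \<in> inv_edges R. e \<subseteq> W}"

lemma edges_in_carrier: "edges_in (carrier R) = inv_edges R"
  by (auto simp: edges_in_def inv_edges_def inv_adj_def)

text \<open>Handshake count over ordered adjacent pairs: two for each edge, \<open>card Inv\<close>
  for each vertex.\<close>

lemma card_edges_in:
  assumes W: "W \<subseteq> carrier R" "\<And>x y. x \<in> W \<Longrightarrow> inv_adj R x y \<Longrightarrow> y \<in> W"
  shows "2 * card (edges_in W) = card W * card Inv"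
proof -
  define P where "P = (SIGMA x:W. {y. inv_adj R x y})"
  define \<phi> where "\<phi> p = {fst p, snd p}" for p :: "'a \<times> 'a"
  have fW: "finite W" using W(1) fin finite_subset by blast
  have "card P = (\<Sum>x\<in>W. card {y. inv_adj R x y})"
    unfolding P_def using fW W(1) fin
    by (intro card_SigmaI) (auto intro: finite_subset[of _ "carrier R"] simp: inv_adj_def)
  also have "\<dots> = card W * card Inv" using card_nbrs W(1) by (simp add: subset_iff)
  finally have cP: "card P = card W * card Inv" .
  have fP: "finite P"
    unfolding P_def using fW fin by (intro finite_SigmaI) (auto intro: finite_subset[of _ "carrier R"] simp: inv_adj_def)
  have im: "\<phi> ` P = edges_in W"
  proof (intro equalityI subsetI)
    fix e assume "e \<in> \<phi> ` P"
    then obtain x y where "e = {x, y}" "x \<in> W" "inv_adj R x y" by (auto simp: \<phi>_def P_def)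
    then show "e \<in> edges_in W" using W(2) edge_iff by (auto simp: edges_in_def)
  next
    fix e assume "e \<in> edges_in W"
    then obtain x y where "e = {x, y}" "inv_adj R x y" "x \<in> W" by (auto simp: edges_in_def inv_edges_def)
    then have "e = \<phi> (x, y)" "(x, y) \<in> P" by (simp_all add: \<phi>_def P_def)
    then show "e \<in> \<phi> ` P" by blast
  qed
  have fib: "card {p \<in> P. \<phi> p = e} = 2" if "e \<in> edges_in W" for e
  proof -
    obtain x y where xy: "e = {x, y}" "inv_adj R x y" using \<open>e \<in> edges_in W\<close> by (auto simp: edges_in_def inv_edges_def)
    have xW: "x \<in> W" "y \<in> W" using \<open>e \<in> edges_in W\<close> xy by (auto simp: edges_in_def)
    have "x \<noteq> y" using xy(2) by (simp add: inv_adj_def)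
    have "{p \<in> P. \<phi> p = e} = {(x, y), (y, x)}"
      using xW xy adj_sym[OF xy(2)] by (auto simp: P_def \<phi>_def doubleton_eq_iff)
    then show ?thesis using \<open>x \<noteq> y\<close> by simp
  qed
  have "card P = (\<Sum>e\<in>\<phi> ` P. \<Sum>p\<in>{p \<in> P. \<phi> p = e}. 1)"
    using sum.image_gen[OF fP, of "\<lambda>_. 1::nat" \<phi>] by simp
  also have "\<dots> = (\<Sum>e\<in>edges_in W. 2)" unfolding im using fib by (intro sum.cong) simp_all
  finally show ?thesis using cP by simp
qed

text \<open>The differences p, q and p + q are involutions, so t = p q satisfies 1 + 2t = 0, and t +
  2 = 0 after multiplication by t. Together these give 3 = 0 and t = 1, hence p = q: two vertices of
  a triangle determine the third.\<close>

lemma triangle_third: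
  assumes "a \<noteq> c" "inv_adj R a b" "inv_adj R b c" "inv_adj R a c"
  shows "\<one> \<oplus> \<one> \<oplus> \<one> = \<zero>" "c = b \<ominus> (a \<ominus> b)"
proof -
  define p where "p = a \<ominus> b"
  define q where "q = b \<ominus> c"
  have abc: "a \<in> carrier R" "b \<in> carrier R" "c \<in> carrier R" and I: "p \<in> Inv" "q \<in> Inv" "a \<ominus> c \<in> Inv"
    using assms(2-4) by (simp_all add: adj_iff p_def q_def)
  then have pq: "p \<in> carrier R" "q \<in> carrier R" by simp_all
  define t where "t = p \<otimes> q"
  have t: "t \<in> carrier R" "t \<otimes> t = \<one>" using mult_Inv[OF I(1,2)] by (simp_all add: t_def)
  have "a \<ominus> c = p \<oplus> q" using abc unfolding p_def q_def by algebra
  then have "(p \<oplus> q) \<otimes> (p \<oplus> q) = \<one>" using I(3) by simp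
  moreover have "(p \<oplus> q) \<otimes> (p \<oplus> q) = p \<otimes> p \<oplus> q \<otimes> q \<oplus> (t \<oplus> t)"
    using pq unfolding t_def by algebra
  ultimately have "\<one> \<oplus> \<one> \<oplus> (t \<oplus> t) = \<one>" using I by simp
  moreover have "\<one> \<oplus> \<one> \<oplus> (t \<oplus> t) = \<one> \<oplus> (\<one> \<oplus> (t \<oplus> t))" using t by (simp add: a_assoc)
  ultimately have calc: "\<one> \<oplus> (\<one> \<oplus> (t \<oplus> t)) = \<one>" by simp
  have 1: "\<one> \<oplus> (t \<oplus> t) = \<zero>" 
  proof -
    have "\<one> \<oplus> (t \<oplus> t) = (\<one> \<oplus> (\<one> \<oplus> (t \<oplus> t))) \<ominus> \<one>" using t(1) by algebra
    also have "\<one> \<oplus> (\<one> \<oplus> (t \<oplus> t)) = \<one>" using calc by simp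
    finally show ?thesis by (simp add: a_minus_def r_neg)
  qed
  have "t \<otimes> (\<one> \<oplus> (t \<oplus> t)) = t \<oplus> (t \<otimes> t \<oplus> t \<otimes> t)" using t(1) by algebra
  then have 2: "t \<oplus> (\<one> \<oplus> \<one>) = \<zero>" using 1 t by simp
  \<comment> \<open>3 = 2(t + 2) - (1 + 2t).\<close>
  have "\<one> \<oplus> \<one> \<oplus> \<one> = (t \<oplus> (\<one> \<oplus> \<one>)) \<oplus> (t \<oplus> (\<one> \<oplus> \<one>)) \<ominus> (\<one> \<oplus> (t \<oplus> t))"
    using t(1) by algebra
  then show 3: "\<one> \<oplus> \<one> \<oplus> \<one> = \<zero>" using 1 2 by (simp add: a_minus_def)
  have "t = (t \<oplus> (\<one> \<oplus> \<one>)) \<ominus> (\<one> \<oplus> \<one> \<oplus> \<one>) \<oplus> \<one>" using t(1) by algebra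
  then have "t = \<one>" using 2 3 by (simp add: a_minus_def)
  then have "p \<otimes> (p \<otimes> q) = p" using pq by (simp add: t_def)
  moreover have "p \<otimes> (p \<otimes> q) = q" using pq I by (simp add: m_assoc[symmetric])
  ultimately have "q = p" by simp
  moreover have "c = b \<ominus> q" using abc by (simp add: q_def sub_sub)
  ultimately show "c = b \<ominus> (a \<ominus> b)" by (simp add: p_def)
qed

section \<open>Components and why four involutions make them non-planar\<close>

definition cls :: "'a \<Rightarrow> 'a set" where
  "cls x = {y. (inv_adj R)\<^sup>*\<^sup>* x y}"

lemma cls_carrier: "x \<in> carrier R \<Longrightarrow> cls x \<subseteq> carrier R"
proof -
  have "y \<in> carrier R" if "(inv_adj R)\<^sup>*\<^sup>* x y" "x \<in> carrier R" for y
    using that by (induction rule: rtranclp_induct) (auto simp: inv_adj_def)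
  then show "x \<in> carrier R \<Longrightarrow> cls x \<subseteq> carrier R" by (auto simp: cls_def)
qed

lemma cls_closed: "y \<in> cls x \<Longrightarrow> inv_adj R y z \<Longrightarrow> z \<in> cls x"
  unfolding cls_def by (simp add: rtranclp.rtrancl_into_rtrancl)

lemma cls_self: "x \<in> cls x"
  by (simp add: cls_def)

lemma cls_disjoint:
  assumes "\<not> (inv_adj R)\<^sup>*\<^sup>* x y"
  shows "cls x \<inter> cls y = {}"
proof -
  have "symp (inv_adj R)" using adj_sym by (simp add: symp_def)
  then have s: "(inv_adj R)\<^sup>*\<^sup>* z y" if "(inv_adj R)\<^sup>*\<^sup>* y z" for z
    using that symp_rtranclp by (metis sympD)
  show ?thesis using assms s unfolding cls_def by (auto dest: rtranclp_trans)
qed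

lemma cls_subset:
  assumes T: "x \<in> T" "\<And>z a. z \<in> T \<Longrightarrow> a \<in> Inv \<Longrightarrow> z \<ominus> a \<in> T" "T \<subseteq> carrier R"
  shows "cls x \<subseteq> T"
proof -
  have "y \<in> T" if "(inv_adj R)\<^sup>*\<^sup>* x y" for y
    using that
  proof (induction rule: rtranclp_induct)
    case (step y z)
    then have "y \<ominus> z \<in> Inv" "y \<in> carrier R" "z \<in> carrier R" by (simp_all add: adj_iff)
    then show ?case using T(2)[OF step.IH, of "y \<ominus> z"] by (simp add: sub_sub)
  qed (rule T(1))
  then show ?thesis by (auto simp: cls_def)
qed

lemma Inv_eq_pm:
  assumes "card Inv = 4" "\<one> \<noteq> \<ominus> \<one>"
  obtains u where "u \<in> Inv" "u \<noteq> \<one>" "u \<noteq> \<ominus> \<one>" "Inv = {\<one>, \<ominus> \<one>, u, \<ominus> u}"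
proof -
  have "\<not> Inv \<subseteq> {\<one>, \<ominus> \<one>}"
  proof
    assume "Inv \<subseteq> {\<one>, \<ominus> \<one>}"
    then have "card Inv \<le> card {\<one>, \<ominus> \<one>}" by (intro card_mono) auto
    also have "\<dots> \<le> 2" by (simp add: card_insert_if)
    finally show False using assms(1) by simp
  qed
  then obtain u where u: "u \<in> Inv" "u \<noteq> \<one>" "u \<noteq> \<ominus> \<one>" by blast
  have uc: "u \<in> carrier R" using u by simp
  have "\<ominus> u \<noteq> u"
  proof
    assume "\<ominus> u = u"
    then have "u \<otimes> (\<ominus> u) = \<one>" using u(1) by simp
    then have "\<ominus> \<one> = \<one>" using u(1) uc by (simp add: r_minus)
    then show False using assms(2) by simp
  qed
  moreover have "\<ominus> u \<noteq> \<one>" "\<ominus> u \<noteq> \<ominus> \<one>" using u uc by (metis minus_minus one_closed)+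
  ultimately have "card {\<one>, \<ominus> \<one>, u, \<ominus> u} = 4" using u assms(2) by auto
  moreover have "{\<one>, \<ominus> \<one>, u, \<ominus> u} \<subseteq> Inv" using u by simp
  ultimately have "Inv = {\<one>, \<ominus> \<one>, u, \<ominus> u}" using finite_Inv assms(1) by (metis card_subset_eq)
  then show ?thesis using that u by blast
qed

text \<open>Every vertex of the component has the form x + i + j u with i and j taken modulo 3,
  which leaves 3 * 3 possibilities.\<close>

lemma cls_card_char3:
  assumes 3: "\<one> \<oplus> \<one> \<oplus> \<one> = \<zero>" and I: "card Inv = 4" and x: "x \<in> carrier R"
  shows "card (cls x) \<le> 9"
proof -
  have "\<one> \<noteq> \<ominus> \<one>"
  proof
    assume "\<one> = \<ominus> \<one>"
    then have "\<one> \<oplus> \<one> = \<zero>" by (metis one_closed r_neg)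
    then show False using 3 ne by simp
  qed
  then obtain u where u: "u \<in> Inv" "Inv = {\<one>, \<ominus> \<one>, u, \<ominus> u}" using Inv_eq_pm[OF I] by metis
  have uc: "u \<in> carrier R" using u by simp
  define C where "C = {-1, 0, 1::int}"
  define T where "T = (\<lambda>(i, j). x \<oplus> (\<iota> i \<oplus> \<iota> j \<otimes> u)) ` (C \<times> C)"
  have i3: "\<iota> 3 = \<zero>" using iota_add[of 2 1] 3 by (simp add: iota_2)
  have shift: "\<exists>i'\<in>C. \<iota> i' = \<iota> (i + k)" if "i \<in> C" "k \<in> {-1, 1}" for i k
  proof -
    have "\<iota> 2 = \<iota> (- 1)" "\<iota> (- 2) = \<iota> 1"
      using iota_add[of "- 1" 3] iota_diff[of 1 3] i3 by (simp_all add: a_minus_def)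
    then show ?thesis using that unfolding C_def by auto
  qed
  have "cls x \<subseteq> T"
  proof (rule cls_subset)
    have "x = x \<oplus> (\<iota> 0 \<oplus> \<iota> 0 \<otimes> u)" using x uc by simp
    then show "x \<in> T" unfolding T_def C_def by force
    show "T \<subseteq> carrier R" using x uc unfolding T_def by auto
    fix z a assume "z \<in> T" and a: "a \<in> Inv"
    then obtain i j where ij: "i \<in> C" "j \<in> C" "z = x \<oplus> (\<iota> i \<oplus> \<iota> j \<otimes> u)" unfolding T_def by auto
    have "\<exists>k l. a = \<iota> k \<oplus> \<iota> l \<otimes> u \<and> ((k \<in> {-1, 1} \<and> l = 0) \<or> (k = 0 \<and> l \<in> {-1, 1}))"
    proof -
      from a u(2) consider "a = \<one>" | "a = \<ominus> \<one>" | "a = u" | "a = \<ominus> u" by blast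
      then show ?thesis
      proof cases
        case 1 then show ?thesis using uc by (intro exI[of _ 1] exI[of _ 0]) simp
      next
        case 2 then show ?thesis using uc by (intro exI[of _ "-1"] exI[of _ 0]) (simp add: iota_neg)
      next
        case 3 then show ?thesis using uc by (intro exI[of _ 0] exI[of _ 1]) simp
      next
        case 4 then show ?thesis using uc by (intro exI[of _ 0] exI[of _ "-1"]) (simp add: iota_neg l_minus)
      qed
    qed
    then obtain k l where kl: "a = \<iota> k \<oplus> \<iota> l \<otimes> u" "(k \<in> {-1, 1} \<and> l = 0) \<or> (k = 0 \<and> l \<in> {-1, 1})" by blast
    have "\<exists>i'\<in>C. \<iota> i' = \<iota> (i - k)" "\<exists>j'\<in>C. \<iota> j' = \<iota> (j - l)"
      using shift[OF ij(1), of "- k"] shift[OF ij(2), of "- l"] kl(2) ij(1,2) by auto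
    then obtain i' j' where ij': "i' \<in> C" "j' \<in> C" "\<iota> i' = \<iota> i \<ominus> \<iota> k" "\<iota> j' = \<iota> j \<ominus> \<iota> l"
      by (auto simp: iota_diff)
    have gen: "x \<oplus> (ii \<oplus> jj \<otimes> u) \<ominus> (kk \<oplus> ll \<otimes> u) = x \<oplus> ((ii \<ominus> kk) \<oplus> (jj \<ominus> ll) \<otimes> u)"
      if "ii \<in> carrier R" "jj \<in> carrier R" "kk \<in> carrier R" "ll \<in> carrier R" for ii jj kk ll
      using x uc that by algebra
    have "z \<ominus> a = x \<oplus> (\<iota> i' \<oplus> \<iota> j' \<otimes> u)"
      unfolding ij(3) kl(1) ij'(3,4) by (rule gen) simp_all
    then show "z \<ominus> a \<in> T" unfolding T_def using ij'(1,2) by force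
  qed
  then have "card (cls x) \<le> card T" by (intro card_mono) (simp_all add: T_def C_def)
  also have "\<dots> \<le> card (C \<times> C)" unfolding T_def by (intro card_image_le) (simp add: C_def)
  also have "\<dots> = 9" by (simp add: C_def card_cartesian_product)
  finally show ?thesis .
qed

lemma cls_not_planar:
  assumes I: "card Inv = 4" and x: "x \<in> carrier R"
  shows "\<not> planar_graph (cls x) (edges_in (cls x))"
proof
  let ?W = "cls x" and ?E = "edges_in (cls x)"
  assume "planar_graph ?W ?E"
  moreover have fW: "finite ?W" using cls_carrier[OF x] fin finite_subset by blast
  moreover have "e \<subseteq> ?W" if "e \<in> ?E" for e using that by (simp add: edges_in_def)
  ultimately obtain f \<gamma> where "plane_graph ?W ?E f \<gamma>" using planar_graph_plane_graph by metis
  then interpret pl: plane_graph ?W ?E f \<gamma> .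
  have "2 * card ?E = card ?W * card Inv"
    by (rule card_edges_in[OF cls_carrier[OF x] cls_closed])
  then have cE: "card ?E = 2 * card ?W" using I by simp
  have Wne: "?W \<noteq> {}" using cls_self by blast
  have adjE: "inv_adj R p q" if "{p, q} \<in> ?E" for p q using that edge_iff by (simp add: edges_in_def)
  show False
  proof (cases "\<exists>D\<subseteq>?E. is_triangle D")
    case False
    then have "card ?E + 4 \<le> 2 * card ?W" using cE by (intro pl.edge_bound_triangle_free[OF Wne]) auto
    then show False using cE by simp
  next
    case True
    then obtain a b c where "a \<noteq> c" "{a, b} \<in> ?E" "{b, c} \<in> ?E" "{a, c} \<in> ?E"
      unfolding is_triangle_def by auto
    then have 3: "\<one> \<oplus> \<one> \<oplus> \<one> = \<zero>" using triangle_third(1) adjE by metis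
    \<comment> \<open>An edge determines the triangle through it, so two triangles with a common
      edge coincide.\<close>
    have tri: "D = {{p, q}, {q, q \<ominus> (p \<ominus> q)}, {p, q \<ominus> (p \<ominus> q)}}"
      if D: "D \<subseteq> ?E" "is_triangle D" "{p, q} \<in> D" for D p q
    proof -
      obtain a b c where abc: "a \<noteq> b" "b \<noteq> c" "a \<noteq> c" "D = {{a, b}, {b, c}, {a, c}}"
        using D(2) unfolding is_triangle_def by blast
      have third: "\<exists>r. D = {{p, q}, {q, r}, {p, r}} \<and> p \<noteq> r"
      proof -
        have "{p, q} = {a, b} \<or> {p, q} = {b, c} \<or> {p, q} = {a, c}" using D(3) abc(4) by blast
        then consider "p = a" "q = b" | "p = b" "q = a" | "p = b" "q = c" | "p = c" "q = b"
          | "p = a" "q = c" | "p = c" "q = a" unfolding doubleton_eq_iff by blast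
        then have "\<exists>r\<in>{a, b, c}. {{a, b}, {b, c}, {a, c}} = {{p, q}, {q, r}, {p, r}} \<and> p \<noteq> r"
        proof cases
          case 1 then show ?thesis using abc(3) by (intro bexI[of _ c]) simp_all
        next
          case 2 then show ?thesis using abc(2) by (intro bexI[of _ c]) (simp_all add: insert_commute)
        next
          case 3 then show ?thesis using abc(1) by (intro bexI[of _ a]) (simp_all add: insert_commute)
        next
          case 4 then show ?thesis using abc(3) by (intro bexI[of _ a]) (simp_all add: insert_commute)
        next
          case 5 then show ?thesis using abc(1) by (intro bexI[of _ b]) (simp_all add: insert_commute)
        next
          case 6 then show ?thesis using abc(2) by (intro bexI[of _ b]) (simp_all add: insert_commute)
        qed
        then show ?thesis unfolding abc(4) by blast
      qed
      then obtain r where r: "D = {{p, q}, {q, r}, {p, r}}" "p \<noteq> r" by blast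
      then have "inv_adj R p q" "inv_adj R q r" "inv_adj R p r" using D(1) adjE by auto
      then have "r = q \<ominus> (p \<ominus> q)" using triangle_third(2) r(2) by blast
      then show ?thesis using r(1) by simp
    qed
    have "12 \<le> card ?W"
    proof (rule pl.edge_disjoint_triangles_bound[OF Wne cE])
      fix D D' assume D: "D \<subseteq> ?E" "D' \<subseteq> ?E" "is_triangle D" "is_triangle D'" "D \<noteq> D'"
      show "D \<inter> D' = {}"
      proof (rule ccontr)
        assume "D \<inter> D' \<noteq> {}"
        then obtain e where e: "e \<in> D" "e \<in> D'" by blast
        then obtain p q where "e = {p, q}" using D(3) unfolding is_triangle_def by blast
        then show False using tri[OF D(1,3), of p q] tri[OF D(2,4), of p q] e D(5) by metis
      qed
    qed
    \<comment> \<open>At least twelve vertices against at most nine.\<close>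
    then show False using cls_card_char3[OF 3 I x] by simp
  qed
qed

section \<open>The possible numbers of involutions\<close>

lemma card_Un_coset:
  assumes "B \<subseteq> Inv" "\<And>x y. x \<in> B \<Longrightarrow> y \<in> B \<Longrightarrow> x \<otimes> y \<in> B" "v \<in> Inv" "v \<notin> B"
  shows "B \<union> (\<lambda>x. v \<otimes> x) ` B \<subseteq> Inv" "card (B \<union> (\<lambda>x. v \<otimes> x) ` B) = 2 * card B"
    "\<And>x y. x \<in> B \<union> (\<lambda>x. v \<otimes> x) ` B \<Longrightarrow> y \<in> B \<union> (\<lambda>x. v \<otimes> x) ` B \<Longrightarrow> x \<otimes> y \<in> B \<union> (\<lambda>x. v \<otimes> x) ` B"
proof -
  have Bc: "x \<in> carrier R" "x \<otimes> x = \<one>" if "x \<in> B" for x using that assms(1) by auto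
  have vc: "v \<in> carrier R" "v \<otimes> v = \<one>" using assms(3) by simp_all
  show "B \<union> (\<lambda>x. v \<otimes> x) ` B \<subseteq> Inv" using assms(1,3) by auto
  have canc: "v \<otimes> (v \<otimes> x) = x" if "x \<in> carrier R" for x using that vc by (simp add: m_assoc[symmetric])
  have "inj_on (\<lambda>x. v \<otimes> x) B" by (rule inj_onI) (metis canc Bc(1))
  moreover have "B \<inter> (\<lambda>x. v \<otimes> x) ` B = {}"
  proof (rule ccontr)
    assume "B \<inter> (\<lambda>x. v \<otimes> x) ` B \<noteq> {}"
    then obtain x where x: "x \<in> B" "v \<otimes> x \<in> B" by blast
    have "(v \<otimes> x) \<otimes> x = v" using x Bc vc by (simp add: m_assoc)
    then show False using assms(2)[OF x(2,1)] assms(4) by simp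
  qed
  moreover have "finite B" using assms(1) finite_Inv finite_subset by blast
  ultimately show "card (B \<union> (\<lambda>x. v \<otimes> x) ` B) = 2 * card B"
    by (simp add: card_Un_disjoint card_image)
  fix x y assume "x \<in> B \<union> (\<lambda>x. v \<otimes> x) ` B" "y \<in> B \<union> (\<lambda>x. v \<otimes> x) ` B"
  then obtain a b where ab: "a \<in> B" "b \<in> B" "x = a \<or> x = v \<otimes> a" "y = b \<or> y = v \<otimes> b" by blast
  have "a \<otimes> (v \<otimes> b) = v \<otimes> (a \<otimes> b)" "(v \<otimes> a) \<otimes> b = v \<otimes> (a \<otimes> b)" "(v \<otimes> a) \<otimes> (v \<otimes> b) = a \<otimes> b"
    using ab(1,2) Bc vc canc[of "a \<otimes> b"] by (simp_all add: m_ac)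
  then show "x \<otimes> y \<in> B \<union> (\<lambda>x. v \<otimes> x) ` B" using ab assms(2)[OF ab(1,2)] by auto
qed

text \<open>Starting from the trivial group, every further involution doubles the subgroup, and
  three of them give order 8. A group of order two is split according to whether its nontrivial
  element is -1, because the two kinds of graph are drawn differently.\<close>

lemma Inv_cases:
  obtains "Inv \<subseteq> {\<one>, \<ominus> \<one>}" | u where "Inv = {\<one>, u}" "u \<noteq> \<one>" "\<one> \<oplus> \<one> = \<zero>"
    | "card Inv = 4" | "8 \<le> card Inv"
proof (cases "Inv = {\<one>}")
  case True
  then show ?thesis using that(1) by simp
next
  case False
  then obtain u where u: "u \<in> Inv" "u \<noteq> \<one>" using one_Inv by blast
  define B1 where "B1 = {\<one>} \<union> (\<lambda>x. u \<otimes> x) ` {\<one>}"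
  note c1 = card_Un_coset[of "{\<one>}" u, folded B1_def]
  have B1: "B1 \<subseteq> Inv" "card B1 = 2" "\<And>x y. x \<in> B1 \<Longrightarrow> y \<in> B1 \<Longrightarrow> x \<otimes> y \<in> B1"
    using c1 u by simp_all
  have B1u: "B1 = {\<one>, u}" using u by (auto simp: B1_def)
  show ?thesis
  proof (cases "Inv = B1")
    case True
    show ?thesis
    proof (cases "\<ominus> \<one> = \<one>")
      case True
      then have "\<one> \<oplus> \<one> = \<zero>" by (metis one_closed r_neg)
      then show ?thesis using that(2) \<open>Inv = B1\<close> B1u u(2) by blast
    next
      case False
      have "\<ominus> \<one> \<in> Inv" by simp
      then have "\<ominus> \<one> = u" using \<open>Inv = B1\<close> B1u False by blast
      then show ?thesis using that(1) \<open>Inv = B1\<close> B1u by simp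
    qed
  next
    case False
    then obtain v where v: "v \<in> Inv" "v \<notin> B1" using B1(1) by blast
    define B2 where "B2 = B1 \<union> (\<lambda>x. v \<otimes> x) ` B1"
    note B2 = card_Un_coset[OF B1(1,3) v, folded B2_def]
    show ?thesis
    proof (cases "Inv = B2")
      case True
      then show ?thesis using that(3) B2(2) B1(2) by simp
    next
      case False
      then obtain w where w: "w \<in> Inv" "w \<notin> B2" using B2(1) by blast
      note B3 = card_Un_coset[OF B2(1,3) w]
      have "card (B2 \<union> (\<lambda>x. w \<otimes> x) ` B2) \<le> card Inv" by (rule card_mono[OF finite_Inv B3(1)])
      then have "8 \<le> card Inv" using B3(2) B2(2) B1(2) by simp
      then show ?thesis by (rule that(4))
    qed
  qed
qed

end

section \<open>Planar drawings for at most two involutions\<close>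

context inv_ring
begin

text \<open>\<open>en\<close> lists an additive subgroup in cyclic order so that each involution
  moves one step forward or back. Every coset is then a copy of the same cycle, and the cosets are
  drawn on different circles.\<close>

lemma planar_cosets:
  fixes en :: "nat \<Rightarrow> 'a"
  assumes n: "2 \<le> n" and inj: "inj_on en {..<n}" and enc: "\<And>i. en i \<in> carrier R"
    and diff: "\<And>i j. i < n \<Longrightarrow> j < n \<Longrightarrow> en i \<ominus> en j \<in> en ` {..<n}"
    and step: "\<And>a i. a \<in> Inv \<Longrightarrow> i < n \<Longrightarrow> \<exists>j<n. {en i, en i \<ominus> a} = {en j, en ((j + 1) mod n)}"
  shows "planar_graph (carrier R) (inv_edges R)"
proof -
  define B where "B = en ` {..<n}"
  have Bc: "B \<subseteq> carrier R" using enc by (auto simp: B_def)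
  have Bdiff: "x \<ominus> y \<in> B" if "x \<in> B" "y \<in> B" for x y using that diff by (auto simp: B_def)
  have "0 < n" using n by simp
  then have "en 0 \<in> B" by (simp add: B_def)
  then have B0: "\<zero> \<in> B" using Bdiff[of "en 0" "en 0"] enc by (simp add: a_minus_def r_neg)
  have Badd: "x \<oplus> y \<in> B" if "x \<in> B" "y \<in> B" for x y
  proof -
    have "x \<oplus> y = x \<ominus> (\<zero> \<ominus> y)" using that Bc by (auto simp: a_minus_def)
    then show ?thesis using Bdiff that B0 by simp
  qed
  \<comment> \<open>The defining condition is the same for all elements of a coset, so this picks
    one representative for each coset.\<close>
  define root where "root x = (SOME z. z \<in> carrier R \<and> x \<ominus> z \<in> B)" for x
  have root: "root x \<in> carrier R" "x \<ominus> root x \<in> B" if "x \<in> carrier R" for x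
  proof -
    have "x \<in> carrier R \<and> x \<ominus> x \<in> B" using that B0 by (simp add: a_minus_def r_neg)
    from someI[of "\<lambda>z. z \<in> carrier R \<and> x \<ominus> z \<in> B", OF this]
    show "root x \<in> carrier R" "x \<ominus> root x \<in> B" unfolding root_def by simp_all
  qed
  have root_eq: "root x = root y" if xy: "x \<in> carrier R" "y \<in> carrier R" "x \<ominus> y \<in> B" for x y
  proof -
    have "(z \<in> carrier R \<and> x \<ominus> z \<in> B) \<longleftrightarrow> (z \<in> carrier R \<and> y \<ominus> z \<in> B)" for z
    proof -
      have "x \<ominus> z = (x \<ominus> y) \<oplus> (y \<ominus> z)" "y \<ominus> z = (x \<ominus> z) \<ominus> (x \<ominus> y)" if "z \<in> carrier R"
        using xy(1,2) that by (algebra, algebra)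
      then show ?thesis using Badd[OF xy(3), of "y \<ominus> z"] Bdiff[OF _ xy(3), of "x \<ominus> z"] by metis
    qed
    then show ?thesis unfolding root_def by simp
  qed
  define idx where "idx x = (SOME i. i < n \<and> x = root x \<oplus> en i)" for x
  have idx: "idx x < n" "x = root x \<oplus> en (idx x)" if x: "x \<in> carrier R" for x
  proof -
    obtain i where "i < n" "x \<ominus> root x = en i" using root(2)[OF x] by (auto simp: B_def)
    moreover have "x = root x \<oplus> (x \<ominus> root x)" using x root(1)[OF x] by algebra
    ultimately have "i < n \<and> x = root x \<oplus> en i" by simp
    from someI[of "\<lambda>i. i < n \<and> x = root x \<oplus> en i", OF this]
    show "idx x < n" "x = root x \<oplus> en (idx x)" unfolding idx_def by simp_all
  qed
  have idx_eq: "idx x = i" if x: "x \<in> carrier R" "i < n" "x = root x \<oplus> en i" for x i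
  proof -
    have "root x \<oplus> en (idx x) = root x \<oplus> en i" using idx(2)[OF x(1)] x(3) by metis
    then have "en (idx x) = en i" using root(1)[OF x(1)] enc by simp
    then show ?thesis using inj idx(1)[OF x(1)] x(2) by (simp add: inj_on_def)
  qed
  obtain h :: "'a \<Rightarrow> nat" where h: "inj_on h (carrier R)"
    using finite_imp_inj_to_nat_seg[OF fin] by blast
  define pos where "pos x = (h (root x), idx x)" for x
  show ?thesis
  proof (rule disjoint_cycles_planar[OF n, of pos])
    show "inj_on pos (carrier R)"
    proof (rule inj_onI)
      fix x y assume xy: "x \<in> carrier R" "y \<in> carrier R" "pos x = pos y"
      then have "root x = root y" "idx x = idx y"
        using h root(1) by (auto simp: pos_def inj_on_def)
      then show "x = y" using idx(2) xy(1,2) by metis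
    qed
    show "snd (pos v) < n" if "v \<in> carrier R" for v using idx(1)[OF that] by (simp add: pos_def)
    have edge: "\<exists>x y. {x', y'} = {x, y} \<and> x \<in> carrier R \<and> y \<in> carrier R \<and> fst (pos x) = fst (pos y) \<and>
        snd (pos y) = (snd (pos x) + 1) mod n"
      if r: "r \<in> carrier R" "x' = r \<oplus> en j" "y' = r \<oplus> en ((j + 1) mod n)" "j < n" "root x' = r" for x' y' r j
    proof -
      have m: "(j + 1) mod n < n" using n by simp
      have c: "x' \<in> carrier R" "y' \<in> carrier R" using r enc by simp_all
      have "x' \<ominus> y' = en j \<ominus> en ((j + 1) mod n)" using r(1) enc[of j] enc[of "(j + 1) mod n"] unfolding r(2,3) by algebra
      then have "root y' = r" using root_eq[OF c] diff[OF r(4) m] r(5) by (simp add: B_def)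
      then have "idx x' = j" "idx y' = (j + 1) mod n"
        using idx_eq[OF c(1) r(4)] idx_eq[OF c(2) m] r by simp_all
      then have "fst (pos x') = fst (pos y')" "snd (pos y') = (snd (pos x') + 1) mod n"
        using \<open>root y' = r\<close> r(5) by (simp_all add: pos_def)
      then show ?thesis using c by blast
    qed
    fix e assume "e \<in> inv_edges R"
    then obtain x y where xy: "e = {x, y}" "inv_adj R x y" by (auto simp: inv_edges_def)
    then have c: "x \<in> carrier R" "y \<in> carrier R" "x \<ominus> y \<in> Inv" by (simp_all add: adj_iff)
    define r i where "r = root x" and "i = idx x"
    have r: "r \<in> carrier R" "i < n" "x = r \<oplus> en i" using root(1) idx c(1) by (simp_all add: r_def i_def)
    obtain j where j: "j < n" "{en i, en i \<ominus> (x \<ominus> y)} = {en j, en ((j + 1) mod n)}"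
      using step[OF c(3) r(2)] by blast
    have y: "y = r \<oplus> (en i \<ominus> (x \<ominus> y))"
    proof -
      have "y = (r \<oplus> en i) \<ominus> ((r \<oplus> en i) \<ominus> y)" using c(2) r(1) enc[of i] by algebra
      also have "\<dots> = r \<oplus> (en i \<ominus> ((r \<oplus> en i) \<ominus> y))" using c(2) r(1) enc[of i] by algebra
      finally show ?thesis using r(3) by simp
    qed
    have m: "(j + 1) mod n < n" using n by simp
    \<comment> \<open>An edge may run against the cyclic order; its ends are then exchanged.\<close>
    from j(2) consider "en i = en j" "en i \<ominus> (x \<ominus> y) = en ((j + 1) mod n)"
      | "en i = en ((j + 1) mod n)" "en i \<ominus> (x \<ominus> y) = en j" unfolding doubleton_eq_iff by blast
    then show "\<exists>x y. e = {x, y} \<and> x \<in> carrier R \<and> y \<in> carrier R \<and> fst (pos x) = fst (pos y) \<and>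
        snd (pos y) = (snd (pos x) + 1) mod n"
    proof cases
      case 1
      have xj: "x = r \<oplus> en j" using r(3) unfolding 1(1) .
      have yj: "y = r \<oplus> en ((j + 1) mod n)" using y unfolding 1(2) .
      show ?thesis unfolding xy(1) by (rule edge[OF r(1) xj yj j(1)]) (simp add: r_def)
    next
      case 2
      have "x \<ominus> y = en i \<ominus> (en i \<ominus> (x \<ominus> y))" using c enc by (simp add: sub_sub)
      then have "x \<ominus> y \<in> B" using 2 diff[OF m j(1)] by (simp add: B_def)
      then have "root y = r" using root_eq[OF c(1,2)] by (simp add: r_def)
      then have ry: "root y = r" .
      have xj: "x = r \<oplus> en ((j + 1) mod n)" using r(3) unfolding 2(1) .
      have yj: "y = r \<oplus> en j" using y unfolding 2(2) .
      show ?thesis unfolding xy(1) insert_commute[of x y "{}"] by (rule edge[OF r(1) yj xj j(1) ry])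
    qed
  qed
qed

text \<open>The subgroup is the image of the integers, cyclic of order the characteristic, with 1 as
  the step.\<close>

lemma planar_pm:
  assumes "Inv \<subseteq> {\<one>, \<ominus> \<one>}"
  shows "planar_graph (carrier R) (inv_edges R)"
proof -
  obtain c where c: "0 < c" "\<And>k. \<iota> k = \<zero> \<longleftrightarrow> c dvd k" using iota_char by blast
  have "\<not> c dvd 1" using c(2)[of 1] ne by simp
  then have c2: "2 \<le> c" using c(1) by (cases "c = 1") auto
  define n where "n = nat c"
  have n: "2 \<le> n" "int n = c" using c2 by (simp_all add: n_def)
  define en where "en i = \<iota> (int i)" for i
  have ieq: "\<iota> k = \<iota> l \<longleftrightarrow> k mod c = l mod c" for k l
  proof -
    have "\<iota> k = \<iota> l \<longleftrightarrow> \<iota> (k - l) = \<zero>" by (simp add: iota_diff)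
    then show ?thesis using c(2) by (simp add: mod_eq_dvd_iff)
  qed
  have rep: "\<exists>j<n. \<iota> k = en j" for k
  proof (intro exI[of _ "nat (k mod c)"] conjI)
    have k: "0 \<le> k mod c" "k mod c < c" using c(1) by simp_all
    then show "nat (k mod c) < n" by (simp add: n_def)
    show "\<iota> k = en (nat (k mod c))" using k(1) ieq by (simp add: en_def)
  qed
  have suc: "en ((j + 1) mod n) = \<iota> (int j + 1)" for j
    unfolding en_def ieq using n(2) by (simp add: zmod_int add.commute)
  show ?thesis
  proof (rule planar_cosets[OF n(1)])
    show "inj_on en {..<n}"
      using ieq n(2) by (auto simp: inj_on_def en_def)
    show "en i \<in> carrier R" for i by (simp add: en_def)
    show "en i \<ominus> en j \<in> en ` {..<n}" for i j
      using rep[of "int i - int j"] by (auto simp: en_def iota_diff)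
    fix a i assume a: "a \<in> Inv" and i: "i < n"
    then consider "a = \<one>" | "a = \<ominus> \<one>" using assms by blast
    then show "\<exists>j<n. {en i, en i \<ominus> a} = {en j, en ((j + 1) mod n)}"
    proof cases
      case 1
      obtain j where j: "j < n" "\<iota> (int i - 1) = en j" using rep by blast
      have "\<iota> (int j + 1) = \<iota> (int i)"
        using j(2) iota_add[of "int i - 1" 1] by (simp add: en_def iota_add)
      then have "en ((j + 1) mod n) = en i" unfolding suc by (simp add: en_def)
      moreover have "en i \<ominus> a = en j" using 1 j(2) by (simp add: iota_diff en_def)
      ultimately show ?thesis using j(1) by (intro exI[of _ j]) (simp add: insert_commute)
    next
      case 2
      have "en i \<ominus> a = en ((i + 1) mod n)" unfolding suc using 2 by (simp add: iota_add en_def a_minus_def)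
      then show ?thesis using i by (intro exI[of _ i]) simp
    qed
  qed
qed

text \<open>In characteristic 2 the involutions 1 and u span a group of order four, whose graph is a
  4-cycle.\<close>

lemma planar_two:
  assumes I: "Inv = {\<one>, u}" "u \<noteq> \<one>" and 2: "\<one> \<oplus> \<one> = \<zero>"
  shows "planar_graph (carrier R) (inv_edges R)"
proof -
  have u: "u \<in> Inv" using I by simp
  then have uc: "u \<in> carrier R" "u \<noteq> \<zero>" using Inv_ne_zero by auto
  have dbl: "x \<oplus> x = \<zero>" if "x \<in> carrier R" for x
  proof -
    have "x \<oplus> x = x \<otimes> (\<one> \<oplus> \<one>)" using that by algebra
    then show ?thesis using 2 that by simp
  qed
  have mns: "x \<ominus> y = x \<oplus> y" if "x \<in> carrier R" "y \<in> carrier R" for x y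
    using dbl[OF that(2)] that by (metis a_minus_def minus_equality)
  define w where "w = \<one> \<oplus> u"
  have w: "w \<in> carrier R" using uc by (simp add: w_def)
  have tab: "\<one> \<oplus> u = w" "u \<oplus> \<one> = w" "\<one> \<oplus> w = u" "w \<oplus> \<one> = u" "u \<oplus> w = \<one>" "w \<oplus> u = \<one>"
    "\<one> \<oplus> \<one> = \<zero>" "u \<oplus> u = \<zero>" "w \<oplus> w = \<zero>"
  proof -
    show "\<one> \<oplus> u = w" "u \<oplus> \<one> = w" using uc by (simp_all add: w_def a_comm)
    have "\<one> \<oplus> w = (\<one> \<oplus> \<one>) \<oplus> u" "u \<oplus> w = \<one> \<oplus> (u \<oplus> u)" using uc unfolding w_def by (algebra, algebra)
    then show "\<one> \<oplus> w = u" "u \<oplus> w = \<one>" using 2 dbl uc by simp_all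
    then show "w \<oplus> \<one> = u" "w \<oplus> u = \<one>" using uc w by (simp_all add: a_comm)
  qed (use 2 dbl uc w in simp_all)
  have dist: "w \<noteq> \<zero>" "w \<noteq> \<one>" "w \<noteq> u"
    using tab uc ne I(2) w by (metis l_zero r_zero one_closed)+
  \<comment> \<open>In this order consecutive elements differ by 1, u, 1, u.\<close>
  define en where "en i = [\<zero>, \<one>, w, u] ! (i mod 4)" for i
  have en: "en 0 = \<zero>" "en 1 = \<one>" "en 2 = w" "en 3 = u" "en (Suc 0) = \<one>" by (simp_all add: en_def)
  have im: "en ` {..<4} = {\<zero>, \<one>, w, u}"
  proof -
    have "{..<4::nat} = {0, 1, 2, 3}" by auto
    then show ?thesis using en by simp
  qed
  have four: "i = 0 \<or> i = 1 \<or> i = 2 \<or> i = 3" if "i < 4" for i :: nat using that by linarith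
  show ?thesis
  proof (rule planar_cosets[of 4 en])
    show "inj_on en {..<4}"
    proof (rule inj_onI)
      fix i j assume "i \<in> {..<4}" "j \<in> {..<4}" "en i = en j"
      then show "i = j" using four[of i] four[of j] en dist ne uc(2) I(2) by auto
    qed
    have "i mod 4 < 4" for i :: nat by simp
    then show "en i \<in> carrier R" for i
      using four[of "i mod 4"] uc w unfolding en_def by auto
    fix i :: nat assume i: "i < 4"
    { fix j :: nat assume j: "j < 4"
      show "en i \<ominus> en j \<in> en ` {..<4}"
        unfolding im using four[OF i] four[OF j] en uc w by (elim disjE) (simp_all add: mns tab) }
    fix a assume "a \<in> Inv"
    then have "a = \<one> \<or> a = u" using I by simp
    then show "\<exists>j<4. {en i, en i \<ominus> a} = {en j, en ((j + 1) mod 4)}"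
    proof
      assume a: "a = \<one>"
      show ?thesis
        using four[OF i]
      proof (elim disjE)
        assume "i = 0" then show ?thesis using a en by (intro exI[of _ 0]) (simp add: mns tab)
      next
        assume "i = 1" then show ?thesis using a en by (intro exI[of _ 0]) (simp add: mns tab insert_commute)
      next
        assume "i = 2" then show ?thesis using a en w by (intro exI[of _ 2]) (simp add: mns tab)
      next
        assume "i = 3" then show ?thesis using a en uc by (intro exI[of _ 2]) (simp add: mns tab insert_commute)
      qed
    next
      assume a: "a = u"
      show ?thesis
        using four[OF i]
      proof (elim disjE)
        assume "i = 0" then show ?thesis using a en uc by (intro exI[of _ 3]) (simp add: mns tab insert_commute)
      next
        assume "i = 1" then show ?thesis using a en uc by (intro exI[of _ 1]) (simp add: mns tab numeral_2_eq_2[symmetric])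
      next
        assume "i = 2" then show ?thesis using a en uc w by (intro exI[of _ 1]) (simp add: mns tab insert_commute numeral_2_eq_2[symmetric])
      next
        assume "i = 3" then show ?thesis using a en uc by (intro exI[of _ 3]) (simp add: mns tab)
      qed
    qed
  qed simp
qed

section \<open>Toroidal drawings for four involutions\<close>

definition conn :: bool where
  "conn \<longleftrightarrow> (\<forall>x\<in>carrier R. \<forall>y\<in>carrier R. (inv_adj R)\<^sup>*\<^sup>* x y)"

lemma conn_subset:
  assumes conn "\<zero> \<in> T" "\<And>z a. z \<in> T \<Longrightarrow> a \<in> Inv \<Longrightarrow> z \<ominus> a \<in> T" "T \<subseteq> carrier R"
  shows "T = carrier R"
proof -
  have "cls \<zero> \<subseteq> T" using cls_subset assms(2-4) by blast
  moreover have "carrier R \<subseteq> cls \<zero>" using assms(1) unfolding conn_def cls_def by blast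
  ultimately show ?thesis using assms(4) by blast
qed

definition gv :: "'a \<Rightarrow> int \<Rightarrow> int \<Rightarrow> 'a" where
  "gv u i j = \<iota> i \<oplus> \<iota> j \<otimes> u"

lemma gv_closed [simp]: "u \<in> carrier R \<Longrightarrow> gv u i j \<in> carrier R"
  by (simp add: gv_def)

lemma gv_add: "u \<in> carrier R \<Longrightarrow> gv u (i + i') (j + j') = gv u i j \<oplus> gv u i' j'"
proof -
  assume u: "u \<in> carrier R"
  have "(a \<oplus> a') \<oplus> (b \<oplus> b') \<otimes> u = (a \<oplus> b \<otimes> u) \<oplus> (a' \<oplus> b' \<otimes> u)"
    if "a \<in> carrier R" "a' \<in> carrier R" "b \<in> carrier R" "b' \<in> carrier R" for a a' b b'
    using u that by algebra
  then show ?thesis by (simp add: gv_def iota_add)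
qed

lemma gv_diff: "u \<in> carrier R \<Longrightarrow> gv u (i - i') (j - j') = gv u i j \<ominus> gv u i' j'"
proof -
  assume u: "u \<in> carrier R"
  have "(a \<ominus> a') \<oplus> (b \<ominus> b') \<otimes> u = (a \<oplus> b \<otimes> u) \<ominus> (a' \<oplus> b' \<otimes> u)"
    if "a \<in> carrier R" "a' \<in> carrier R" "b \<in> carrier R" "b' \<in> carrier R" for a a' b b'
    using u that by algebra
  then show ?thesis by (simp add: gv_def iota_diff)
qed

lemma gv_eq_iff: "u \<in> carrier R \<Longrightarrow> gv u i j = gv u i' j' \<longleftrightarrow> gv u (i - i') (j - j') = \<zero>"
  by (simp add: gv_diff)

lemma gv_0 [simp]: "u \<in> carrier R \<Longrightarrow> gv u 0 0 = \<zero>"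
  by (simp add: gv_def)

lemma gv_10 [simp]: "u \<in> carrier R \<Longrightarrow> gv u 1 0 = \<one>"
  by (simp add: gv_def)

lemma gv_01 [simp]: "u \<in> carrier R \<Longrightarrow> gv u 0 1 = u"
  by (simp add: gv_def)

lemma gv_iota [simp]: "u \<in> carrier R \<Longrightarrow> gv u i 0 = \<iota> i"
  by (simp add: gv_def)

lemma gv_smult: "u \<in> carrier R \<Longrightarrow> gv u (k * i) (k * j) = \<iota> k \<otimes> gv u i j"
  by (simp add: gv_def iota_mult r_distr m_assoc)

lemma gv_mult: "u \<in> Inv \<Longrightarrow> gv u (i * i' + j * j') (i * j' + j * i') = gv u i j \<otimes> gv u i' j'"
proof -
  assume u: "u \<in> Inv"
  then have uc: "u \<in> carrier R" and uu: "u \<otimes> u = \<one>" by simp_all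
  have "(a \<oplus> b \<otimes> u) \<otimes> (a' \<oplus> b' \<otimes> u) = (a \<otimes> a' \<oplus> b \<otimes> b' \<otimes> (u \<otimes> u)) \<oplus> (a \<otimes> b' \<oplus> b \<otimes> a') \<otimes> u"
    if "a \<in> carrier R" "a' \<in> carrier R" "b \<in> carrier R" "b' \<in> carrier R" for a a' b b'
    using uc that by algebra
  from this[of "\<iota> i" "\<iota> i'" "\<iota> j" "\<iota> j'"] show ?thesis
    by (simp add: gv_def iota_add iota_mult uu)
qed

lemma gv_range:
  assumes conn "u \<in> Inv" "Inv = {\<one>, \<ominus> \<one>, u, \<ominus> u}"
  shows "range (\<lambda>p. gv u (fst p) (snd p)) = carrier R"
proof (rule conn_subset[OF assms(1)])
  have uc: "u \<in> carrier R" using assms(2) by simp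
  show "\<zero> \<in> range (\<lambda>p. gv u (fst p) (snd p))" by (rule image_eqI[of _ _ "(0, 0)"]) (use uc in simp_all)
  show "range (\<lambda>p. gv u (fst p) (snd p)) \<subseteq> carrier R" using uc by auto
  fix z a assume "z \<in> range (\<lambda>p. gv u (fst p) (snd p))" and a: "a \<in> Inv"
  then obtain i j where z: "z = gv u i j" by auto
  have "a = gv u 1 0 \<or> a = gv u (0 - 1) (0 - 0) \<or> a = gv u 0 1 \<or> a = gv u (0 - 0) (0 - 1)"
    unfolding gv_diff[OF uc] using a assms(3) uc by (auto simp: a_minus_def)
  then obtain k l where "a = gv u k l" by blast
  then have "z \<ominus> a = gv u (i - k) (j - l)" using z uc by (simp add: gv_diff)
  then show "z \<ominus> a \<in> range (\<lambda>p. gv u (fst p) (snd p))"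
    by (intro image_eqI[of _ _ "(i - k, j - l)"]) simp_all
qed

text \<open>Grid point (i, j) becomes i + j u, and unit steps in the grid are the edges. The Hermite
  basis of the relations is read off: m generates the relations without u, n the possible
  coefficients of u, and c + n u = 0 is one relation attaining n.\<close>

lemma toroidal_pm:
  assumes conn and I: "u \<in> Inv" "Inv = {\<one>, \<ominus> \<one>, u, \<ominus> u}"
  shows "toroidal_graph (carrier R) (inv_edges R)"
proof -
  have uc: "u \<in> carrier R" using I by simp
  define g where "g p = gv u (fst p) (snd p)" for p
  have ran: "range g = carrier R" unfolding g_def by (rule gv_range[OF assms])
  obtain m where m: "0 < m" "\<And>k. \<iota> k = \<zero> \<longleftrightarrow> m dvd k" using iota_char by blast
  obtain n where n: "0 < n" "\<And>j. (\<exists>i. gv u i j = \<zero>) \<longleftrightarrow> n dvd j"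
  proof (rule int_subgroup_principal[of "\<lambda>j. \<exists>i. gv u i j = \<zero>" m])
    have "\<iota> m = \<zero>" using m(2) by simp
    then have "gv u 0 m = \<zero>" using uc by (simp add: gv_def)
    then show "\<exists>i. gv u i m = \<zero>" ..
    show "\<exists>i. gv u i (x - y) = \<zero>" if "\<exists>i. gv u i x = \<zero>" "\<exists>i. gv u i y = \<zero>" for x y
    proof -
      obtain i i' where "gv u i x = \<zero>" "gv u i' y = \<zero>" using \<open>\<exists>i. gv u i x = \<zero>\<close> \<open>\<exists>i. gv u i y = \<zero>\<close> by blast
      then have "gv u (i - i') (x - y) = \<zero>" using uc by (simp add: gv_diff)
      then show ?thesis ..
    qed
  qed (use m(1) in simp_all)
  obtain c where c: "gv u c n = \<zero>" using n(2)[of n] by auto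
  have "toroidal_graph (range g) {{g x, g (x + d)} |x d. d = (1, 0) \<or> d = (0, 1)}"
  proof (rule grid_quotient_toroidal[OF m(1) n(1)])
    fix x y
    have "g x = g y \<longleftrightarrow> gv u (fst x - fst y) (snd x - snd y) = \<zero>" unfolding g_def by (rule gv_eq_iff[OF uc])
    also have "\<dots> \<longleftrightarrow> (\<exists>k l. x - y = (k * m + l * c, l * n))"
    proof
      assume z: "gv u (fst x - fst y) (snd x - snd y) = \<zero>"
      then have "n dvd snd x - snd y" using n(2) by blast
      then obtain l where "snd x - snd y = n * l" by (rule dvdE)
      then have l: "snd x - snd y = l * n" by (simp add: mult.commute)
      have "gv u (fst x - fst y - l * c) (snd x - snd y - l * n) = \<zero>"
        unfolding gv_diff[OF uc, of "fst x - fst y" "l * c"] gv_smult[OF uc] c z using uc by simp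
      then have "\<iota> (fst x - fst y - l * c) = \<zero>" using l uc by simp
      then obtain k where "fst x - fst y - l * c = m * k" using m(2) by blast
      then have "x - y = (k * m + l * c, l * n)" using l by (simp add: prod_eq_iff algebra_simps)
      then show "\<exists>k l. x - y = (k * m + l * c, l * n)" by blast
    next
      assume "\<exists>k l. x - y = (k * m + l * c, l * n)"
      then obtain k l where "x - y = (k * m + l * c, l * n)" by blast
      then have kl: "fst x - fst y = k * m + l * c" "snd x - snd y = k * 0 + l * n" by (auto simp: prod_eq_iff)
      have "\<iota> m = \<zero>" using m(2) by simp
      then show "gv u (fst x - fst y) (snd x - snd y) = \<zero>"
        unfolding kl gv_add[OF uc] gv_smult[OF uc] c using uc by simp
    qed
    finally show "g x = g y \<longleftrightarrow> (\<exists>k l. x - y = (k * m + l * c, l * n))" .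
  next
    fix x
    have "g (x + d) = g x \<oplus> g d" for d unfolding g_def by (simp add: gv_add[OF uc])
    moreover have "g x \<in> carrier R" using uc by (simp add: g_def)
    moreover have "g (1, 0) = \<one>" "g (0, 1) = u" using uc by (simp_all add: g_def)
    ultimately show "g x \<noteq> g (x + (1, 0))" "g x \<noteq> g (x + (0, 1))"
      using ne Inv_ne_zero[OF I(1)] uc by simp_all
  qed
  moreover have "{{g x, g (x + d)} |x d. d = (1, 0) \<or> d = (0, 1)} = inv_edges R"
  proof (intro equalityI subsetI)
    fix e assume "e \<in> {{g x, g (x + d)} |x d. d = (1, 0) \<or> d = (0, 1)}"
    then obtain x d where e: "e = {g x, g (x + d)}" "d = (1, 0) \<or> d = (0, 1)" by blast
    have "g (x + d) = g x \<oplus> g d" unfolding g_def by (simp add: gv_add[OF uc])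
    moreover have gc: "g x \<in> carrier R" "g d \<in> carrier R" using uc by (simp_all add: g_def)
    moreover have "g d \<in> Inv" using e(2) uc I(1) by (auto simp: g_def)
    moreover have "(g x \<oplus> g d) \<ominus> g x = g d" using gc by algebra
    ultimately have "inv_adj R (g (x + d)) (g x)" by (simp add: adj_iff)
    then show "e \<in> inv_edges R" using edge_iff[of "g x" "g (x + d)"] adj_sym e(1) by blast
  next
    fix e assume "e \<in> inv_edges R"
    then obtain x y where xy: "e = {x, y}" "inv_adj R x y" by (auto simp: inv_edges_def)
    then have c: "x \<in> carrier R" "y \<in> carrier R" "x \<ominus> y \<in> Inv" by (simp_all add: adj_iff)
    obtain p q where pq: "x = g p" "y = g q" using ran c(1,2) by blast
    have ga: "g (r + d) = g r \<oplus> g d" for r d unfolding g_def by (simp add: gv_add[OF uc])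
    have g1: "g (1, 0) = \<one>" "g (0, 1) = u" using uc by (simp_all add: g_def)
    have x: "x = y \<oplus> (x \<ominus> y)" using c(1,2) by algebra
    have y: "y = x \<oplus> \<ominus> (x \<ominus> y)" using c(1,2) by algebra
    from c(3) I(2) consider "x \<ominus> y = \<one>" | "x \<ominus> y = u" | "\<ominus> (x \<ominus> y) = \<one>" | "\<ominus> (x \<ominus> y) = u"
      using uc by fastforce
    then have "(\<exists>d. (d = (1, 0) \<or> d = (0, 1)) \<and> (x = g (q + d) \<or> y = g (p + d)))"
      using x y pq ga g1 by cases metis+
    then show "e \<in> {{g x, g (x + d)} |x d. d = (1, 0) \<or> d = (0, 1)}"
    proof (elim exE conjE)
      fix d :: "int \<times> int"
      assume d: "d = (1, 0) \<or> d = (0, 1)"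
      { assume "x = g (q + d)"
        then have "e = {g q, g (q + d)}" using xy(1) pq(2) by (simp add: insert_commute)
        then have "\<exists>x d. e = {g x, g (x + d)} \<and> (d = (1, 0) \<or> d = (0, 1))" using d by blast }
      moreover
      { assume "y = g (p + d)"
        then have "e = {g p, g (p + d)}" using xy(1) pq(1) by simp
        then have "\<exists>x d. e = {g x, g (x + d)} \<and> (d = (1, 0) \<or> d = (0, 1))" using d by blast }
      moreover assume "x = g (q + d) \<or> y = g (p + d)"
      ultimately show ?thesis by blast
    qed
  qed
  ultimately show ?thesis using ran by simp
qed

text \<open>With -1 = 1 the involutions are no longer 1, -1, u, -u, and another grid is needed. Here
  1 + Inv is closed under addition and Inv is its complement, so the graph is K_{4,4}. This is the
  circulant graph on Z/8 with steps 1 and 3, a quotient of the grid by (i, j) to i + 3j.\<close>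

lemma toroidal_char2:
  assumes conn and I: "card Inv = 4" and 2: "\<one> \<oplus> \<one> = \<zero>"
  shows "toroidal_graph (carrier R) (inv_edges R)"
proof -
  have dbl: "x \<oplus> x = \<zero>" if "x \<in> carrier R" for x
  proof -
    have "x \<oplus> x = x \<otimes> (\<one> \<oplus> \<one>)" using that by algebra
    then show ?thesis using 2 that by simp
  qed
  have mns: "x \<ominus> y = x \<oplus> y" if "x \<in> carrier R" "y \<in> carrier R" for x y
    using dbl[OF that(2)] that by (metis a_minus_def minus_equality)
  \<comment> \<open>In characteristic 2 squaring is additive, so the sum of three involutions
    squares to 1 + 1 + 1 = 1.\<close>
  have sum3: "\<one> \<oplus> a \<oplus> b \<in> Inv" if "a \<in> Inv" "b \<in> Inv" for a b
  proof -
    have c: "a \<in> carrier R" "b \<in> carrier R" using that by simp_all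
    have "(\<one> \<oplus> a \<oplus> b) \<otimes> (\<one> \<oplus> a \<oplus> b) = \<one> \<oplus> a \<otimes> a \<oplus> b \<otimes> b \<oplus> (\<one> \<oplus> \<one>) \<otimes> (a \<oplus> b \<oplus> a \<otimes> b)"
      using c by algebra
    also have "\<dots> = \<one> \<oplus> \<one> \<oplus> \<one>" using that c 2 by simp
    also have "\<dots> = \<one>" using 2 by simp
    finally show ?thesis using c by (simp add: Inv_def del: InvD)
  qed
  define M where "M = (\<lambda>a. \<one> \<oplus> a) ` Inv"
  have dis: "M \<inter> Inv = {}"
  proof (rule ccontr)
    assume "M \<inter> Inv \<noteq> {}"
    then obtain a where a: "a \<in> Inv" "\<one> \<oplus> a \<in> Inv" by (auto simp: M_def)
    then have "\<one> \<oplus> a \<oplus> (\<one> \<oplus> a) \<in> Inv" using dbl sum3[of a "\<one> \<oplus> a"] by simp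
    then show False using dbl[of "\<one> \<oplus> a"] a Inv_ne_zero[of "\<zero>"] by auto
  qed
  have II: "a \<oplus> b \<in> M" if "a \<in> Inv" "b \<in> Inv" for a b
  proof -
    have c: "a \<in> carrier R" "b \<in> carrier R" using that by simp_all
    have "a \<oplus> b = (\<one> \<oplus> (\<one> \<oplus> a \<oplus> b)) \<ominus> (\<one> \<oplus> \<one>)" using c by algebra
    then have "a \<oplus> b = \<one> \<oplus> (\<one> \<oplus> a \<oplus> b)" using 2 c by (simp add: a_minus_def)
    then show ?thesis unfolding M_def using sum3[OF that] by blast
  qed
  have MI: "x \<oplus> b \<in> Inv" if "x \<in> M" "b \<in> Inv" for x b
    using that sum3 by (auto simp: M_def)
  have MM: "x \<oplus> y \<in> M" if xy: "x \<in> M" "y \<in> M" for x y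
  proof -
    obtain a b where ab: "a \<in> Inv" "b \<in> Inv" "x = \<one> \<oplus> a" "y = \<one> \<oplus> b" using xy unfolding M_def by blast
    have c: "a \<in> carrier R" "b \<in> carrier R" using ab by simp_all
    have "(\<one> \<oplus> a) \<oplus> (\<one> \<oplus> b) = (\<one> \<oplus> \<one>) \<oplus> (a \<oplus> b)" using c by algebra
    then show ?thesis using II[OF ab(1,2)] ab(3,4) 2 c by simp
  qed
  have Mc: "M \<subseteq> carrier R" by (auto simp: M_def)
  have Ic: "Inv \<subseteq> carrier R" by auto
  have car: "M \<union> Inv = carrier R"
  proof (rule conn_subset[OF assms(1)])
    show "\<zero> \<in> M \<union> Inv" using II[of "\<one>" "\<one>"] 2 by simp
    show "M \<union> Inv \<subseteq> carrier R" using Mc Ic by blast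
    fix z a assume "z \<in> M \<union> Inv" and a: "a \<in> Inv"
    then show "z \<ominus> a \<in> M \<union> Inv" using MI[OF _ a] II[OF _ a] mns Mc Ic by auto
  qed
  obtain b where b: "bij_betw b {0..<4::nat} Inv"
    using ex_bij_betw_nat_finite[OF finite_Inv] I by metis
  have bI: "b i \<in> Inv" if "i < 4" for i using b that unfolding bij_betw_def by auto
  have binj: "b i = b j \<longleftrightarrow> i = j" if "i < 4" "j < 4" for i j
    using b that unfolding bij_betw_def inj_on_def by auto
  \<comment> \<open>Odd residues modulo 8 enumerate the involutions and even residues their
    translates by 1.\<close>
  define h where "h k = (let t = k mod 8 in if odd t then b (nat (t div 2)) else \<one> \<oplus> b (nat (t div 2)))" for k :: int
  have t4: "nat (k mod 8 div 2) < 4" for k :: int by simp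
  have hodd: "h k \<in> Inv" if "odd k" for k
    using that bI[OF t4[of k]] by (simp add: h_def Let_def dvd_mod_iff)
  have heven: "h k \<in> M" if "even k" for k
    using that bI[OF t4[of k]] by (simp add: h_def Let_def dvd_mod_iff M_def)
  have heq: "h k = h l \<longleftrightarrow> k mod 8 = l mod 8" for k l
  proof
    assume eq: "h k = h l"
    then have "odd k = odd l" using hodd heven dis by (metis disjoint_iff)
    then have par: "odd (k mod 8) = odd (l mod 8)" by (simp add: dvd_mod_iff)
    have bc: "b (nat (k mod 8 div 2)) \<in> carrier R" "b (nat (l mod 8 div 2)) \<in> carrier R"
      using bI[OF t4] by auto
    have "b (nat (k mod 8 div 2)) = b (nat (l mod 8 div 2))"
    proof (cases "odd (k mod 8)")
      case True
      then show ?thesis using eq par by (simp add: h_def Let_def)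
    next
      case False
      then have "\<one> \<oplus> b (nat (k mod 8 div 2)) = \<one> \<oplus> b (nat (l mod 8 div 2))"
        using eq par by (simp add: h_def Let_def)
      then show ?thesis using bc by simp
    qed
    then have nn: "nat (k mod 8 div 2) = nat (l mod 8 div 2)" by (rule iffD1[OF binj[OF t4[of k] t4[of l]]])
    have "0 \<le> k mod 8 div 2" "0 \<le> l mod 8 div 2" by simp_all
    then have "k mod 8 div 2 = l mod 8 div 2" using nn by (rule iffD1[OF eq_nat_nat_iff])
    then show "k mod 8 = l mod 8" using par by presburger
  qed (simp add: h_def)
  have hsurj: "\<exists>k. x = h k" if xc: "x \<in> carrier R" for x
  proof -
    have ex: "\<exists>i<4. a = b i" if a: "a \<in> Inv" for a
    proof -
      have "a \<in> b ` {0..<4}" using a b unfolding bij_betw_def by simp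
      then show ?thesis by (auto simp: image_iff)
    qed
    show ?thesis
    proof (cases "x \<in> Inv")
      case True
      then obtain i where i: "i < 4" "x = b i" using ex by blast
      have "(2 * int i + 1) mod 8 = 2 * int i + 1" using i(1) by simp
      then have "h (2 * int i + 1) = x" using i by (simp add: h_def Let_def)
      then show ?thesis by metis
    next
      case False
      then obtain a where a: "a \<in> Inv" "x = \<one> \<oplus> a" using xc car unfolding M_def by blast
      then obtain i where i: "i < 4" "a = b i" using ex by blast
      have "(2 * int i) mod 8 = 2 * int i" using i(1) by simp
      then have "h (2 * int i) = x" using i a by (simp add: h_def Let_def)
      then show ?thesis by metis
    qed
  qed
  define g where "g p = h (fst p + 3 * snd p)" for p :: "int \<times> int"
  have hc: "h k \<in> carrier R" for k using hodd[of k] heven[of k] Mc Ic by (cases "odd k") auto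
  have ran: "range g = carrier R"
  proof
    show "range g \<subseteq> carrier R" using hc by (auto simp: g_def)
    show "carrier R \<subseteq> range g"
    proof
      fix x assume "x \<in> carrier R"
      then obtain k where "x = h k" using hsurj by blast
      then have "x = g (k, 0)" by (simp add: g_def)
      then show "x \<in> range g" by blast
    qed
  qed
  have "toroidal_graph (range g) {{g x, g (x + d)} |x d. d = (1, 0) \<or> d = (0, 1)}"
  \<comment> \<open>(8, 0) and (-3, 1) span the kernel of (i, j) to i + 3j modulo 8.\<close>
  proof (rule grid_quotient_toroidal[of 8 1 g "- 3"])
    fix x y :: "int \<times> int"
    have "g x = g y \<longleftrightarrow> 8 dvd (fst x + 3 * snd x) - (fst y + 3 * snd y)"
      unfolding g_def heq by (rule mod_eq_dvd_iff)
    also have "\<dots> \<longleftrightarrow> (\<exists>k l. x - y = (k * 8 + l * - 3, l * 1))"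
    proof
      assume "8 dvd (fst x + 3 * snd x) - (fst y + 3 * snd y)"
      then obtain k where "(fst x + 3 * snd x) - (fst y + 3 * snd y) = 8 * k" by (rule dvdE)
      then have "x - y = (k * 8 + (snd x - snd y) * - 3, (snd x - snd y) * 1)"
        by (simp add: prod_eq_iff)
      then show "\<exists>k l. x - y = (k * 8 + l * - 3, l * 1)" by blast
    next
      assume "\<exists>k l. x - y = (k * 8 + l * - 3, l * 1)"
      then obtain k l where "x - y = (k * 8 + l * - 3, l * 1)" by blast
      then have "fst x - fst y = k * 8 + l * - 3" "snd x - snd y = l" by (auto simp: prod_eq_iff)
      then have "(fst x + 3 * snd x) - (fst y + 3 * snd y) = 8 * k" by simp
      then show "8 dvd (fst x + 3 * snd x) - (fst y + 3 * snd y)" by simp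
    qed
    finally show "g x = g y \<longleftrightarrow> (\<exists>k l. x - y = (k * 8 + l * - 3, l * 1))" .
  next
    fix x :: "int \<times> int"
    have "k mod 8 \<noteq> (k + 1) mod 8" "k mod 8 \<noteq> (k + 3) mod 8" for k :: int by presburger+
    moreover have "fst (x + (1, 0)) + 3 * snd (x + (1, 0)) = (fst x + 3 * snd x) + 1"
      "fst (x + (0, 1)) + 3 * snd (x + (0, 1)) = (fst x + 3 * snd x) + 3" by simp_all
    ultimately show "g x \<noteq> g (x + (1, 0))" "g x \<noteq> g (x + (0, 1))" unfolding g_def heq by metis+
  qed simp_all
  moreover have "{{g x, g (x + d)} |x d. d = (1, 0) \<or> d = (0, 1)} = inv_edges R"
  proof (intro equalityI subsetI)
    have opp: "inv_adj R (h k) (h l)" if "even k" "odd l" for k l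
      using MI[OF heven[OF that(1)] hodd[OF that(2)]] hc by (simp add: adj_iff mns)
    fix e assume "e \<in> {{g x, g (x + d)} |x d. d = (1, 0) \<or> d = (0, 1)}"
    then obtain x d where e: "e = {g x, g (x + d)}" "d = (1, 0) \<or> d = (0, 1)" by blast
    then obtain k l where kl: "e = {h k, h l}" "odd k \<noteq> odd l" by (auto simp: g_def)
    then show "e \<in> inv_edges R"
      using opp[of k l] opp[of l k] edge_iff[of "h k" "h l"] adj_sym by blast
  next
    fix e assume "e \<in> inv_edges R"
    then obtain x y where xy: "e = {x, y}" "inv_adj R x y" by (auto simp: inv_edges_def)
    then have c0: "x \<in> carrier R" "y \<in> carrier R" "x \<ominus> y \<in> Inv" by (simp_all add: adj_iff)
    then have c: "x \<in> carrier R" "y \<in> carrier R" "x \<oplus> y \<in> Inv" using mns[of x y] by simp_all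
    obtain k l where kl: "x = h k" "y = h l" using hsurj c(1,2) by blast
    have "odd k \<noteq> odd l"
    proof
      assume eq: "odd k = odd l"
      have "h k \<oplus> h l \<in> M"
      proof (cases "odd k")
        case True
        then show ?thesis using eq by (intro II hodd) simp_all
      next
        case False
        then show ?thesis using eq by (intro MM heven) simp_all
      qed
      then show False using c(3) dis kl by blast
    qed
    then have "odd (k - l)" by simp
    \<comment> \<open>The odd residues modulo 8 are exactly 1, 3, -1, -3, so any two vertices of
      opposite parity are joined by a grid edge.\<close>
    moreover have "odd D \<Longrightarrow> 8 dvd D - 1 \<or> 8 dvd D - 3 \<or> 8 dvd - D - 1 \<or> 8 dvd - D - 3" for D :: int
      by presburger
    ultimately have "8 dvd (k - l) - 1 \<or> 8 dvd (k - l) - 3 \<or> 8 dvd - (k - l) - 1 \<or> 8 dvd - (k - l) - 3"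
      by blast
    then have "8 dvd k - (l + 1) \<or> 8 dvd k - (l + 3) \<or> 8 dvd l - (k + 1) \<or> 8 dvd l - (k + 3)"
    proof -
      assume "8 dvd (k - l) - 1 \<or> 8 dvd (k - l) - 3 \<or> 8 dvd - (k - l) - 1 \<or> 8 dvd - (k - l) - 3"
      moreover have "(k - l) - 1 = k - (l + 1)" "(k - l) - 3 = k - (l + 3)"
        "- (k - l) - 1 = l - (k + 1)" "- (k - l) - 3 = l - (k + 3)" by simp_all
      ultimately show ?thesis by metis
    qed
    then have opts: "h k = h (l + 1) \<or> h k = h (l + 3) \<or> h l = h (k + 1) \<or> h l = h (k + 3)"
      unfolding heq mod_eq_dvd_iff .
    have e1: "{h m, h (m + 1)} \<in> {{g x, g (x + d)} |x d. d = (1, 0) \<or> d = (0, 1)}" for m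
    proof -
      have "{h m, h (m + 1)} = {g (m, 0), g ((m, 0) + (1, 0))}" by (simp add: g_def)
      then show ?thesis by blast
    qed
    have e3: "{h m, h (m + 3)} \<in> {{g x, g (x + d)} |x d. d = (1, 0) \<or> d = (0, 1)}" for m
    proof -
      have "{h m, h (m + 3)} = {g (m, 0), g ((m, 0) + (0, 1))}" by (simp add: g_def)
      then show ?thesis by blast
    qed
    from opts show "e \<in> {{g x, g (x + d)} |x d. d = (1, 0) \<or> d = (0, 1)}"
    proof (elim disjE)
      assume 1: "h k = h (l + 1)"
      have ee: "e = {h l, h (l + 1)}" unfolding xy(1) kl 1 by (rule insert_commute)
      show ?thesis unfolding ee by (rule e1)
    next
      assume 2: "h k = h (l + 3)"
      have ee: "e = {h l, h (l + 3)}" unfolding xy(1) kl 2 by (rule insert_commute)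
      show ?thesis unfolding ee by (rule e3)
    next
      assume 3: "h l = h (k + 1)"
      have ee: "e = {h k, h (k + 1)}" unfolding xy(1) kl 3 ..
      show ?thesis unfolding ee by (rule e1)
    next
      assume 4: "h l = h (k + 3)"
      have ee: "e = {h k, h (k + 3)}" unfolding xy(1) kl 4 ..
      show ?thesis unfolding ee by (rule e3)
    qed
  qed
  ultimately show ?thesis using ran by simp
qed

theorem genus_one_iff:
  "genus_one (carrier R) (inv_edges R) \<longleftrightarrow> conn \<and> card Inv = 4"
proof
  assume g1: "genus_one (carrier R) (inv_edges R)"
  then have tor: "toroidal_graph (carrier R) (inv_edges R)" and np: "\<not> planar_graph (carrier R) (inv_edges R)"
    by (simp_all add: genus_one_def)
  have sub: "e \<subseteq> carrier R" if "e \<in> inv_edges R" for e using that by (auto simp: inv_edges_def inv_adj_def)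
  obtain f \<gamma> s t d where td: "torus_drawing (carrier R) (inv_edges R) f \<gamma> s t d"
    using toroidal_graph_torus_drawing[OF tor fin sub] by metis
  interpret T: torus_drawing "carrier R" "inv_edges R" f \<gamma> s t d by (rule td)
  have car0: "card (carrier R) \<noteq> 0" using fin by auto
  have I4: "card Inv = 4"
  proof (cases rule: Inv_cases)
    case 1
    then show ?thesis using planar_pm np by blast
  next
    case (2 u)
    then show ?thesis using planar_two np by blast
  next
    case 3
    then show ?thesis .
  next
    case 4
    \<comment> \<open>Degree at least 8 means at least 4V edges, above the toroidal bound
      3V.\<close>
    have "2 * card (inv_edges R) = card (carrier R) * card Inv"
      using card_edges_in[of "carrier R"] by (simp add: edges_in_carrier inv_adj_def)
    moreover have "card (carrier R) * 8 \<le> card (carrier R) * card Inv" using 4 by simp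
    moreover have "card (inv_edges R) \<le> 3 * card (carrier R)" by (rule T.edge_bound_torus)
    ultimately have "card (carrier R) * 8 \<le> card (carrier R) * 6" by linarith
    then show ?thesis using car0 by simp
  qed
  have conn
  proof (rule ccontr)
    assume "\<not> conn"
    then obtain x y where xy: "x \<in> carrier R" "y \<in> carrier R" "\<not> (inv_adj R)\<^sup>*\<^sup>* x y"
      by (auto simp: conn_def)
    have "planar_graph (cls x) (edges_in (cls x)) \<or> planar_graph (cls y) (edges_in (cls y))"
      by (rule T.disjoint_parts_planar[OF _ _ cls_carrier[OF xy(1)] cls_carrier[OF xy(2)] cls_disjoint[OF xy(3)]])
        (auto simp: edges_in_def)
    then show False using cls_not_planar[OF I4] xy by blast
  qed
  then show "conn \<and> card Inv = 4" using I4 by blast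
next
  assume *: "conn \<and> card Inv = 4"
  have "cls \<zero> = carrier R"
    using * cls_carrier[of \<zero>] unfolding conn_def cls_def by auto
  then have "\<not> planar_graph (carrier R) (inv_edges R)"
    using cls_not_planar[of \<zero>] * edges_in_carrier by simp
  moreover have "toroidal_graph (carrier R) (inv_edges R)"
  proof (cases "\<one> = \<ominus> \<one>")
    case True
    then have "\<one> \<oplus> \<one> = \<zero>" by (metis one_closed r_neg)
    then show ?thesis using toroidal_char2 * by blast
  next
    case False
    then show ?thesis using toroidal_pm Inv_eq_pm * by metis
  qed
  ultimately show "genus_one (carrier R) (inv_edges R)" by (simp add: genus_one_def)
qed

end

section \<open>Models and isomorphisms\<close>

text \<open>A homomorphism from \<open>\<int>[u]/(u\<^sup>2 - 1)\<close>, written as a function of the coefficients of \<open>i + j u\<close>.\<close>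
definition zhom :: "('c, 'd) ring_scheme \<Rightarrow> (int \<Rightarrow> int \<Rightarrow> 'c) \<Rightarrow> bool" where
  "zhom S g \<longleftrightarrow> (\<forall>i j. g i j \<in> carrier S) \<and>
     (\<forall>i j i' j'. g (i + i') (j + j') = g i j \<oplus>\<^bsub>S\<^esub> g i' j') \<and>
     (\<forall>i j i' j'. g (i * i' + j * j') (i * j' + j * i') = g i j \<otimes>\<^bsub>S\<^esub> g i' j') \<and>
     g 1 0 = \<one>\<^bsub>S\<^esub>"

definition zsurj :: "('c, 'd) ring_scheme \<Rightarrow> (int \<Rightarrow> int \<Rightarrow> 'c) \<Rightarrow> bool" where
  "zsurj S g \<longleftrightarrow> (\<forall>x\<in>carrier S. \<exists>i j. x = g i j)"

lemma zhomD:
  assumes "zhom S g"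
  shows "g i j \<in> carrier S" "g (i + i') (j + j') = g i j \<oplus>\<^bsub>S\<^esub> g i' j'"
    "g (i * i' + j * j') (i * j' + j * i') = g i j \<otimes>\<^bsub>S\<^esub> g i' j'" "g 1 0 = \<one>\<^bsub>S\<^esub>"
  using assms unfolding zhom_def by blast+

text \<open>Both rings are quotients of Z[u]/(u^2 - 1), and \<open>eq\<close> says that the two
  kernels agree.\<close>

lemma zhom_iso:
  assumes g: "zhom S g" "zsurj S g" and h: "zhom T h" "zsurj T h"
    and eq: "\<And>i j i' j'. g i j = g i' j' \<longleftrightarrow> h i j = h i' j'"
  shows "S \<simeq> T"
proof -
  define \<phi> where "\<phi> x = (SOME y. \<exists>i j. x = g i j \<and> y = h i j)" for x
  have \<phi>: "\<phi> (g i j) = h i j" for i j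
  proof -
    have "\<exists>i' j'. g i j = g i' j' \<and> \<phi> (g i j) = h i' j'"
      unfolding \<phi>_def by (rule someI_ex) blast
    then show ?thesis using eq by metis
  qed
  have "\<phi> \<in> ring_hom S T"
  proof (rule ring_hom_memI)
    fix x y assume "x \<in> carrier S" "y \<in> carrier S"
    then obtain i j i' j' where xy: "x = g i j" "y = g i' j'" using g(2) unfolding zsurj_def by blast
    show "\<phi> x \<in> carrier T" unfolding xy \<phi> by (rule zhomD(1)[OF h(1)])
    show "\<phi> (x \<otimes>\<^bsub>S\<^esub> y) = \<phi> x \<otimes>\<^bsub>T\<^esub> \<phi> y"
      unfolding xy zhomD(3)[OF g(1), symmetric] \<phi> by (rule zhomD(3)[OF h(1)])
    show "\<phi> (x \<oplus>\<^bsub>S\<^esub> y) = \<phi> x \<oplus>\<^bsub>T\<^esub> \<phi> y"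
      unfolding xy zhomD(2)[OF g(1), symmetric] \<phi> by (rule zhomD(2)[OF h(1)])
  next
    show "\<phi> \<one>\<^bsub>S\<^esub> = \<one>\<^bsub>T\<^esub>"
      unfolding zhomD(4)[OF g(1), symmetric] \<phi> by (rule zhomD(4)[OF h(1)])
  qed
  moreover have "bij_betw \<phi> (carrier S) (carrier T)"
    unfolding bij_betw_def
  proof
    show "inj_on \<phi> (carrier S)"
    proof (rule inj_onI)
      fix x y assume xy: "x \<in> carrier S" "y \<in> carrier S" "\<phi> x = \<phi> y"
      then obtain i j i' j' where "x = g i j" "y = g i' j'" using g(2) unfolding zsurj_def by blast
      then show "x = y" using xy(3) \<phi> eq by simp
    qed
    show "\<phi> ` carrier S = carrier T"
    proof (intro equalityI subsetI)
      fix y assume "y \<in> \<phi> ` carrier S"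
      then obtain x where x: "x \<in> carrier S" "y = \<phi> x" by blast
      then obtain i j where "x = g i j" using g(2) unfolding zsurj_def by blast
      then have "y = \<phi> (g i j)" using x(2) by simp
      then show "y \<in> carrier T" using \<phi> zhomD(1)[OF h(1)] by simp
    next
      fix y assume "y \<in> carrier T"
      then obtain i j where "y = h i j" using h(2) unfolding zsurj_def by blast
      then have "y = \<phi> (g i j)" using \<phi> by simp
      then show "y \<in> \<phi> ` carrier S" using zhomD(1)[OF g(1)] by blast
    qed
  qed
  ultimately show ?thesis unfolding is_ring_iso_def ring_iso_def by blast
qed

text \<open>Composing with an isomorphism carries a presentation of a concrete ring over to
  \<open>R\<close> with the same relations.\<close>

lemma zhom_transport:
  assumes "ring R" "R \<simeq> S" "zhom S g" "zsurj S g"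
  obtains g' where "zhom R g'" "zsurj R g'" "\<And>i j i' j'. g' i j = g' i' j' \<longleftrightarrow> g i j = g i' j'"
proof -
  obtain \<psi> where \<psi>: "\<psi> \<in> ring_iso S R"
    using ring_iso_sym[OF assms(1,2)] unfolding is_ring_iso_def by blast
  have hom: "\<psi> \<in> ring_hom S R" and bij: "bij_betw \<psi> (carrier S) (carrier R)"
    using \<psi> by (simp_all add: ring_iso_def)
  note gD = zhomD[OF assms(3)]
  show ?thesis
  proof (rule that)
    show "zhom R (\<lambda>i j. \<psi> (g i j))"
      unfolding zhom_def
      using gD ring_hom_closed[OF hom] ring_hom_add[OF hom] ring_hom_mult[OF hom] ring_hom_one[OF hom]
      by metis
    show "zsurj R (\<lambda>i j. \<psi> (g i j))"
      unfolding zsurj_def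
    proof
      fix x assume "x \<in> carrier R"
      then obtain y where y: "y \<in> carrier S" "x = \<psi> y" using bij unfolding bij_betw_def by blast
      then obtain i j where "y = g i j" using assms(4) unfolding zsurj_def by blast
      then show "\<exists>i j. x = \<psi> (g i j)" using y(2) by blast
    qed
    show "\<psi> (g i j) = \<psi> (g i' j') \<longleftrightarrow> g i j = g i' j'" for i j i' j'
      using inj_on_eq_iff[of \<psi> "carrier S" "g i j" "g i' j'"] bij gD(1) by (simp add: bij_betw_def)
  qed
qed

text \<open>Turns an isomorphism around when the source is a record given by explicit formulas, for
  which closure under the operations can be checked directly.\<close>

lemma ring_iso_inverse:
  assumes h: "h \<in> ring_hom S R" "bij_betw h (carrier S) (carrier R)"
    and S: "\<And>x y. x \<in> carrier S \<Longrightarrow> y \<in> carrier S \<Longrightarrow> x \<otimes>\<^bsub>S\<^esub> y \<in> carrier S"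
      "\<And>x y. x \<in> carrier S \<Longrightarrow> y \<in> carrier S \<Longrightarrow> x \<oplus>\<^bsub>S\<^esub> y \<in> carrier S" "\<one>\<^bsub>S\<^esub> \<in> carrier S"
  shows "R \<simeq> S"
proof -
  define k where "k = inv_into (carrier S) h"
  have kb: "bij_betw k (carrier R) (carrier S)" unfolding k_def by (rule bij_betw_inv_into[OF h(2)])
  have kc: "k x \<in> carrier S" if "x \<in> carrier R" for x using kb that by (rule bij_betwE[rule_format])
  have hk: "h (k x) = x" if "x \<in> carrier R" for x
    unfolding k_def using h(2) that by (rule bij_betw_inv_into_right)
  have kh: "k (h x) = x" if "x \<in> carrier S" for x
    unfolding k_def using h(2) that by (rule bij_betw_inv_into_left)
  have "k \<in> ring_hom R S"
  proof (rule ring_hom_memI)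
    fix x y assume xy: "x \<in> carrier R" "y \<in> carrier R"
    show "k x \<in> carrier S" by (rule kc[OF xy(1)])
    have "h (k x \<otimes>\<^bsub>S\<^esub> k y) = x \<otimes>\<^bsub>R\<^esub> y" "h (k x \<oplus>\<^bsub>S\<^esub> k y) = x \<oplus>\<^bsub>R\<^esub> y"
      using ring_hom_mult[OF h(1)] ring_hom_add[OF h(1)] kc hk xy by simp_all
    then show "k (x \<otimes>\<^bsub>R\<^esub> y) = k x \<otimes>\<^bsub>S\<^esub> k y" "k (x \<oplus>\<^bsub>R\<^esub> y) = k x \<oplus>\<^bsub>S\<^esub> k y"
      using kh[OF S(1)] kh[OF S(2)] kc xy by metis+
  next
    show "k \<one>\<^bsub>R\<^esub> = \<one>\<^bsub>S\<^esub>" using ring_hom_one[OF h(1)] kh[OF S(3)] by metis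
  qed
  then show ?thesis using kb unfolding is_ring_iso_def ring_iso_def by blast
qed

section \<open>Presentations of the rings in the list\<close>

lemma ZMod_hom: "ZMod n \<in> ring_hom \<Z> (ZFact n)"
proof -
  interpret ideal "Idl\<^bsub>\<Z>\<^esub> {n}" \<Z> by (rule int.genideal_ideal) simp
  have "ZMod n = (+>\<^bsub>\<Z>\<^esub>) (Idl\<^bsub>\<Z>\<^esub> {n})" by (rule ext) (simp add: ZMod_def)
  then show ?thesis using rcos_ring_hom by (simp add: ZFact_def)
qed

lemma ZMod_simps:
  "ZMod n k \<in> carrier (ZFact n)" "ZMod n (k + l) = ZMod n k \<oplus>\<^bsub>ZFact n\<^esub> ZMod n l"
  "ZMod n (k * l) = ZMod n k \<otimes>\<^bsub>ZFact n\<^esub> ZMod n l" "ZMod n 1 = \<one>\<^bsub>ZFact n\<^esub>"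
  using ring_hom_closed[OF ZMod_hom, of k] ring_hom_add[OF ZMod_hom, of k l]
    ring_hom_mult[OF ZMod_hom, of k l] ring_hom_one[OF ZMod_hom] by simp_all

lemma ZMod_eq_iff: "ZMod n k = ZMod n l \<longleftrightarrow> n dvd k - l"
  by (simp add: ZMod_eq_mod mod_eq_dvd_iff)

lemma ZFact_carrierE:
  assumes "x \<in> carrier (ZFact n)"
  obtains k where "x = ZMod n k"
  using assms unfolding ZFact_def FactRing_def A_RCOSETS_def' ZMod_def by auto

text \<open>u is sent to \<open>w\<close>, a square root of 1 modulo \<open>n\<close>.\<close>

lemma zhom_ZMod:
  assumes "n dvd w * w - 1"
  shows "zhom (ZFact n) (\<lambda>i j. ZMod n (i + w * j))"
  unfolding zhom_def
proof (intro conjI allI)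
  fix i j i' j'
  show "ZMod n (i + w * j) \<in> carrier (ZFact n)" by (rule ZMod_simps)
  have "i + i' + w * (j + j') = (i + w * j) + (i' + w * j')" by (simp add: algebra_simps)
  then show "ZMod n (i + i' + w * (j + j')) = ZMod n (i + w * j) \<oplus>\<^bsub>ZFact n\<^esub> ZMod n (i' + w * j')"
    using ZMod_simps(2) by metis
  have "(i + w * j) * (i' + w * j') - (i * i' + j * j' + w * (i * j' + j * i')) = (w * w - 1) * (j * j')"
    by (simp add: algebra_simps)
  then have "n dvd (i + w * j) * (i' + w * j') - (i * i' + j * j' + w * (i * j' + j * i'))"
    using assms by simp
  then have "ZMod n (i * i' + j * j' + w * (i * j' + j * i')) = ZMod n ((i + w * j) * (i' + w * j'))"
    using ZMod_eq_iff by metis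
  then show "ZMod n (i * i' + j * j' + w * (i * j' + j * i')) = ZMod n (i + w * j) \<otimes>\<^bsub>ZFact n\<^esub> ZMod n (i' + w * j')"
    using ZMod_simps(3) by metis
next
  show "ZMod n (1 + w * 0) = \<one>\<^bsub>ZFact n\<^esub>" using ZMod_simps(4) by simp
qed

lemma RDirProd_simps:
  "carrier (RDirProd S T) = carrier S \<times> carrier T"
  "(a, b) \<otimes>\<^bsub>RDirProd S T\<^esub> (a', b') = (a \<otimes>\<^bsub>S\<^esub> a', b \<otimes>\<^bsub>T\<^esub> b')"
  "(a, b) \<oplus>\<^bsub>RDirProd S T\<^esub> (a', b') = (a \<oplus>\<^bsub>S\<^esub> a', b \<oplus>\<^bsub>T\<^esub> b')"
  "\<one>\<^bsub>RDirProd S T\<^esub> = (\<one>\<^bsub>S\<^esub>, \<one>\<^bsub>T\<^esub>)"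
  by (simp_all add: RDirProd_def DirProd_def monoid.defs)

lemma zhom_RDirProd:
  assumes "zhom S g" "zhom T h"
  shows "zhom (RDirProd S T) (\<lambda>i j. (g i j, h i j))"
  unfolding zhom_def RDirProd_simps
  using zhomD[OF assms(1)] zhomD[OF assms(2)] by simp

text \<open>u is sent to 1 + x, whose square is 1 + 2x + x^2 = 1, so i + j u becomes (i + j) + j
  x.\<close>

lemma zhom_Z2x: "zhom Z2x (\<lambda>i j. ((i + j) mod 2, j mod 2))"
  unfolding zhom_def
proof (intro conjI allI)
  fix i j i' j' :: int
  have "(i + j) mod 2 \<in> {0, 1}" "j mod 2 \<in> {0, 1}" by auto
  then show "((i + j) mod 2, j mod 2) \<in> carrier Z2x" unfolding Z2x_def partial_object.simps by (rule SigmaI)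
  show "((i + i' + (j + j')) mod 2, (j + j') mod 2) =
      ((i + j) mod 2, j mod 2) \<oplus>\<^bsub>Z2x\<^esub> ((i' + j') mod 2, j' mod 2)"
  proof -
    have eq: "i + i' + (j + j') = (i + j) + (i' + j')" by simp
    show ?thesis unfolding eq by (simp add: Z2x_def mod_add_eq)
  qed
  have "i * i' + j * j' + (i * j' + j * i') = (i + j) * (i' + j')" by (simp add: algebra_simps)
  then have "(i * i' + j * j' + (i * j' + j * i')) mod 2 = ((i + j) mod 2 * ((i' + j') mod 2)) mod 2"
    by (simp only: mod_mult_eq)
  moreover have "(i * j' + j * i') mod 2 = ((i + j) mod 2 * (j' mod 2) + j mod 2 * ((i' + j') mod 2)) mod 2"
  proof -
    have "(i + j) * j' + j * (i' + j') = (i * j' + j * i') + 2 * (j * j')" by (simp add: algebra_simps)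
    then have "((i + j) * j' + j * (i' + j')) mod 2 = (i * j' + j * i') mod 2" by simp
    moreover have "((i + j) mod 2 * (j' mod 2) + j mod 2 * ((i' + j') mod 2)) mod 2 =
        ((i + j) * j' + j * (i' + j')) mod 2"
      by (intro mod_add_cong mod_mult_cong mod_mod_trivial)
    ultimately show ?thesis by metis
  qed
  ultimately show "((i * i' + j * j' + (i * j' + j * i')) mod 2, (i * j' + j * i') mod 2) =
      ((i + j) mod 2, j mod 2) \<otimes>\<^bsub>Z2x\<^esub> ((i' + j') mod 2, j' mod 2)"
    by (simp only: Z2x_def monoid.simps prod.case)
qed (simp add: Z2x_def)

text \<open>Again u is sent to 1 + x. The coefficient of x is only defined modulo 2, which absorbs
  the reduction of the other factor modulo 4.\<close>

lemma zhom_Z4x: "zhom Z4x (\<lambda>i j. ((i + j) mod 4, j mod 2))"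
  unfolding zhom_def
proof (intro conjI allI)
  fix i j i' j' :: int
  have "j mod 2 = 0 \<or> j mod 2 = 1" by presburger
  then show "((i + j) mod 4, j mod 2) \<in> carrier Z4x" by (auto simp: Z4x_def)
  show "((i + i' + (j + j')) mod 4, (j + j') mod 2) =
      ((i + j) mod 4, j mod 2) \<oplus>\<^bsub>Z4x\<^esub> ((i' + j') mod 4, j' mod 2)"
  proof -
    have eq: "i + i' + (j + j') = (i + j) + (i' + j')" by simp
    show ?thesis unfolding eq by (simp add: Z4x_def mod_add_eq)
  qed
  have "i * i' + j * j' + (i * j' + j * i') = (i + j) * (i' + j')" by (simp add: algebra_simps)
  then have "(i * i' + j * j' + (i * j' + j * i')) mod 4 = ((i + j) mod 4 * ((i' + j') mod 4)) mod 4"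
    by (simp only: mod_mult_eq)
  moreover have "(i * j' + j * i') mod 2 = ((i + j) mod 4 * (j' mod 2) + j mod 2 * ((i' + j') mod 4)) mod 2"
  proof -
    have m4: "(x mod 4) mod 2 = x mod 2" for x :: int by (simp add: mod_mod_cancel)
    have "(i + j) * j' + j * (i' + j') = (i * j' + j * i') + 2 * (j * j')" by (simp add: algebra_simps)
    then have "((i + j) * j' + j * (i' + j')) mod 2 = (i * j' + j * i') mod 2" by simp
    moreover have "((i + j) mod 4 * (j' mod 2) + j mod 2 * ((i' + j') mod 4)) mod 2 =
        ((i + j) * j' + j * (i' + j')) mod 2"
      by (intro mod_add_cong mod_mult_cong mod_mod_trivial m4)
    ultimately show ?thesis by metis
  qed
  ultimately show "((i * i' + j * j' + (i * j' + j * i')) mod 4, (i * j' + j * i') mod 2) =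
      ((i + j) mod 4, j mod 2) \<otimes>\<^bsub>Z4x\<^esub> ((i' + j') mod 4, j' mod 2)"
    by (simp only: Z4x_def monoid.simps prod.case)
qed (simp add: Z4x_def)

lemma odd_adjust_parity:
  fixes n x y :: int
  assumes "odd n"
  obtains x' where "n dvd x' - x" "2 dvd x' - y"
  using that[of x] that[of "x + n"] assms by (cases "2 dvd x - y") auto

text \<open>For the square roots of 1: the odd prime cannot divide both x - 1 and x + 1, so its
  whole power divides one of them.\<close>

lemma odd_prime_powerD:
  assumes "odd_prime_power a"
  shows "odd a" "1 < a" "\<And>x. a dvd x * x - 1 \<Longrightarrow> a dvd x - 1 \<or> a dvd x + 1"
proof -
  obtain p :: nat and n where p: "Factorial_Ring.prime p" "odd p" "1 \<le> n" "a = int (p ^ n)"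
    using assms unfolding odd_prime_power_def by blast
  have pi: "Factorial_Ring.prime (int p)" using p(1) by simp
  have a: "a = int p ^ n" using p(4) by simp
  show "odd a" using p(2) a by simp
  have "1 < int p" using p(1) prime_gt_1_nat by simp
  then show "1 < a" using p(3) unfolding a by (intro one_less_power) simp_all
  fix x assume "a dvd x * x - 1"
  then have d: "a dvd (x - 1) * (x + 1)" by (simp add: algebra_simps)
  show "a dvd x - 1 \<or> a dvd x + 1"
  proof (cases "int p dvd x - 1")
    case True
    have "\<not> int p dvd x + 1"
    proof
      assume "int p dvd x + 1"
      then have "int p dvd (x + 1) - (x - 1)" using True by (rule dvd_diff)
      moreover have "odd (int p)" using p(2) by simp
      ultimately show False using odd_not_dvd_2[OF \<open>1 < int p\<close>] by simp
    qed
    then have "coprime a (x + 1)" unfolding a using pi by (simp add: prime_imp_coprime)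
    then show ?thesis using d coprime_dvd_mult_left_iff by blast
  next
    case False
    then have "coprime a (x - 1)" unfolding a using pi by (simp add: prime_imp_coprime)
    then show ?thesis using d coprime_dvd_mult_right_iff by blast
  qed
qed

text \<open>For x = 2m + 1, x^2 - 1 = 4m(m + 1), and one of m, m + 1 is odd, so 2^(n-2) divides the
  other. Whether the quotient is even or odd distinguishes the four roots.\<close>

lemma square_one_mod_two_power:
  fixes x :: int
  assumes "3 \<le> n" "2 ^ n dvd x * x - 1"
  shows "2 ^ n dvd x - 1 \<or> 2 ^ n dvd x + 1 \<or> 2 ^ n dvd x - (1 + 2 ^ (n - 1)) \<or> 2 ^ n dvd x + (1 + 2 ^ (n - 1))"
proof -
  obtain k where k: "n = k + 3" using assms(1) by (metis add.commute le_Suc_ex)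
  \<comment> \<open>\<open>h\<close> is 2^(n-2).\<close>
  define h :: int where "h = 2 ^ (k + 1)"
  have n: "2 ^ n = 4 * h" "2 ^ (n - 1) = 2 * h" by (simp_all add: k h_def power_add)
  have "2 dvd x * x - 1" using assms(2) n by (metis dvd_mult_left mult.assoc numeral_Bit0_eq_double)
  then have "odd x" by auto
  then obtain m where m: "x = 2 * m + 1" by (metis oddE)
  have "x * x - 1 = 4 * (m * (m + 1))" by (simp add: m algebra_simps)
  then have "h dvd m * (m + 1)" using assms(2) n by simp
  moreover have "coprime h m \<or> coprime h (m + 1)" unfolding h_def by auto
  ultimately have "h dvd m \<or> h dvd m + 1"
    using coprime_dvd_mult_left_iff coprime_dvd_mult_right_iff by blast
  then show ?thesis
  proof
    assume "h dvd m"
    then obtain r where r: "m = h * r" by blast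
    show ?thesis
    proof (cases "even r")
      case True
      then obtain q where "r = 2 * q" by blast
      then have "x - 1 = 2 ^ n * q" unfolding n by (simp add: m r)
      then show ?thesis by simp
    next
      case False
      then obtain q where "r = 2 * q + 1" by (metis oddE)
      then have "x - (1 + 2 ^ (n - 1)) = 2 ^ n * q" unfolding n by (simp add: m r algebra_simps)
      then show ?thesis by simp
    qed
  next
    assume "h dvd m + 1"
    then obtain r where r: "m + 1 = h * r" by blast
    then have x: "x + 1 = 2 * (h * r)" by (simp add: m)
    show ?thesis
    proof (cases "even r")
      case True
      then obtain q where "r = 2 * q" by blast
      then have "x + 1 = 2 ^ n * q" unfolding n x by simp
      then show ?thesis by simp
    next
      case False
      then obtain q where "r = 2 * q + 1" by (metis oddE)
      then have "x + (1 + 2 ^ (n - 1)) = 2 ^ n * (q + 1)" unfolding n using x by (simp add: algebra_simps)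
      then show ?thesis by simp
    qed
  qed
qed

text \<open>Solving i + j = x modulo a and i - j = y modulo b requires x and y of equal parity,
  which is arranged by adding the odd number a to x if necessary.\<close>

lemma zsurj_odd_odd:
  assumes "odd a"
  shows "zsurj (RDirProd (ZFact a) (ZFact b)) (\<lambda>i j. (ZMod a (i + 1 * j), ZMod b (i + - 1 * j)))"
  unfolding zsurj_def RDirProd_simps
proof
  fix z assume "z \<in> carrier (ZFact a) \<times> carrier (ZFact b)"
  then obtain x y where z: "z = (ZMod a x, ZMod b y)" by (metis ZFact_carrierE mem_Times_iff prod.collapse)
  obtain x' where x': "a dvd x' - x" "2 dvd x' - y" using odd_adjust_parity[OF assms] .
  then obtain q where q: "x' - y = 2 * q" by blast
  have "ZMod a x = ZMod a ((y + q) + 1 * q)" "ZMod b y = ZMod b ((y + q) + - 1 * q)"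
    unfolding ZMod_eq_iff using x'(1) q by (simp_all add: dvd_diff_commute[of a x] algebra_simps)
  then show "\<exists>i j. z = (ZMod a (i + 1 * j), ZMod b (i + - 1 * j))" unfolding z by blast
qed

text \<open>Both right-hand sides are adjusted to the parity prescribed by the component modulo
  2.\<close>

lemma zsurj_odd_odd_2:
  assumes "odd a" "odd b"
  shows "zsurj (RDirProd (ZFact a) (RDirProd (ZFact b) (ZFact 2)))
    (\<lambda>i j. (ZMod a (i + 1 * j), (ZMod b (i + - 1 * j), ZMod 2 (i + 1 * j))))"
  unfolding zsurj_def RDirProd_simps
proof
  fix z assume "z \<in> carrier (ZFact a) \<times> carrier (ZFact b) \<times> carrier (ZFact 2)"
  then obtain x y w where z: "z = (ZMod a x, ZMod b y, ZMod 2 w)" by (metis ZFact_carrierE mem_Times_iff prod.collapse)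
  obtain x' where x': "a dvd x' - x" "2 dvd x' - w" using odd_adjust_parity[OF assms(1)] .
  obtain y' where y': "b dvd y' - y" "2 dvd y' - w" using odd_adjust_parity[OF assms(2)] .
  have eq: "(x' - w) - (y' - w) = x' - y'" by simp
  have "2 dvd (x' - w) - (y' - w)" using x'(2) y'(2) by (rule dvd_diff)
  then obtain q where q: "x' - y' = 2 * q" unfolding eq by blast
  have i: "(y' + q) + 1 * q = x'" "(y' + q) + - 1 * q = y'" using q by simp_all
  have "z = (ZMod a ((y' + q) + 1 * q), ZMod b ((y' + q) + - 1 * q), ZMod 2 ((y' + q) + 1 * q))"
    unfolding z i prod.inject ZMod_eq_iff using x' y' by (simp add: dvd_diff_commute)
  then show "\<exists>i j. z = (ZMod a (i + 1 * j), ZMod b (i + - 1 * j), ZMod 2 (i + 1 * j))" by blast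
qed

text \<open>The case of sign 1 carries over by replacing j with \<open>\<sigma> * j\<close>.\<close>

lemma zsurj_odd_4:
  assumes "odd a" and \<sigma>: "\<sigma> = 1 \<or> \<sigma> = - 1"
  shows "zsurj (RDirProd (ZFact a) (ZFact 4)) (\<lambda>i j. (ZMod a (i + \<sigma> * j), ZMod 4 (i + - \<sigma> * j)))"
proof -
  have s: "zsurj (RDirProd (ZFact a) (ZFact 4)) (\<lambda>i j. (ZMod a (i + 1 * j), ZMod 4 (i + - 1 * j)))"
    by (rule zsurj_odd_odd[OF assms(1)])
  have "\<exists>i j. z = (ZMod a (i + \<sigma> * j), ZMod 4 (i + - \<sigma> * j))" if z: "z \<in> carrier (RDirProd (ZFact a) (ZFact 4))" for z
  proof -
    obtain i j where "z = (ZMod a (i + 1 * j), ZMod 4 (i + - 1 * j))" using s z unfolding zsurj_def by blast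
    then have "z = (ZMod a (i + \<sigma> * (\<sigma> * j)), ZMod 4 (i + - \<sigma> * (\<sigma> * j)))" using \<sigma> by auto
    then show ?thesis by blast
  qed
  then show ?thesis unfolding zsurj_def by blast
qed

text \<open>j is fixed by the coefficient of x; then i + \<open>\<sigma>\<close> j only has to be
  adjusted to a prescribed parity, which an odd modulus allows.\<close>

lemma zsurj_odd_Z2x:
  assumes "odd a" and \<sigma>: "\<sigma> = 1 \<or> \<sigma> = - 1"
  shows "zsurj (RDirProd (ZFact a) Z2x) (\<lambda>i j. (ZMod a (i + \<sigma> * j), ((i + j) mod 2, j mod 2)))"
  unfolding zsurj_def RDirProd_simps
proof
  fix z assume z0: "z \<in> carrier (ZFact a) \<times> carrier Z2x"
  obtain x where x: "fst z = ZMod a x" using z0 ZFact_carrierE by (metis mem_Times_iff)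
  obtain p q where pq: "snd z = (p, q)" "p = 0 \<or> p = 1" "q = 0 \<or> q = 1"
    using z0 by (auto simp: Z2x_def mem_Times_iff)
  obtain x' where x': "a dvd x' - x" "2 dvd x' - p" using odd_adjust_parity[OF assms(1)] .
  have "ZMod a x = ZMod a ((x' - \<sigma> * q) + \<sigma> * q)" unfolding ZMod_eq_iff using x'(1) by (simp add: dvd_diff_commute)
  moreover have "((x' - \<sigma> * q) + q) mod 2 = p" using x'(2) pq(2,3) \<sigma> by (auto; presburger)
  moreover have "q mod 2 = q" using pq(3) by auto
  ultimately have "z = (ZMod a ((x' - \<sigma> * q) + \<sigma> * q), (((x' - \<sigma> * q) + q) mod 2, q mod 2))"
    using x pq(1) by (metis prod.collapse)
  then show "\<exists>i j. z = (ZMod a (i + \<sigma> * j), (i + j) mod 2, j mod 2)" by blast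
qed

lemma zsurj_Z4x: "zsurj Z4x (\<lambda>i j. ((i + j) mod 4, j mod 2))"
  unfolding zsurj_def
proof
  fix z assume "z \<in> carrier Z4x"
  then obtain p q where "z = (p, q)" "0 \<le> p" "p \<le> 3" "q = 0 \<or> q = 1" by (auto simp: Z4x_def)
  then have "z = (((p - q) + q) mod 4, q mod 2)" by auto
  then show "\<exists>i j. z = ((i + j) mod 4, j mod 2)" by blast
qed

lemma zsurj_ZMod: "zsurj (ZFact n) (\<lambda>i j. ZMod n (i + w * j))"
  unfolding zsurj_def
proof
  fix z assume "z \<in> carrier (ZFact n)"
  then obtain k where "z = ZMod n k" by (rule ZFact_carrierE)
  then have "z = ZMod n (k + w * 0)" by simp
  then show "\<exists>i j. z = ZMod n (i + w * j)" by blast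
qed

section \<open>From a presentation back to connectedness and four involutions\<close>

context inv_ring
begin

lemma conn_if_cls_zero:
  assumes "carrier R \<subseteq> cls \<zero>"
  shows conn
proof -
  have "symp (inv_adj R)" using adj_sym by (simp add: symp_def)
  then have s: "(inv_adj R)\<^sup>*\<^sup>* y x" if "(inv_adj R)\<^sup>*\<^sup>* x y" for x y
    using that symp_rtranclp by (metis sympD)
  show ?thesis using assms s unfolding conn_def cls_def by (blast intro: rtranclp_trans)
qed

lemma cls_zero_diff: "z \<in> cls \<zero> \<Longrightarrow> a \<in> Inv \<Longrightarrow> z \<ominus> a \<in> cls \<zero>"
proof -
  assume z: "z \<in> cls \<zero>" and a: "a \<in> Inv"
  then have "z \<in> carrier R" using cls_carrier[of \<zero>] by blast
  then have "inv_adj R z (z \<ominus> a)" using a by (simp add: adj_iff sub_sub)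
  then show ?thesis by (rule cls_closed[OF z])
qed

text \<open>\<open>invs\<close> leaves only 1, -1, u, -u as involutions and \<open>d\<close> keeps
  them distinct. Since every element is i + j u, it is reached from 0 by steps 1, -1, u, -u.\<close>

lemma zhom_conn_card:
  assumes g: "zhom R g" "zsurj R g" and \<Lambda>: "\<And>i j i' j'. g i j = g i' j' \<longleftrightarrow> \<Lambda> (i - i') (j - j')"
    and invs: "\<And>i j. \<Lambda> (i * i + j * j - 1) (2 * i * j) \<Longrightarrow>
        \<Lambda> (i - 1) j \<or> \<Lambda> (i + 1) j \<or> \<Lambda> i (j - 1) \<or> \<Lambda> i (j + 1)"
    and d: "\<not> \<Lambda> 2 0" "\<not> \<Lambda> 1 1" "\<not> \<Lambda> 1 (- 1)"
  shows "conn \<and> card Inv = 4"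
proof -
  note gD = zhomD[OF g(1)]
  have gc: "g i j \<in> carrier R" for i j by (rule gD(1))
  have g0: "g 0 0 = \<zero>"
  proof -
    have "g 0 0 = g 0 0 \<oplus> g 0 0" using gD(2)[of 0 0 0 0] by simp
    then show ?thesis using gc[of 0 0] by (metis add.r_cancel_one')
  qed
  have gneg: "g (- i) (- j) = \<ominus> g i j" for i j
    using gD(2)[of "- i" i "- j" j] g0 gc by (metis add.left_inverse minus_equality)
  have gdiff: "g (i - i') (j - j') = g i j \<ominus> g i' j'" for i j i' j'
    using gD(2)[of i "- i'" j "- j'"] gneg by (simp add: a_minus_def)
  have sq: "g i j \<otimes> g i j = g (i * i + j * j) (2 * i * j)" for i j
    using gD(3)[of i i j j] by (simp add: algebra_simps)
  define u where "u = g 0 1"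
  have u: "u \<in> Inv"
    using sq[of 0 1] gD(4) gc by (simp add: u_def Inv_def del: InvD)
  have ex: "Inv = {\<one>, \<ominus> \<one>, u, \<ominus> u}"
  proof
    show "{\<one>, \<ominus> \<one>, u, \<ominus> u} \<subseteq> Inv" using u by simp
    show "Inv \<subseteq> {\<one>, \<ominus> \<one>, u, \<ominus> u}"
    proof
      fix v assume v: "v \<in> Inv"
      then have "v \<in> carrier R" by simp
      then obtain i j where ij: "v = g i j" using g(2) unfolding zsurj_def by blast
      have "g i j \<otimes> g i j = \<one>" using InvD(2)[OF v] ij by simp
      then have "g (i * i + j * j) (2 * i * j) = g 1 0" using sq gD(4) by metis
      then have "\<Lambda> (i * i + j * j - 1) (2 * i * j)" unfolding \<Lambda> by simp
      then have "\<Lambda> (i - 1) j \<or> \<Lambda> (i + 1) j \<or> \<Lambda> i (j - 1) \<or> \<Lambda> i (j + 1)" by (rule invs)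
      then have "g i j = g 1 0 \<or> g i j = g (- 1) (- 0) \<or> g i j = g 0 1 \<or> g i j = g (- 0) (- 1)"
        unfolding \<Lambda> by simp
      then show "v \<in> {\<one>, \<ominus> \<one>, u, \<ominus> u}" unfolding gneg ij u_def gD(4) by blast
    qed
  qed
  have "g 1 0 \<noteq> g (- 1) (- 0)" "g 1 0 \<noteq> g 0 1" "g 1 0 \<noteq> g (- 0) (- 1)" unfolding \<Lambda> using d by simp_all
  then have ne1: "\<one> \<noteq> \<ominus> \<one>" "\<one> \<noteq> u" "\<one> \<noteq> \<ominus> u" unfolding gneg gD(4) u_def by simp_all
  have uc: "u \<in> carrier R" using u by simp
  have ne2: "\<ominus> \<one> \<noteq> u" "\<ominus> \<one> \<noteq> \<ominus> u" using ne1 uc by (metis minus_minus one_closed)+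
  have "u \<noteq> \<ominus> u"
  proof
    assume "u = \<ominus> u"
    then have "u \<otimes> u = \<ominus> (u \<otimes> u)" using uc by (metis r_minus)
    then show False using ne1(1) u by simp
  qed
  then have c4: "card Inv = 4" unfolding ex using ne1 ne2 by simp
  have Isub: "a \<in> Inv \<Longrightarrow> z \<in> cls \<zero> \<Longrightarrow> z \<oplus> a \<in> cls \<zero>" for a z
    using cls_zero_diff[of z "\<ominus> a"] by (simp add: a_minus_def)
  have nat1: "g (int k) 0 \<in> cls \<zero> \<and> g (- int k) 0 \<in> cls \<zero>" for k
  proof (induction k)
    case 0 then show ?case using g0 cls_self by simp
  next
    case (Suc k)
    have "g (int (Suc k)) 0 = g (int k) 0 \<oplus> \<one>" "g (- int (Suc k)) 0 = g (- int k) 0 \<ominus> \<one>"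
    proof -
      have e: "int (Suc k) = int k + 1" "- int (Suc k) = - int k - 1" by simp_all
      show "g (int (Suc k)) 0 = g (int k) 0 \<oplus> \<one>" "g (- int (Suc k)) 0 = g (- int k) 0 \<ominus> \<one>"
        unfolding e using gD(2)[of "int k" 1 0 0] gdiff[of "- int k" 1 0 0] gD(4) by simp_all
    qed
    then show ?case using Suc Isub[OF one_Inv] cls_zero_diff[OF _ one_Inv] by simp
  qed
  have i1: "g i 0 \<in> cls \<zero>" for i
    using nat1[of "nat i"] nat1[of "nat (- i)"] by (cases "0 \<le> i") simp_all
  have nat2: "g i (int k) \<in> cls \<zero> \<and> g i (- int k) \<in> cls \<zero>" for i k
  proof (induction k)
    case 0 then show ?case using i1 by simp
  next
    case (Suc k)
    have "g i (int (Suc k)) = g i (int k) \<oplus> u" "g i (- int (Suc k)) = g i (- int k) \<ominus> u"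
    proof -
      have e: "int (Suc k) = int k + 1" "- int (Suc k) = - int k - 1" by simp_all
      show "g i (int (Suc k)) = g i (int k) \<oplus> u" "g i (- int (Suc k)) = g i (- int k) \<ominus> u"
        unfolding e u_def using gD(2)[of i 0 "int k" 1] gdiff[of i 0 "- int k" 1] by simp_all
    qed
    then show ?case using Suc Isub[OF u] cls_zero_diff[OF _ u] by simp
  qed
  have "g i j \<in> cls \<zero>" for i j
    using nat2[of i "nat j"] nat2[of i "nat (- j)"] by (cases "0 \<le> j") simp_all
  then have "carrier R \<subseteq> cls \<zero>" using g(2) unfolding zsurj_def by (metis subsetI)
  then show ?thesis using conn_if_cls_zero c4 by blast
qed

lemma iso_conn_card:
  assumes "R \<simeq> S" "zhom S g" "zsurj S g" and \<Lambda>: "\<And>i j i' j'. g i j = g i' j' \<longleftrightarrow> \<Lambda> (i - i') (j - j')"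
    and "\<And>i j. \<Lambda> (i * i + j * j - 1) (2 * i * j) \<Longrightarrow>
        \<Lambda> (i - 1) j \<or> \<Lambda> (i + 1) j \<or> \<Lambda> i (j - 1) \<or> \<Lambda> i (j + 1)"
    and "\<not> \<Lambda> 2 0" "\<not> \<Lambda> 1 1" "\<not> \<Lambda> 1 (- 1)"
  shows "conn \<and> card Inv = 4"
proof -
  obtain g' where g': "zhom R g'" "zsurj R g'" "\<And>i j i' j'. g' i j = g' i' j' \<longleftrightarrow> g i j = g i' j'"
    using zhom_transport[OF ring_axioms assms(1-3)] by metis
  show ?thesis
    by (rule zhom_conn_card[OF g'(1,2), of \<Lambda>]) (use g'(3) \<Lambda> assms(5-8) in simp_all)
qed

end

section \<open>The ring in which 1 and -1 coincide\<close>

context inv_ring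
begin

text \<open>For two involutions u, v other than 1, p = 1 + u and q = 1 + v have square zero, and 1 +
  p + q is the fourth involution. These elements generate the ring, so only p q = 0 is missing for
  the presentation.\<close>

lemma iso_Z2xy:
  assumes conn and I: "card Inv = 4" and 2: "\<one> \<oplus> \<one> = \<zero>"
  shows "R \<simeq> Z2xy"
proof -
  have dbl: "x \<oplus> x = \<zero>" if "x \<in> carrier R" for x
  proof -
    have "x \<oplus> x = x \<otimes> (\<one> \<oplus> \<one>)" using that by algebra
    then show ?thesis using 2 that by simp
  qed
  have neg1: "\<ominus> x = x" if "x \<in> carrier R" for x
    using dbl[OF that] that by (metis minus_equality)
  obtain u where u: "u \<in> Inv" "u \<noteq> \<one>"
  proof -
    have "\<not> Inv \<subseteq> {\<one>}" using I card_mono[of "{\<one>}" Inv] by auto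
    then show ?thesis using that by blast
  qed
  obtain v where v: "v \<in> Inv" "v \<noteq> \<one>" "v \<noteq> u"
  proof -
    have "card {\<one>, u} = 2" using u by simp
    then have "\<not> Inv \<subseteq> {\<one>, u}" using I card_mono[of "{\<one>, u}" Inv] by auto
    then show ?thesis using that by blast
  qed
  have c: "u \<in> carrier R" "v \<in> carrier R" using u v by simp_all
  define p where "p = \<one> \<oplus> u"
  define q where "q = \<one> \<oplus> v"
  have pq: "p \<in> carrier R" "q \<in> carrier R" using c by (simp_all add: p_def q_def)
  have up: "u = \<one> \<oplus> p" and vq: "v = \<one> \<oplus> q"
  proof -
    have "\<one> \<oplus> p = (\<one> \<oplus> \<one>) \<oplus> u" "\<one> \<oplus> q = (\<one> \<oplus> \<one>) \<oplus> v" using c unfolding p_def q_def by (algebra, algebra)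
    then show "u = \<one> \<oplus> p" "v = \<one> \<oplus> q" using 2 c by simp_all
  qed
  have sqr: "(\<one> \<oplus> x) \<otimes> (\<one> \<oplus> x) = \<one> \<oplus> x \<otimes> x" if "x \<in> carrier R" for x
  proof -
    have "(\<one> \<oplus> x) \<otimes> (\<one> \<oplus> x) = (\<one> \<oplus> x \<otimes> x) \<oplus> x \<otimes> (\<one> \<oplus> \<one>)" using that by algebra
    then show ?thesis using 2 that by simp
  qed
  have pp: "p \<otimes> p = \<zero>" and qq: "q \<otimes> q = \<zero>"
  proof -
    have "p \<otimes> p = \<one> \<oplus> u \<otimes> u" "q \<otimes> q = \<one> \<oplus> v \<otimes> v" unfolding p_def q_def using sqr c by simp_all
    then show "p \<otimes> p = \<zero>" "q \<otimes> q = \<zero>" using u v 2 by simp_all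
  qed
  have p0: "p \<noteq> \<zero>" and q0: "q \<noteq> \<zero>" and pneq: "p \<noteq> q"
    using u(2) v(2,3) up vq pq by auto
  have pq0: "p \<oplus> q \<noteq> \<zero>"
  proof
    assume "p \<oplus> q = \<zero>"
    then have "p = \<ominus> q" using pq by (metis minus_equality a_comm)
    then show False using neg1 pq pneq by simp
  qed
  have "(\<one> \<oplus> (p \<oplus> q)) \<otimes> (\<one> \<oplus> (p \<oplus> q)) = \<one> \<oplus> (p \<otimes> p \<oplus> q \<otimes> q \<oplus> p \<otimes> q \<otimes> (\<one> \<oplus> \<one>))"
  proof -
    have "(p \<oplus> q) \<otimes> (p \<oplus> q) = p \<otimes> p \<oplus> q \<otimes> q \<oplus> p \<otimes> q \<otimes> (\<one> \<oplus> \<one>)" using pq by algebra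
    then show ?thesis using sqr[of "p \<oplus> q"] pq by simp
  qed
  also have "\<dots> = \<one>" using pp qq 2 pq by simp
  finally have s: "\<one> \<oplus> (p \<oplus> q) \<in> Inv" using pq by (simp add: Inv_def del: InvD)
  define w where "w = \<one> \<oplus> (p \<oplus> q)"
  have wc: "w \<in> carrier R" using pq by (simp add: w_def)
  have wne: "w \<noteq> \<one>" "w \<noteq> u" "w \<noteq> v"
    unfolding w_def up vq using pq pq0 p0 q0 by simp_all
  have "card {\<one>, u, v, w} = 4" using u v wne by auto
  moreover have "{\<one>, u, v, w} \<subseteq> Inv" using u v s by (simp add: w_def)
  ultimately have Ieq: "Inv = {\<one>, u, v, w}" using finite_Inv I by (metis card_subset_eq)
  \<comment> \<open>u v = (1 + p + q) + p q is an involution other than 1, u and v, so it equals 1 +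
    p + q and p q vanishes.\<close>
  have "u \<otimes> v \<in> Inv" using u v by simp
  moreover have uv: "u \<otimes> v = w \<oplus> p \<otimes> q" unfolding up vq w_def using pq by algebra
  moreover have "u \<otimes> v \<noteq> \<one>"
  proof
    assume "u \<otimes> v = \<one>"
    then have "u \<otimes> (u \<otimes> v) = u" using c by simp
    moreover have "u \<otimes> (u \<otimes> v) = v" using c u(1) by (simp add: m_assoc[symmetric])
    ultimately show False using v(3) by simp
  qed
  moreover have "u \<otimes> v \<noteq> u"
  proof
    assume "u \<otimes> v = u"
    then have "u \<otimes> (u \<otimes> v) = \<one>" using u(1) by simp
    moreover have "u \<otimes> (u \<otimes> v) = v" using c u(1) by (simp add: m_assoc[symmetric])
    ultimately show False using v(2) by simp
  qed
  moreover have "u \<otimes> v \<noteq> v"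
  proof
    assume "u \<otimes> v = v"
    then have "(u \<otimes> v) \<otimes> v = \<one>" using v(1) by simp
    moreover have "(u \<otimes> v) \<otimes> v = u" using c v(1) by (simp add: m_assoc)
    ultimately show False using u(2) by simp
  qed
  ultimately have "w \<oplus> p \<otimes> q = w" unfolding Ieq by simp
  then have pq_0: "p \<otimes> q = \<zero>"
  proof -
    assume *: "w \<oplus> p \<otimes> q = w"
    have "p \<otimes> q = (w \<oplus> p \<otimes> q) \<ominus> w" using wc pq by algebra
    then show ?thesis using * wc by simp
  qed
  define \<psi> where "\<psi> a b d = \<iota> a \<oplus> \<iota> b \<otimes> p \<oplus> \<iota> d \<otimes> q" for a b d
  have i2: "\<iota> k = \<iota> (k mod 2)" for k
  proof -
    have "\<iota> k = \<iota> (2 * (k div 2) + k mod 2)" by simp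
    also have "\<dots> = \<iota> 2 \<otimes> \<iota> (k div 2) \<oplus> \<iota> (k mod 2)" by (simp only: iota_add iota_mult)
    also have "\<dots> = \<iota> (k mod 2)" using 2 by (simp add: iota_2)
    finally show ?thesis .
  qed
  have \<psi>mod: "\<psi> (a mod 2) (b mod 2) (d mod 2) = \<psi> a b d" for a b d
    unfolding \<psi>_def using i2 by metis
  have \<psi>c: "\<psi> a b d \<in> carrier R" for a b d using pq by (simp add: \<psi>_def)
  have \<psi>add: "\<psi> (a + a') (b + b') (d + d') = \<psi> a b d \<oplus> \<psi> a' b' d'" for a a' b b' d d'
  proof -
    have "(x \<oplus> x') \<oplus> (y \<oplus> y') \<otimes> p \<oplus> (z \<oplus> z') \<otimes> q = (x \<oplus> y \<otimes> p \<oplus> z \<otimes> q) \<oplus> (x' \<oplus> y' \<otimes> p \<oplus> z' \<otimes> q)"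
      if "x \<in> carrier R" "x' \<in> carrier R" "y \<in> carrier R" "y' \<in> carrier R" "z \<in> carrier R" "z' \<in> carrier R"
      for x x' y y' z z' using that pq by algebra
    then show ?thesis by (simp add: \<psi>_def iota_add)
  qed
  have \<psi>mult: "\<psi> (a * a') (a * b' + b * a') (a * d' + d * a') = \<psi> a b d \<otimes> \<psi> a' b' d'" for a a' b b' d d'
  proof -
    have 1: "(y \<otimes> p \<oplus> z \<otimes> q) \<otimes> (y' \<otimes> p \<oplus> z' \<otimes> q) =
        (y \<otimes> y') \<otimes> (p \<otimes> p) \<oplus> (y \<otimes> z' \<oplus> z \<otimes> y') \<otimes> (p \<otimes> q) \<oplus> (z \<otimes> z') \<otimes> (q \<otimes> q)"
      if "y \<in> carrier R" "y' \<in> carrier R" "z \<in> carrier R" "z' \<in> carrier R" for y y' z z'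
      using that pq by algebra
    have 2: "(x \<oplus> y \<oplus> z) \<otimes> (x' \<oplus> y' \<oplus> z') =
        x \<otimes> x' \<oplus> (x \<otimes> y' \<oplus> y \<otimes> x') \<oplus> (x \<otimes> z' \<oplus> z \<otimes> x') \<oplus> (y \<oplus> z) \<otimes> (y' \<oplus> z')"
      if "x \<in> carrier R" "x' \<in> carrier R" "y \<in> carrier R" "y' \<in> carrier R" "z \<in> carrier R" "z' \<in> carrier R"
      for x x' y y' z z' using that by algebra
    have 3: "(x \<otimes> y' \<oplus> y \<otimes> x') \<otimes> r = x \<otimes> (y' \<otimes> r) \<oplus> (y \<otimes> r) \<otimes> x'"
      if "x \<in> carrier R" "x' \<in> carrier R" "y \<in> carrier R" "y' \<in> carrier R" "r \<in> carrier R"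
      for x x' y y' r using that by algebra
    have 4: "(\<iota> b \<otimes> p \<oplus> \<iota> d \<otimes> q) \<otimes> (\<iota> b' \<otimes> p \<oplus> \<iota> d' \<otimes> q) = \<zero>"
      by (simp add: 1 pp qq pq_0)
    have "\<psi> a b d \<otimes> \<psi> a' b' d' = \<iota> a \<otimes> \<iota> a' \<oplus> (\<iota> a \<otimes> (\<iota> b' \<otimes> p) \<oplus> (\<iota> b \<otimes> p) \<otimes> \<iota> a') \<oplus>
        (\<iota> a \<otimes> (\<iota> d' \<otimes> q) \<oplus> (\<iota> d \<otimes> q) \<otimes> \<iota> a') \<oplus> \<zero>"
      unfolding \<psi>_def 4[symmetric] by (rule 2) (simp_all add: pq)
    then show ?thesis by (simp add: \<psi>_def iota_add iota_mult 3 pq)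
  qed
  have \<psi>neg: "\<psi> (a - a') (b - b') (d - d') = \<psi> a b d \<ominus> \<psi> a' b' d'" for a a' b b' d d'
  proof -
    have "\<psi> a b d \<ominus> \<psi> a' b' d' = \<psi> a b d \<oplus> \<psi> a' b' d'" using neg1[OF \<psi>c] by (simp add: a_minus_def)
    also have "\<dots> = \<psi> (a + a') (b + b') (d + d')" by (simp add: \<psi>add)
    also have "\<dots> = \<psi> (a - a') (b - b') (d - d')"
    proof -
      have "(x + y) mod 2 = (x - y) mod 2" for x y :: int by presburger
      then show ?thesis using \<psi>mod by metis
    qed
    finally show ?thesis by simp
  qed
  \<comment> \<open>Squaring kills the nilpotent part and isolates a; then b and d vanish modulo 2
    because p, q and p + q are nonzero.\<close>
  have \<psi>0: "a mod 2 = 0 \<and> b mod 2 = 0 \<and> d mod 2 = 0" if z: "\<psi> a b d = \<zero>" for a b d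
  proof -
    have zz: "\<psi> (a mod 2) (b mod 2) (d mod 2) = \<zero>" using z \<psi>mod by simp
    have e: "x mod 2 = 0 \<or> x mod 2 = 1" for x :: int by presburger
    have "\<psi> (a * a) (a * b + b * a) (a * d + d * a) = \<zero>" unfolding \<psi>mult z by simp
    then have "\<psi> ((a * a) mod 2) ((a * b + b * a) mod 2) ((a * d + d * a) mod 2) = \<zero>" by (rule trans[OF \<psi>mod])
    moreover have "(a * b + b * a) mod 2 = 0" "(a * d + d * a) mod 2 = 0" by (simp_all add: mult.commute)
    ultimately have "\<iota> ((a * a) mod 2) = \<zero>" using pq by (simp add: \<psi>_def)
    moreover have "(a * a) mod 2 = a mod 2" using e[of a] by (metis mod_mult_eq mult.right_neutral mult_zero_right mod_0 one_mod_two_eq_one)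
    ultimately have a0: "a mod 2 = 0" using e[of a] ne by auto
    then have "\<iota> (b mod 2) \<otimes> p \<oplus> \<iota> (d mod 2) \<otimes> q = \<zero>" using zz pq by (simp add: \<psi>_def)
    then show ?thesis using a0 e[of b] e[of d] p0 q0 pq0 pq by auto
  qed
  define T where "T = range (\<lambda>(a, b, d). \<psi> a b d)"
  have T: "T = carrier R"
  proof (rule conn_subset[OF assms(1)])
    have "\<zero> = \<psi> 0 0 0" using pq by (simp add: \<psi>_def)
    then show "\<zero> \<in> T" unfolding T_def by (intro image_eqI[of _ _ "(0, 0, 0)"]) simp_all
    show "T \<subseteq> carrier R" using \<psi>c by (auto simp: T_def)
    fix z x assume "z \<in> T" and x: "x \<in> Inv"
    then obtain a b d where z: "z = \<psi> a b d" by (auto simp: T_def)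
    have "\<exists>b' d'. x = \<psi> 1 b' d'"
    proof -
      have "\<one> = \<psi> 1 0 0" "u = \<psi> 1 1 0" "v = \<psi> 1 0 1" "w = \<psi> 1 1 1"
        using pq by (simp_all add: \<psi>_def up vq w_def a_assoc)
      then show ?thesis using x unfolding Ieq by blast
    qed
    then obtain b' d' where "x = \<psi> 1 b' d'" by blast
    then have "z \<ominus> x = \<psi> (a - 1) (b - b') (d - d')" using z \<psi>neg by simp
    then show "z \<ominus> x \<in> T" unfolding T_def by (intro image_eqI[of _ _ "(a - 1, b - b', d - d')"]) simp_all
  qed
  define \<Psi> where "\<Psi> = (\<lambda>(a, b, d). \<psi> a b d)"
  have "\<Psi> \<in> ring_hom Z2xy R"
  proof (rule ring_hom_memI)
    fix x y assume "x \<in> carrier Z2xy" "y \<in> carrier Z2xy"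
    obtain a b d a' b' d' where xy: "x = (a, b, d)" "y = (a', b', d')" by (metis prod_cases3)
    show "\<Psi> x \<in> carrier R" using \<psi>c by (simp add: \<Psi>_def xy)
    show "\<Psi> (x \<otimes>\<^bsub>Z2xy\<^esub> y) = \<Psi> x \<otimes> \<Psi> y"
      using \<psi>mult[of a a' b' b d' d] by (simp add: \<Psi>_def xy Z2xy_def \<psi>mod)
    show "\<Psi> (x \<oplus>\<^bsub>Z2xy\<^esub> y) = \<Psi> x \<oplus> \<Psi> y"
      using \<psi>add[of a a' b b' d d'] by (simp add: \<Psi>_def xy Z2xy_def \<psi>mod)
  next
    show "\<Psi> \<one>\<^bsub>Z2xy\<^esub> = \<one>" using pq by (simp add: \<Psi>_def Z2xy_def \<psi>_def)
  qed
  moreover have "bij_betw \<Psi> (carrier Z2xy) (carrier R)"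
    unfolding bij_betw_def
  proof
    show "inj_on \<Psi> (carrier Z2xy)"
    proof (rule inj_onI)
      fix x y assume xy: "x \<in> carrier Z2xy" "y \<in> carrier Z2xy" "\<Psi> x = \<Psi> y"
      obtain a b d a' b' d' where e: "x = (a, b, d)" "y = (a', b', d')" by (metis prod_cases3)
      have "\<psi> (a - a') (b - b') (d - d') = \<zero>"
        unfolding \<psi>neg using xy(3) \<psi>c by (simp add: \<Psi>_def e)
      then have dm: "(a - a') mod 2 = 0 \<and> (b - b') mod 2 = 0 \<and> (d - d') mod 2 = 0" by (rule \<psi>0)
      have bit: "s = t" if "s \<in> {0, 1}" "t \<in> {0, 1}" "(s - t) mod 2 = 0" for s t :: int
        using that by auto
      have mem: "a \<in> {0, 1} \<and> b \<in> {0, 1} \<and> d \<in> {0, 1}" "a' \<in> {0, 1} \<and> b' \<in> {0, 1} \<and> d' \<in> {0, 1}"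
        using xy(1,2) unfolding e Z2xy_def partial_object.simps mem_Sigma_iff .
      have "a = a'" "b = b'" "d = d'" using mem dm by (rule_tac [!] bit, blast+)
      then show "x = y" unfolding e by (simp only:)
    qed
    show "\<Psi> ` carrier Z2xy = carrier R"
    proof
      show "\<Psi> ` carrier Z2xy \<subseteq> carrier R" using \<psi>c by (auto simp: \<Psi>_def)
      show "carrier R \<subseteq> \<Psi> ` carrier Z2xy"
      proof
        fix x assume "x \<in> carrier R"
        then have "x \<in> T" by (simp only: T)
        then obtain a b d where "x = \<psi> a b d" by (auto simp: T_def)
        then have "x = \<Psi> (a mod 2, b mod 2, d mod 2)" by (simp add: \<Psi>_def \<psi>mod)
        moreover have "y mod 2 \<in> {0, 1}" for y :: int by auto
        then have "(a mod 2, b mod 2, d mod 2) \<in> carrier Z2xy"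
          unfolding Z2xy_def partial_object.simps by (intro SigmaI)
        ultimately show "x \<in> \<Psi> ` carrier Z2xy" by blast
      qed
    qed
  qed
  ultimately show ?thesis
  proof (rule ring_iso_inverse)
    have e: "y mod 2 \<in> {0, 1}" for y :: int by auto
    fix x y assume "x \<in> carrier Z2xy" "y \<in> carrier Z2xy"
    obtain a b d a' b' d' where xy: "x = (a, b, d)" "y = (a', b', d')" by (metis prod_cases3)
    show "x \<otimes>\<^bsub>Z2xy\<^esub> y \<in> carrier Z2xy" "x \<oplus>\<^bsub>Z2xy\<^esub> y \<in> carrier Z2xy"
      unfolding xy Z2xy_def
      by (simp_all only: partial_object.simps monoid.simps ring.simps prod.case mem_Sigma_iff e simp_thms)
  qed (simp add: Z2xy_def)
qed

text \<open>The involutions are the four elements with constant coefficient 1. Every other element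
  becomes one after adding 1, so each vertex is at most two steps from 0.\<close>

lemma conn_card_Z2xy:
  assumes "R \<simeq> Z2xy"
  shows "conn \<and> card Inv = 4"
proof -
  obtain \<phi> where \<phi>: "\<phi> \<in> ring_hom R Z2xy" "bij_betw \<phi> (carrier R) (carrier Z2xy)"
    using assms unfolding is_ring_iso_def ring_iso_def by blast
  have inj: "inj_on \<phi> (carrier R)" and im: "\<phi> ` carrier R = carrier Z2xy"
    using \<phi>(2) by (simp_all add: bij_betw_def)
  have one: "\<phi> \<one> = (1, 0, 0)" using ring_hom_one[OF \<phi>(1)] by (simp add: Z2xy_def)
  have car: "carrier Z2xy = {0, 1} \<times> {0, 1} \<times> {0, 1}" by (simp add: Z2xy_def)
  have Inv_iff: "x \<in> Inv \<longleftrightarrow> fst (\<phi> x) = 1" if x: "x \<in> carrier R" for x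
  proof -
    obtain a b d where e: "\<phi> x = (a, b, d)" by (metis prod_cases3)
    have "\<phi> x \<in> carrier Z2xy" using x im by blast
    then have m: "a = 0 \<or> a = 1" "b = 0 \<or> b = 1" "d = 0 \<or> d = 1" unfolding e car by auto
    have "\<phi> (x \<otimes> x) = ((a * a) mod 2, (a * b + b * a) mod 2, (a * d + d * a) mod 2)"
      using ring_hom_mult[OF \<phi>(1) x x] e by (simp add: Z2xy_def)
    then have "\<phi> (x \<otimes> x) = \<phi> \<one> \<longleftrightarrow> a = 1" using m one by auto
    moreover have "\<phi> (x \<otimes> x) = \<phi> \<one> \<longleftrightarrow> x \<otimes> x = \<one>" using inj x by (simp add: inj_on_eq_iff)
    ultimately show ?thesis using x e by (simp add: Inv_def del: InvD)
  qed
  have "\<phi> ` Inv = {1} \<times> {0, 1} \<times> {0, 1}"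
  proof (intro equalityI subsetI)
    fix y assume "y \<in> \<phi> ` Inv"
    then obtain x where x: "x \<in> Inv" "y = \<phi> x" by blast
    then have "x \<in> carrier R" by simp
    then have "y \<in> carrier Z2xy" "fst y = 1" using x im Inv_iff by blast+
    then show "y \<in> {1} \<times> {0, 1} \<times> {0, 1}" unfolding car by auto
  next
    fix y :: "int \<times> int \<times> int" assume y: "y \<in> {1} \<times> {0, 1} \<times> {0, 1}"
    then have "y \<in> carrier Z2xy" unfolding car by auto
    then obtain x where "x \<in> carrier R" "y = \<phi> x" using im by blast
    then show "y \<in> \<phi> ` Inv" using Inv_iff y by auto
  qed
  then have "card (\<phi> ` Inv) = card ({1} \<times> {0, 1} \<times> {0, 1} :: (int \<times> int \<times> int) set)" by simp
  moreover have "inj_on \<phi> Inv" using inj by (rule inj_on_subset) auto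
  ultimately have c4: "card Inv = 4" by (simp add: card_image card_cartesian_product)
  have Icls: "x \<in> cls \<zero>" if "x \<in> Inv" for x
    using cls_zero_diff[OF cls_self neg_Inv[OF that]] that by (simp add: a_minus_def)
  have "x \<in> cls \<zero>" if x: "x \<in> carrier R" for x
  proof (cases "x \<in> Inv")
    case False
    obtain a b d where e: "\<phi> x = (a, b, d)" by (metis prod_cases3)
    have "\<phi> x \<in> carrier Z2xy" using x im by blast
    then have "a = 0" using False Inv_iff[OF x] unfolding e car by auto
    then have "fst (\<phi> (x \<oplus> \<one>)) = 1"
      using ring_hom_add[OF \<phi>(1) x one_closed] e one by (simp add: Z2xy_def)
    then have "x \<oplus> \<one> \<in> Inv" using Inv_iff x by simp
    then have "(x \<oplus> \<one>) \<ominus> \<one> \<in> cls \<zero>" using cls_zero_diff[OF Icls one_Inv] by blast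
    moreover have "(x \<oplus> \<one>) \<ominus> \<one> = x" using x by algebra
    ultimately show ?thesis by simp
  qed (rule Icls)
  then show ?thesis using conn_if_cls_zero c4 by blast
qed

end

section \<open>Relation lattices of the listed rings\<close>

definition lattice_odd_odd :: "int \<Rightarrow> int \<Rightarrow> int \<Rightarrow> int \<Rightarrow> bool" where
  "lattice_odd_odd a b i j \<longleftrightarrow> a dvd i + 1 * j \<and> b dvd i + - 1 * j"

definition lattice_odd_odd_2 :: "int \<Rightarrow> int \<Rightarrow> int \<Rightarrow> int \<Rightarrow> bool" where
  "lattice_odd_odd_2 a b i j \<longleftrightarrow> a dvd i + 1 * j \<and> b dvd i + - 1 * j \<and> 2 dvd i + 1 * j"

definition lattice_odd_4 :: "int \<Rightarrow> int \<Rightarrow> int \<Rightarrow> int \<Rightarrow> bool" where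
  "lattice_odd_4 a \<sigma> i j \<longleftrightarrow> a dvd i + \<sigma> * j \<and> 4 dvd i + - \<sigma> * j"

definition lattice_odd_Z2x :: "int \<Rightarrow> int \<Rightarrow> int \<Rightarrow> int \<Rightarrow> bool" where
  "lattice_odd_Z2x a \<sigma> i j \<longleftrightarrow> a dvd i + \<sigma> * j \<and> 2 dvd i + j \<and> 2 dvd j"

definition lattice_Z4x :: "int \<Rightarrow> int \<Rightarrow> bool" where
  "lattice_Z4x i j \<longleftrightarrow> 4 dvd i + j \<and> 2 dvd j"

text \<open>The lattices above are written with the factors \<open>1 *\<close> and
  \<open>- 1 *\<close> so that they match this form literally for w = 1 and w = -1.\<close>

lemma ZMod_lin_eq_iff:
  "ZMod n (i + w * j) = ZMod n (i' + w * j') \<longleftrightarrow> n dvd (i - i') + w * (j - j')"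
proof -
  have "(i + w * j) - (i' + w * j') = (i - i') + w * (j - j')" by (simp add: algebra_simps)
  then show ?thesis unfolding ZMod_eq_iff by (simp only:)
qed

lemma model_odd_odd:
  assumes "odd a"
  obtains g where "zhom (RDirProd (ZFact a) (ZFact b)) g" "zsurj (RDirProd (ZFact a) (ZFact b)) g"
    "\<And>i j i' j'. g i j = g i' j' \<longleftrightarrow> lattice_odd_odd a b (i - i') (j - j')"
proof (rule that)
  show "zhom (RDirProd (ZFact a) (ZFact b)) (\<lambda>i j. (ZMod a (i + 1 * j), ZMod b (i + - 1 * j)))"
    by (intro zhom_RDirProd zhom_ZMod) simp_all
qed (use zsurj_odd_odd[OF assms] in \<open>simp_all only: prod.inject ZMod_lin_eq_iff lattice_odd_odd_def\<close>)

lemma model_odd_odd_2: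
  assumes "odd a" "odd b"
  obtains g where "zhom (RDirProd (ZFact a) (RDirProd (ZFact b) (ZFact 2))) g"
    "zsurj (RDirProd (ZFact a) (RDirProd (ZFact b) (ZFact 2))) g"
    "\<And>i j i' j'. g i j = g i' j' \<longleftrightarrow> lattice_odd_odd_2 a b (i - i') (j - j')"
proof (rule that)
  show "zhom (RDirProd (ZFact a) (RDirProd (ZFact b) (ZFact 2)))
      (\<lambda>i j. (ZMod a (i + 1 * j), (ZMod b (i + - 1 * j), ZMod 2 (i + 1 * j))))"
    by (intro zhom_RDirProd zhom_ZMod) simp_all
qed (use zsurj_odd_odd_2[OF assms] in \<open>simp_all only: prod.inject ZMod_lin_eq_iff lattice_odd_odd_2_def\<close>)

lemma model_odd_4:
  assumes "odd a" "\<sigma> = 1 \<or> \<sigma> = - 1"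
  obtains g where "zhom (RDirProd (ZFact a) (ZFact 4)) g" "zsurj (RDirProd (ZFact a) (ZFact 4)) g"
    "\<And>i j i' j'. g i j = g i' j' \<longleftrightarrow> lattice_odd_4 a \<sigma> (i - i') (j - j')"
proof (rule that)
  show "zhom (RDirProd (ZFact a) (ZFact 4)) (\<lambda>i j. (ZMod a (i + \<sigma> * j), ZMod 4 (i + - \<sigma> * j)))"
    using assms(2) by (intro zhom_RDirProd zhom_ZMod) auto
qed (use zsurj_odd_4[OF assms] in \<open>simp_all only: prod.inject ZMod_lin_eq_iff lattice_odd_4_def\<close>)

lemma model_odd_Z2x:
  assumes "odd a" "\<sigma> = 1 \<or> \<sigma> = - 1"
  obtains g where "zhom (RDirProd (ZFact a) Z2x) g" "zsurj (RDirProd (ZFact a) Z2x) g"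
    "\<And>i j i' j'. g i j = g i' j' \<longleftrightarrow> lattice_odd_Z2x a \<sigma> (i - i') (j - j')"
proof (rule that)
  show "zhom (RDirProd (ZFact a) Z2x) (\<lambda>i j. (ZMod a (i + \<sigma> * j), ((i + j) mod 2, j mod 2)))"
    using assms(2) by (intro zhom_RDirProd zhom_ZMod zhom_Z2x) auto
qed (use zsurj_odd_Z2x[OF assms] in \<open>simp_all only: prod.inject ZMod_lin_eq_iff mod_eq_dvd_iff add_diff_add lattice_odd_Z2x_def\<close>)

lemma model_Z4x:
  obtains g where "zhom Z4x g" "zsurj Z4x g" "\<And>i j i' j'. g i j = g i' j' \<longleftrightarrow> lattice_Z4x (i - i') (j - j')"
  by (rule that[OF zhom_Z4x zsurj_Z4x]) (simp only: prod.inject mod_eq_dvd_iff add_diff_add lattice_Z4x_def)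

lemma model_ZFact:
  assumes "n dvd w * w - 1"
  obtains g where "zhom (ZFact n) g" "zsurj (ZFact n) g"
    "\<And>i j i' j'. g i j = g i' j' \<longleftrightarrow> n dvd (i - i') + w * (j - j')"
  by (rule that[OF zhom_ZMod[OF assms] zsurj_ZMod ZMod_lin_eq_iff])

lemma square_one_mod_4: "(4::int) dvd x * x - 1 \<Longrightarrow> 4 dvd x - 1 \<or> 4 dvd x + 1"
proof -
  assume "4 dvd x * x - 1"
  then have "2 dvd x * x - 1" by presburger
  then have "odd x" by auto
  then show ?thesis by presburger
qed

text \<open>i + j u takes the value i + j at u = 1 and i - j at u = -1, and its square is 1 when
  both values are roots of 1. The four combinations of signs are 1, -1, u and -u.\<close>

lemma two_components:
  fixes a b i j :: int
  assumes "\<And>x. a dvd x * x - 1 \<Longrightarrow> a dvd x - 1 \<or> a dvd x + 1"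
    "\<And>x. b dvd x * x - 1 \<Longrightarrow> b dvd x - 1 \<or> b dvd x + 1"
    and "lattice_odd_odd a b (i * i + j * j - 1) (2 * i * j)"
  shows "lattice_odd_odd a b (i - 1) j \<or> lattice_odd_odd a b (i + 1) j \<or> lattice_odd_odd a b i (j - 1) \<or> lattice_odd_odd a b i (j + 1)"
proof -
  have sq: "i * i + j * j - 1 + 1 * (2 * i * j) = (i + j) * (i + j) - 1"
    "i * i + j * j - 1 + - 1 * (2 * i * j) = (i - j) * (i - j) - 1" by (simp_all add: algebra_simps)
  have "a dvd (i + j) - 1 \<or> a dvd (i + j) + 1" "b dvd (i - j) - 1 \<or> b dvd (i - j) + 1"
    using assms unfolding lattice_odd_odd_def sq by blast+
  moreover have "(i - 1) + 1 * j = (i + j) - 1" "(i - 1) + - 1 * j = (i - j) - 1"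
    "(i + 1) + 1 * j = (i + j) + 1" "(i + 1) + - 1 * j = (i - j) + 1"
    "i + 1 * (j - 1) = (i + j) - 1" "i + - 1 * (j - 1) = (i - j) + 1"
    "i + 1 * (j + 1) = (i + j) + 1" "i + - 1 * (j + 1) = (i - j) - 1" by simp_all
  ultimately show ?thesis unfolding lattice_odd_odd_def by metis
qed

text \<open>The value at u = 1 fixes i + j up to sign modulo \<open>a\<close>; the parity of j, the
  coefficient of x, then tells 1 and -1 from u and -u.\<close>

lemma nilpotent_component:
  fixes a i j :: int
  assumes "\<And>x. a dvd x * x - 1 \<Longrightarrow> a dvd x - 1 \<or> a dvd x + 1" "a dvd (i * i + j * j - 1) + (2 * i * j)"
  shows "(a dvd (i - 1) + j \<and> 2 dvd j) \<or> (a dvd (i + 1) + j \<and> 2 dvd j) \<or>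
    (a dvd i + (j - 1) \<and> 2 dvd j - 1) \<or> (a dvd i + (j + 1) \<and> 2 dvd j + 1)"
proof -
  have sq: "i * i + j * j - 1 + 2 * i * j = (i + j) * (i + j) - 1" by (simp add: algebra_simps)
  have "a dvd (i + j) - 1 \<or> a dvd (i + j) + 1" using assms unfolding sq by blast
  moreover have "(i - 1) + j = (i + j) - 1" "(i + 1) + j = (i + j) + 1"
    "i + (j - 1) = (i + j) - 1" "i + (j + 1) = (i + j) + 1" by simp_all
  moreover have "2 dvd j \<or> (2 dvd j - 1 \<and> 2 dvd j + 1)" by presburger
  ultimately show ?thesis by metis
qed

section \<open>The listed rings have connected graphs and four involutions\<close>

context inv_ring
begin

lemma conn_card_odd_odd:
  assumes "R \<simeq> RDirProd (ZFact a) (ZFact b)" and a: "odd_prime_power a" and b: "odd_prime_power b"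
  shows "conn \<and> card Inv = 4"
proof -
  note A = odd_prime_powerD[OF a] and B = odd_prime_powerD[OF b]
  obtain g where g: "zhom (RDirProd (ZFact a) (ZFact b)) g" "zsurj (RDirProd (ZFact a) (ZFact b)) g"
    "\<And>i j i' j'. g i j = g i' j' \<longleftrightarrow> lattice_odd_odd a b (i - i') (j - j')"
    using model_odd_odd[OF A(1)] by metis
  show ?thesis
    by (rule iso_conn_card[OF assms(1) g two_components[OF A(3) B(3)]])
      (use odd_not_dvd_2[OF A(2,1)] odd_not_dvd_2[OF B(2,1)] in \<open>simp_all add: lattice_odd_odd_def\<close>)
qed

lemma conn_card_odd_odd_2:
  assumes "R \<simeq> RDirProd (ZFact a) (RDirProd (ZFact b) (ZFact 2))"
    and a: "odd_prime_power a" and b: "odd_prime_power b"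
  shows "conn \<and> card Inv = 4"
proof -
  note A = odd_prime_powerD[OF a] and B = odd_prime_powerD[OF b]
  obtain g where g: "zhom (RDirProd (ZFact a) (RDirProd (ZFact b) (ZFact 2))) g"
    "zsurj (RDirProd (ZFact a) (RDirProd (ZFact b) (ZFact 2))) g"
    "\<And>i j i' j'. g i j = g i' j' \<longleftrightarrow> lattice_odd_odd_2 a b (i - i') (j - j')"
    by (rule model_odd_odd_2[OF A(1) B(1)]) (rule that)
  have split: "lattice_odd_odd_2 a b i j \<longleftrightarrow> lattice_odd_odd a b i j \<and> even (i + j)" for i j
    by (auto simp: lattice_odd_odd_2_def lattice_odd_odd_def)
  show ?thesis
  proof (rule iso_conn_card[OF assms(1) g])
    fix i j assume "lattice_odd_odd_2 a b (i * i + j * j - 1) (2 * i * j)"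
    then have h: "lattice_odd_odd a b (i * i + j * j - 1) (2 * i * j)" "even (i * i + j * j - 1 + 2 * i * j)"
      unfolding split by simp_all
    \<comment> \<open>The factor Z_2 only records the parity of i + j. It is odd for an involution,
      so the differences to 1, -1, u, -u are all even and this factor imposes nothing
      further.\<close>
    have "even ((i + j) * (i + j) - 1)" using h(2) by (simp add: algebra_simps)
    then have "odd (i + j)" by auto
    then have "even ((i - 1) + j)" "even ((i + 1) + j)" "even (i + (j - 1))" "even (i + (j + 1))" by presburger+
    then show "lattice_odd_odd_2 a b (i - 1) j \<or> lattice_odd_odd_2 a b (i + 1) j \<or> lattice_odd_odd_2 a b i (j - 1) \<or> lattice_odd_odd_2 a b i (j + 1)"
      unfolding split using two_components[OF A(3) B(3) h(1)] by blast
  qed (use odd_not_dvd_2[OF A(2,1)] odd_not_dvd_2[OF B(2,1)] in \<open>simp_all add: lattice_odd_odd_2_def\<close>)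
qed

text \<open>The lattice with two components is used with 4 as second modulus, since 1 has only the
  square roots 1 and -1 modulo 4 as well.\<close>

lemma conn_card_odd_4:
  assumes "R \<simeq> RDirProd (ZFact a) (ZFact 4)" and a: "odd_prime_power a"
  shows "conn \<and> card Inv = 4"
proof -
  note A = odd_prime_powerD[OF a]
  obtain g where g: "zhom (RDirProd (ZFact a) (ZFact 4)) g" "zsurj (RDirProd (ZFact a) (ZFact 4)) g"
    "\<And>i j i' j'. g i j = g i' j' \<longleftrightarrow> lattice_odd_odd a 4 (i - i') (j - j')"
    using model_odd_odd[OF A(1), of 4] by metis
  show ?thesis
    by (rule iso_conn_card[OF assms(1) g two_components[OF A(3) square_one_mod_4]])
      (use odd_not_dvd_2[OF A(2,1)] in \<open>simp_all add: lattice_odd_odd_def\<close>)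
qed

text \<open>Both signs present the same ring; the presentation with \<open>\<sigma>\<close> = 1 is
  taken.\<close>

lemma conn_card_odd_Z2x:
  assumes "R \<simeq> RDirProd (ZFact a) Z2x" and a: "odd_prime_power a"
  shows "conn \<and> card Inv = 4"
proof -
  note A = odd_prime_powerD[OF a]
  obtain g where g: "zhom (RDirProd (ZFact a) Z2x) g" "zsurj (RDirProd (ZFact a) Z2x) g"
    "\<And>i j i' j'. g i j = g i' j' \<longleftrightarrow> lattice_odd_Z2x a 1 (i - i') (j - j')"
    using model_odd_Z2x[OF A(1), of 1] by metis
  show ?thesis
  proof (rule iso_conn_card[OF assms(1) g])
    fix i j assume "lattice_odd_Z2x a 1 (i * i + j * j - 1) (2 * i * j)"
    then have h: "a dvd (i * i + j * j - 1) + 2 * i * j" "even (i * i + j * j - 1 + 2 * i * j)"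
      unfolding lattice_odd_Z2x_def by simp_all
    have "even ((i + j) * (i + j) - 1)" using h(2) by (simp add: algebra_simps)
    then have "odd (i + j)" by auto
    then have "even ((i - 1) + j)" "even ((i + 1) + j)" "even (i + (j - 1))" "even (i + (j + 1))" by presburger+
    then show "lattice_odd_Z2x a 1 (i - 1) j \<or> lattice_odd_Z2x a 1 (i + 1) j \<or> lattice_odd_Z2x a 1 i (j - 1) \<or> lattice_odd_Z2x a 1 i (j + 1)"
      unfolding lattice_odd_Z2x_def mult_1 using nilpotent_component[OF A(3) h(1)] by blast
  qed (use odd_not_dvd_2[OF A(2,1)] in \<open>simp_all add: lattice_odd_Z2x_def\<close>)
qed

lemma conn_card_Z4x:
  assumes "R \<simeq> Z4x"
  shows "conn \<and> card Inv = 4"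
proof -
  obtain g where g: "zhom Z4x g" "zsurj Z4x g" "\<And>i j i' j'. g i j = g i' j' \<longleftrightarrow> lattice_Z4x (i - i') (j - j')"
    using model_Z4x by metis
  show ?thesis
  proof (rule iso_conn_card[OF assms g])
    fix i j assume "lattice_Z4x (i * i + j * j - 1) (2 * i * j)"
    then have "4 dvd (i * i + j * j - 1) + 2 * i * j" unfolding lattice_Z4x_def by simp
    from nilpotent_component[OF square_one_mod_4 this]
    show "lattice_Z4x (i - 1) j \<or> lattice_Z4x (i + 1) j \<or> lattice_Z4x i (j - 1) \<or> lattice_Z4x i (j + 1)" unfolding lattice_Z4x_def .
  qed (simp_all add: lattice_Z4x_def)
qed

lemma conn_card_two_power:
  assumes "R \<simeq> ZFact (2 ^ n)" "3 \<le> n"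
  shows "conn \<and> card Inv = 4"
proof -
  obtain k where k: "n = k + 3" using assms(2) by (metis add.commute le_Suc_ex)
  define h :: int where "h = 2 ^ k"
  have h0: "0 < h" by (simp add: h_def)
  have n: "2 ^ n = 8 * h" "2 ^ (n - 1) = 4 * h" by (simp_all add: k h_def power_add)
  \<comment> \<open>The square root of 1 other than 1 and -1, up to sign; it plays the role of
    u.\<close>
  define w :: int where "w = 1 + 2 ^ (n - 1)"
  have "w * w - 1 = 2 ^ n * (1 + 2 * h)" unfolding w_def n by (simp add: algebra_simps)
  then have w: "2 ^ n dvd w * w - 1" by simp
  obtain g where g: "zhom (ZFact (2 ^ n)) g" "zsurj (ZFact (2 ^ n)) g"
    "\<And>i j i' j'. g i j = g i' j' \<longleftrightarrow> 2 ^ n dvd (i - i') + w * (j - j')"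
    using model_ZFact[OF w] by metis
  show ?thesis
  proof (rule iso_conn_card[OF assms(1) g])
    fix i j assume *: "2 ^ n dvd i * i + j * j - 1 + w * (2 * i * j)"
    \<comment> \<open>Adding (w^2 - 1) j^2, which is 0 modulo 2^n, completes the square to (i + w
      j)^2 - 1.\<close>
    have "2 ^ n dvd (i * i + j * j - 1 + w * (2 * i * j)) + (w * w - 1) * (j * j)"
      by (rule dvd_add[OF * dvd_mult2[OF w]])
    moreover have "(i * i + j * j - 1 + w * (2 * i * j)) + (w * w - 1) * (j * j) = (i + w * j) * (i + w * j) - 1"
      by (simp add: algebra_simps)
    ultimately have "2 ^ n dvd (i + w * j) * (i + w * j) - 1" by simp
    from square_one_mod_two_power[OF assms(2) this]
    have "2 ^ n dvd (i + w * j) - 1 \<or> 2 ^ n dvd (i + w * j) + 1 \<or> 2 ^ n dvd (i + w * j) - w \<or> 2 ^ n dvd (i + w * j) + w"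
      unfolding w_def .
    moreover have "(i - 1) + w * j = (i + w * j) - 1" "(i + 1) + w * j = (i + w * j) + 1"
      "i + w * (j - 1) = (i + w * j) - w" "i + w * (j + 1) = (i + w * j) + w" by (simp_all add: algebra_simps)
    ultimately show "2 ^ n dvd i - 1 + w * j \<or> 2 ^ n dvd i + 1 + w * j \<or>
        2 ^ n dvd i + w * (j - 1) \<or> 2 ^ n dvd i + w * (j + 1)" by metis
  next
    have "\<not> 4 dvd (2::int)" by simp
    have e: "\<not> 8 * h dvd 2 + 4 * (c * h)" for c
    proof
      assume "8 * h dvd 2 + 4 * (c * h)"
      moreover have "4 dvd 8 * h" by simp
      ultimately have "4 dvd 2 + 4 * (c * h)" by (metis dvd_trans)
      then show False by presburger
    qed
    show "\<not> 2 ^ n dvd 2 + w * 0" using e[of 0] unfolding n by simp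
    show "\<not> 2 ^ n dvd 1 + w * 1" using e[of 1] unfolding w_def n by (simp add: algebra_simps)
    show "\<not> 2 ^ n dvd 1 + w * - 1"
    proof
      assume "2 ^ n dvd 1 + w * - 1"
      then have "8 * h dvd 4 * h" unfolding w_def n by (simp add: algebra_simps)
      then show False using zdvd_imp_le[of "8 * h" "4 * h"] h0 by simp
    qed
  qed
qed

section \<open>Classification when 1 and -1 differ\<close>

lemma zhom_gv:
  assumes "u \<in> Inv"
  shows "zhom R (gv u)"
  unfolding zhom_def using assms gv_add gv_mult by simp

text \<open>The relations i + j u = 0 in \<open>R\<close> form an \<open>inv_lattice\<close>. Each
  lattice in its classification is that of a listed ring, and equal relations give isomorphic
  rings.\<close>

lemma classification_ne:
  assumes conn and I: "card Inv = 4" and ne1: "\<one> \<noteq> \<ominus> \<one>"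
  shows "(\<exists>a b. odd_prime_power a \<and> odd_prime_power b \<and>
      (R \<simeq> RDirProd (ZFact a) (ZFact b) \<or> R \<simeq> RDirProd (ZFact a) (RDirProd (ZFact b) (ZFact 2)))) \<or>
    (\<exists>a. odd_prime_power a \<and> (R \<simeq> RDirProd (ZFact a) (ZFact 4) \<or> R \<simeq> RDirProd (ZFact a) Z2x)) \<or>
    R \<simeq> Z4x \<or> (\<exists>n\<ge>3. R \<simeq> ZFact (2 ^ n))"
proof -
  obtain u where u: "u \<in> Inv" "u \<noteq> \<one>" "u \<noteq> \<ominus> \<one>" "Inv = {\<one>, \<ominus> \<one>, u, \<ominus> u}"
    using Inv_eq_pm[OF I ne1] .
  have uc: "u \<in> carrier R" using u(1) by simp
  define \<Lambda> where "\<Lambda> i j \<longleftrightarrow> gv u i j = \<zero>" for i j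
  have zh: "zhom R (gv u)" by (rule zhom_gv[OF u(1)])
  have zs: "zsurj R (gv u)"
  proof -
    have r: "range (\<lambda>p. gv u (fst p) (snd p)) = carrier R" by (rule gv_range[OF assms(1) u(1,4)])
    have "\<exists>i j. x = gv u i j" if "x \<in> carrier R" for x
    proof -
      have "x \<in> range (\<lambda>p. gv u (fst p) (snd p))" using that r by simp
      then show ?thesis by auto
    qed
    then show ?thesis unfolding zsurj_def by blast
  qed
  have eqL: "gv u i j = gv u i' j' \<longleftrightarrow> \<Lambda> (i - i') (j - j')" for i j i' j'
    unfolding \<Lambda>_def by (rule gv_eq_iff[OF uc])
  have gvn: "gv u (- i) (- j) = \<ominus> gv u i j" for i j
    using gv_diff[OF uc, of 0 i 0 j] uc by (simp add: a_minus_def)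
  obtain m where m: "0 < m" "\<And>k. \<iota> k = \<zero> \<longleftrightarrow> m dvd k" using iota_char by blast
  have "inv_lattice \<Lambda> m"
  proof
    fix i j i' j'
    show "\<Lambda> (i + i') (j + j')" if "\<Lambda> i j" "\<Lambda> i' j'"
      using that unfolding \<Lambda>_def gv_add[OF uc] by simp
    show "\<Lambda> (- i) (- j)" if "\<Lambda> i j" using that unfolding \<Lambda>_def gvn by simp
    show "\<Lambda> j i" if "\<Lambda> i j"
      using that gv_mult[OF u(1), of i 0 j 1] uc unfolding \<Lambda>_def by simp
    have e: "i * j + j * i - 0 = 2 * i * j" by simp
    assume "\<Lambda> (i * i + j * j - 1) (2 * i * j)"
    then have "gv u (i * i + j * j) (i * j + j * i) = gv u 1 0" unfolding eqL e .
    then have "gv u i j \<otimes> gv u i j = \<one>" unfolding gv_mult[OF u(1)] using uc by simp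
    then have "gv u i j \<in> Inv" using uc by (simp add: Inv_def del: InvD)
    then have "gv u i j = gv u 1 0 \<or> gv u i j = gv u (- 1) (- 0) \<or> gv u i j = gv u 0 1 \<or> gv u i j = gv u (- 0) (- 1)"
      unfolding gvn u(4) using uc by simp
    then show "\<Lambda> (i - 1) j \<or> \<Lambda> (i + 1) j \<or> \<Lambda> i (j - 1) \<or> \<Lambda> i (j + 1)" unfolding eqL by simp
  next
    show "0 < m" by (rule m(1))
    show "\<Lambda> m 0" using m(2) uc by (simp add: \<Lambda>_def)
    have g: "gv u 1 0 = \<one>" "gv u (- 1) (- 0) = \<ominus> \<one>" "gv u 0 1 = u" "gv u (- 0) (- 1) = \<ominus> u"
      unfolding gvn using uc by simp_all
    have "u \<noteq> \<ominus> u"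
    proof
      assume "u = \<ominus> u"
      then have "u \<otimes> u = \<ominus> (u \<otimes> u)" using uc by (metis r_minus)
      then show False using ne1 u(1) by simp
    qed
    have "\<one> \<noteq> \<ominus> u" using u(3) uc by (metis minus_minus)
    show "\<not> \<Lambda> 2 0" using eqL[of 1 0 "- 1" "- 0"] g ne1 by simp
    show "\<not> \<Lambda> 1 (- 1)" using eqL[of 1 0 0 1] g u(2) by auto
    show "\<not> \<Lambda> 1 1" using eqL[of 1 0 "- 0" "- 1"] g \<open>\<one> \<noteq> \<ominus> u\<close> by simp
  qed
  then interpret L: inv_lattice \<Lambda> m .
  have iso: "R \<simeq> S" if "zhom S h" "zsurj S h" "\<And>i j i' j'. h i j = h i' j' \<longleftrightarrow> \<Lambda>' (i - i') (j - j')"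
      "\<And>i j. \<Lambda> i j \<longleftrightarrow> \<Lambda>' i j" for S :: "('s, 't) ring_scheme" and h \<Lambda>'
    by (rule zhom_iso[OF zh zs that(1,2)]) (simp add: eqL that(3,4))
  from L.classification consider
    (1) a b where "odd_prime_power a" "odd_prime_power b" "\<forall>i j. \<Lambda> i j \<longleftrightarrow> a dvd i + j \<and> b dvd i - j"
  | (2) a b where "odd_prime_power a" "odd_prime_power b" "\<forall>i j. \<Lambda> i j \<longleftrightarrow> a dvd i + j \<and> b dvd i - j \<and> 2 dvd i + j"
  | (3) a \<sigma> where "odd_prime_power a" "\<sigma> = 1 \<or> \<sigma> = - 1" "\<forall>i j. \<Lambda> i j \<longleftrightarrow> a dvd i + \<sigma> * j \<and> 2 dvd i \<and> 2 dvd j"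
  | (4) a \<sigma> where "odd_prime_power a" "\<sigma> = 1 \<or> \<sigma> = - 1" "\<forall>i j. \<Lambda> i j \<longleftrightarrow> a dvd i + \<sigma> * j \<and> 4 dvd i - \<sigma> * j"
  | (5) "\<forall>i j. \<Lambda> i j \<longleftrightarrow> 4 dvd i + j \<and> 2 dvd j"
  | (6) n w where "3 \<le> n" "2 ^ n dvd w * w - 1" "\<forall>i j. \<Lambda> i j \<longleftrightarrow> 2 ^ n dvd i + w * j"
    by (elim disjE exE conjE) metis+
  then show ?thesis
  proof cases
    case (1 a b)
    obtain h where h: "zhom (RDirProd (ZFact a) (ZFact b)) h" "zsurj (RDirProd (ZFact a) (ZFact b)) h"
      "\<And>i j i' j'. h i j = h i' j' \<longleftrightarrow> lattice_odd_odd a b (i - i') (j - j')"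
      using model_odd_odd[OF odd_prime_powerD(1)[OF 1(1)]] by metis
    have "R \<simeq> RDirProd (ZFact a) (ZFact b)" by (rule iso[OF h]) (simp add: 1(3) lattice_odd_odd_def)
    then show ?thesis using 1 by blast
  next
    case (2 a b)
    obtain h where h: "zhom (RDirProd (ZFact a) (RDirProd (ZFact b) (ZFact 2))) h"
      "zsurj (RDirProd (ZFact a) (RDirProd (ZFact b) (ZFact 2))) h"
      "\<And>i j i' j'. h i j = h i' j' \<longleftrightarrow> lattice_odd_odd_2 a b (i - i') (j - j')"
      by (rule model_odd_odd_2[OF odd_prime_powerD(1)[OF 2(1)] odd_prime_powerD(1)[OF 2(2)]]) (rule that)
    have "R \<simeq> RDirProd (ZFact a) (RDirProd (ZFact b) (ZFact 2))" by (rule iso[OF h]) (simp add: 2(3) lattice_odd_odd_2_def)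
    then show ?thesis using 2 by blast
  next
    case (3 a \<sigma>)
    obtain h where h: "zhom (RDirProd (ZFact a) Z2x) h" "zsurj (RDirProd (ZFact a) Z2x) h"
      "\<And>i j i' j'. h i j = h i' j' \<longleftrightarrow> lattice_odd_Z2x a \<sigma> (i - i') (j - j')"
      using model_odd_Z2x[OF odd_prime_powerD(1)[OF 3(1)] 3(2)] by metis
    have "R \<simeq> RDirProd (ZFact a) Z2x" by (rule iso[OF h]) (auto simp: 3(3) lattice_odd_Z2x_def)
    then show ?thesis using 3 by blast
  next
    case (4 a \<sigma>)
    obtain h where h: "zhom (RDirProd (ZFact a) (ZFact 4)) h" "zsurj (RDirProd (ZFact a) (ZFact 4)) h"
      "\<And>i j i' j'. h i j = h i' j' \<longleftrightarrow> lattice_odd_4 a \<sigma> (i - i') (j - j')"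
      using model_odd_4[OF odd_prime_powerD(1)[OF 4(1)] 4(2)] by metis
    have "R \<simeq> RDirProd (ZFact a) (ZFact 4)" by (rule iso[OF h]) (simp add: 4(3) lattice_odd_4_def)
    then show ?thesis using 4 by blast
  next
    case 5
    obtain h where h: "zhom Z4x h" "zsurj Z4x h" "\<And>i j i' j'. h i j = h i' j' \<longleftrightarrow> lattice_Z4x (i - i') (j - j')"
      using model_Z4x by metis
    have "R \<simeq> Z4x" by (rule iso[OF h]) (simp add: 5 lattice_Z4x_def)
    then show ?thesis by blast
  next
    case (6 n w)
    obtain h where h: "zhom (ZFact (2 ^ n)) h" "zsurj (ZFact (2 ^ n)) h"
      "\<And>i j i' j'. h i j = h i' j' \<longleftrightarrow> 2 ^ n dvd (i - i') + w * (j - j')"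
      using model_ZFact[OF 6(2)] by metis
    have "R \<simeq> ZFact (2 ^ n)"
      by (rule iso[OF h(1,2), of "\<lambda>i j. 2 ^ n dvd i + w * j"]) (simp_all add: h(3) 6(3))
    then show ?thesis using 6(1) by blast
  qed
qed

end

theorem mainTheorem7:
  fixes R :: "('a, 'b) ring_scheme"
  assumes "cring R" and "finite (carrier R)" and "\<one>\<^bsub>R\<^esub> \<noteq> \<zero>\<^bsub>R\<^esub>"
  shows "(genus_one (carrier R) (inv_edges R) \<longleftrightarrow>
           (R \<simeq> Z2xy \<or> R \<simeq> Z4x \<or> (\<exists>n::nat. n \<ge> 3 \<and> R \<simeq> ZFact (2 ^ n))) \<or>
           (\<exists>(p::nat) (q::nat) (n::nat) (m::nat). Factorial_Ring.prime p \<and> Factorial_Ring.prime q \<and> odd p \<and> odd q \<and>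
               n \<ge> 1 \<and> m \<ge> 1 \<and>
               (R \<simeq> RDirProd (ZFact (int (p ^ n))) (ZFact (int (q ^ m))) \<or>
                R \<simeq> RDirProd (ZFact (int (p ^ n))) (RDirProd (ZFact (int (q ^ m))) (ZFact 2)) \<or>
                R \<simeq> RDirProd (ZFact (int (p ^ n))) (ZFact 4) \<or>
                R \<simeq> RDirProd (ZFact (int (p ^ n))) Z2x)))
       \<and> (genus_one (carrier R) (inv_edges R) \<longleftrightarrow>
           ((\<forall>x\<in>carrier R. \<forall>y\<in>carrier R. (inv_adj R)\<^sup>*\<^sup>* x y) \<and>
            (\<forall>x\<in>carrier R. card {y. inv_adj R x y} = 4)))"
proof -
  interpret inv_ring R
    by (rule inv_ring.intro[OF assms(1)], unfold_locales) (rule assms)+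
  have opp: "odd_prime_power (int (p ^ n))" if "Factorial_Ring.prime p" "odd p" "1 \<le> n" for p n :: nat
    using that unfolding odd_prime_power_def by blast
  \<comment> \<open>The pivot of both equivalences: the genus, the list of rings and 4-regularity
    are each compared with this condition.\<close>
  have "conn \<and> card Inv = 4 \<longleftrightarrow>
           (R \<simeq> Z2xy \<or> R \<simeq> Z4x \<or> (\<exists>n::nat. n \<ge> 3 \<and> R \<simeq> ZFact (2 ^ n))) \<or>
           (\<exists>(p::nat) (q::nat) (n::nat) (m::nat). Factorial_Ring.prime p \<and> Factorial_Ring.prime q \<and> odd p \<and> odd q \<and>
               n \<ge> 1 \<and> m \<ge> 1 \<and>
               (R \<simeq> RDirProd (ZFact (int (p ^ n))) (ZFact (int (q ^ m))) \<or>
                R \<simeq> RDirProd (ZFact (int (p ^ n))) (RDirProd (ZFact (int (q ^ m))) (ZFact 2)) \<or>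
                R \<simeq> RDirProd (ZFact (int (p ^ n))) (ZFact 4) \<or>
                R \<simeq> RDirProd (ZFact (int (p ^ n))) Z2x))" (is "?L \<longleftrightarrow> ?A \<or> ?B")
  proof
    assume L: ?L
    show "?A \<or> ?B"
    proof (cases "\<one>\<^bsub>R\<^esub> = \<ominus>\<^bsub>R\<^esub> \<one>\<^bsub>R\<^esub>")
      case True
      then have "\<one>\<^bsub>R\<^esub> \<oplus>\<^bsub>R\<^esub> \<one>\<^bsub>R\<^esub> = \<zero>\<^bsub>R\<^esub>" by (metis one_closed r_neg)
      then show ?thesis using iso_Z2xy L by blast
    next
      case False
      from classification_ne[OF conjunct1[OF L] conjunct2[OF L] False] show ?thesis
      proof (elim disjE)
        assume "\<exists>a b. odd_prime_power a \<and> odd_prime_power b \<and>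
          (R \<simeq> RDirProd (ZFact a) (ZFact b) \<or> R \<simeq> RDirProd (ZFact a) (RDirProd (ZFact b) (ZFact 2)))"
        then have ?B unfolding odd_prime_power_def by blast
        then show ?thesis ..
      next
        assume "\<exists>a. odd_prime_power a \<and> (R \<simeq> RDirProd (ZFact a) (ZFact 4) \<or> R \<simeq> RDirProd (ZFact a) Z2x)"
        then have ?B unfolding odd_prime_power_def by blast
        then show ?thesis ..
      qed blast+
    qed
  next
    assume "?A \<or> ?B"
    then show ?L
    proof
      assume ?A
      then show ?L using conn_card_Z2xy conn_card_Z4x conn_card_two_power by blast
    next
      assume ?B
      then obtain p q n m where
        pq: "Factorial_Ring.prime p" "Factorial_Ring.prime q" "odd p" "odd q" "1 \<le> n" "1 \<le> m"
        and iso: "R \<simeq> RDirProd (ZFact (int (p ^ n))) (ZFact (int (q ^ m))) \<or>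
                R \<simeq> RDirProd (ZFact (int (p ^ n))) (RDirProd (ZFact (int (q ^ m))) (ZFact 2)) \<or>
                R \<simeq> RDirProd (ZFact (int (p ^ n))) (ZFact 4) \<or>
                R \<simeq> RDirProd (ZFact (int (p ^ n))) Z2x" by (elim exE conjE) (rule that)
      note ops = opp[OF pq(1,3,5)] opp[OF pq(2,4,6)]
      from iso show ?L
        using conn_card_odd_odd[OF _ ops] conn_card_odd_odd_2[OF _ ops]
          conn_card_odd_4[OF _ ops(1)] conn_card_odd_Z2x[OF _ ops(1)] by (elim disjE)
    qed
  qed
  \<comment> \<open>Every degree equals \<open>card Inv\<close>, and zero supplies a vertex at which
    to read it off.\<close>
  moreover have "genus_one (carrier R) (inv_edges R) \<longleftrightarrow>
           ((\<forall>x\<in>carrier R. \<forall>y\<in>carrier R. (inv_adj R)\<^sup>*\<^sup>* x y) \<and>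
            (\<forall>x\<in>carrier R. card {y. inv_adj R x y} = 4))"
    unfolding genus_one_iff conn_def using card_nbrs zero_closed by auto
  ultimately show ?thesis unfolding genus_one_iff by blast
qed

end
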